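(* Let $h:\mathbb R_+\to\mathbb R_+$ be such that $h(\delta)\to\infty$ for $\delta\to0$. Let $(\epsilon,\delta)\to(0,0)$ (with $\epsilon,\delta>0$) such that $\epsilon\cdot h(\delta)^\alpha\to0$. Then, along this limit, $\Gamma\text{-}\lim_{(\epsilon,\delta)\to0}\mathcal H^{\tilde\mu}_{\epsilon,\delta}=\mathcal H^{\mu}$ with respect to weak-$*$ convergence in $\mathcal M(\tilde\Omega;\mathbb R^d)$.
   Context: Setting: $d\in\mathbb N$; $\Omega\subset\mathbb R^d$ is compact and its interior $\Omega^\circ$ is a bounded Lipschitz domain; $\Omega$ is strictly star shaped with respect to $0$: $\lambda x\in\Omega^\circ$ for all $x\in\Omega$, $0\le\lambda<1$; $w:\Omega\to[0,\infty)$ is continuous; $1<\alpha<\frac{d}{d-1}$, $\alpha'=\frac{\alpha}{\alpha-1}$; $\mu^+,\mu^-$ are Borel probability measures on $\Omega$, $\mu:=\mu^+-\mu^-$. $|\cdot|$ is the Euclidean norm, $|q|$ the total variation measure of a vector measure $q$, $dx$ Lebesgue measure, $\mathcal M(K;\mathbb R^d)$ the $\mathbb R^d$-valued Radon measures on a compact set $K$ (weak-$*$ topology as dual of $C(K;\mathbb R^d)$). Spaces, for a compact set $K$ (here $K=\Omega$ or $K=\Omega_\tau$ below; Sobolev spaces on the interior): $W^{1,p}_\emptyset(K)=\{v\in W^{1,p}(K):\int_K v\,dx=0\}$; $W^{-1,p}_\perp(K)=\{v\in(W^{1,p'}(K))^*:\langle v,1\rangle=0\}$ with $p'$ conjugate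 to $p$; $\operatorname{div}:L^p(K;\mathbb R^d)\to W^{-1,p}_\perp(K)$, $\langle\operatorname{div}q,\phi\rangle=-\int_K q\cdot\nabla\phi\,dx$ for $\phi\in W^{1,p'}_\emptyset(K)$. Measures with total mass zero are regarded as elements of $W^{-1,\alpha}_\perp(K)$ (since $W^{1,\alpha'}(K)\hookrightarrow C(K)$). $C^1_\emptyset(K)=\{v\in C^1(K):\int_Kv\,dx=0\}$; for $q\in\mathcal M(\Omega;\mathbb R^d)$, $\operatorname{div}_{\mathcal M}q=\mu$ means $-\int_\Omega\nabla\phi\cdot dq=\int_\Omega\phi\,d\mu$ for all $\phi\in C^1_\emptyset(\Omega)$. Assumption on $\Omega$: for every $\nu\in W^{-1,\alpha'}_\perp(\Omega)$ there is a unique $y\in W^{1,\alpha'}_\emptyset(\Omega)$ with $-\int_\Omega\nabla y\cdot\nabla\phi\,dx=\langle\nu,\phi\rangle$ for all $\phi\in W^{1,\alpha}_\emptyset(\Omega)$. Enlarged domains: fix a sequence of parameters $\tau>0$, $\tau\to0$, and nonnegative mollifiers $\phi_\tau\in C_c^\infty(\mathbb R^d)$ ($\int\phi_\tau=1$, supports shrinking to $\{0\}$). For each $\tau$ choose $s_\tau>0$, $s_\tau\to0$, such that $\Omega_\tau:=(1+s_\tau)\Omega\supset\Omega+\operatorname{supp}\phi_\tau$ and $\Omega_\tau\supset\Omega_\vartheta$ for $\tau>\vartheta$. Put $\tilde\Omega=\bigcup_\tau\Omega_\tau$. $\tilde f$ denotes extension of a function or measure $f$ by zero to $\tilde\Omega$;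 $\hat w$ is a continuous extension of $w$ to $\tilde\Omega$ with $\min_{\tilde\Omega}\hat w=\min_\Omega w$. The parameter $\epsilon$ runs through this family of parameters and $\Omega_\epsilon$ is the domain for $\tau=\epsilon$. Integrand: for $\delta>0$, $\mathcal G^*_{\epsilon,\delta}(x,q)=|q|^2\frac{\hat w(x)}{2\delta}-\delta\hat w(x)$ if $|q|\le\delta$, and $\mathcal G^*_{\epsilon,\delta}(x,q)=\frac\epsilon\alpha(|q|-\delta)^\alpha-\frac32\delta\hat w(x)+|q|\hat w(x)$ otherwise. Functionals: for $q\in\mathcal M(\Omega_\epsilon;\mathbb R^d)$, $\mathcal H^{\tilde\mu}_{\epsilon,\delta}(q)=\int_{\Omega_\epsilon}\mathcal G^*_{\epsilon,\delta}(x,\frac{dq}{dx}(x))\,dx$ if $q\ll dx$, $\frac{dq}{dx}\in L^\alpha(\Omega_\epsilon;\mathbb R^d)$ and $\operatorname{div}\frac{dq}{dx}=\tilde\mu$ in $W^{-1,\alpha}_\perp(\Omega_\epsilon)$, and $+\infty$ otherwise. For $q\in\mathcal M(\Omega;\mathbb R^d)$, $\mathcal H^{\mu}(q)=\int_\Omega w\,d|q|$ if $\operatorname{div}_{\mathcal M}q=\mu$, and $+\infty$ otherwise. Both are regarded as functionals on $\mathcal M(\tilde\Omega;\mathbb R^d)$ by identifying measures on $\Omega_\epsilon$ (resp. $\Omega$) with their zero extensions, with value $+\infty$ on measures that are not such zero extensions. $\Gamma$-convergence $F=\Gamma\text{-}\lim F_n$: (i) $F(x)\le\liminf F_n(x_n)$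 whenever $x_n\to x$; (ii) for every $x$ there is $x_n\to x$ with $F(x)\ge\limsup F_n(x_n)$; here convergence is weak-$*$ (sequential). *)

theory Defs
  imports "HOL-Probability.Probability"
begin

subsection \<open>Lipschitz domains\<close>

text \<open>Near every boundary point, the domain is the strict subgraph, in some unit direction \<open>e\<close>, of a
  Lipschitz function of the component orthogonal to \<open>e\<close>.\<close>

definition bounded_lipschitz_domain :: "'a::euclidean_space set \<Rightarrow> bool" where
  "bounded_lipschitz_domain U \<longleftrightarrow>
     open U \<and> connected U \<and> bounded U \<and> U \<noteq> {} \<and>
     (\<forall>x\<in>frontier U. \<exists>r>0. \<exists>e g L. norm e = 1 \<and> lipschitz_on L {z. z \<bullet> e = 0} g \<and>
        U \<inter> ball x r = {y \<in> ball x r. y \<bullet> e < g (y - (y \<bullet> e) *\<^sub>R e)})"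

definition strictly_star_shaped :: "'a::euclidean_space set \<Rightarrow> bool" where
  "strictly_star_shaped K \<longleftrightarrow> (\<forall>x\<in>K. \<forall>l. 0 \<le> l \<and> l < 1 \<longrightarrow> l *\<^sub>R x \<in> interior K)"


subsection \<open>Test functions\<close>

definition supp :: "('a::euclidean_space \<Rightarrow> real) \<Rightarrow> 'a set" where
  "supp f = closure {x. f x \<noteq> 0}"

primrec C_k :: "nat \<Rightarrow> ('a::euclidean_space \<Rightarrow> real) \<Rightarrow> bool" where
  "C_k 0 f \<longleftrightarrow> continuous_on UNIV f"
| "C_k (Suc k) f \<longleftrightarrow>
     (\<forall>x. f differentiable (at x)) \<and> (\<forall>b\<in>Basis. C_k k (\<lambda>x. frechet_derivative f (at x) b))"

definition C_c_infinity :: "'a::euclidean_space set \<Rightarrow> ('a \<Rightarrow> real) set" where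
  "C_c_infinity U = {f. (\<forall>k. C_k k f) \<and> compact (supp f) \<and> supp f \<subseteq> U}"


subsection \<open>Lebesgue and Sobolev spaces\<close>

text \<open>All spaces consist of functions rather than of equivalence classes; only the values on \<open>K\<close> matter.\<close>

definition Lp :: "real \<Rightarrow> 'a::euclidean_space set \<Rightarrow> ('a \<Rightarrow> 'b::euclidean_space) set" where
  "Lp p K = {f. f \<in> borel_measurable (lebesgue_on K) \<and>
                integrable (lebesgue_on K) (\<lambda>x. norm (f x) powr p)}"

definition conj_exp :: "real \<Rightarrow> real" where
  "conj_exp p = p / (p - 1)"

definition is_weak_gradient ::
    "'a::euclidean_space set \<Rightarrow> ('a \<Rightarrow> real) \<Rightarrow> ('a \<Rightarrow> 'a) \<Rightarrow> bool" where
  "is_weak_gradient U u g \<longleftrightarrow>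
     (\<forall>\<phi>\<in>C_c_infinity U. \<forall>b\<in>Basis.
        (\<integral>x. u x * frechet_derivative \<phi> (at x) b \<partial>lebesgue_on U) =
        - (\<integral>x. (g x \<bullet> b) * \<phi> x \<partial>lebesgue_on U))"

definition sobolev :: "real \<Rightarrow> 'a::euclidean_space set \<Rightarrow> ('a \<Rightarrow> real) set" where
  "sobolev p K = {u \<in> Lp p K. \<exists>g\<in>Lp p K. is_weak_gradient (interior K) u g}"

definition weak_gradient :: "'a::euclidean_space set \<Rightarrow> ('a \<Rightarrow> real) \<Rightarrow> 'a \<Rightarrow> 'a" where
  "weak_gradient K u = (SOME g. g \<in> Lp 1 K \<and> is_weak_gradient (interior K) u g)"

definition sobolev_norm :: "real \<Rightarrow> 'a::euclidean_space set \<Rightarrow> ('a \<Rightarrow> real) \<Rightarrow> real" where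
  "sobolev_norm p K u =
     ((\<integral>x. \<bar>u x\<bar> powr p \<partial>lebesgue_on K) +
      (\<integral>x. norm (weak_gradient K u x) powr p \<partial>lebesgue_on K)) powr (1 / p)"

definition sobolev_mean0 :: "real \<Rightarrow> 'a::euclidean_space set \<Rightarrow> ('a \<Rightarrow> real) set" where
  "sobolev_mean0 p K = {u \<in> sobolev p K. (\<integral>x. u x \<partial>lebesgue_on K) = 0}"

text \<open>The dual space \<open>W\<^sup>-\<^sup>1\<^sup>,\<^sup>p\<close> with the constraint that constants are annihilated. The norm bound
  forces functionals to respect almost-everywhere equality.\<close>

definition sobolev_dual_perp :: "real \<Rightarrow> 'a::euclidean_space set \<Rightarrow> (('a \<Rightarrow> real) \<Rightarrow> real) set" where
  "sobolev_dual_perp p K =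
     {\<nu>. (\<forall>u\<in>sobolev (conj_exp p) K. \<forall>v\<in>sobolev (conj_exp p) K.
             \<nu> (\<lambda>x. u x + v x) = \<nu> u + \<nu> v) \<and>
         (\<forall>c. \<forall>u\<in>sobolev (conj_exp p) K. \<nu> (\<lambda>x. c * u x) = c * \<nu> u) \<and>
         (\<exists>C. \<forall>u\<in>sobolev (conj_exp p) K. \<bar>\<nu> u\<bar> \<le> C * sobolev_norm (conj_exp p) K u) \<and>
         \<nu> (\<lambda>x. 1) = 0}"

text \<open>Equality of functionals in \<open>sobolev_dual_perp p K\<close>: they are determined by their values on mean-zero
  functions.\<close>

definition eq_sobolev_dual_perp ::
    "real \<Rightarrow> 'a::euclidean_space set \<Rightarrow> (('a \<Rightarrow> real) \<Rightarrow> real) \<Rightarrow> (('a \<Rightarrow> real) \<Rightarrow> real) \<Rightarrow> bool" where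
  "eq_sobolev_dual_perp p K \<nu>1 \<nu>2 \<longleftrightarrow> (\<forall>\<phi>\<in>sobolev_mean0 (conj_exp p) K. \<nu>1 \<phi> = \<nu>2 \<phi>)"

definition div_Lp :: "'a::euclidean_space set \<Rightarrow> ('a \<Rightarrow> 'a) \<Rightarrow> ('a \<Rightarrow> real) \<Rightarrow> real" where
  "div_Lp K q = (\<lambda>\<phi>. - (\<integral>x. q x \<bullet> weak_gradient K \<phi> x \<partial>lebesgue_on K))"

text \<open>The functional induced by the signed measure \<open>mp - mm\<close>; the embedding into the continuous functions is
  made explicit by passing to the continuous representative.\<close>

definition cont_rep :: "'a::euclidean_space set \<Rightarrow> ('a \<Rightarrow> real) \<Rightarrow> 'a \<Rightarrow> real" where
  "cont_rep K \<phi> = (SOME \<psi>. continuous_on K \<psi> \<and> (AE x in lebesgue_on K. \<psi> x = \<phi> x))"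

definition measure_functional ::
    "'a::euclidean_space set \<Rightarrow> 'a measure \<Rightarrow> 'a measure \<Rightarrow> ('a \<Rightarrow> real) \<Rightarrow> real" where
  "measure_functional K mp mm =
     (\<lambda>\<phi>. (LINT x:K|mp. cont_rep K \<phi> x) - (LINT x:K|mm. cont_rep K \<phi> x))"

text \<open>Unique solvability (up to null sets) of the Neumann problem, with data in the dual of \<open>W\<^sup>1\<^sup>,\<^sup>p\<close> for the
  exponent \<open>p\<close> conjugate to \<open>r\<close>, and solutions in \<open>W\<^sup>1\<^sup>,\<^sup>r\<close>.\<close>

definition weak_poisson_sol ::
    "real \<Rightarrow> 'a::euclidean_space set \<Rightarrow> (('a \<Rightarrow> real) \<Rightarrow> real) \<Rightarrow> ('a \<Rightarrow> real) \<Rightarrow> bool" where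
  "weak_poisson_sol r K \<nu> y \<longleftrightarrow> y \<in> sobolev_mean0 r K \<and>
     (\<forall>\<phi>\<in>sobolev_mean0 (conj_exp r) K.
        - (\<integral>x. weak_gradient K y x \<bullet> weak_gradient K \<phi> x \<partial>lebesgue_on K) = \<nu> \<phi>)"

definition poisson_uniquely_solvable :: "real \<Rightarrow> 'a::euclidean_space set \<Rightarrow> bool" where
  "poisson_uniquely_solvable r K \<longleftrightarrow>
     (\<forall>\<nu>\<in>sobolev_dual_perp r K.
        \<exists>y. weak_poisson_sol r K \<nu> y \<and>
            (\<forall>z. weak_poisson_sol r K \<nu> z \<longrightarrow> (AE x in lebesgue_on K. z x = y x)))"


subsection \<open>Vector measures\<close>

text \<open>A vector measure on the compact set \<open>K\<close> is a countably additive function on the Borel sets of the whole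
  space that is concentrated on \<open>K\<close>; finiteness of the variation and regularity are then automatic.
  Extension by zero from \<open>K\<close> to a larger set is therefore the inclusion of \<open>vector_measures K\<close> into
  the vector measures on the larger set. Values on non-Borel sets are irrelevant.\<close>

definition vector_measures :: "'a::euclidean_space set \<Rightarrow> ('a set \<Rightarrow> 'a) set" where
  "vector_measures K =
     {q. (\<forall>F. range F \<subseteq> sets borel \<and> disjoint_family F \<longrightarrow> (\<lambda>i::nat. q (F i)) sums q (\<Union>i. F i)) \<and>
         (\<forall>A\<in>sets borel. A \<inter> K = {} \<longrightarrow> q A = 0)}"

definition total_variation :: "('a::euclidean_space set \<Rightarrow> 'a) \<Rightarrow> 'a measure" where
  "total_variation q = measure_of UNIV (sets borel)
     (\<lambda>A. SUP F \<in> {F :: nat \<Rightarrow> 'a set. range F \<subseteq> sets borel \<and> disjoint_family F \<and> (\<Union>i. F i) = A}.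
            (\<Sum>i. ennreal (norm (q (F i)))))"

text \<open>Positive part in the Jordan decomposition of a finite signed measure (\<open>ennreal\<close> maps negative
  numbers to 0); the negative part is the positive part of the negated measure.\<close>

definition positive_part :: "('a::euclidean_space set \<Rightarrow> real) \<Rightarrow> 'a measure" where
  "positive_part \<nu> = measure_of UNIV (sets borel)
     (\<lambda>A. SUP B \<in> {B \<in> sets borel. B \<subseteq> A}. ennreal (\<nu> B))"

definition signed_integral ::
    "'a::euclidean_space set \<Rightarrow> ('a set \<Rightarrow> real) \<Rightarrow> ('a \<Rightarrow> real) \<Rightarrow> real" where
  "signed_integral K \<nu> f =
     (LINT x:K|positive_part \<nu>. f x) - (LINT x:K|positive_part (\<lambda>A. - \<nu> A). f x)"

text \<open>The pairing of a continuous vector field with a vector measure, computed componentwise.\<close>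

definition vector_integral ::
    "'a::euclidean_space set \<Rightarrow> ('a set \<Rightarrow> 'a) \<Rightarrow> ('a \<Rightarrow> 'a) \<Rightarrow> real" where
  "vector_integral K q \<phi> = (\<Sum>b\<in>Basis. signed_integral K (\<lambda>A. q A \<bullet> b) (\<lambda>x. \<phi> x \<bullet> b))"

definition weak_star_conv ::
    "'a::euclidean_space set \<Rightarrow> (nat \<Rightarrow> 'a set \<Rightarrow> 'a) \<Rightarrow> ('a set \<Rightarrow> 'a) \<Rightarrow> bool" where
  "weak_star_conv K qs q \<longleftrightarrow>
     (\<forall>\<phi>. continuous_on K \<phi> \<longrightarrow> (\<lambda>n. vector_integral K (qs n) \<phi>) \<longlonglongrightarrow> vector_integral K q \<phi>)"

definition abs_cont :: "('a::euclidean_space set \<Rightarrow> 'a) \<Rightarrow> bool" where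
  "abs_cont q \<longleftrightarrow> (\<forall>A\<in>null_sets lborel. q A = 0)"

definition vector_RN_deriv :: "('a::euclidean_space set \<Rightarrow> 'a) \<Rightarrow> 'a \<Rightarrow> 'a" where
  "vector_RN_deriv q =
     (SOME f. integrable lborel f \<and> (\<forall>A\<in>sets borel. q A = (LINT x:A|lborel. f x)))"

text \<open>Pairs of a mean-zero continuously differentiable function on the compact set \<open>K\<close> and its gradient:
  the function is \<open>C\<^sup>1\<close> in the interior, and it and its gradient extend continuously to \<open>K\<close>. If \<open>K\<close> is the
  closure of its interior, the gradient is uniquely determined on \<open>K\<close>.\<close>

definition C1_mean0 :: "'a::euclidean_space set \<Rightarrow> (('a \<Rightarrow> real) \<times> ('a \<Rightarrow> 'a)) set" where
  "C1_mean0 K = {(\<phi>, g). continuous_on K \<phi> \<and> continuous_on K g \<and>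
     (\<forall>x\<in>interior K. (\<phi> has_derivative (\<lambda>v. g x \<bullet> v)) (at x)) \<and>
     (\<integral>x. \<phi> x \<partial>lebesgue_on K) = 0}"

definition div_measure_eq ::
    "'a::euclidean_space set \<Rightarrow> ('a set \<Rightarrow> 'a) \<Rightarrow> 'a measure \<Rightarrow> 'a measure \<Rightarrow> bool" where
  "div_measure_eq K q mp mm \<longleftrightarrow>
     (\<forall>(\<phi>, g)\<in>C1_mean0 K. - vector_integral K q g = (LINT x:K|mp. \<phi> x) - (LINT x:K|mm. \<phi> x))"


subsection \<open>Enlarged domains, functionals and Gamma-convergence\<close>

definition enlarged :: "(real \<Rightarrow> real) \<Rightarrow> 'a::euclidean_space set \<Rightarrow> real \<Rightarrow> 'a set" where
  "enlarged s K t = (\<lambda>x. (1 + s t) *\<^sub>R x) ` K"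

definition G_star ::
    "real \<Rightarrow> ('a::euclidean_space \<Rightarrow> real) \<Rightarrow> real \<Rightarrow> real \<Rightarrow> 'a \<Rightarrow> 'a \<Rightarrow> real" where
  "G_star \<alpha> w \<epsilon> \<delta> x q =
     (if norm q \<le> \<delta> then (norm q)\<^sup>2 * (w x / (2 * \<delta>)) - \<delta> * w x
      else \<epsilon> / \<alpha> * (norm q - \<delta>) powr \<alpha> - 3 / 2 * \<delta> * w x + norm q * w x)"

definition H_reg ::
    "real \<Rightarrow> ('a::euclidean_space \<Rightarrow> real) \<Rightarrow> 'a set \<Rightarrow> 'a measure \<Rightarrow> 'a measure
       \<Rightarrow> real \<Rightarrow> real \<Rightarrow> ('a set \<Rightarrow> 'a) \<Rightarrow> ereal" where
  "H_reg \<alpha> w K mp mm \<epsilon> \<delta> q =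
     (if q \<in> vector_measures K \<and> abs_cont q \<and> vector_RN_deriv q \<in> Lp \<alpha> K \<and>
         eq_sobolev_dual_perp \<alpha> K (div_Lp K (vector_RN_deriv q)) (measure_functional K mp mm)
      then ereal (\<integral>x. G_star \<alpha> w \<epsilon> \<delta> x (vector_RN_deriv q x) \<partial>lebesgue_on K)
      else \<infinity>)"

definition H_lim ::
    "('a::euclidean_space \<Rightarrow> real) \<Rightarrow> 'a set \<Rightarrow> 'a measure \<Rightarrow> 'a measure \<Rightarrow> ('a set \<Rightarrow> 'a) \<Rightarrow> ereal" where
  "H_lim w K mp mm q =
     (if q \<in> vector_measures K \<and> div_measure_eq K q mp mm
      then enn2ereal (\<integral>\<^sup>+x\<in>K. ennreal (w x) \<partial>total_variation q)
      else \<infinity>)"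

definition Gamma_lim ::
    "'x set \<Rightarrow> ((nat \<Rightarrow> 'x) \<Rightarrow> 'x \<Rightarrow> bool) \<Rightarrow> (nat \<Rightarrow> 'x \<Rightarrow> ereal) \<Rightarrow> ('x \<Rightarrow> ereal) \<Rightarrow> bool" where
  "Gamma_lim X conv Fs F \<longleftrightarrow>
     (\<forall>x\<in>X. \<forall>xs. (\<forall>n. xs n \<in> X) \<and> conv xs x \<longrightarrow> F x \<le> liminf (\<lambda>n. Fs n (xs n))) \<and>
     (\<forall>x\<in>X. \<exists>xs. (\<forall>n. xs n \<in> X) \<and> conv xs x \<and> limsup (\<lambda>n. Fs n (xs n)) \<le> F x)"

end

theory Submission
 imports Defs
begin

text \<open>Lower bound: \<open>G*(x, q) \<ge> wh |q| - 2 \<delta> wh\<close>, so a bound on the energies bounds the pairings with all fields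
 \<open>|\<psi>| \<le> wh\<close>; these pass to the weak-* limit, and duality turns them back into a weighted variation. The limit
 lives on the intersection \<open>\<Omega>\<close> of the enlarged domains, and its divergence is found by testing with \<open>\<phi>(x / (1 + s))\<close>.

 Recovery sequence: by the uniform cone condition there are finitely many directions \<open>c\<close> such that averages over
 \<open>x + r (c + supp \<beta>)\<close> stay inside \<open>\<Omega>\<close>. Localise \<open>q\<close> by a partition of unity and smooth each piece with the kernel
 \<open>F\<^sub>t\<close> of its direction. As \<open>dF\<^sub>r/dr = - div (F\<^sub>r(y) y / r)\<close>, the field \<open>\<integral>F\<^sub>r(y) y / r dr\<close> over \<open>0 < r \<le> t\<close> transports a
 point mass to \<open>F\<^sub>t\<close>; such corrections restore the divergence \<open>\<mu>\<close> exactly. Morrey's estimate, valid because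
 \<open>\<alpha> < d / (d - 1)\<close>, puts them into \<open>L\<^sup>\<alpha>\<close>. Letting \<open>t \<rightarrow> 0\<close> slowly along the sequence makes \<open>\<epsilon> \<integral>|q|\<^sup>\<alpha>\<close> vanish.\<close>

text \<open>The constraint has to hold against every function \<phi> of W^{1,\<alpha>'}, not only
  smooth ones, and the measures may charge the boundary, so an approximate divergence is useless.
  With \<phi>_i the average of \<phi> in direction \<open>c i\<close>, put u = sum of \<chi>_i
  \<phi>_i. This u is C1 up to the boundary and may be inserted into the equation for
  \<open>q\<close>. Its gradient consists of the terms \<chi>_i \<nabla>\<phi>_i, which the smoothed
  pieces produce, and \<phi>_i \<nabla>\<chi>_i. As the \<nabla>\<chi>_i add up to 0, \<phi>_i may
  be replaced there by \<phi>_i - \<phi>, and exchanging u for \<phi> under the two probability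
  measures again leaves only differences \<phi>_i - \<phi>. These are integrals of the gradient of
  \<phi>, hence pairings with a vector field: that is what a correction is. The estimate that makes
  the pairing finite also shows, by duality, that the corrections lie in L^\<alpha>. Their mass is
  O(t), so neither the weak-* limit nor the weighted variation notices them. All fields vanish
  outside the interior of \<Omega>, so one family serves every enlarged domain.\<close>

abbreviation nn_lborel :: "('a::euclidean_space => ennreal) => ennreal" (binder "NN " 10) where
 "nn_lborel f \<equiv> nn_integral lborel f"

lemmas LINT_cong = Bochner_Integration.integral_cong
lemmas LINT_cong_AE = Bochner_Integration.integral_cong_AE
lemmas LINT_zero = Bochner_Integration.integral_zero
lemmas LINT_diff = Bochner_Integration.integral_diff
lemmas LINT_nonneg = Bochner_Integration.integral_nonneg

section \<open>Test functions\<close>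

lemma frechet_derivative_eqI:
 "(f has_derivative f') (at x) ==> frechet_derivative f (at x) b = f' b"
 using frechet_derivative_at by metis

lemma C_k_Suc_D: "C_k (Suc k) f ==> C_k k f"
proof (induction k arbitrary: f)
 case 0
 then show ?case
  by (auto intro!: continuous_at_imp_continuous_on differentiable_imp_continuous_within)
qed (auto simp del: C_k.simps simp: C_k.simps(2))

lemma C_k_add: "C_k k f ==> C_k k g ==> C_k k (\<lambda>x. f x + g x)"
proof (induction k arbitrary: f g)
 case 0
 then show ?case by (auto intro: continuous_intros)
next
 case (Suc k)
 have d: "frechet_derivative (\<lambda>x. f x + g x) (at x) b =
   frechet_derivative f (at x) b + frechet_derivative g (at x) b" for x b
  using Suc.prems
  by (intro frechet_derivative_eqI has_derivative_add) (auto simp: frechet_derivative_works)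
 show ?case
  using Suc by (auto simp: d intro!: derivative_intros)
qed

text \<open>The prefactor \<open>a\<close> is there for the induction: every differentiation brings
  out another factor \<open>c\<close>.\<close>

lemma C_k_affine:
 assumes "C_k k f"
 shows "C_k k (\<lambda>x. a * f (c *\<^sub>R x + y))"
 using assms
proof (induction k arbitrary: f a)
 case 0
 then have "continuous_on UNIV f" by simp
 then have "continuous_on UNIV (\<lambda>x. f (c *\<^sub>R x + y))"
  by (rule continuous_on_compose2) (auto intro!: continuous_intros)
 then show ?case by (simp add: continuous_on_mult_left)
next
 case (Suc k)
 have d: "((\<lambda>x. a * f (c *\<^sub>R x + y)) has_derivative
   (\<lambda>h. a * frechet_derivative f (at (c *\<^sub>R x + y)) (c *\<^sub>R h))) (at x)" for x
 proof -
  have "(f has_derivative frechet_derivative f (at (c *\<^sub>R x + y))) (at (c *\<^sub>R x + y))"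
   using Suc.prems by (auto simp: frechet_derivative_works)
  then have "((\<lambda>x. f (c *\<^sub>R x + y)) has_derivative
    (\<lambda>h. frechet_derivative f (at (c *\<^sub>R x + y)) (c *\<^sub>R h))) (at x)"
   by (rule has_derivative_compose[rotated]) (auto intro!: derivative_eq_intros)
  then show ?thesis by (rule has_derivative_mult_right)
 qed
 have "frechet_derivative (\<lambda>x. a * f (c *\<^sub>R x + y)) (at x) b =
   (a * c) * frechet_derivative f (at (c *\<^sub>R x + y)) b" for x b
 proof -
  have "linear (frechet_derivative f (at (c *\<^sub>R x + y)))"
   using Suc.prems by (auto intro: linear_frechet_derivative)
  then show ?thesis
   using frechet_derivative_eqI[OF d, of x] by (simp add: linear_cmul)
 qed
 moreover have "C_k k (\<lambda>x. (a * c) * frechet_derivative f (at (c *\<^sub>R x + y)) b)"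
  if "b \<in> Basis" for b
  using Suc.prems that by (intro Suc.IH) simp
 moreover have "(\<lambda>x. a * f (c *\<^sub>R x + y)) differentiable (at x)" for x
  using d by (rule differentiableI)
 ultimately show ?case by simp
qed

text \<open>Products with affine functions are enough, because the test fields below are a kernel
  times a coordinate. The derivative is a constant multiple of \<open>f\<close> plus a product of
  the same shape with one derivative on \<open>f\<close>, so the induction closes.\<close>

lemma C_k_mult_linear:
 assumes "C_k k f"
 shows "C_k k (\<lambda>x. f x * (x \<bullet> v + a))"
 using assms
proof (induction k arbitrary: f)
 case 0
 then show ?case by (auto intro!: continuous_intros)
next
 case (Suc k)
 have d: "((\<lambda>x. f x * (x \<bullet> v + a)) has_derivative
   (\<lambda>h. f x * (h \<bullet> v) + frechet_derivative f (at x) h * (x \<bullet> v + a))) (at x)" for x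
 proof -
  have "(f has_derivative frechet_derivative f (at x)) (at x)"
   using Suc.prems by (auto simp: frechet_derivative_works)
  then show ?thesis
   by (auto intro!: derivative_eq_intros)
 qed
 \<comment> \<open>The argument is spelled \<open>1 *\<^sub>R x + 0\<close> to make the first term
   an instance of \<open>C_k_affine\<close>.\<close>
 have "frechet_derivative (\<lambda>x. f x * (x \<bullet> v + a)) (at x) b =
   (b \<bullet> v) * f (1 *\<^sub>R x + 0) + frechet_derivative f (at x) b * (x \<bullet> v + a)" for x b
  using frechet_derivative_eqI[OF d, of x] by simp
 then have "C_k k (\<lambda>x. frechet_derivative (\<lambda>x. f x * (x \<bullet> v + a)) (at x) b)" if "b \<in> Basis" for b
  using C_k_add[OF C_k_affine[OF C_k_Suc_D[OF Suc.prems], of "b \<bullet> v" 1 0]] Suc that by simp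
 moreover have "(\<lambda>x. f x * (x \<bullet> v + a)) differentiable (at x)" for x
  using d by (rule differentiableI)
 ultimately show ?case by simp
qed

lemma C_c_infinityI:
 assumes "\<And>k. C_k k f" "compact T" "{x. f x \<noteq> 0} \<subseteq> T" "T \<subseteq> U"
 shows "f \<in> C_c_infinity U"
proof -
 have "supp f \<subseteq> T"
  unfolding supp_def using assms by (intro closure_minimal) (auto intro: compact_imp_closed)
 then have "compact (supp f)"
  using assms(2) by (metis compact_closure compact_imp_bounded bounded_subset closure_subset
   supp_def compact_eq_bounded_closed closed_closure)
 with \<open>supp f \<subseteq> T\<close> assms show ?thesis by (auto simp: C_c_infinity_def)
qed

lemma supp_nz: "f x \<noteq> 0 ==> x \<in> supp f"
 unfolding supp_def using closure_subset by force

lemma C_c_infinity_mono: "U \<subseteq> V ==> C_c_infinity U \<subseteq> C_c_infinity V"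
 by (auto simp: C_c_infinity_def)

lemma C_c_infinity_differentiable: "f \<in> C_c_infinity U ==> f differentiable (at x)"
 unfolding C_c_infinity_def by (auto dest!: spec[of _ "Suc 0"])

lemma C_c_infinity_continuous: "f \<in> C_c_infinity U ==> continuous_on UNIV f"
 unfolding C_c_infinity_def by (auto dest!: spec[of _ "0"])

lemma C_c_infinity_has_derivative:
 "f \<in> C_c_infinity U ==> (f has_derivative frechet_derivative f (at x)) (at x)"
 using C_c_infinity_differentiable frechet_derivative_works by blast

lemma C_c_infinity_partial:
 assumes "f \<in> C_c_infinity U" "b \<in> Basis"
 shows "continuous_on UNIV (\<lambda>x. frechet_derivative f (at x) b)"
  and "\<And>x. x \<notin> supp f ==> frechet_derivative f (at x) b = 0"
proof -
 have "C_k (Suc 0) f" using assms(1) unfolding C_c_infinity_def by blast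
 then show "continuous_on UNIV (\<lambda>x. frechet_derivative f (at x) b)"
  using assms(2) by auto
 fix x assume x: "x \<notin> supp f"
 have "open (- supp f)" by (auto simp: supp_def)
 then have "eventually (\<lambda>y. y \<in> - supp f) (nhds x)" using x by (intro eventually_nhds_in_open) auto
 then have "eventually (\<lambda>y. f y = 0) (nhds x)"
  by eventually_elim (use supp_nz in auto)
 then have "\<forall>\<^sub>F y in at x. (\<lambda>_. 0) y = f y"
  by (auto simp: eventually_at_filter elim: eventually_mono)
 then have "(f has_derivative (\<lambda>_. 0)) (at x)"
  by (rule has_derivative_transform_eventually[OF has_derivative_const[of 0]])
   (use x supp_nz in force)+
 then show "frechet_derivative f (at x) b = 0"
  by (rule frechet_derivative_eqI)
qed

lemma continuous_compact_support_bounded: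
 fixes f :: "'a::metric_space => 'b::real_normed_vector"
 assumes "continuous_on UNIV f" "compact T" "\<And>x. x \<notin> T ==> f x = 0"
 obtains B where "B > 0" "\<And>x. norm (f x) \<le> B"
proof -
 have "compact (f ` T)"
  using assms by (intro compact_continuous_image continuous_on_subset[OF assms(1)]) auto
 then obtain B where B: "B > 0" "\<And>y. y \<in> f ` T ==> norm y \<le> B"
  using compact_imp_bounded bounded_pos by metis
 show thesis
  by (rule that[of B]) (use B assms(3) in \<open>metis imageI less_imp_le norm_zero\<close>)+
qed

text \<open>The kernel F_r of direction \<open>c\<close>: \<open>\<beta>\<close> is moved to
  \<open>c\<close> and dilated by \<open>r\<close>, and the divisor preserves its integral. As
  \<open>r\<close> decreases the support shrinks to the origin inside a cone around
  \<open>c\<close>, which keeps averages near the boundary within the domain.\<close>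

definition cone_kernel :: "('a::euclidean_space => real) => 'a => real => 'a => real" where
 "cone_kernel \<beta> c r y = \<beta> (y /\<^sub>R r - c) / r ^ DIM('a)"

lemma cone_kernel_support:
 assumes "supp \<beta> \<subseteq> ball 0 \<kappa>" "r > 0" "cone_kernel \<beta> c r y \<noteq> 0"
 shows "\<exists>v\<in>ball c \<kappa>. y = r *\<^sub>R v"
proof -
 have "y /\<^sub>R r - c \<in> ball 0 \<kappa>"
  using assms supp_nz[of \<beta> "y /\<^sub>R r - c"] by (auto simp: cone_kernel_def)
 then have "y /\<^sub>R r \<in> ball c \<kappa>" by (auto simp: dist_norm norm_minus_commute)
 moreover have "y = r *\<^sub>R (y /\<^sub>R r)" using assms(2) by simp
 ultimately show ?thesis by blast
qed

lemma cone_kernel_norm_le: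
 assumes "supp \<beta> \<subseteq> ball 0 \<kappa>" "r > 0" "cone_kernel \<beta> c r y \<noteq> 0"
 shows "norm y \<le> r * (norm c + \<kappa>)"
proof -
 obtain v where v: "v \<in> ball c \<kappa>" "y = r *\<^sub>R v" using cone_kernel_support[OF assms] by blast
 have "norm v \<le> norm c + norm (v - c)" by (metis norm_triangle_sub)
 then have "norm v \<le> norm c + \<kappa>" using v by (auto simp: dist_norm norm_minus_commute)
 then show ?thesis using v assms by (simp add: mult_left_mono)
qed

text \<open>The product with a coordinate is included because the field F_r(y) y is tested component
  by component; its divergence links the averages for different \<open>r\<close>.\<close>

lemma cone_kernel_test:
 fixes \<beta> :: "'a::euclidean_space => real"
 assumes \<beta>: "\<beta> \<in> C_c_infinity UNIV" "supp \<beta> \<subseteq> ball 0 \<kappa>" and r: "r > 0"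
  and U: "\<And>v. v \<in> ball c \<kappa> ==> x + r *\<^sub>R v \<in> U"
 shows "(\<lambda>z. cone_kernel \<beta> c r (z - x)) \<in> C_c_infinity U"
  and "(\<lambda>z. cone_kernel \<beta> c r (z - x) * ((z - x) \<bullet> b)) \<in> C_c_infinity U"
proof -
 define T where "T = (\<lambda>v. x + r *\<^sub>R (c + v)) ` supp \<beta>"
 have T: "compact T"
  unfolding T_def using \<beta> by (intro compact_continuous_image continuous_intros)
   (auto simp: C_c_infinity_def)
 have TU: "T \<subseteq> U"
  unfolding T_def using \<beta> U by (force simp: dist_norm)
 have nz: "z \<in> T" if "cone_kernel \<beta> c r (z - x) \<noteq> 0" for z
 proof -
  have "(z - x) /\<^sub>R r - c \<in> supp \<beta>" using that by (auto simp: cone_kernel_def intro: supp_nz)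
  moreover have "z = x + r *\<^sub>R (c + ((z - x) /\<^sub>R r - c))" using r by simp
  ultimately show ?thesis unfolding T_def by blast
 qed
 have eq: "cone_kernel \<beta> c r (z - x) =
   (1 / r ^ DIM('a)) * \<beta> ((1/r) *\<^sub>R z + (- (x /\<^sub>R r) - c))" for z
  by (simp add: cone_kernel_def algebra_simps divide_inverse_commute)
 have Ck: "C_k k (\<lambda>z. cone_kernel \<beta> c r (z - x))" for k
  unfolding eq using \<beta> by (intro C_k_affine) (auto simp: C_c_infinity_def)
 then have Ck2: "C_k k (\<lambda>z. cone_kernel \<beta> c r (z - x) * ((z - x) \<bullet> b))" for k
  using C_k_mult_linear[of k "\<lambda>z. cone_kernel \<beta> c r (z - x)" b "- (x \<bullet> b)"]
  by (simp add: inner_diff_left)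
 show "(\<lambda>z. cone_kernel \<beta> c r (z - x)) \<in> C_c_infinity U"
  using Ck nz TU by (intro C_c_infinityI[OF _ T]) auto
 show "(\<lambda>z. cone_kernel \<beta> c r (z - x) * ((z - x) \<bullet> b)) \<in> C_c_infinity U"
  using Ck2 nz TU by (intro C_c_infinityI[OF _ T]) auto
qed

section \<open>Vector measures and their densities\<close>

lemma integrable_indicator_mult:
 fixes f :: "'a => real"
 shows "A \<in> sets M ==> integrable M f ==> integrable M (\<lambda>x. indicator A x * f x)"
 using integrable_mult_indicator[of A M f] by simp

section \<open>Jordan decomposition of countably additive set functions\<close>

definition countably_additive_fun :: "('a::euclidean_space set => 'b::real_normed_vector) => bool" where
 "countably_additive_fun \<nu> \<longleftrightarrow>
   (\<forall>F. range F \<subseteq> sets borel \<and> disjoint_family F \<longrightarrow> (\<lambda>i::nat. \<nu> (F i)) sums \<nu> (\<Union>i. F i))"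

lemma caf_sums:
 "countably_additive_fun \<nu> ==> range F \<subseteq> sets borel ==> disjoint_family F ==>
  (\<lambda>i::nat. \<nu> (F i)) sums \<nu> (\<Union>i. F i)"
 unfolding countably_additive_fun_def by blast

text \<open>The empty set repeated for ever is a disjoint family, so a constant series converges and
  its term must be 0.\<close>

lemma caf_empty:
 assumes "countably_additive_fun \<nu>" shows "\<nu> {} = 0"
proof -
 have "(\<lambda>i::nat. \<nu> {}) sums \<nu> {}"
  using caf_sums[OF assms, of "\<lambda>_. {}"] by (auto simp: disjoint_family_on_def)
 then have "(\<lambda>i::nat. \<nu> {}) \<longlonglongrightarrow> 0" by (intro summable_LIMSEQ_zero) (auto simp: sums_iff)
 then show ?thesis using LIMSEQ_unique tendsto_const by blast
qed

lemma caf_Un: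
 assumes \<nu>: "countably_additive_fun \<nu>" and "A \<in> sets borel" "B \<in> sets borel" "A \<inter> B = {}"
 shows "\<nu> (A \<union> B) = \<nu> A + \<nu> B"
proof -
 have "(\<lambda>i. \<nu> (binaryset A B i)) sums \<nu> (\<Union>i. binaryset A B i)"
  using assms by (intro caf_sums[OF \<nu>])
   (auto simp: binaryset_def disjoint_family_on_def)
 moreover have "(\<lambda>i. \<nu> (binaryset A B i)) sums (\<nu> A + \<nu> B)"
  using caf_empty[OF \<nu>] by (intro binaryset_sums) auto
 ultimately show ?thesis using sums_unique2 by (metis UN_binaryset_eq)
qed

lemma caf_Diff:
 assumes \<nu>: "countably_additive_fun \<nu>" and "A \<in> sets borel" "B \<in> sets borel" "A \<subseteq> B"
 shows "\<nu> (B - A) = \<nu> B - \<nu> A"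
proof -
 have "\<nu> (A \<union> (B - A)) = \<nu> A + \<nu> (B - A)"
  using assms by (intro caf_Un) auto
 moreover have "A \<union> (B - A) = B" using assms by auto
 ultimately show ?thesis by simp
qed

text \<open>The set function behind \<open>positive_part\<close>, named because it must be known to
  be countably additive before \<open>measure_of\<close> takes over its values.\<close>

definition upper_var :: "('a::euclidean_space set => real) => 'a set => ennreal" where
 "upper_var \<nu> A = (SUP B \<in> {B \<in> sets borel. B \<subseteq> A}. ennreal (\<nu> B))"

lemma upper_var_upper: "B \<in> sets borel ==> B \<subseteq> A ==> ennreal (\<nu> B) \<le> upper_var \<nu> A"
 unfolding upper_var_def by (intro SUP_upper) auto

lemma upper_var_countably_additive:
 assumes \<nu>: "countably_additive_fun \<nu>"
 shows "countably_additive (sets borel) (upper_var \<nu>)"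
proof (rule countably_additiveI)
 fix A :: "nat => 'a set"
 assume A: "range A \<subseteq> sets borel" "disjoint_family A" "(\<Union>i. A i) \<in> sets borel"
 show "(\<Sum>i. upper_var \<nu> (A i)) = upper_var \<nu> (\<Union>i. A i)"
 proof (rule antisym)
  show "upper_var \<nu> (\<Union>i. A i) \<le> (\<Sum>i. upper_var \<nu> (A i))"
   unfolding upper_var_def[of \<nu> "\<Union>i. A i"]
  proof (intro SUP_least, clarify)
   fix B assume B: "B \<in> sets borel" "B \<subseteq> (\<Union>i. A i)"
   have d: "disjoint_family (\<lambda>i. B \<inter> A i)" using A(2) by (auto simp: disjoint_family_on_def)
   have "(\<Union>i. B \<inter> A i) = B" using B by auto
   then have s: "(\<lambda>i. \<nu> (B \<inter> A i)) sums \<nu> B"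
    using caf_sums[OF \<nu> _ d] A B by (simp add: image_subset_iff)
   have lim: "(\<lambda>n. \<Sum>i<n. \<nu> (B \<inter> A i)) \<longlonglongrightarrow> \<nu> B" using s by (simp add: sums_def)
   have "ennreal (\<Sum>i<n. \<nu> (B \<inter> A i)) \<le> (\<Sum>i. upper_var \<nu> (A i))" for n
   proof -
    have "ennreal (\<Sum>i<n. \<nu> (B \<inter> A i)) \<le> ennreal (\<Sum>i<n. max 0 (\<nu> (B \<inter> A i)))"
     by (intro ennreal_leI sum_mono) auto
    also have "\<dots> = (\<Sum>i<n. ennreal (max 0 (\<nu> (B \<inter> A i))))"
     by (intro sum_ennreal[symmetric]) auto
    also have "\<dots> = (\<Sum>i<n. ennreal (\<nu> (B \<inter> A i)))"
     by (intro sum.cong) (auto simp: max_def ennreal_neg)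
    also have "\<dots> \<le> (\<Sum>i<n. upper_var \<nu> (A i))"
     using A B by (intro sum_mono upper_var_upper) auto
    also have "\<dots> \<le> (\<Sum>i. upper_var \<nu> (A i))"
     by (intro sum_le_suminf) auto
    finally show ?thesis .
   qed
   moreover have "(\<lambda>n. ennreal (\<Sum>i<n. \<nu> (B \<inter> A i))) \<longlonglongrightarrow> ennreal (\<nu> B)"
    using lim by (rule tendsto_ennrealI)
   ultimately show "ennreal (\<nu> B) \<le> (\<Sum>i. upper_var \<nu> (A i))"
    by (intro LIMSEQ_le_const2) auto
  qed
 next
  have fin: "(\<Sum>i<n. upper_var \<nu> (A i)) \<le> upper_var \<nu> (\<Union>i<n. A i)" for n
  proof (induction n)
   case (Suc n)
   have "upper_var \<nu> (\<Union>i<n. A i) + upper_var \<nu> (A n) \<le> upper_var \<nu> (\<Union>i<Suc n. A i)"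
   proof -
    have "ennreal (\<nu> B) + ennreal (\<nu> C) \<le> upper_var \<nu> (\<Union>i<Suc n. A i)" (is ?th)
     if "B \<in> {B \<in> sets borel. B \<subseteq> (\<Union>i<n. A i)}" "C \<in> {B \<in> sets borel. B \<subseteq> A n}" for B C
    proof -
    from that
    have BC: "B \<in> sets borel" "B \<subseteq> (\<Union>i<n. A i)" "C \<in> sets borel" "C \<subseteq> A n" by auto
    have "A i \<inter> A n = {}" if "i < n" for i using A(2) that by (simp add: disjoint_family_on_def)
    then have dis: "(\<Union>i<n. A i) \<inter> A n = {}" by auto
    \<comment> \<open>If both values are nonnegative, the union of the two sets competes in the
      supremum; a negative value counts as 0, and then the other set competes alone.\<close>
    consider "\<nu> B \<ge> 0" "\<nu> C \<ge> 0" | "\<nu> B < 0" | "\<nu> C < 0" by linarith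
    then show ?th
    proof cases
     case 1
     have "B \<inter> C = {}" using dis BC by blast
     then have "ennreal (\<nu> B) + ennreal (\<nu> C) = ennreal (\<nu> (B \<union> C))"
      using caf_Un[OF \<nu> BC(1,3)] 1 by (subst ennreal_plus[symmetric]) auto
     then show ?thesis using BC by (auto intro!: upper_var_upper simp: lessThan_Suc)
    qed (use BC in \<open>auto intro!: upper_var_upper simp: lessThan_Suc ennreal_neg\<close>)
    qed
    note pair = this
    have ne: "{B \<in> sets borel. B \<subseteq> X} \<noteq> {}" for X :: "'a set"
     by (auto intro!: exI[of _ "{}"])
    have "ennreal (\<nu> B) + upper_var \<nu> (A n) \<le> upper_var \<nu> (\<Union>i<Suc n. A i)"
     if "B \<in> {B \<in> sets borel. B \<subseteq> (\<Union>i<n. A i)}" for B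
     unfolding upper_var_def[of \<nu> "A n"] ennreal_SUP_add_right[OF ne]
     by (intro SUP_least pair[OF that])
    then show ?thesis
     unfolding upper_var_def[of \<nu> "\<Union>i<n. A i"] ennreal_SUP_add_left[OF ne, symmetric]
     by (intro SUP_least)
   qed
   with Suc show ?case by (simp add: ac_simps) (metis add_mono_thms_linordered_semiring(2)
    add.commute order_trans)
  qed auto
  have mono: "upper_var \<nu> (\<Union>i<n. A i) \<le> upper_var \<nu> (\<Union>i. A i)" for n
   unfolding upper_var_def by (intro SUP_subset_mono) auto
  show "(\<Sum>i. upper_var \<nu> (A i)) \<le> upper_var \<nu> (\<Union>i. A i)"
   using fin mono by (intro suminf_le_const) (auto intro: order_trans)
 qed
qed

lemma upper_var_empty: "countably_additive_fun \<nu> ==> upper_var \<nu> {} = 0"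
 by (simp add: upper_var_def caf_empty cong: conj_cong)

lemma positive_part_upper_var: "positive_part \<nu> = measure_of UNIV (sets borel) (upper_var \<nu>)"
 unfolding positive_part_def upper_var_def ..

lemma sets_positive_part [simp]: "sets (positive_part \<nu>) = sets borel"
 unfolding positive_part_def
 by (subst sets_measure_of) (auto simp: sets.sigma_sets_eq[of borel, simplified])

lemma space_positive_part [simp]: "space (positive_part \<nu>) = UNIV"
 using sets_eq_imp_space_eq[OF sets_positive_part] by simp

lemma emeasure_positive_part:
 assumes "countably_additive_fun \<nu>" "A \<in> sets borel"
 shows "emeasure (positive_part \<nu>) A = upper_var \<nu> A"
proof (rule emeasure_measure_of[OF positive_part_upper_var])
 show "sets borel \<subseteq> Pow UNIV" by simp
 show "positive (sets (positive_part \<nu>)) (upper_var \<nu>)"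
  using upper_var_empty[OF assms(1)] by (simp add: positive_def)
 show "countably_additive (sets (positive_part \<nu>)) (upper_var \<nu>)"
  using upper_var_countably_additive[OF assms(1)] by simp
qed (use assms in simp)

text \<open>If the upper variation were infinite, one could split off disjoint sets of measure larger than
 one forever, contradicting the convergence of the series.\<close>

lemma upper_var_finite:
 assumes \<nu>: "countably_additive_fun \<nu>"
 shows "upper_var \<nu> UNIV \<noteq> \<infinity>"
proof
 assume inf: "upper_var \<nu> UNIV = \<infinity>"
 define P where "P = positive_part \<nu>"
 have P: "emeasure P A = upper_var \<nu> A" if "A \<in> sets borel" for A
  using emeasure_positive_part[OF \<nu> that] by (simp add: P_def)
 have split: "\<exists>B. B \<in> sets borel \<and> B \<subseteq> E \<and> upper_var \<nu> B = \<infinity> \<and> \<bar>\<nu> (E - B)\<bar> > 1"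
  if E: "E \<in> sets borel" "upper_var \<nu> E = \<infinity>" for E
 proof -
  \<comment> \<open>A set B of value above 1 + |\<nu> E| leaves a rest E - B of value below -1, so
    both parts are large. The infinite upper variation sits on one of them, and the other can be
    split off.\<close>
  have "ennreal (1 + \<bar>\<nu> E\<bar>) < upper_var \<nu> E" using E by (simp add: ennreal_less_top)
  then obtain B where B: "B \<in> sets borel" "B \<subseteq> E" "ennreal (1 + \<bar>\<nu> E\<bar>) < ennreal (\<nu> B)"
   unfolding upper_var_def less_SUP_iff by auto
  have b: "\<nu> B > 1 + \<bar>\<nu> E\<bar>" using B(3) by (subst (asm) ennreal_less_iff) auto
  have d: "\<nu> (E - B) = \<nu> E - \<nu> B" using caf_Diff[OF \<nu>] B E by auto
  have "emeasure P (B \<union> (E - B)) = emeasure P B + emeasure P (E - B)"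
   using B E by (intro plus_emeasure[symmetric]) (auto simp: P_def)
  moreover have "B \<union> (E - B) = E" using B by auto
  ultimately have "upper_var \<nu> B + upper_var \<nu> (E - B) = \<infinity>"
   using B E by (simp add: P)
  then consider "upper_var \<nu> B = \<infinity>" | "upper_var \<nu> (E - B) = \<infinity>" by auto
  then show ?thesis
  proof cases
   case 1 then show ?thesis using B d b by (intro exI[of _ B]) auto
  next
   case 2
   have "E - (E - B) = B" using B by auto
   then show ?thesis using 2 B E b by (intro exI[of _ "E - B"]) auto
  qed
 qed
 define nxt where "nxt E = (SOME B. B \<in> sets borel \<and> B \<subseteq> E \<and> upper_var \<nu> B = \<infinity> \<and> \<bar>\<nu> (E - B)\<bar> > 1)" for E
 have nxt: "nxt E \<in> sets borel \<and> nxt E \<subseteq> E \<and> upper_var \<nu> (nxt E) = \<infinity> \<and> \<bar>\<nu> (E - nxt E)\<bar> > 1"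
  if "E \<in> sets borel" "upper_var \<nu> E = \<infinity>" for E
  unfolding nxt_def by (rule someI_ex[OF split[OF that]])
 define S where "S n = (nxt ^^ n) UNIV" for n
 have S: "S n \<in> sets borel \<and> upper_var \<nu> (S n) = \<infinity>" for n
  by (induction n) (use inf nxt in \<open>auto simp: S_def\<close>)
 have Suc: "S (Suc n) = nxt (S n)" for n by (simp add: S_def)
 have dec: "S n \<subseteq> S m" if "m \<le> n" for m n
  using that by (induction rule: dec_induct) (use nxt S Suc in blast)+
 define F where "F n = S n - S (Suc n)" for n
 have "disjoint_family F"
  unfolding disjoint_family_on_def
 proof (intro ballI impI)
  fix m n :: nat assume "m \<noteq> n"
  then show "F m \<inter> F n = {}"
   using dec[of "Suc m" n] dec[of "Suc n" m] unfolding F_def by (cases "m < n") auto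
 qed
 then have "(\<lambda>n. \<nu> (F n)) sums \<nu> (\<Union>n. F n)"
  using S unfolding F_def by (intro caf_sums[OF \<nu>]) auto
 then have "(\<lambda>n. \<nu> (F n)) \<longlonglongrightarrow> 0" by (intro summable_LIMSEQ_zero) (auto simp: sums_iff)
 then have "eventually (\<lambda>n. \<bar>\<nu> (F n)\<bar> < 1) sequentially"
  using order_tendstoD(2)[OF tendsto_rabs_zero] zero_less_one by blast
 then obtain n where "\<bar>\<nu> (F n)\<bar> < 1" by (auto simp: eventually_sequentially)
 moreover have "\<bar>\<nu> (F n)\<bar> > 1" using nxt[of "S n"] S Suc by (simp add: F_def)
 ultimately show False by simp
qed

lemma finite_measure_positive_part:
 assumes "countably_additive_fun \<nu>" shows "finite_measure (positive_part \<nu>)"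
 using upper_var_finite[OF assms] emeasure_positive_part[OF assms, of UNIV]
 by (intro finite_measureI) auto

lemma caf_uminus: "countably_additive_fun \<nu> ==> countably_additive_fun (\<lambda>A. - \<nu> A)"
 unfolding countably_additive_fun_def using sums_minus by metis

text \<open>For B inside A, \<nu> B = \<nu> A - \<nu> (A - B), and -\<nu> (A - B) is at most the
  negative variation of A. The supremum over B gives one inequality, the same argument for -\<nu>
  the other.\<close>

lemma jordan_decomposition:
 assumes \<nu>: "countably_additive_fun \<nu>" and A: "A \<in> sets borel"
 shows "\<nu> A = measure (positive_part \<nu>) A - measure (positive_part (\<lambda>A. - \<nu> A)) A"
proof -
 interpret P: finite_measure "positive_part \<nu>" by (rule finite_measure_positive_part[OF \<nu>])
 interpret N: finite_measure "positive_part (\<lambda>A. - \<nu> A)"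
  by (rule finite_measure_positive_part[OF caf_uminus[OF \<nu>]])
 have le: "measure (positive_part \<nu>) A \<le> measure (positive_part (\<lambda>A. - \<nu> A)) A + \<nu> A"
  if \<nu>: "countably_additive_fun \<nu>" for \<nu>
 proof -
  interpret P: finite_measure "positive_part \<nu>" by (rule finite_measure_positive_part[OF \<nu>])
  interpret N: finite_measure "positive_part (\<lambda>A. - \<nu> A)"
   by (rule finite_measure_positive_part[OF caf_uminus[OF \<nu>]])
  have N: "- \<nu> B \<le> measure (positive_part (\<lambda>A. - \<nu> A)) A" if "B \<in> sets borel" "B \<subseteq> A" for B
  proof -
   have "ennreal (- \<nu> B) \<le> emeasure (positive_part (\<lambda>A. - \<nu> A)) A"
    using upper_var_upper[OF that, of "\<lambda>A. - \<nu> A"] emeasure_positive_part[OF caf_uminus[OF \<nu>] A] by simp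
   then show ?thesis by (simp add: N.emeasure_eq_measure ennreal_le_iff)
  qed
  have "emeasure (positive_part \<nu>) A \<le> ennreal (measure (positive_part (\<lambda>A. - \<nu> A)) A + \<nu> A)"
   unfolding emeasure_positive_part[OF \<nu> A] upper_var_def
  proof (intro SUP_least ennreal_leI, clarify)
   fix B assume B: "B \<in> sets borel" "B \<subseteq> A"
   have "\<nu> (A - B) = \<nu> A - \<nu> B" using caf_Diff[OF \<nu> B(1) A B(2)] .
   then show "\<nu> B \<le> measure (positive_part (\<lambda>A. - \<nu> A)) A + \<nu> A"
    using N[of "A - B"] A B by auto
  qed
  moreover have "0 \<le> measure (positive_part (\<lambda>A. - \<nu> A)) A + \<nu> A" using N[OF A] by auto
  ultimately show ?thesis by (simp add: P.emeasure_eq_measure ennreal_le_iff)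
 qed
 show ?thesis using le[OF \<nu>] le[OF caf_uminus[OF \<nu>]] by simp
qed

text \<open>Set functions are handled through a density with respect to some positive measure:
  \<open>lborel\<close> for the regularised functionals, a finite dominating measure for the limit.
  The type of values is left open to cover vector measures and their components.\<close>

definition represents :: "('a::euclidean_space set => 'b::euclidean_space) => 'a measure => ('a => 'b) => bool" where
 "represents q M f \<longleftrightarrow> sets M = sets borel \<and> integrable M f \<and> (\<forall>A\<in>sets borel. q A = (LINT x:A|M. f x))"

lemma represents_caf:
 assumes "represents q M f" shows "countably_additive_fun q"
 unfolding countably_additive_fun_def
proof (intro allI impI, elim conjE)
 fix F :: "nat => 'a set" assume F: "range F \<subseteq> sets borel" "disjoint_family F"
 have m: "sets M = sets borel" and f: "integrable M f" using assms by (auto simp: represents_def)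
 have si: "set_integrable M A f" if "A \<in> sets borel" for A
  using f that m by (auto simp: set_integrable_def intro!: integrable_mult_indicator integrable_indicator_mult)
 have U: "(\<Union>n. \<Union>i<n. F i) = (\<Union>i. F i)" by auto
 have "(\<lambda>n. LINT x:(\<Union>i<n. F i)|M. f x) \<longlonglongrightarrow> (LINT x:(\<Union>n. \<Union>i<n. F i)|M. f x)"
  using F m by (intro set_integral_cont_up si)
   (force simp: incseq_def intro!: sets.countable_UN sets.finite_UN)+
 moreover have "(LINT x:(\<Union>i<n. F i)|M. f x) = (\<Sum>i<n. LINT x:F i|M. f x)" for n
  using F m si by (intro set_integral_finite_Union) (auto simp: disjoint_family_on_def)
 ultimately have "(\<lambda>i. LINT x:F i|M. f x) sums (LINT x:(\<Union>i. F i)|M. f x)"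
  by (simp add: sums_def U)
 moreover have "(LINT x:F i|M. f x) = q (F i)" for i using assms F by (auto simp: represents_def)
 moreover have "(LINT x:(\<Union>i. F i)|M. f x) = q (\<Union>i. F i)"
  using assms F by (auto simp: represents_def)
 ultimately show "(\<lambda>i. q (F i)) sums q (\<Union>i. F i)" by simp
qed

lemma vector_measures_caf: "q \<in> vector_measures K ==> countably_additive_fun q"
 unfolding vector_measures_def countably_additive_fun_def by blast

lemma caf_inner: "countably_additive_fun q ==> countably_additive_fun (\<lambda>A. q A \<bullet> b)"
 unfolding countably_additive_fun_def
 using bounded_linear.sums[OF bounded_linear_inner_left[of b]] by metis

lemma emeasure_positive_part_0:
 assumes "countably_additive_fun \<nu>" "A \<in> sets borel" "\<And>B. B \<in> sets borel ==> B \<subseteq> A ==> \<nu> B = 0"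
 shows "emeasure (positive_part \<nu>) A = 0"
 unfolding emeasure_positive_part[OF assms(1,2)] upper_var_def
 using assms(3) by (intro antisym SUP_least) auto

text \<open>Subsets of a null set are null for \<nu>, so its upper variation is absolutely
  continuous. The Radon-Nikodym density is extended-valued at first; finiteness of the positive part
  makes it finite almost everywhere.\<close>

lemma positive_part_RN:
 assumes N: "sigma_finite_measure N" "sets N = sets borel"
  and \<nu>: "countably_additive_fun \<nu>" and ac: "\<And>A. A \<in> null_sets N ==> \<nu> A = 0"
 obtains g where "integrable N g" "\<And>A. A \<in> sets borel ==> measure (positive_part \<nu>) A = (LINT x:A|N. g x)"
proof -
 interpret N: sigma_finite_measure N by fact
 interpret P: finite_measure "positive_part \<nu>" by (rule finite_measure_positive_part[OF \<nu>])
 have "absolutely_continuous N (positive_part \<nu>)"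
  unfolding absolutely_continuous_def
 proof
  fix A assume A: "A \<in> null_sets N"
  have "\<nu> B = 0" if "B \<in> sets borel" "B \<subseteq> A" for B
   using ac null_sets_subset[OF A] that N(2) by metis
  then show "A \<in> null_sets (positive_part \<nu>)"
   using A N(2) by (auto intro!: null_setsI emeasure_positive_part_0[OF \<nu>] dest: null_setsD2)
 qed
 then obtain f where f: "f \<in> borel_measurable N" "density N f = positive_part \<nu>"
  using N.Radon_Nikodym[of "positive_part \<nu>"] N(2) by auto
 have fin: "(\<integral>\<^sup>+x. f x \<partial>N) < \<infinity>"
 proof -
  have "(\<integral>\<^sup>+x. f x \<partial>N) = emeasure (density N f) UNIV"
   using f(1) N(2) sets_eq_imp_space_eq[OF N(2)] by (subst emeasure_density) (auto cong: nn_integral_cong)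
  then show ?thesis using P.emeasure_finite[of UNIV] by (metis f(2) infinity_ennreal_def top.not_eq_extremum)
 qed
 have ae: "AE x in N. ennreal (enn2real (f x)) = f x"
  using nn_integral_PInf_AE[OF f(1)] fin by (auto simp: less_top elim!: AE_mp)
 have meas: "(\<lambda>x. enn2real (f x)) \<in> borel_measurable N" using f(1) by simp
 have nn: "(\<integral>\<^sup>+x. ennreal (enn2real (f x)) \<partial>N) = (\<integral>\<^sup>+x. f x \<partial>N)"
  using ae by (intro nn_integral_cong_AE) auto
 have int: "integrable N (\<lambda>x. enn2real (f x))"
  using meas fin nn by (intro integrableI_nonneg) auto
 show thesis
 proof (rule that[OF int])
  fix A :: "'a set" assume A: "A \<in> sets borel"
  have "ennreal (LINT x:A|N. enn2real (f x)) = (\<integral>\<^sup>+x. ennreal (enn2real (f x) * indicator A x) \<partial>N)"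
   unfolding set_lebesgue_integral_def using int A N(2)
   by (subst nn_integral_eq_integral) (auto simp: mult.commute intro!: integrable_real_mult_indicator)
  also have "\<dots> = (\<integral>\<^sup>+x. f x * indicator A x \<partial>N)"
   using ae by (intro nn_integral_cong_AE) (auto simp: indicator_def)
  also have "\<dots> = emeasure (density N f) A"
   using f(1) A N(2) by (subst emeasure_density) auto
  also have "\<dots> = ennreal (measure (positive_part \<nu>) A)"
   by (simp add: f P.emeasure_eq_measure)
  finally show "measure (positive_part \<nu>) A = (LINT x:A|N. enn2real (f x))"
   by (subst (asm) ennreal_inj) (auto simp: set_lebesgue_integral_def intro!: integral_nonneg_AE)
 qed
qed

lemma represents_sigma_finite:
 fixes q :: "'a::euclidean_space set => 'b::euclidean_space"
 assumes N: "sigma_finite_measure N" "sets N = sets borel"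
  and q: "countably_additive_fun q" and ac: "\<And>A. A \<in> null_sets N ==> q A = 0"
 obtains f where "represents q N f"
proof -
 have "\<exists>g. integrable N g \<and> (\<forall>A\<in>sets borel. q A \<bullet> b = (LINT x:A|N. g x))" for b
 proof -
  have c: "countably_additive_fun (\<lambda>A. q A \<bullet> b)" using q by (rule caf_inner)
  obtain g1 where g1: "integrable N g1"
   "\<And>A. A \<in> sets borel ==> measure (positive_part (\<lambda>A. q A \<bullet> b)) A = (LINT x:A|N. g1 x)"
   using positive_part_RN[OF N c] ac by auto
  obtain g2 where g2: "integrable N g2"
   "\<And>A. A \<in> sets borel ==> measure (positive_part (\<lambda>A. - (q A \<bullet> b))) A = (LINT x:A|N. g2 x)"
   using positive_part_RN[OF N caf_uminus[OF c]] ac by auto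
  have "q A \<bullet> b = (LINT x:A|N. g1 x - g2 x)" if A: "A \<in> sets borel" for A
  proof -
   have "(LINT x:A|N. g1 x - g2 x) = (LINT x:A|N. g1 x) - (LINT x:A|N. g2 x)"
    using g1 g2 A N(2) by (intro set_integral_diff) (auto simp: set_integrable_def intro!: integrable_mult_indicator integrable_indicator_mult)
   then show ?thesis using jordan_decomposition[OF c A] g1(2)[OF A] g2(2)[OF A] by simp
  qed
  then show ?thesis using g1 g2 by (intro exI[of _ "\<lambda>x. g1 x - g2 x"]) auto
 qed
 then obtain g where g: "\<And>b. integrable N (g b)"
  "\<And>b A. A \<in> sets borel ==> q A \<bullet> b = (LINT x:A|N. g b x)" by metis
 have "represents q N (\<lambda>x. \<Sum>b\<in>Basis. g b x *\<^sub>R b)"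
  unfolding represents_def
 proof (intro conjI ballI)
  show "integrable N (\<lambda>x. \<Sum>b\<in>Basis. g b x *\<^sub>R b)" using g by auto
  fix A :: "'a set" assume A: "A \<in> sets borel"
  have gi: "integrable N (\<lambda>x. indicator A x *\<^sub>R g b x)" for b
   using g A N(2) by (intro integrable_mult_indicator) auto
  have "(LINT x:A|N. \<Sum>b\<in>Basis. g b x *\<^sub>R b) = (LINT x|N. (\<Sum>b\<in>Basis. (indicator A x *\<^sub>R g b x) *\<^sub>R b))"
   by (simp add: set_lebesgue_integral_def scaleR_sum_right)
  also have "\<dots> = (\<Sum>b\<in>Basis. (q A \<bullet> b) *\<^sub>R b)"
   using gi by (subst Bochner_Integration.integral_sum) (auto simp: g(2)[OF A] set_lebesgue_integral_def)
  finally show "q A = (LINT x:A|N. \<Sum>b\<in>Basis. g b x *\<^sub>R b)" by (simp add: euclidean_representation)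
 qed (use N in auto)
 then show thesis by (rule that)
qed

text \<open>At this stage \<open>total_variation\<close> is not known to be a finite measure. The
  dominating measure is therefore the sum of the Jordan parts of all components, each finite by
  \<open>upper_var_finite\<close>.\<close>

lemma vector_measure_representation:
 fixes q :: "'a::euclidean_space set => 'a"
 assumes q: "q \<in> vector_measures K" and K: "K \<in> sets borel"
 obtains M f where "represents q M f" "finite_measure M" "emeasure M (- K) = 0"
proof -
 let ?P = "\<lambda>b. positive_part (\<lambda>A. q A \<bullet> b)" and ?N = "\<lambda>b. positive_part (\<lambda>A. - (q A \<bullet> b))"
 let ?\<mu> = "\<lambda>A. \<Sum>b\<in>Basis. emeasure (?P b) A + emeasure (?N b) A"
 define M where "M = measure_of UNIV (sets borel) ?\<mu>"
 have caf: "countably_additive_fun q" by (rule vector_measures_caf[OF q])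
 note c = caf_inner[OF caf] and c' = caf_uminus[OF caf_inner[OF caf]]
 have M: "sets M = sets borel"
  unfolding M_def by (subst sets_measure_of) (auto simp: sets.sigma_sets_eq[of borel, simplified])
 have em: "emeasure M A = ?\<mu> A" if "A \<in> sets borel" for A
 proof (rule emeasure_measure_of[OF M_def])
  show "positive (sets M) ?\<mu>" by (auto simp: positive_def)
  show "countably_additive (sets M) ?\<mu>"
  proof (rule countably_additiveI)
   fix F :: "nat => 'a set" assume F: "range F \<subseteq> sets M" "disjoint_family F"
   have "(\<Sum>i. ?\<mu> (F i)) = (\<Sum>b\<in>Basis. \<Sum>i. emeasure (?P b) (F i) + emeasure (?N b) (F i))"
    by (intro suminf_sum) auto
   also have "\<dots> = (\<Sum>b\<in>Basis. (\<Sum>i. emeasure (?P b) (F i)) + (\<Sum>i. emeasure (?N b) (F i)))"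
    by (intro sum.cong refl suminf_add[symmetric]) auto
   also have "\<dots> = ?\<mu> (\<Union>i. F i)"
    using F M by (intro sum.cong refl arg_cong2[where f="(+)"] suminf_emeasure) auto
   finally show "(\<Sum>i. ?\<mu> (F i)) = ?\<mu> (\<Union>i. F i)" .
  qed
 qed (use that M in auto)
 have fin: "finite_measure M"
  using M em[of UNIV] sets_eq_imp_space_eq[OF M] c c'
  by (intro finite_measureI) (auto simp: finite_measure.emeasure_finite[OF finite_measure_positive_part])
 have null: "q A = 0" if "A \<in> null_sets M" for A
 proof -
  have A: "A \<in> sets borel" using that M by auto
  then have A0: "?\<mu> A = 0" using that em[OF A] by (simp only: null_setsD1)
  have "q A \<bullet> b = 0" if "b \<in> Basis" for b
  proof -
   have "emeasure (?P b) A = 0" "emeasure (?N b) A = 0" using A0 that by auto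
   then show ?thesis using jordan_decomposition[OF c A, of b] by (simp add: measure_def)
  qed
  then show ?thesis by (simp add: euclidean_eq_iff[of _ "0::'a"])
 qed
 have out: "emeasure M (- K) = 0"
 proof -
  have "q B = 0" if "B \<in> sets borel" "B \<subseteq> - K" for B
   using q that unfolding vector_measures_def by blast
  then have "emeasure (?P b) (- K) = 0" "emeasure (?N b) (- K) = 0" for b
   using K by (auto intro!: emeasure_positive_part_0 c c')
  then show ?thesis using K by (subst em) auto
 qed
 interpret M: finite_measure M by fact
 obtain f where "represents q M f"
  using represents_sigma_finite[OF M.sigma_finite_measure_axioms M caf null] by blast
 then show thesis using fin out by (rule that)
qed

text \<open>The supremum is attained on the Hahn set, the part of \<open>A\<close> where
  \<open>g\<close> is nonnegative. The density needs no explicit positive part, as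
  \<open>ennreal\<close> sends negative values to 0.\<close>

lemma positive_part_density:
 fixes \<nu> :: "'a::euclidean_space set => real"
 assumes r: "represents \<nu> M g"
 shows "positive_part \<nu> = density M (\<lambda>x. ennreal (g x))"
proof (rule measure_eqI)
 have M: "sets M = sets borel" and g: "integrable M g" using r by (auto simp: represents_def)
 note gm = borel_measurable_integrable[OF g]
 show "sets (positive_part \<nu>) = sets (density M (\<lambda>x. ennreal (g x)))" using M by simp
 fix A assume "A \<in> sets (positive_part \<nu>)"
 then have A: "A \<in> sets borel" by simp
 have eq: "(\<integral>\<^sup>+x. ennreal (indicator B x * max 0 (g x)) \<partial>M) = ennreal (LINT x|M. indicator B x * max 0 (g x))"
  if "B \<in> sets borel" for B
  using integrable_indicator_mult[of B M "\<lambda>x. max 0 (g x)"] g that M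
  by (intro nn_integral_eq_integral) (auto simp: indicator_def)
 have "upper_var \<nu> A = (\<integral>\<^sup>+x. ennreal (g x) * indicator A x \<partial>M)"
 proof (rule antisym)
  show "upper_var \<nu> A \<le> (\<integral>\<^sup>+x. ennreal (g x) * indicator A x \<partial>M)"
   unfolding upper_var_def
  proof (intro SUP_least, clarify)
   fix B assume B: "B \<in> sets borel" "B \<subseteq> A"
   have "\<nu> B = (LINT x|M. indicator B x * g x)"
    using r B by (simp add: represents_def set_lebesgue_integral_def)
   also have "\<dots> \<le> (LINT x|M. indicator B x * max 0 (g x))"
    using g B M integrable_indicator_mult[of B M "\<lambda>x. max 0 (g x)"] integrable_indicator_mult[of B M g]
    by (intro integral_mono) (auto simp: indicator_def)
   finally have "ennreal (\<nu> B) \<le> (\<integral>\<^sup>+x. ennreal (indicator B x * max 0 (g x)) \<partial>M)"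
    using eq[OF B(1)] by (simp add: ennreal_leI)
   also have "\<dots> \<le> (\<integral>\<^sup>+x. ennreal (g x) * indicator A x \<partial>M)"
    using B by (intro nn_integral_mono) (auto simp: indicator_def max_def)
   finally show "ennreal (\<nu> B) \<le> (\<integral>\<^sup>+x. ennreal (g x) * indicator A x \<partial>M)" .
  qed
  define B where "B = A \<inter> {x. g x \<ge> 0}"
  have "{x \<in> space M. g x \<ge> 0} \<in> sets M" using gm by measurable
  then have B: "B \<in> sets borel" "B \<subseteq> A" using A M sets_eq_imp_space_eq[OF M] by (auto simp: B_def)
  have "(\<integral>\<^sup>+x. ennreal (g x) * indicator A x \<partial>M) = (\<integral>\<^sup>+x. ennreal (indicator B x * max 0 (g x)) \<partial>M)"
   by (intro nn_integral_cong) (auto simp: B_def indicator_def ennreal_neg)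
  also have "\<dots> = ennreal (LINT x|M. indicator B x * max 0 (g x))" by (rule eq[OF B(1)])
  also have "(LINT x|M. indicator B x * max 0 (g x)) = (LINT x|M. indicator B x * g x)"
   by (intro LINT_cong) (auto simp: B_def indicator_def)
  also have "\<dots> = \<nu> B" using r B by (simp add: represents_def set_lebesgue_integral_def)
  also have "ennreal (\<nu> B) \<le> upper_var \<nu> A" using B by (rule upper_var_upper)
  finally show "(\<integral>\<^sup>+x. ennreal (g x) * indicator A x \<partial>M) \<le> upper_var \<nu> A" .
 qed
 then show "emeasure (positive_part \<nu>) A = emeasure (density M (\<lambda>x. ennreal (g x))) A"
  using A M gm by (simp add: emeasure_positive_part[OF represents_caf[OF r]] emeasure_density)
qed

lemma represents_inner:
 assumes r: "represents q M f" shows "represents (\<lambda>A. q A \<bullet> b) M (\<lambda>x. f x \<bullet> b)"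
 unfolding represents_def
proof (intro conjI ballI)
 have f: "sets M = sets borel" "integrable M f" using r by (auto simp: represents_def)
 then show "sets M = sets borel" "integrable M (\<lambda>x. f x \<bullet> b)" by auto
 fix A :: "'a set" assume A: "A \<in> sets borel"
 then have "integrable M (\<lambda>x. indicator A x *\<^sub>R f x)"
  using f by (intro integrable_mult_indicator) auto
 then have "(LINT x|M. indicator A x *\<^sub>R f x) \<bullet> b = (LINT x|M. (indicator A x *\<^sub>R f x) \<bullet> b)"
  by (intro integral_inner_left[symmetric]) auto
 then show "q A \<bullet> b = (LINT x:A|M. f x \<bullet> b)"
  using r A by (simp add: represents_def set_lebesgue_integral_def)
qed

lemma represents_uminus: "represents q M f ==> represents (\<lambda>A. - q A) M (\<lambda>x. - f x)"
 unfolding represents_def set_lebesgue_integral_def by auto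

lemma integrable_bounded_mult:
 fixes g :: "'a => real"
 assumes "integrable M g" "h \<in> borel_measurable M" "\<And>x. \<bar>h x\<bar> \<le> B"
 shows "integrable M (\<lambda>x. h x * g x)"
proof (rule Bochner_Integration.integrable_bound)
 show "integrable M (\<lambda>x. B * norm (g x))" using assms by auto
 show "AE x in M. norm (h x * g x) \<le> norm (B * norm (g x))"
  using assms(3) order_trans[OF abs_ge_zero assms(3)] by (auto simp: abs_mult intro!: mult_right_mono)
qed (use assms in auto)

lemma compact_indicator:
 fixes \<phi> :: "'a::euclidean_space => 'b::euclidean_space"
 assumes "compact K" "continuous_on K \<phi>"
 shows "(\<lambda>x. indicator K x *\<^sub>R \<phi> x) \<in> borel_measurable borel"
  and "\<exists>B\<ge>0. \<forall>x. norm (indicator K x *\<^sub>R \<phi> x) \<le> B"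
proof -
 show "(\<lambda>x. indicator K x *\<^sub>R \<phi> x) \<in> borel_measurable borel"
  using assms by (intro borel_measurable_continuous_on_indicator) (auto dest: compact_imp_closed)
 have "bounded (\<phi> ` K)" using assms by (intro compact_imp_bounded compact_continuous_image)
 then obtain B where "\<forall>y\<in>\<phi> ` K. norm y \<le> B" by (auto simp: bounded_iff)
 then show "\<exists>B\<ge>0. \<forall>x. norm (indicator K x *\<^sub>R \<phi> x) \<le> B"
  by (intro exI[of _ "max B 0"]) (auto simp: indicator_def)
qed

lemma signed_integral_represents:
 fixes h :: "'a::euclidean_space => real"
 assumes r: "represents \<nu> M g" and K: "compact K" "continuous_on K h"
 shows "integrable M (\<lambda>x. indicator K x * h x * g x)"
  and "signed_integral K \<nu> h = (LINT x|M. indicator K x * h x * g x)"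
proof -
 have M: "sets M = sets borel" and g: "integrable M g" using r by (auto simp: represents_def)
 note hm = compact_indicator(1)[OF K]
 have hm': "(\<lambda>x. indicator K x * h x) \<in> borel_measurable M" using hm M by (simp cong: measurable_cong_sets)
 obtain B where B: "\<And>x. \<bar>indicator K x * h x\<bar> \<le> B"
  using compact_indicator(2)[OF K] by auto
 have int: "integrable M (\<lambda>x. indicator K x * h x * g x)" if "integrable M g" for g
  using that hm' B by (rule integrable_bounded_mult)
 show "integrable M (\<lambda>x. indicator K x * h x * g x)" using g by (rule int)
 have gm: "g \<in> borel_measurable M" using g by auto
 have *: "(LINT x:K|density M (\<lambda>x. ennreal (f x)). h x) = (LINT x|M. indicator K x * h x * max 0 (f x))"
  if "f \<in> borel_measurable M" for f
 proof -
  \<comment> \<open>The density formula for Bochner integrals asks for a nonnegative real density,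
    hence the detour over the maximum.\<close>
  have "(LINT x:K|density M (\<lambda>x. ennreal (max 0 (f x))). h x) = (LINT x|M. indicator K x * h x * max 0 (f x))"
   unfolding set_lebesgue_integral_def using hm' that
   by (subst integral_density) (auto simp: ac_simps)
  moreover have "(\<lambda>x. ennreal (max 0 (f x))) = (\<lambda>x. ennreal (f x))"
   by (auto simp: max_def ennreal_neg)
  ultimately show ?thesis by simp
 qed
 have "signed_integral K \<nu> h = (LINT x|M. indicator K x * h x * max 0 (g x)) -
   (LINT x|M. indicator K x * h x * max 0 (- g x))"
  unfolding signed_integral_def positive_part_density[OF r]
   positive_part_density[OF represents_uminus[OF r]]
  using gm by (simp add: *)
 also have "\<dots> = (LINT x|M. indicator K x * h x * max 0 (g x) - indicator K x * h x * max 0 (- g x))"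
  using g by (intro LINT_diff[symmetric] int) auto
 also have "\<dots> = (LINT x|M. indicator K x * h x * g x)"
  by (intro LINT_cong) (auto simp: max_def)
 finally show "signed_integral K \<nu> h = (LINT x|M. indicator K x * h x * g x)" .
qed

lemma vector_integral_represents:
 fixes \<phi> :: "'a::euclidean_space => 'a"
 assumes r: "represents q M f" and K: "compact K" "continuous_on K \<phi>"
 shows "vector_integral K q \<phi> = (LINT x|M. indicator K x * (\<phi> x \<bullet> f x))"
  and "integrable M (\<lambda>x. indicator K x * (\<phi> x \<bullet> f x))"
proof -
 have c: "continuous_on K (\<lambda>x. \<phi> x \<bullet> b)" for b using K by (intro continuous_intros)
 note s = signed_integral_represents[OF represents_inner[OF r] K(1) c]
 have eq: "(\<Sum>b\<in>Basis. indicator K x * (\<phi> x \<bullet> b) * (f x \<bullet> b)) = indicator K x * (\<phi> x \<bullet> f x)" for x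
  by (subst euclidean_inner) (simp add: sum_distrib_left ac_simps)
 have "vector_integral K q \<phi> = (\<Sum>b\<in>Basis. (LINT x|M. indicator K x * (\<phi> x \<bullet> b) * (f x \<bullet> b)))"
  unfolding vector_integral_def by (intro sum.cong refl s)
 also have "\<dots> = (LINT x|M. (\<Sum>b\<in>Basis. indicator K x * (\<phi> x \<bullet> b) * (f x \<bullet> b)))"
  using s(1) by (subst Bochner_Integration.integral_sum) auto
 finally show "vector_integral K q \<phi> = (LINT x|M. indicator K x * (\<phi> x \<bullet> f x))" by (simp add: eq)
 have "integrable M (\<lambda>x. \<Sum>b\<in>Basis. indicator K x * (\<phi> x \<bullet> b) * (f x \<bullet> b))"
  using s(1) by auto
 then show "integrable M (\<lambda>x. indicator K x * (\<phi> x \<bullet> f x))" by (simp add: eq)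
qed

text \<open>One inequality is the triangle inequality. For the other, \<open>A\<close> is cut into
  countably many pieces on which \<open>f\<close> stays close to one vector of a countable dense
  set; there the norm of the integral and the integral of the norm almost agree.\<close>

lemma total_variation_density:
 fixes q :: "'a::euclidean_space set => 'a"
 assumes r: "represents q M f" and fin: "finite_measure M"
 shows "total_variation q = density M (\<lambda>x. ennreal (norm (f x)))"
proof -
 interpret finite_measure M by fact
 have M: "sets M = sets borel" and f: "integrable M f" using r by (auto simp: represents_def)
 have sp: "space M = UNIV" using sets_eq_imp_space_eq[OF M] by simp
 have fm: "f \<in> borel_measurable M" using f by auto
 let ?D = "density M (\<lambda>x. ennreal (norm (f x)))"
 have em: "emeasure ?D A = (\<integral>\<^sup>+x. ennreal (norm (f x)) * indicator A x \<partial>M)" if "A \<in> sets borel" for A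
  using that fm M by (intro emeasure_density) auto
 have emi: "emeasure ?D A = ennreal (LINT x|M. indicator A x * norm (f x))" if "A \<in> sets borel" for A
 proof -
  have "(\<integral>\<^sup>+x. ennreal (indicator A x * norm (f x)) \<partial>M) = ennreal (LINT x|M. indicator A x * norm (f x))"
   using that f M by (intro nn_integral_eq_integral integrable_indicator_mult) auto
  moreover have "(\<integral>\<^sup>+x. ennreal (indicator A x * norm (f x)) \<partial>M) = emeasure ?D A"
   unfolding em[OF that] by (intro nn_integral_cong) (auto simp: indicator_def)
  ultimately show ?thesis by simp
 qed
 have intA: "integrable M (\<lambda>x. indicator A x *\<^sub>R f x)" if "A \<in> sets borel" for A
  using that f M by (intro integrable_mult_indicator) auto
 let ?\<mu> = "\<lambda>A. SUP F \<in> {F :: nat => 'a set. range F \<subseteq> sets borel \<and> disjoint_family F \<and> (\<Union>i. F i) = A}.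
      (\<Sum>i. ennreal (norm (q (F i))))"
 have "?\<mu> A = emeasure ?D A" if A: "A \<in> sets borel" for A
 proof (rule antisym)
  show "?\<mu> A \<le> emeasure ?D A"
  proof (intro SUP_least, clarify)
   fix F :: "nat => 'a set" assume F: "range F \<subseteq> sets borel" "disjoint_family F" "A = (\<Union>i. F i)"
   have "norm (q (F i)) \<le> (LINT x|M. indicator (F i) x * norm (f x))" for i
   proof -
    have "norm (q (F i)) = norm (LINT x|M. indicator (F i) x *\<^sub>R f x)"
     using r F by (simp add: represents_def set_lebesgue_integral_def image_subset_iff)
    also have "\<dots> \<le> (LINT x|M. norm (indicator (F i) x *\<^sub>R f x))" by (rule integral_norm_bound)
    finally show ?thesis by simp
   qed
   then have "(\<Sum>i. ennreal (norm (q (F i)))) \<le> (\<Sum>i. emeasure ?D (F i))"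
    using F by (intro suminf_le) (auto simp: emi image_subset_iff ennreal_leI)
   also have "\<dots> = emeasure ?D (\<Union>i. F i)"
    using F M by (intro suminf_emeasure) auto
   finally show "(\<Sum>i. ennreal (norm (q (F i)))) \<le> emeasure ?D (\<Union>i. F i)" .
  qed
  show "emeasure ?D A \<le> ?\<mu> A"
  proof (rule ennreal_le_epsilon)
   fix e :: real assume "e > 0"
   \<comment> \<open>On every piece the error is 2 \<epsilon> times its measure: \<epsilon> for
     replacing the norm of \<open>f\<close> by that of \<open>d i\<close>, and \<epsilon> for
     replacing \<open>q (F i)\<close> by the integral of the constant. The summand 1 keeps the
     divisor positive when \<open>M\<close> is 0.\<close>
   define \<epsilon> where "\<epsilon> = e / (2 * (measure M UNIV + 1))"
   have mp: "measure M UNIV + 1 > 0" using measure_nonneg[of M UNIV] by linarith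
   have \<epsilon>: "\<epsilon> > 0" using \<open>e > 0\<close> mp by (simp add: \<epsilon>_def)
   have "2 * \<epsilon> * (measure M UNIV + 1) = e" using mp by (simp add: \<epsilon>_def field_simps)
   then have \<epsilon>M: "2 * \<epsilon> * measure M UNIV \<le> e" using \<epsilon> by (simp add: algebra_simps)
   obtain D :: "'a set" where D: "countable D" "\<And>X. open X ==> X \<noteq> {} ==> \<exists>d\<in>D. d \<in> X"
    using countable_dense_setE by blast
   have "D \<noteq> {}" using D(2)[of UNIV] by auto
   define d where "d = from_nat_into D"
   have rd: "range d = D" using D(1) \<open>D \<noteq> {}\<close> by (simp add: d_def)
   define E where "E i = A \<inter> f -` ball (d i) \<epsilon>" for i
   define F where "F = disjointed E"
   have E: "E i \<in> sets borel" for i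
    using measurable_sets[OF fm, of "ball (d i) \<epsilon>"] A M sp by (auto simp: E_def)
   then have F: "F i \<in> sets borel" for i
    using sets.range_disjointed_sets[of E borel] by (auto simp: F_def)
   have UE: "(\<Union>i. E i) = A"
   proof -
    have "\<exists>i. f x \<in> ball (d i) \<epsilon>" for x
     using D(2)[of "ball (f x) \<epsilon>"] \<epsilon> rd by (auto simp: dist_commute)
    then show ?thesis by (auto simp: E_def)
   qed
   have FU: "(\<Union>i. F i) = A" "disjoint_family F"
    unfolding F_def using UE by (simp_all add: UN_disjointed_eq disjoint_family_disjointed)
   have FE: "F i \<subseteq> E i" for i unfolding F_def by (rule disjointed_subset)
   have est: "(LINT x|M. indicator (F i) x * norm (f x)) \<le> norm (q (F i)) + 2 * \<epsilon> * measure M (F i)" for i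
   proof -
    have ic: "integrable M (\<lambda>x. indicator (F i) x *\<^sub>R c)" for c :: "'c::euclidean_space"
     using F M by (intro integrable_mult_indicator) auto
    have ic': "integrable M (\<lambda>x. indicator (F i) x * c)" for c :: real
     using ic[of c] by simp
    have Ic: "(LINT x|M. indicator (F i) x * c) = c * measure M (F i)" for c :: real
     using F[of i] M sp by simp
    have bd: "norm (f x - d i) \<le> \<epsilon>" if "x \<in> F i" for x
     using FE[of i] that by (auto simp: E_def dist_norm norm_minus_commute less_imp_le)
    have "(LINT x|M. indicator (F i) x * norm (f x)) \<le> (LINT x|M. indicator (F i) x * (norm (d i) + \<epsilon>))"
    proof (intro integral_mono)
     show "integrable M (\<lambda>x. indicator (F i) x * norm (f x))"
      using integrable_norm[OF intA[OF F[of i]]] by simp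
     show "integrable M (\<lambda>x. indicator (F i) x * (norm (d i) + \<epsilon>))" by (rule ic')
     show "indicator (F i) x * norm (f x) \<le> indicator (F i) x * (norm (d i) + \<epsilon>)" for x
      using bd[of x] norm_triangle_sub[of "f x" "d i"] by (auto simp: indicator_def)
    qed
    also have "\<dots> = (norm (d i) + \<epsilon>) * measure M (F i)" by (rule Ic)
    finally have 1: "(LINT x|M. indicator (F i) x * norm (f x)) \<le> (norm (d i) + \<epsilon>) * measure M (F i)" .
    have "(LINT x|M. indicator (F i) x *\<^sub>R d i) = measure M (F i) *\<^sub>R d i"
    proof -
     have "emeasure M (F i) < \<infinity>" using emeasure_finite[of "F i"] by (simp add: less_top[symmetric])
     then have "has_bochner_integral M (\<lambda>x. indicator (F i) x *\<^sub>R d i) (measure M (F i) *\<^sub>R d i)"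
      using F[of i] M by (intro has_bochner_integral_indicator) auto
     then show ?thesis by (rule has_bochner_integral_integral_eq)
    qed
    then have "q (F i) - measure M (F i) *\<^sub>R d i = (LINT x|M. indicator (F i) x *\<^sub>R f x) - (LINT x|M. indicator (F i) x *\<^sub>R d i)"
     using r F[of i] M sp by (simp add: represents_def set_lebesgue_integral_def)
    also have "\<dots> = (LINT x|M. indicator (F i) x *\<^sub>R f x - indicator (F i) x *\<^sub>R d i)"
     by (intro LINT_diff[symmetric] intA F ic)
    also have "norm \<dots> \<le> (LINT x|M. indicator (F i) x * \<epsilon>)"
    proof (rule order_trans[OF integral_norm_bound], rule integral_mono)
     show "integrable M (\<lambda>x. norm (indicator (F i) x *\<^sub>R f x - indicator (F i) x *\<^sub>R d i))"
      by (intro integrable_norm Bochner_Integration.integrable_diff intA F ic)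
     show "integrable M (\<lambda>x. indicator (F i) x * \<epsilon>)" by (rule ic')
     show "norm (indicator (F i) x *\<^sub>R f x - indicator (F i) x *\<^sub>R d i) \<le> indicator (F i) x * \<epsilon>" for x
      using bd[of x] by (auto simp: indicator_def)
    qed
    also have "\<dots> = \<epsilon> * measure M (F i)" by (rule Ic)
    finally have "norm (measure M (F i) *\<^sub>R d i) \<le> norm (q (F i)) + \<epsilon> * measure M (F i)"
     using norm_triangle_sub[of "measure M (F i) *\<^sub>R d i" "q (F i)"] by (simp add: norm_minus_commute)
    then show ?thesis using 1 by (simp add: algebra_simps)
   qed
   have "emeasure ?D A = (\<Sum>i. emeasure ?D (F i))"
    using FU F M by (subst suminf_emeasure) (auto simp: FU)
   also have "\<dots> \<le> (\<Sum>i. ennreal (norm (q (F i))) + ennreal (2 * \<epsilon>) * emeasure M (F i))"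
   proof (intro suminf_le)
    fix i
    have "emeasure ?D (F i) \<le> ennreal (norm (q (F i)) + 2 * \<epsilon> * measure M (F i))"
     using est F by (simp add: emi ennreal_leI)
    also have "\<dots> = ennreal (norm (q (F i))) + ennreal (2 * \<epsilon>) * emeasure M (F i)"
     using \<epsilon> by (simp add: emeasure_eq_measure ennreal_mult ennreal_plus)
    finally show "emeasure ?D (F i) \<le> ennreal (norm (q (F i))) + ennreal (2 * \<epsilon>) * emeasure M (F i)" .
   qed auto
   also have "\<dots> = (\<Sum>i. ennreal (norm (q (F i)))) + ennreal (2 * \<epsilon>) * (\<Sum>i. emeasure M (F i))"
    by (subst suminf_add[symmetric]) (auto simp: ennreal_suminf_cmult)
   also have "(\<Sum>i. emeasure M (F i)) = emeasure M A"
    using FU F M by (subst suminf_emeasure) (auto simp: FU)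
   finally have 1: "emeasure ?D A \<le> (\<Sum>i. ennreal (norm (q (F i)))) + ennreal (2 * \<epsilon>) * emeasure M A" .
   have 2: "ennreal (2 * \<epsilon>) * emeasure M A \<le> ennreal e"
   proof -
    have "ennreal (2 * \<epsilon>) * emeasure M A = ennreal (2 * \<epsilon> * measure M A)"
     using \<epsilon> by (simp add: emeasure_eq_measure ennreal_mult)
    also have "2 * \<epsilon> * measure M A \<le> 2 * \<epsilon> * measure M UNIV"
     using \<epsilon> M A by (intro mult_left_mono finite_measure_mono) auto
    also have "\<dots> \<le> e" by (rule \<epsilon>M)
    finally show ?thesis by (simp add: ennreal_leI)
   qed
   have 3: "(\<Sum>i. ennreal (norm (q (F i)))) \<le> ?\<mu> A"
    using FU F by (intro SUP_upper) auto
   show "emeasure ?D A \<le> ?\<mu> A + ennreal e" by (rule order_trans[OF 1 add_mono[OF 3 2]])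
  qed
 qed
 then have "total_variation q = measure_of UNIV (sets borel) (emeasure ?D)"
  unfolding total_variation_def by (intro measure_of_eq) (auto simp: sets.sigma_sets_eq[of borel, simplified])
 also have "\<dots> = measure_of (space ?D) (sets ?D) (emeasure ?D)" using M sp by simp
 also have "\<dots> = ?D" by (rule measure_of_of_measure)
 finally show ?thesis .
qed

section \<open>Mollification and weak gradients\<close>

text \<open>Stated for arbitrary finite Borel measures because it serves two of them: the measure
  with density |f|, and Lebesgue measure on a ball.\<close>

lemma continuous_dense_L1:
 fixes g :: "'a::euclidean_space => 'b::euclidean_space"
 assumes N: "finite_measure N" "sets N = sets borel" and g: "integrable N g" and "e > 0"
 shows "\<exists>c. continuous_on UNIV c \<and> integrable N c \<and> (LINT x|N. norm (g x - c x)) < e"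
 using g \<open>e > 0\<close>
proof (induction arbitrary: e rule: integrable_induct)
 case (base A v)
 interpret finite_measure N by fact
 have sp: "space N = UNIV" using sets_eq_imp_space_eq[OF N(2)] by simp
 \<comment> \<open>The indicator and its Urysohn substitute differ at most on U - K, of measure
   below 2 e'. This explains the factor 2; the summand 1 allows v = 0.\<close>
 define e' where "e' = e / (2 * (norm v + 1))"
 have nv: "norm v + 1 > 0" by (simp add: add_nonneg_pos)
 have e0: "e' > 0" using base(3) nv by (simp add: e'_def)
 have "2 * e' * (norm v + 1) = e" using nv by (simp add: e'_def field_simps)
 then have e': "e' > 0" "norm v * (2 * e') < e" using e0 by (simp_all add: algebra_simps)
 have A: "A \<in> sets borel" using base N by auto
 have fin: "emeasure N (space N) \<noteq> \<infinity>" by simp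
 have "\<exists>K\<in>{K. K \<subseteq> A \<and> compact K}. emeasure N A < emeasure N K + ennreal e'"
  using e' by (intro SUP_approx_ennreal inner_regular[OF N(2) fin A])
   (auto intro!: exI[of _ "{}"] simp: less_top[symmetric])
 then obtain K where K: "K \<subseteq> A" "compact K" "emeasure N A < emeasure N K + ennreal e'" by auto
 have "\<exists>U\<in>{U. A \<subseteq> U \<and> open U}. emeasure N U < emeasure N A + ennreal e'"
  using e' by (intro INF_approx_ennreal outer_regular[OF N(2) fin A]) auto
 then obtain U where U: "A \<subseteq> U" "open U" "emeasure N U < emeasure N A + ennreal e'" by auto
 have mA: "measure N A < measure N K + e'"
  using K(3) e' by (simp add: emeasure_eq_measure ennreal_less_iff flip: ennreal_plus)
 have mU: "measure N U < measure N A + e'"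
  using U(3) e' by (simp add: emeasure_eq_measure ennreal_less_iff flip: ennreal_plus)
 have KB: "K \<in> sets borel" "U \<in> sets borel" using K U by (auto intro: borel_compact)
 have mUK: "measure N (U - K) < 2 * e'"
  using mA mU KB N K U by (subst finite_measure_Diff) auto
 have cl: "closed K" "closed (- U)" "K \<inter> - U = {}" using K U compact_imp_closed by auto
 obtain h :: "'a => real" where h: "continuous_on UNIV h" "\<And>x. h x \<in> closed_segment 1 0"
  "\<And>x. x \<in> K ==> h x = 1" "\<And>x. x \<in> - U ==> h x = 0"
  by (rule Urysohn[OF cl, where a="1::real" and b=0], rule that)
 have h01: "0 \<le> h x" "h x \<le> 1" for x using h(2)[of x] by (auto simp: closed_segment_eq_real_ivl)
 have hm: "h \<in> borel_measurable N"
  using borel_measurable_continuous_onI[OF h(1)] N by (simp cong: measurable_cong_sets)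
 have ih: "integrable N h"
  by (rule integrable_const_bound[of _ 1]) (use h01 hm in auto)
 have "(LINT x|N. norm (indicator A x *\<^sub>R v - h x *\<^sub>R v)) \<le> (LINT x|N. indicator (U - K) x * norm v)"
 proof (rule integral_mono)
  show "integrable N (\<lambda>x. norm (indicator A x *\<^sub>R v - h x *\<^sub>R v))"
   using ih A N by (intro integrable_norm Bochner_Integration.integrable_diff integrable_mult_indicator
    integrable_scaleR_left) auto
  show "integrable N (\<lambda>x. indicator (U - K) x * norm v)"
   using KB N by (intro integrable_indicator_mult) auto
  fix x
  have "indicator A x *\<^sub>R v - h x *\<^sub>R v = (indicator A x - h x) *\<^sub>R v" by (simp add: scaleR_diff_left)
  moreover have "\<bar>indicator A x - h x\<bar> \<le> (indicator (U - K) x :: real)"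
   using h01[of x] h(3,4)[of x] K(1) U(1) by (auto simp: indicator_def)
  ultimately show "norm (indicator A x *\<^sub>R v - h x *\<^sub>R v) \<le> indicator (U - K) x * norm v"
   by (simp add: mult_right_mono)
 qed
 also have "\<dots> = norm v * measure N (U - K)" using KB N sp by simp
 also have "\<dots> \<le> norm v * (2 * e')" using mUK by (intro mult_left_mono) auto
 also have "\<dots> < e" by (rule e')
 finally show ?case
  using h(1) ih by (intro exI[of _ "\<lambda>x. h x *\<^sub>R v"]) (auto intro!: continuous_intros)
next
 case (add f g)
 obtain c1 where c1: "continuous_on UNIV c1" "integrable N c1" "(LINT x|N. norm (f x - c1 x)) < e/2"
  using add.IH(1)[of "e/2"] add.prems by auto
 obtain c2 where c2: "continuous_on UNIV c2" "integrable N c2" "(LINT x|N. norm (g x - c2 x)) < e/2"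
  using add.IH(2)[of "e/2"] add.prems by auto
 have "(LINT x|N. norm (f x + g x - (c1 x + c2 x))) \<le> (LINT x|N. norm (f x - c1 x) + norm (g x - c2 x))"
  using c1 c2 add.hyps
  by (intro integral_mono) (auto simp: add_diff_add norm_triangle_ineq)
 also have "\<dots> < e" using c1 c2 add.hyps by (subst Bochner_Integration.integral_add) auto
 finally show ?case using c1 c2
  by (intro exI[of _ "\<lambda>x. c1 x + c2 x"]) (auto intro!: continuous_intros)
next
 case (lim f s)
 have "(\<lambda>i. LINT x|N. norm (f x - s i x)) \<longlonglongrightarrow> (LINT x|N. (0::real))"
 proof (rule integral_dominated_convergence[where w="\<lambda>x. 3 * norm (f x)"])
  show "AE x in N. (\<lambda>i. norm (f x - s i x)) \<longlonglongrightarrow> 0"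
  proof (rule AE_I2)
   fix x assume "x \<in> space N"
   then have "(\<lambda>i. norm (f x - s i x)) \<longlonglongrightarrow> norm (f x - f x)"
    by (intro tendsto_intros lim.hyps)
   then show "(\<lambda>i. norm (f x - s i x)) \<longlonglongrightarrow> 0" by simp
  qed
  show "AE x in N. norm (norm (f x - s i x)) \<le> 3 * norm (f x)" for i
  proof (rule AE_I2)
   fix x assume "x \<in> space N"
   then show "norm (norm (f x - s i x)) \<le> 3 * norm (f x)"
    using lim.hyps(3)[of x i] norm_triangle_ineq4[of "f x" "s i x"] by simp
  qed
 qed (use lim.hyps in auto)
 then have "(\<lambda>i. LINT x|N. norm (f x - s i x)) \<longlonglongrightarrow> 0" by simp
 then have "\<forall>\<^sub>F i in sequentially. (LINT x|N. norm (f x - s i x)) < e/2"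
  using lim.prems by (intro order_tendstoD(2)) auto
 then obtain i where i: "(LINT x|N. norm (f x - s i x)) < e/2" by (auto simp: eventually_sequentially)
 obtain c where c: "continuous_on UNIV c" "integrable N c" "(LINT x|N. norm (s i x - c x)) < e/2"
  using lim.IH[of "e/2" i] lim.prems by auto
 have "(LINT x|N. norm (f x - c x)) \<le> (LINT x|N. norm (f x - s i x) + norm (s i x - c x))"
  using c lim norm_triangle_ineq[of "f x - s i x" "s i x - c x" for x]
  by (intro integral_mono) auto
 also have "\<dots> < e" using c i lim by (subst Bochner_Integration.integral_add) auto
 finally show ?case using c by blast
qed

text \<open>The optimal field W sgn f is only measurable. It is approximated by continuous fields in
  L1 of the measure |f| M, which controls exactly the error of the pairing, and these are then
  forced into the unit ball to become admissible.\<close>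

lemma integral_norm_le_by_duality:
 fixes f :: "'a::euclidean_space => 'b::euclidean_space"
 assumes M: "sets M = sets borel" and f: "integrable M f" and K: "compact K"
  and W: "continuous_on K W" "\<And>x. x \<in> K ==> 0 \<le> W x"
  and le: "\<And>\<psi>. continuous_on K \<psi> ==> (\<And>x. x \<in> K ==> norm (\<psi> x) \<le> W x) ==>
   (LINT x|M. indicator K x * (\<psi> x \<bullet> f x)) \<le> C"
 shows "(LINT x|M. indicator K x * (W x * norm (f x))) \<le> C"
proof (rule field_le_epsilon)
 fix e :: real assume "e > 0"
 obtain B where B: "B \<ge> 0" "\<And>x. \<bar>indicator K x * W x\<bar> \<le> B"
  using compact_indicator(2)[OF K W(1)] by auto
 have Wm: "(\<lambda>x. indicator K x * W x) \<in> borel_measurable M"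
  using compact_indicator(1)[OF K W(1)] M by (simp cong: measurable_cong_sets)
 define N where "N = density M (\<lambda>x. ennreal (norm (f x)))"
 have fm: "f \<in> borel_measurable M" using f by auto
 have N: "sets N = sets borel" using M by (simp add: N_def)
 have "emeasure N (space N) = (\<integral>\<^sup>+x. ennreal (norm (f x)) \<partial>M)"
  using fm by (simp add: N_def emeasure_density cong: nn_integral_cong)
 also have "\<dots> < \<infinity>" using f by (simp add: integrable_iff_bounded)
 finally have fin: "finite_measure N" by (intro finite_measureI) auto
 interpret N: finite_measure N by fact
 have sg: "integrable N (\<lambda>x. sgn (f x))"
  using fm by (intro N.integrable_const_bound[of _ 1]) (auto simp: norm_sgn N_def)
 define e' where "e' = e / (B + 1)"
 have e0: "e' > 0" using \<open>e > 0\<close> B(1) by (simp add: e'_def)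
 have "e' * (B + 1) = e" using B(1) by (simp add: e'_def)
 then have e': "e' > 0" "B * e' \<le> e" using e0 by (simp_all add: algebra_simps)
 obtain c where c: "continuous_on UNIV c" "integrable N c" "(LINT x|N. norm (sgn (f x) - c x)) < e'"
  using continuous_dense_L1[OF fin N sg e'(1)] by blast
 \<comment> \<open>The projection onto the unit ball is 1-Lipschitz and fixes sgn f, so it does not
   spoil the approximation.\<close>
 define p where "p x = closest_point (cball 0 1) (c x)" for x
 have cont_cp: "continuous_on UNIV (closest_point (cball (0::'b) 1))"
  by (intro continuous_on_closest_point) auto
 have p: "continuous_on UNIV p"
  unfolding p_def by (rule continuous_on_compose2[OF cont_cp c(1)]) auto
 have p1: "norm (p x) \<le> 1" for x
  using closest_point_in_set[of "cball (0::'b) 1" "c x"] by (simp add: p_def)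
 have ps: "norm (sgn (f x) - p x) \<le> norm (sgn (f x) - c x)" for x
 proof -
  have "closest_point (cball 0 1) (sgn (f x)) = sgn (f x)"
   by (intro closest_point_self) (auto simp: norm_sgn)
  then show ?thesis
   using closest_point_lipschitz[of "cball (0::'b) 1" "sgn (f x)" "c x"]
   by (simp add: p_def dist_norm)
 qed
 have pm: "p \<in> borel_measurable M"
  using borel_measurable_continuous_onI[OF p] M by (simp cong: measurable_cong_sets)
 have cm: "c \<in> borel_measurable M"
  using borel_measurable_continuous_onI[OF c(1)] M by (simp cong: measurable_cong_sets)
 have int1: "integrable M (\<lambda>x. (indicator K x * W x) * norm (f x))"
  using f Wm B by (intro integrable_bounded_mult[where B=B]) auto
 have ipf: "integrable M (\<lambda>x. p x \<bullet> f x)"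
 proof (rule Bochner_Integration.integrable_bound[OF integrable_norm[OF f]])
  show "AE x in M. norm (p x \<bullet> f x) \<le> norm (norm (f x))"
   using p1 by (intro AE_I2) (metis Cauchy_Schwarz_ineq2 abs_norm_cancel dual_order.trans
    mult_left_le_one_le norm_ge_zero real_norm_def)
 qed (use pm fm in measurable)
 have int2: "integrable M (\<lambda>x. (indicator K x * W x) * (p x \<bullet> f x))"
  using ipf Wm B by (intro integrable_bounded_mult[where B=B]) auto
 have int3: "integrable M (\<lambda>x. norm (f x) * norm (sgn (f x) - c x))"
 proof -
  have "integrable (density M (\<lambda>x. ennreal (norm (f x)))) (\<lambda>x. norm (sgn (f x) - c x))"
   using sg c unfolding N_def[symmetric] by auto
  then show ?thesis
   using fm cm by (subst (asm) integrable_density) auto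
 qed
 have eqN: "(LINT x|N. norm (sgn (f x) - c x)) = (LINT x|M. norm (f x) * norm (sgn (f x) - c x))"
  unfolding N_def using fm cm by (subst integral_density) auto
 have "(LINT x|M. indicator K x * (W x * norm (f x))) - (LINT x|M. indicator K x * ((W x *\<^sub>R p x) \<bullet> f x))
   = (LINT x|M. (indicator K x * W x) * norm (f x) - (indicator K x * W x) * (p x \<bullet> f x))"
  using int1 int2 by (subst LINT_diff) (auto simp: ac_simps)
 also have "\<dots> \<le> (LINT x|M. B * (norm (f x) * norm (sgn (f x) - c x)))"
 proof (rule integral_mono)
  fix x
  have "norm (f x) - p x \<bullet> f x = (sgn (f x) - p x) \<bullet> f x"
   by (cases "f x = 0") (simp_all add: inner_diff_left sgn_div_norm dot_square_norm power2_eq_square)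
  also have "\<dots> \<le> norm (sgn (f x) - c x) * norm (f x)"
   using norm_cauchy_schwarz[of "sgn (f x) - p x" "f x"] ps[of x]
   by (meson mult_right_mono norm_ge_zero order_trans)
  finally have 1: "norm (f x) - p x \<bullet> f x \<le> norm (f x) * norm (sgn (f x) - c x)" by (simp add: ac_simps)
  have "(indicator K x * W x) * norm (f x) - (indicator K x * W x) * (p x \<bullet> f x)
   = (indicator K x * W x) * (norm (f x) - p x \<bullet> f x)" by (simp add: algebra_simps)
  also have "\<dots> \<le> (indicator K x * W x) * (norm (f x) * norm (sgn (f x) - c x))"
   using W(2) by (intro mult_left_mono[OF 1]) (auto simp: indicator_def)
  also have "\<dots> \<le> B * (norm (f x) * norm (sgn (f x) - c x))"
   using B(2)[of x] by (intro mult_right_mono) auto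
  finally show "(indicator K x * W x) * norm (f x) - (indicator K x * W x) * (p x \<bullet> f x)
   \<le> B * (norm (f x) * norm (sgn (f x) - c x))" .
 qed (use int1 int2 int3 in auto)
 also have "\<dots> = B * (LINT x|N. norm (sgn (f x) - c x))" by (simp add: eqN)
 also have "\<dots> \<le> B * e'" using c(3) B by (intro mult_left_mono) auto
 also have "\<dots> \<le> e" by (rule e')
 finally have "(LINT x|M. indicator K x * (W x * norm (f x)))
   \<le> (LINT x|M. indicator K x * ((W x *\<^sub>R p x) \<bullet> f x)) + e" by simp
 moreover have "(LINT x|M. indicator K x * ((W x *\<^sub>R p x) \<bullet> f x)) \<le> C"
 proof (rule le)
  show "continuous_on K (\<lambda>x. W x *\<^sub>R p x)"
   using W p by (intro continuous_intros) (auto intro: continuous_on_subset)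
  show "norm (W x *\<^sub>R p x) \<le> W x" if "x \<in> K" for x
   using W(2)[OF that] p1[of x] by (simp add: mult_left_le)
 qed
 ultimately show "(LINT x|M. indicator K x * (W x * norm (f x))) \<le> C + e" by simp
qed

section \<open>Translations in L1\<close>

lemma integrable_continuous_compact_support:
 fixes f :: "'a::euclidean_space => 'b::euclidean_space"
 assumes "continuous_on UNIV f" "compact T" "\<And>x. x \<notin> T ==> f x = 0"
 shows "integrable lborel f"
proof -
 have "integrable lborel (\<lambda>x. indicator T x *\<^sub>R f x)"
  using assms by (intro borel_integrable_compact) (auto intro: continuous_on_subset)
 moreover have "(\<lambda>x. indicator T x *\<^sub>R f x) = f"
  using assms(3) by (auto simp: indicator_def)
 ultimately show ?thesis by simp
qed

lemma lborel_translate: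
 fixes f :: "'a::euclidean_space => 'b::{banach, second_countable_topology}"
 assumes "f \<in> borel_measurable borel"
 shows "(LBINT x. f (x + h)) = (LBINT x. f x)"
  and "integrable lborel (\<lambda>x. f (x + h)) \<longleftrightarrow> integrable lborel f"
proof -
 have "(LBINT x. f x) = (LINT x|distr lborel borel ((+) h). f x)" by (simp add: lborel_distr_plus)
 also have "\<dots> = (LBINT x. f (h + x))" using assms by (subst integral_distr) auto
 finally show "(LBINT x. f (x + h)) = (LBINT x. f x)" by (simp add: add.commute)
 have "integrable lborel f \<longleftrightarrow> integrable (distr lborel borel ((+) h)) f" by (simp add: lborel_distr_plus)
 also have "\<dots> \<longleftrightarrow> integrable lborel (\<lambda>x. f (h + x))" using assms by (subst integrable_distr_eq) auto
 finally show "integrable lborel (\<lambda>x. f (x + h)) \<longleftrightarrow> integrable lborel f" by (simp add: add.commute)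
qed

lemma L1_approx_compact_support:
 fixes f :: "'a::euclidean_space => 'b::euclidean_space"
 assumes f: "integrable lborel f" and "e > 0"
 obtains k R where "continuous_on UNIV k" "R > 0" "\<And>x. norm x \<ge> R ==> k x = 0"
  "(LBINT x. norm (f x - k x)) < e"
proof -
 have fm: "f \<in> borel_measurable borel" using f by (auto dest: borel_measurable_integrable)
 have "(\<lambda>n::nat. LINT x|lborel. indicator (- ball 0 (real n)) x * norm (f x)) \<longlonglongrightarrow> (LINT x|(lborel::'a measure). (0::real))"
 proof (rule integral_dominated_convergence[where w="\<lambda>x. norm (f x)"])
  show "AE x in lborel. (\<lambda>n. indicator (- ball 0 (real n)) x * norm (f x)) \<longlonglongrightarrow> 0"
  proof (rule AE_I2)
   fix x :: 'a
   have "\<forall>\<^sub>F n in sequentially. norm x < real n"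
    using eventually_gt_at_top filterlim_real_sequentially
    by (auto intro: filterlim_at_top_dense[THEN iffD1, rule_format])
   then have "\<forall>\<^sub>F n in sequentially. indicator (- ball 0 (real n)) x * norm (f x) = 0"
    by eventually_elim auto
   then show "(\<lambda>n. indicator (- ball 0 (real n)) x * norm (f x)) \<longlonglongrightarrow> 0" by (rule tendsto_eventually)
  qed
 qed (use f fm in \<open>auto simp: indicator_def\<close>)
 then have "(\<lambda>n::nat. LINT x|lborel. indicator (- ball 0 (real n)) x * norm (f x)) \<longlonglongrightarrow> 0" by simp
 then have "\<forall>\<^sub>F n in sequentially. (LBINT x. indicator (- ball 0 (real n)) x * norm (f x)) < e/3"
  using \<open>e > 0\<close> by (intro order_tendstoD(2)) auto
 then obtain n :: nat where n: "(LBINT x. indicator (- ball 0 (real n)) x * norm (f x)) < e/3"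
  by (auto simp: eventually_sequentially)
 define S where "S = ball (0::'a) (real n + 1)"
 define N where "N = density lborel (\<lambda>x. ennreal (indicator S x))"
 have S: "S \<in> sets borel" by (simp add: S_def)
 have "emeasure N (space N) = emeasure lborel S"
  using S by (simp add: N_def emeasure_density nn_integral_indicator ennreal_indicator cong: nn_integral_cong)
 then have fin: "finite_measure N"
  using emeasure_lborel_ball_finite[of "0::'a" "real n + 1"] by (intro finite_measureI) (auto simp: S_def)
 have N: "sets N = sets borel" by (simp add: N_def)
 have fN: "integrable N f"
  unfolding N_def using fm S f by (subst integrable_density) (auto intro!: integrable_mult_indicator)
 obtain c where c: "continuous_on UNIV c" "integrable N c" "(LINT x|N. norm (f x - c x)) < e/3"
  using continuous_dense_L1[OF fin N fN, of "e/3"] \<open>e > 0\<close> by auto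
 have cm: "c \<in> borel_measurable borel" using c(1) by (rule borel_measurable_continuous_onI)
 \<comment> \<open>A cut-off equal to 1 on the ball of radius n and to 0 beyond radius n + 1. In the
   shell between, the error is a convex combination of f, whose tail is small by the choice of n,
   and of f - c.\<close>
 define z where "z x = max 0 (min 1 (real n + 1 - norm x))" for x :: 'a
 define k where "k x = z x *\<^sub>R c x" for x
 have k: "continuous_on UNIV k" unfolding k_def z_def using c by (intro continuous_intros) auto
 have km: "k \<in> borel_measurable borel" using k by (rule borel_measurable_continuous_onI)
 have z0: "k x = 0" if "norm x \<ge> real n + 1" for x using that by (simp add: k_def z_def)
 have eqN: "(LINT x|N. norm (f x - c x)) = (LBINT x. indicator S x * norm (f x - c x))"
  unfolding N_def using fm cm S by (subst integral_density) auto
 have iN: "integrable lborel (\<lambda>x. indicator S x * norm (f x - c x))"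
 proof -
  have "integrable (density lborel (\<lambda>x. ennreal (indicator S x))) (\<lambda>x. norm (f x - c x))"
   using fN c unfolding N_def[symmetric] by auto
  then show ?thesis using fm cm S by (subst (asm) integrable_density) auto
 qed
 have k0: "integrable lborel k"
  by (rule integrable_continuous_compact_support[OF k compact_cball[of 0 "real n + 1"]])
   (auto intro: z0)
 have iB: "integrable lborel (\<lambda>x. indicator (- ball 0 (real n)) x * norm (f x))"
  using f by (intro integrable_indicator_mult) auto
 have "(LBINT x. norm (f x - k x)) \<le>
   (LBINT x. indicator S x * norm (f x - c x) + indicator (- ball 0 (real n)) x * norm (f x))"
 proof (rule integral_mono)
  fix x
  have zb: "0 \<le> z x" "z x \<le> 1" by (auto simp: z_def)
  consider "norm x < real n" | "real n \<le> norm x" "norm x < real n + 1" | "norm x \<ge> real n + 1" by linarith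
  then show "norm (f x - k x) \<le> indicator S x * norm (f x - c x) + indicator (- ball 0 (real n)) x * norm (f x)"
  proof cases
   case 1 then show ?thesis by (simp add: k_def z_def S_def)
  next
   case 2
   have "f x - k x = (1 - z x) *\<^sub>R f x + z x *\<^sub>R (f x - c x)" by (simp add: k_def algebra_simps)
   also have "norm \<dots> \<le> (1 - z x) * norm (f x) + z x * norm (f x - c x)"
    using zb by (metis abs_of_nonneg diff_ge_0_iff_ge norm_scaleR norm_triangle_ineq)
   also have "\<dots> \<le> norm (f x) + norm (f x - c x)"
    using zb by (intro add_mono mult_left_le_one_le) auto
   finally show ?thesis using 2 by (simp add: S_def)
  next
   case 3 then show ?thesis using z0[OF 3] by (simp add: S_def)
  qed
 qed (use f k0 iN iB in auto)
 also have "\<dots> < e"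
  using iN iB n c(3) \<open>e > 0\<close> by (subst Bochner_Integration.integral_add) (auto simp: eqN)
 finally show thesis using that[OF k, of "real n + 1"] z0 by auto
qed

text \<open>Clear for continuous functions with compact support by uniform continuity; approximation
  extends it, since translating the error does not change its L1 norm.\<close>

lemma L1_translation_continuous:
 fixes f :: "'a::euclidean_space => 'b::euclidean_space"
 assumes f: "integrable lborel f" and "e > 0"
 shows "\<exists>d>0. \<forall>h. norm h < d \<longrightarrow> (LBINT x. norm (f (x + h) - f x)) < e"
proof -
 obtain k R where k: "continuous_on UNIV k" "R > 0" "\<And>x. norm x \<ge> R ==> k x = 0"
  "(LBINT x. norm (f x - k x)) < e/3"
  using L1_approx_compact_support[OF f, of "e/3"] \<open>e > 0\<close> by auto
 have fm: "f \<in> borel_measurable borel" using f by (auto dest: borel_measurable_integrable)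
 have km: "k \<in> borel_measurable borel" using k(1) by (rule borel_measurable_continuous_onI)
 have k0: "integrable lborel k"
  by (rule integrable_continuous_compact_support[OF k(1) compact_cball[of 0 R]]) (auto intro: k)
 let ?S = "cball (0::'a) (R + 1)"
 define e' where "e' = e / (3 * (measure lborel ?S + 1))"
 have mS: "measure lborel ?S + 1 > 0" by (simp add: add_nonneg_pos)
 have e': "e' > 0" using \<open>e > 0\<close> mS by (simp add: e'_def)
 have "e' * (measure lborel ?S + 1) = e/3" using mS by (simp add: e'_def field_simps)
 then have e'': "e' * measure lborel ?S < e/3" using e' by (simp add: algebra_simps)
 \<comment> \<open>For |h| < 1 both k x and k (x + h) vanish when |x| > R + 1, and for all other x
   both points lie in the ball of radius R + 2.\<close>
 have "uniformly_continuous_on (cball 0 (R + 2)) k"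
  using k(1) by (intro compact_uniformly_continuous) (auto intro: continuous_on_subset)
 then obtain d where d: "d > 0" "\<And>x x'. x \<in> cball 0 (R + 2) ==> x' \<in> cball 0 (R + 2) ==> dist x' x < d ==> dist (k x') (k x) < e'"
  using e' unfolding uniformly_continuous_on_def by metis
 show ?thesis
 proof (intro exI[of _ "min d 1"] conjI allI impI)
  fix h :: 'a assume h: "norm h < min d 1"
  have iS: "integrable lborel (\<lambda>x. indicator ?S x * e')"
   using emeasure_lborel_cball_finite[of "0::'a" "R + 1"]
   by (intro integrable_mult_left integrable_real_indicator) (auto simp: less_top)
  have if': "integrable lborel (\<lambda>x. f (x + h))" "integrable lborel (\<lambda>x. k (x + h))"
   using f k0 lborel_translate(2)[OF fm] lborel_translate(2)[OF km] by auto
  have "(LBINT x. norm (f (x + h) - f x)) \<le>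
    (LBINT x. norm (f (x + h) - k (x + h)) + indicator ?S x * e' + norm (f x - k x))"
  proof (rule integral_mono)
   fix x
   have kk: "norm (k (x + h) - k x) \<le> indicator ?S x * e'"
   proof (cases "x \<in> ?S")
    case True
    have "norm (x + h) \<le> norm x + norm h" by (rule norm_triangle_ineq)
    then have "x + h \<in> cball 0 (R + 2)" "x \<in> cball 0 (R + 2)" using True h by auto
    then have "dist (k (x + h)) (k x) < e'" using h by (intro d) (auto simp: dist_norm)
    then show ?thesis using True by (simp add: dist_norm)
   next
    case False
    have "norm x \<le> norm (x + h) + norm h" using norm_triangle_sub[of x "x + h"] by simp
    then have "norm (x + h) \<ge> R" "norm x \<ge> R" using False h by auto
    then show ?thesis using k(3) False by simp
   qed
   have "f (x + h) - f x = (f (x + h) - k (x + h)) + (k (x + h) - k x) + (k x - f x)" by simp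
   then have "norm (f (x + h) - f x) \<le> norm (f (x + h) - k (x + h)) + norm (k (x + h) - k x) + norm (k x - f x)"
    by (metis (no_types, lifting) add_mono_thms_linordered_semiring(3) norm_triangle_ineq order_trans)
   then show "norm (f (x + h) - f x) \<le> norm (f (x + h) - k (x + h)) + indicator ?S x * e' + norm (f x - k x)"
    using kk by (simp add: norm_minus_commute)
  qed (use f k0 if' iS in auto)
  also have "\<dots> = (LBINT x. norm (f (x + h) - k (x + h))) + (LBINT x. indicator ?S x * e') + (LBINT x. norm (f x - k x))"
   using f k0 if' iS by simp
  also have "(LBINT x. norm (f (x + h) - k (x + h))) = (LBINT x. norm (f x - k x))"
   using lborel_translate(1)[of "\<lambda>x. norm (f x - k x)" h] fm km by simp
  also have "(LBINT x. indicator ?S x * e') = e' * measure lborel ?S" by simp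
  finally show "(LBINT x. norm (f (x + h) - f x)) < e" using k(4) e'' by simp
 qed (use d in auto)
qed

text \<open>Translation continuity makes the averages converge to \<open>f\<close> in L1, and
  Fatou's lemma turns this into equality with the pointwise limits. The kernels need not be centred,
  only their supports must shrink to 0; this admits the one-sided kernels used near the
  boundary.\<close>

lemma averaging_AE:
 fixes f :: "'a::euclidean_space => real" and \<beta> :: "nat => 'a => real"
 assumes f: "integrable lborel f" and S: "S \<in> sets borel"
  and \<beta>: "\<And>n. \<beta> n \<in> borel_measurable borel" "\<And>n v. \<beta> n v \<ge> 0" "\<And>n v. \<beta> n v \<le> B n"
   "\<And>n. integrable lborel (\<beta> n)" "\<And>n. (LBINT v. \<beta> n v) = 1"
  and small: "\<And>r. r > 0 ==> \<forall>\<^sub>F n in sequentially. \<forall>v. \<beta> n v \<noteq> 0 \<longrightarrow> norm v < r"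
  and lim: "\<And>x. x \<in> S ==> (\<lambda>n. LINT v|lborel. \<beta> n v * f (x + v)) \<longlonglongrightarrow> \<psi> x"
 shows "AE x in lborel. x \<in> S \<longrightarrow> \<psi> x = f x"
proof -
 have fm[measurable]: "f \<in> borel_measurable borel" using f by (auto dest: borel_measurable_integrable)
 note \<beta>(1)[measurable] S[measurable]
 define \<psi>n where "\<psi>n n x = (LBINT v. \<beta> n v * f (x + v))" for n x
 have [measurable]: "\<psi>n n \<in> borel_measurable borel" for n unfolding \<psi>n_def by measurable
 have it: "integrable lborel (\<lambda>v. \<beta> n v * f (x + v))" for n x
  using lborel_translate(2)[OF fm, of x] f \<beta>(2,3)
  by (intro integrable_bounded_mult[where B="B n"]) (auto simp: add.commute)
 have bd: "ennreal \<bar>\<psi>n n x - f x\<bar> \<le> (NN v. ennreal (\<beta> n v) * ennreal \<bar>f (x + v) - f x\<bar>)" for n x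
 proof -
  have i2: "integrable lborel (\<lambda>v. \<beta> n v * f x)" using \<beta>(4) by auto
  have "\<psi>n n x - f x = (LBINT v. \<beta> n v * f (x + v)) - (LBINT v. \<beta> n v * f x)"
   using \<beta>(5) by (simp add: \<psi>n_def)
  also have "\<dots> = (LBINT v. \<beta> n v * (f (x + v) - f x))"
   using it i2 by (subst LINT_diff[symmetric]) (auto simp: right_diff_distrib)
  finally have "\<bar>\<psi>n n x - f x\<bar> \<le> (LBINT v. \<beta> n v * \<bar>f (x + v) - f x\<bar>)"
   using integral_norm_bound[of lborel "\<lambda>v. \<beta> n v * (f (x + v) - f x)"] \<beta>(2)
   by (simp add: abs_mult)
  also have "ennreal (LBINT v. \<beta> n v * \<bar>f (x + v) - f x\<bar>) = (NN v. ennreal (\<beta> n v * \<bar>f (x + v) - f x\<bar>))"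
  proof (rule nn_integral_eq_integral[symmetric])
   have "integrable lborel (\<lambda>v. \<bar>\<beta> n v * f (x + v) - \<beta> n v * f x\<bar>)" using it i2 by auto
   then show "integrable lborel (\<lambda>v. \<beta> n v * \<bar>f (x + v) - f x\<bar>)"
    using \<beta>(2) by (simp add: abs_mult flip: right_diff_distrib)
  qed (use \<beta>(2) in auto)
  finally show ?thesis using \<beta>(2) by (simp add: ennreal_mult ennreal_leI)
 qed
 have conv: "\<forall>\<^sub>F n in sequentially. (NN x. ennreal \<bar>\<psi>n n x - f x\<bar>) \<le> ennreal e" if "e > 0" for e
 proof -
  obtain d where d: "d > 0" "\<And>h. norm h < d ==> (LBINT x. norm (f (x + h) - f x)) < e"
   using L1_translation_continuous[OF f \<open>e > 0\<close>] by blast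
  show ?thesis
   using small[OF d(1)]
  proof eventually_elim
   case (elim n)
   have "(NN x. ennreal \<bar>\<psi>n n x - f x\<bar>)
    \<le> (NN x. (NN v. ennreal (\<beta> n v) * ennreal \<bar>f (x + v) - f x\<bar>))"
    by (intro nn_integral_mono bd)
   also have "\<dots> = (NN v. (NN x. ennreal (\<beta> n v) * ennreal \<bar>f (x + v) - f x\<bar>))"
    by (rule lborel_pair.Fubini') measurable
   also have "\<dots> \<le> (NN v. ennreal (\<beta> n v) * ennreal e)"
   proof (rule nn_integral_mono)
    fix v :: 'a
    show "(NN x. ennreal (\<beta> n v) * ennreal \<bar>f (x + v) - f x\<bar>) \<le> ennreal (\<beta> n v) * ennreal e"
    proof (cases "\<beta> n v = 0")
     case False
     then have "(LBINT x. norm (f (x + v) - f x)) < e" using elim d by auto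
     moreover have "(NN x. ennreal \<bar>f (x + v) - f x\<bar>) = ennreal (LBINT x. norm (f (x + v) - f x))"
      using f lborel_translate(2)[OF fm, of v] by (subst nn_integral_eq_integral) auto
     ultimately show ?thesis
      by (subst nn_integral_cmult) (auto intro!: mult_left_mono ennreal_leI)
    qed simp
   qed
   also have "\<dots> = (NN v. ennreal (\<beta> n v)) * ennreal e" by (subst nn_integral_multc) auto
   also have "(NN v. ennreal (\<beta> n v)) = 1"
    using \<beta> by (subst nn_integral_eq_integral) auto
   finally show ?case by simp
  qed
 qed
 define g where "g n x = indicator S x * ennreal \<bar>\<psi>n n x - f x\<bar>" for n x
 have gm[measurable]: "g n \<in> borel_measurable borel" for n unfolding g_def by measurable
 have "(NN x. liminf (\<lambda>n. g n x)) \<le> liminf (\<lambda>n. (NN x. g n x))"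
  by (rule nn_integral_liminf) measurable
 also have "\<dots> \<le> 0"
 proof (rule ennreal_le_epsilon)
  fix e :: real assume "e > 0"
  have "\<forall>\<^sub>F n in sequentially. (NN x. g n x) \<le> ennreal e"
   using conv[OF \<open>e > 0\<close>]
  proof eventually_elim
   case (elim n)
   have "(NN x. g n x) \<le> (NN x. ennreal \<bar>\<psi>n n x - f x\<bar>)"
    by (intro nn_integral_mono) (simp add: g_def indicator_def)
   with elim show ?case by (rule order_trans[rotated])
  qed
  then show "liminf (\<lambda>n. (NN x. g n x)) \<le> 0 + ennreal e"
   using Liminf_le[of sequentially "\<lambda>n. (NN x. g n x)" "ennreal e"] by simp
 qed
 finally have "(NN x. liminf (\<lambda>n. g n x)) = 0" by simp
 then have "AE x in lborel. liminf (\<lambda>n. g n x) = 0"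
  by (subst (asm) nn_integral_0_iff_AE) measurable
 then show ?thesis
 proof eventually_elim
  case (elim x)
  show ?case
  proof
   assume x: "x \<in> S"
   have "(\<lambda>n. ennreal \<bar>\<psi>n n x - f x\<bar>) \<longlonglongrightarrow> ennreal \<bar>\<psi> x - f x\<bar>"
    using lim[OF x] unfolding \<psi>n_def[symmetric] by (intro tendsto_intros)
   then have "liminf (\<lambda>n. g n x) = ennreal \<bar>\<psi> x - f x\<bar>"
    using x by (intro lim_imp_Liminf) (auto simp: g_def)
   then show "\<psi> x = f x" using elim by simp
  qed
 qed
qed

definition mollifiers :: "(nat => 'a::euclidean_space => real) => bool" where
 "mollifiers \<beta> \<longleftrightarrow> (\<forall>n. \<beta> n \<in> C_c_infinity UNIV \<and> (\<forall>x. \<beta> n x \<ge> 0) \<and> (LBINT x. \<beta> n x) = 1) \<and>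
   (\<forall>r>0. \<forall>\<^sub>F n in sequentially. supp (\<beta> n) \<subseteq> ball 0 r)"

lemma C_c_infinity_integrable:
 assumes "f \<in> C_c_infinity U" shows "integrable lborel f" "f \<in> borel_measurable borel"
  "\<exists>B. \<forall>x. \<bar>f x\<bar> \<le> B"
proof -
 have c: "continuous_on UNIV f" "compact (supp f)" "\<And>x. x \<notin> supp f ==> f x = 0"
  using assms C_c_infinity_continuous[OF assms] supp_nz by (auto simp: C_c_infinity_def)
 show "integrable lborel f" by (rule integrable_continuous_compact_support[OF c])
 show "f \<in> borel_measurable borel" using c(1) by (rule borel_measurable_continuous_onI)
 obtain B where "\<And>x. norm (f x) \<le> B" using continuous_compact_support_bounded[OF c] by blast
 then show "\<exists>B. \<forall>x. \<bar>f x\<bar> \<le> B" by auto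
qed

lemma C_c_infinity_partial_integrable:
 assumes "f \<in> C_c_infinity U" "b \<in> Basis"
 shows "integrable lborel (\<lambda>x. frechet_derivative f (at x) b)"
  "(\<lambda>x. frechet_derivative f (at x) b) \<in> borel_measurable borel"
  "\<exists>B. \<forall>x. \<bar>frechet_derivative f (at x) b\<bar> \<le> B"
proof -
 note c = C_c_infinity_partial(1)[OF assms] _ C_c_infinity_partial(2)[OF assms]
 have s: "compact (supp f)" using assms by (auto simp: C_c_infinity_def)
 show "integrable lborel (\<lambda>x. frechet_derivative f (at x) b)"
  by (rule integrable_continuous_compact_support[OF c(1) s c(3)])
 show "(\<lambda>x. frechet_derivative f (at x) b) \<in> borel_measurable borel"
  using c(1) by (rule borel_measurable_continuous_onI)
 obtain B where "\<And>x. norm (frechet_derivative f (at x) b) \<le> B"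
  using continuous_compact_support_bounded[OF c(1) s c(3)] by blast
 then show "\<exists>B. \<forall>x. \<bar>frechet_derivative f (at x) b\<bar> \<le> B" by auto
qed

text \<open>Once its support is small, a mollifier translated to a point of \<open>U\<close> is an
  admissible test function, so the averages of \<open>h\<close> there are eventually 0; their limit
  is \<open>h\<close> almost everywhere.\<close>

lemma fundamental_lemma:
 fixes h :: "'a::euclidean_space => real" and \<beta> :: "nat => 'a => real"
 assumes \<beta>: "mollifiers \<beta>" and h: "integrable lborel h" and U: "open U"
  and 0: "\<And>\<eta>. \<eta> \<in> C_c_infinity U ==> (LBINT x. h x * \<eta> x) = 0"
 shows "AE x in lborel. x \<in> U \<longrightarrow> h x = 0"
proof -
 have \<beta>n: "\<beta> n \<in> C_c_infinity UNIV" "\<beta> n x \<ge> 0" "(LBINT x. \<beta> n x) = 1" for n x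
  using \<beta> by (auto simp: mollifiers_def)
 obtain B where B: "\<And>n x. \<bar>\<beta> n x\<bar> \<le> B n"
  using C_c_infinity_integrable(3)[OF \<beta>n(1)] by metis
 have B': "\<beta> n x \<le> B n" for n x using B[of n x] by simp
 have sm: "\<forall>\<^sub>F n in sequentially. supp (\<beta> n) \<subseteq> ball 0 r" if "r > 0" for r
  using \<beta> that by (auto simp: mollifiers_def)
 have "AE x in lborel. x \<in> U \<longrightarrow> (0::real) = h x"
 proof (rule averaging_AE[where \<beta>=\<beta> and B=B and S=U and f=h and \<psi>="\<lambda>_. 0"])
  show "\<forall>\<^sub>F n in sequentially. \<forall>v. \<beta> n v \<noteq> 0 \<longrightarrow> norm v < r" if "r > 0" for r
   using sm[OF that] by eventually_elim (use supp_nz in force)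
  show "(\<lambda>n. LINT v|lborel. \<beta> n v * h (x + v)) \<longlonglongrightarrow> 0" if x: "x \<in> U" for x
  proof -
   obtain r where r: "r > 0" "ball x r \<subseteq> U" using U x by (auto simp: open_contains_ball)
   have "\<forall>\<^sub>F n in sequentially. (LBINT v. \<beta> n v * h (x + v)) = 0"
    using sm[OF r(1)]
   proof eventually_elim
    case (elim n)
    \<comment> \<open>The kernel with centre 0 and scale 1 is the mollifier itself, so the test
      function lemma for cones applies.\<close>
    have "(\<lambda>z. cone_kernel (\<beta> n) 0 1 (z - x)) \<in> C_c_infinity U"
     by (rule cone_kernel_test(1)[OF \<beta>n(1) elim]) (use r in \<open>auto simp: dist_norm\<close>)
    then have 1: "(LBINT z. h z * \<beta> n (z - x)) = 0" using 0 by (auto simp: cone_kernel_def)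
    have "(LBINT v. \<beta> n v * h (x + v)) = (LBINT v. h (v + x) * \<beta> n (v + x - x))"
     by (simp add: ac_simps)
    also have "\<dots> = (LBINT z. h z * \<beta> n (z - x))"
     using C_c_infinity_integrable(2)[OF \<beta>n(1), of n] borel_measurable_integrable[OF h]
     by (intro lborel_translate(1)[of "\<lambda>z. h z * \<beta> n (z - x)"]) auto
    finally show ?case using 1 by simp
   qed
   then show ?thesis by (rule tendsto_eventually)
  qed
 qed (use h U B' \<beta>n C_c_infinity_integrable[OF \<beta>n(1)] in auto)
 then show ?thesis by eventually_elim auto
qed

section \<open>Integrals over a compact set and Borel representatives\<close>

lemma AE_lebesgue_on:
 assumes "K \<in> sets borel"
 shows "(AE x in lebesgue_on K. P x) \<longleftrightarrow> (AE x in lborel. x \<in> K \<longrightarrow> P x)"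
 using assms by (subst AE_restrict_space_iff) (auto simp: AE_completion_iff)

lemma lebesgue_on_borel:
 fixes k :: "'a::euclidean_space => 'b::euclidean_space"
 assumes K: "K \<in> sets borel" and k: "k \<in> borel_measurable borel"
 shows "integrable (lebesgue_on K) k \<longleftrightarrow> integrable lborel (\<lambda>x. indicator K x *\<^sub>R k x)"
  and "(LINT x|lebesgue_on K. k x) = (LBINT x. indicator K x *\<^sub>R k x)"
proof -
 have m: "(\<lambda>x. indicator K x *\<^sub>R k x) \<in> borel_measurable lborel" using assms by auto
 show "integrable (lebesgue_on K) k \<longleftrightarrow> integrable lborel (\<lambda>x. indicator K x *\<^sub>R k x)"
  using K integrable_completion[OF m] by (subst integrable_restrict_space) auto
 show "(LINT x|lebesgue_on K. k x) = (LBINT x. indicator K x *\<^sub>R k x)"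
  using K integral_completion[OF m] by (subst integral_restrict_space) auto
qed

lemma borel_version_lebesgue_on:
 fixes f :: "'a::euclidean_space => 'b::euclidean_space"
 assumes f: "f \<in> borel_measurable (lebesgue_on K)" and K: "K \<in> sets borel"
 shows "\<exists>f0\<in>borel_measurable borel. (\<forall>x. x \<notin> K \<longrightarrow> f0 x = 0) \<and> (AE x in lebesgue_on K. f x = f0 x)"
proof -
 have "(\<lambda>x. indicator K x *\<^sub>R f x) \<in> borel_measurable lebesgue"
  using f K by (subst (asm) borel_measurable_restrict_space_iff) auto
 then have "(\<lambda>x. (indicator K x *\<^sub>R f x) \<bullet> b) \<in> borel_measurable lebesgue" for b by measurable
 then have "\<exists>g\<in>borel_measurable lborel. AE x in lborel. (indicator K x *\<^sub>R f x) \<bullet> b = g x" for b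
  by (rule completion_ex_borel_measurable_real)
 then obtain g where g: "\<And>b. g b \<in> borel_measurable lborel"
  "\<And>b. AE x in lborel. (indicator K x *\<^sub>R f x) \<bullet> b = g b x" by metis
 define f0 where "f0 x = indicator K x *\<^sub>R (\<Sum>b\<in>Basis. g b x *\<^sub>R b)" for x
 have "AE x in lborel. \<forall>b\<in>Basis. (indicator K x *\<^sub>R f x) \<bullet> b = g b x"
  using g(2) by (intro AE_finite_allI) auto
 then have "AE x in lebesgue_on K. f x = f0 x"
  unfolding AE_lebesgue_on[OF K]
 proof eventually_elim
  case (elim x)
  show ?case
  proof
   assume "x \<in> K"
   then have "f0 x = (\<Sum>b\<in>Basis. (f x \<bullet> b) *\<^sub>R b)" using elim by (simp add: f0_def)
   then show "f x = f0 x" by (simp add: euclidean_representation)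
  qed
 qed
 moreover have "f0 \<in> borel_measurable borel" unfolding f0_def using g(1) K by auto
 ultimately show ?thesis by (intro bexI[of _ f0]) (auto simp: f0_def)
qed

text \<open>The spaces are built on \<open>lebesgue_on K\<close>, while translations and Fubini
  arguments are carried out with Borel functions on the whole space; this is the bridge.
  Integrability holds because a number is at most 1 or at most its p-th power, and \<open>K\<close>
  has finite measure.\<close>

lemma Lp_borel_version:
 fixes f :: "'a::euclidean_space => 'b::euclidean_space"
 assumes f: "f \<in> Lp p K" and K: "compact K" and p: "p \<ge> 1"
 obtains f0 where "integrable lborel f0" "f0 \<in> borel_measurable borel" "\<And>x. x \<notin> K ==> f0 x = 0"
  "AE x in lebesgue_on K. f x = f0 x" "(NN x. ennreal (norm (f0 x) powr p)) < \<infinity>"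
proof -
 have KB: "K \<in> sets borel" using K by (rule borel_compact)
 obtain f0 where f0: "f0 \<in> borel_measurable borel" "\<And>x. x \<notin> K ==> f0 x = 0" "AE x in lebesgue_on K. f x = f0 x"
  using borel_version_lebesgue_on[OF _ KB] f unfolding Lp_def by blast
 have f0m: "f0 \<in> borel_measurable (lebesgue_on K)"
  using f0(1) by (auto intro!: measurable_restrict_space1 measurable_completion)
 have "integrable (lebesgue_on K) (\<lambda>x. norm (f x) powr p)" "f \<in> borel_measurable (lebesgue_on K)"
  using f by (auto simp: Lp_def)
 moreover have "AE x in lebesgue_on K. norm (f x) powr p = norm (f0 x) powr p"
  using f0(3) by eventually_elim simp
 ultimately have "integrable (lebesgue_on K) (\<lambda>x. norm (f0 x) powr p)"
  using f0m by (subst (asm) integrable_cong_AE) auto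
 then have "integrable lborel (\<lambda>x. indicator K x *\<^sub>R (norm (f0 x) powr p))"
  using f0(1) by (subst (asm) lebesgue_on_borel[OF KB]) auto
 moreover have "(\<lambda>x. indicator K x *\<^sub>R (norm (f0 x) powr p)) = (\<lambda>x. norm (f0 x) powr p)"
  using f0(2) by (intro ext) (auto simp: indicator_def)
 ultimately have ip: "integrable lborel (\<lambda>x. norm (f0 x) powr p)" by simp
 have iK: "integrable lborel (\<lambda>x. indicator K x :: real)"
  using KB emeasure_compact_finite[OF K] by (auto simp: less_top)
 have "integrable lborel f0"
 proof (rule Bochner_Integration.integrable_bound[OF Bochner_Integration.integrable_add[OF iK ip]])
  show "AE x in lborel. norm (f0 x) \<le> norm (indicator K x + norm (f0 x) powr p)"
  proof (rule AE_I2)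
   fix x
   consider "x \<notin> K" | "x \<in> K" "norm (f0 x) \<le> 1" | "norm (f0 x) > 1" by linarith
   then show "norm (f0 x) \<le> norm (indicator K x + norm (f0 x) powr p)"
   proof cases
    case 3
    then have "norm (f0 x) powr 1 \<le> norm (f0 x) powr p" using p by (intro powr_mono) auto
    then show ?thesis using 3 by (auto simp: indicator_def)
   qed (use f0(2) in \<open>auto simp: indicator_def intro: add_increasing2\<close>)
  qed
 qed (use f0 in auto)
 moreover have "(NN x. ennreal (norm (f0 x) powr p)) < \<infinity>"
  using ip by (subst nn_integral_eq_integral) auto
 ultimately show thesis using f0 that by blast
qed

text \<open>The integrals run over the whole space. Test functions vanish outside \<open>U\<close>,
  so the values of \<open>\<phi>\<close> and \<open>G\<close> there do not enter, and products with
  kernels can be integrated on \<open>lborel\<close> directly.\<close>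

definition weak_grad :: "'a::euclidean_space set => ('a => real) => ('a => 'a) => bool" where
 "weak_grad U \<phi> G \<longleftrightarrow> integrable lborel \<phi> \<and> integrable lborel G \<and>
   (\<forall>\<eta>\<in>C_c_infinity U. \<forall>b\<in>Basis.
    (LBINT x. \<phi> x * frechet_derivative \<eta> (at x) b) = - (LBINT x. (G x \<bullet> b) * \<eta> x))"

lemma weak_lebesgue_on_lborel:
 fixes \<eta> :: "'a::euclidean_space => real"
 assumes U: "open U" "U \<subseteq> K" and K: "K \<in> sets borel"
  and u0: "u0 \<in> borel_measurable borel" "AE x in lebesgue_on K. u x = u0 x"
  and u: "u \<in> borel_measurable (lebesgue_on K)"
  and k: "k \<in> borel_measurable borel" "\<And>x. x \<notin> U ==> k x = 0"
 shows "(LINT x|lebesgue_on U. u x * k x) = (LBINT x. u0 x * (k x::real))"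
proof -
 have UB: "U \<in> sets borel" using U by auto
 have ae: "AE x in lebesgue_on U. u x = u0 x"
  unfolding AE_lebesgue_on[OF UB]
  by (rule AE_mp[OF u0(2)[unfolded AE_lebesgue_on[OF K]]]) (use U in auto)
 have um: "u \<in> borel_measurable (lebesgue_on U)"
  using u U(2) by (rule measurable_restrict_mono)
 have "(LINT x|lebesgue_on U. u x * k x) = (LINT x|lebesgue_on U. u0 x * k x)"
 proof (rule integral_cong_AE)
  have m: "u0 \<in> borel_measurable (lebesgue_on U)" "k \<in> borel_measurable (lebesgue_on U)"
   using u0(1) k(1) by (auto intro!: measurable_restrict_space1 measurable_completion)
  show "(\<lambda>x. u x * k x) \<in> borel_measurable (lebesgue_on U)" using um m(2) by (rule borel_measurable_times)
  show "(\<lambda>x. u0 x * k x) \<in> borel_measurable (lebesgue_on U)" using m by (rule borel_measurable_times)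
  show "AE x in lebesgue_on U. u x * k x = u0 x * k x" using ae by eventually_elim simp
 qed
 also have "\<dots> = (LBINT x. indicator U x *\<^sub>R (u0 x * k x))"
  using u0(1) k(1) by (intro lebesgue_on_borel[OF UB]) auto
 also have "\<dots> = (LBINT x. u0 x * k x)"
  using k(2) by (intro LINT_cong) (auto simp: indicator_def)
 finally show ?thesis .
qed

lemma is_weak_gradient_lborel:
 assumes w: "is_weak_gradient U u g" and U: "open U" "U \<subseteq> K" and K: "K \<in> sets borel"
  and u: "u \<in> borel_measurable (lebesgue_on K)" "u0 \<in> borel_measurable borel" "AE x in lebesgue_on K. u x = u0 x"
  and g: "g \<in> borel_measurable (lebesgue_on K)" "g0 \<in> borel_measurable borel" "AE x in lebesgue_on K. g x = g0 x"
  and \<eta>: "\<eta> \<in> C_c_infinity U" "b \<in> Basis"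
 shows "(LBINT x. u0 x * frechet_derivative \<eta> (at x) b) = - (LBINT x. (g0 x \<bullet> b) * \<eta> x)"
proof -
 have out: "\<eta> x = 0" "frechet_derivative \<eta> (at x) b = 0" if "x \<notin> U" for x
  using that \<eta> supp_nz[of \<eta> x] C_c_infinity_partial(2)[OF \<eta>, of x] by (auto simp: C_c_infinity_def)
 have "(LINT x|lebesgue_on U. u x * frechet_derivative \<eta> (at x) b) = (LBINT x. u0 x * frechet_derivative \<eta> (at x) b)"
  using out C_c_infinity_partial_integrable(2)[OF \<eta>] u
  by (intro weak_lebesgue_on_lborel[OF U K]) auto
 moreover have "(LINT x|lebesgue_on U. (g x \<bullet> b) * \<eta> x) = (LBINT x. (g0 x \<bullet> b) * \<eta> x)"
 proof (rule weak_lebesgue_on_lborel[OF U K])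
  show "AE x in lebesgue_on K. g x \<bullet> b = g0 x \<bullet> b" using g(3) by eventually_elim simp
 qed (use out C_c_infinity_integrable(2)[OF \<eta>(1)] g in auto)
 ultimately show ?thesis using w \<eta> by (simp add: is_weak_gradient_def)
qed

lemma weak_gradient_unique:
 fixes K :: "'a::euclidean_space set" and \<beta> :: "nat => 'a => real"
 assumes \<beta>: "mollifiers \<beta>" and K: "compact K"
  and g: "g1 \<in> Lp 1 K" "g2 \<in> Lp 1 K" "is_weak_gradient (interior K) u g1" "is_weak_gradient (interior K) u g2"
 shows "AE x in lebesgue_on K. x \<in> interior K \<longrightarrow> g1 x = g2 x"
proof -
 have KB: "K \<in> sets borel" and IB: "interior K \<in> sets borel" using K by (auto intro: borel_compact)
 have U: "open (interior K)" "interior K \<subseteq> K" by (auto simp: interior_subset)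
 obtain f1 where f1: "integrable lborel f1" "f1 \<in> borel_measurable borel" "\<And>x. x \<notin> K ==> f1 x = 0"
  "AE x in lebesgue_on K. g1 x = f1 x" by (rule Lp_borel_version[OF g(1) K]) auto
 obtain f2 where f2: "integrable lborel f2" "f2 \<in> borel_measurable borel" "\<And>x. x \<notin> K ==> f2 x = 0"
  "AE x in lebesgue_on K. g2 x = f2 x" by (rule Lp_borel_version[OF g(2) K]) auto
 have "AE x in lborel. x \<in> interior K \<longrightarrow> (f1 x - f2 x) \<bullet> b = 0" if b: "b \<in> Basis" for b
 proof (rule fundamental_lemma[OF \<beta>])
  show "integrable lborel (\<lambda>x. (f1 x - f2 x) \<bullet> b)" using f1 f2 by auto
  fix \<eta> assume \<eta>: "\<eta> \<in> C_c_infinity (interior K)"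
  obtain B where B: "\<And>x. \<bar>\<eta> x\<bar> \<le> B" using C_c_infinity_integrable(3)[OF \<eta>] by blast
  have eq: "(LINT x|lebesgue_on (interior K). (g x \<bullet> b) * \<eta> x) = (LBINT x. (f x \<bullet> b) * \<eta> x)"
   if "g \<in> Lp 1 K" "f \<in> borel_measurable borel" "AE x in lebesgue_on K. g x = f x" for f g
  proof (rule weak_lebesgue_on_lborel[OF U KB])
   show "AE x in lebesgue_on K. g x \<bullet> b = f x \<bullet> b" using that(3) by eventually_elim simp
   show "\<eta> x = 0" if "x \<notin> interior K" for x
    using that \<eta> supp_nz[of \<eta> x] by (auto simp: C_c_infinity_def)
  qed (use that C_c_infinity_integrable(2)[OF \<eta>] in \<open>auto simp: Lp_def\<close>)
  have int: "integrable lborel (\<lambda>x. (f x \<bullet> b) * \<eta> x)" if "integrable lborel f" for f :: "'a => 'a"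
  proof -
   have "integrable lborel (\<lambda>x. \<eta> x * (f x \<bullet> b))"
    using that B C_c_infinity_integrable(2)[OF \<eta>]
    by (intro integrable_bounded_mult[where B=B]) auto
   then show ?thesis by (subst mult.commute)
  qed
  have "(LBINT x. (f1 x - f2 x) \<bullet> b * \<eta> x) = (LBINT x. (f1 x \<bullet> b) * \<eta> x) - (LBINT x. (f2 x \<bullet> b) * \<eta> x)"
   using int[OF f1(1)] int[OF f2(1)]
   by (subst LINT_diff[symmetric]) (auto simp: inner_diff_left left_diff_distrib)
  also have "\<dots> = 0"
   unfolding eq[OF g(1) f1(2,4), symmetric] eq[OF g(2) f2(2,4), symmetric]
   using g(3,4)[unfolded is_weak_gradient_def, rule_format, OF \<eta> b] by simp
  finally show "(LBINT x. (f1 x - f2 x) \<bullet> b * \<eta> x) = 0" .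
 qed simp
 then have "AE x in lborel. \<forall>b\<in>Basis. x \<in> interior K \<longrightarrow> (f1 x - f2 x) \<bullet> b = 0"
  by (intro AE_finite_allI) auto
 then have "AE x in lebesgue_on K. x \<in> interior K \<longrightarrow> f1 x = f2 x"
  unfolding AE_lebesgue_on[OF KB]
  by eventually_elim (auto simp: euclidean_eq_iff[of "f1 _"] inner_diff_left)
 with f1(4) f2(4) show ?thesis by eventually_elim auto
qed

lemma Lp_subset_L1:
 fixes f :: "'a::euclidean_space => 'b::euclidean_space"
 assumes "f \<in> Lp p K" "compact K" "p \<ge> 1"
 shows "f \<in> Lp 1 K"
proof -
 have KB: "K \<in> sets borel" using assms by (auto intro: borel_compact)
 have fm: "f \<in> borel_measurable (lebesgue_on K)" using assms by (auto simp: Lp_def)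
 obtain f0 where f0: "integrable lborel f0" "f0 \<in> borel_measurable borel" "\<And>x. x \<notin> K ==> f0 x = 0"
  "AE x in lebesgue_on K. f x = f0 x" by (rule Lp_borel_version[OF assms]) auto
 have f0m: "f0 \<in> borel_measurable (lebesgue_on K)"
  using f0(2) by (auto intro!: measurable_restrict_space1 measurable_completion)
 have "integrable (lebesgue_on K) f0"
  using f0 integrable_mult_indicator[of K lborel f0] KB by (subst lebesgue_on_borel[OF KB]) auto
 then have "integrable (lebesgue_on K) f"
  using f0(4) fm f0m by (subst integrable_cong_AE) auto
 then show ?thesis using fm by (auto simp: Lp_def)
qed

text \<open>\<open>weak_gradient\<close> picks an arbitrary integrable weak gradient, so what is
  known about a particular one carries over only through uniqueness, and only in the interior, where
  the test functions live.\<close>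

lemma weak_gradient_AE:
 fixes K :: "'a::euclidean_space set" and \<beta> :: "nat => 'a => real"
 assumes \<beta>: "mollifiers \<beta>" and K: "compact K"
  and g: "g \<in> Lp 1 K" "is_weak_gradient (interior K) u g"
 shows "AE x in lebesgue_on K. x \<in> interior K \<longrightarrow> weak_gradient K u x = g x"
  and "weak_gradient K u \<in> Lp 1 K"
proof -
 have "\<exists>g. g \<in> Lp 1 K \<and> is_weak_gradient (interior K) u g" using g by blast
 from someI_ex[OF this] show "AE x in lebesgue_on K. x \<in> interior K \<longrightarrow> weak_gradient K u x = g x"
  "weak_gradient K u \<in> Lp 1 K"
  unfolding weak_gradient_def[symmetric] using weak_gradient_unique[OF \<beta> K _ g(1) _ g(2)] by auto
qed

lemma sobolev_weak_grad:
 fixes K :: "'a::euclidean_space set" and \<beta> :: "nat => 'a => real"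
 assumes \<beta>: "mollifiers \<beta>" and K: "compact K" and \<phi>: "\<phi> \<in> sobolev p K" and p: "p \<ge> 1"
 obtains \<phi>0 G where "weak_grad (interior K) \<phi>0 G" "\<phi>0 \<in> borel_measurable borel" "G \<in> borel_measurable borel"
  "\<And>x. x \<notin> K ==> \<phi>0 x = 0" "AE x in lebesgue_on K. \<phi> x = \<phi>0 x"
  "AE x in lebesgue_on K. x \<in> interior K \<longrightarrow> weak_gradient K \<phi> x = G x"
  "(NN x. ennreal (norm (G x) powr p)) < \<infinity>"
proof -
 have KB: "K \<in> sets borel" using K by (rule borel_compact)
 have U: "open (interior K)" "interior K \<subseteq> K" by (auto simp: interior_subset)
 obtain g where g: "\<phi> \<in> Lp p K" "g \<in> Lp p K" "is_weak_gradient (interior K) \<phi> g"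
  using \<phi> by (auto simp: sobolev_def)
 obtain f0 where f0: "integrable lborel f0" "f0 \<in> borel_measurable borel" "\<And>x. x \<notin> K ==> f0 x = 0"
  "AE x in lebesgue_on K. \<phi> x = f0 x" by (rule Lp_borel_version[OF g(1) K p]) auto
 obtain g0 where g0: "integrable lborel g0" "g0 \<in> borel_measurable borel" "\<And>x. x \<notin> K ==> g0 x = 0"
  "AE x in lebesgue_on K. g x = g0 x" "(NN x. ennreal (norm (g0 x) powr p)) < \<infinity>"
  by (rule Lp_borel_version[OF g(2) K p]) auto
 have "weak_grad (interior K) f0 g0"
  unfolding weak_grad_def
  using f0(1) g0(1) is_weak_gradient_lborel[OF g(3) U KB _ f0(2,4) _ g0(2,4)] g(1,2) by (auto simp: Lp_def)
 moreover have "AE x in lebesgue_on K. x \<in> interior K \<longrightarrow> weak_gradient K \<phi> x = g0 x"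
  using weak_gradient_AE(1)[OF \<beta> K Lp_subset_L1[OF g(2) K p] g(3)] g0(4) by eventually_elim auto
 ultimately show thesis using f0 g0 that by blast
qed

text \<open>Difference quotients have integral 0 by translation invariance, and dominated
  convergence passes to the derivative.\<close>

lemma integral_directional_derivative_0:
 fixes F :: "'a::euclidean_space => real"
 assumes d: "\<And>x. (F has_derivative F' x) (at x)" and c: "continuous_on UNIV (\<lambda>x. F' x b)"
  and T: "compact T" "\<And>x. x \<notin> T ==> F x = 0" "\<And>x. x \<notin> T ==> F' x b = 0"
 shows "(LBINT x. F' x b) = 0"
proof -
 obtain B where B: "B > 0" "\<And>x. \<bar>F' x b\<bar> \<le> B"
  using continuous_compact_support_bounded[OF c T(1,3)] by auto
 \<comment> \<open>The support swept backwards along b for times up to 1. By the mean value theorem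
   every difference quotient with step at most 1 vanishes outside it, so its indicator
   dominates.\<close>
 define T' where "T' = (\<lambda>(x, t). x - t *\<^sub>R b) ` (T \<times> {0..1::real})"
 have T': "compact T'" unfolding T'_def
  using T(1) by (intro compact_continuous_image compact_Times) (auto intro!: continuous_intros simp: case_prod_unfold)
 have cF: "continuous_on UNIV F"
  using d by (auto intro!: continuous_at_imp_continuous_on has_derivative_continuous)
 then have Fm[measurable]: "F \<in> borel_measurable borel" by (rule borel_measurable_continuous_onI)
 have iF: "integrable lborel F" by (rule integrable_continuous_compact_support[OF cF T(1,2)])
 define hn where "hn n = inverse (real (Suc n))" for n
 have hn: "0 < hn n" "hn n \<le> 1" for n by (auto simp: hn_def field_simps)
 have dl: "((\<lambda>t. F (x + t *\<^sub>R b)) has_real_derivative F' (x + t *\<^sub>R b) b) (at t)" for x t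
 proof -
  have "((\<lambda>t. F (x + t *\<^sub>R b)) has_derivative (\<lambda>s. F' (x + t *\<^sub>R b) (s *\<^sub>R b))) (at t)"
   by (rule has_derivative_compose[OF _ d]) (auto intro!: derivative_eq_intros)
  moreover have "F' (x + t *\<^sub>R b) (s *\<^sub>R b) = s * F' (x + t *\<^sub>R b) b" for s
   using has_derivative_linear[OF d[of "x + t *\<^sub>R b"]] by (simp add: linear_cmul)
  then have "(\<lambda>s. F' (x + t *\<^sub>R b) (s *\<^sub>R b)) = (*) (F' (x + t *\<^sub>R b) b)"
   by (intro ext) (simp add: mult.commute)
  ultimately show ?thesis by (simp add: has_field_derivative_def)
 qed
 define g where "g n x = (F (x + hn n *\<^sub>R b) - F x) / hn n" for n x
 have "(\<lambda>n. LINT x|lborel. g n x) \<longlonglongrightarrow> (LBINT x. F' x b)"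
 proof (rule integral_dominated_convergence[where w="\<lambda>x. B * indicator T' x"])
  show "(\<lambda>x. F' x b) \<in> borel_measurable lborel" using borel_measurable_continuous_onI[OF c] by simp
  show "g n \<in> borel_measurable lborel" for n unfolding g_def by measurable
  show "integrable lborel (\<lambda>x. B * indicator T' x)"
   using borel_compact[OF T'] emeasure_compact_finite[OF T'] by (auto simp: less_top)
  show "AE x in lborel. (\<lambda>n. g n x) \<longlonglongrightarrow> F' x b"
  proof (rule AE_I2)
   fix x
   have "((\<lambda>h. (F (x + (0 + h) *\<^sub>R b) - F (x + 0 *\<^sub>R b)) / h) \<longlongrightarrow> F' (x + 0 *\<^sub>R b) b) (at 0)"
    using dl[of x 0] unfolding DERIV_def by simp
   moreover have "filterlim hn (at 0) sequentially"
    using hn LIMSEQ_inverse_real_of_nat by (auto simp: filterlim_at hn_def[abs_def])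
   ultimately have "(\<lambda>n. (F (x + (0 + hn n) *\<^sub>R b) - F (x + 0 *\<^sub>R b)) / hn n) \<longlonglongrightarrow> F' (x + 0 *\<^sub>R b) b"
    by (rule filterlim_compose)
   then show "(\<lambda>n. g n x) \<longlonglongrightarrow> F' x b" by (simp add: g_def)
  qed
  show "AE x in lborel. norm (g n x) \<le> B * indicator T' x" for n
  proof (rule AE_I2)
   fix x
   obtain t where t: "0 < t" "t < hn n" "F (x + hn n *\<^sub>R b) - F (x + 0 *\<^sub>R b) = (hn n - 0) * F' (x + t *\<^sub>R b) b"
    using MVT2[of 0 "hn n" "\<lambda>t. F (x + t *\<^sub>R b)" "\<lambda>t. F' (x + t *\<^sub>R b) b"] hn dl by metis
   then have g: "g n x = F' (x + t *\<^sub>R b) b" using hn[of n] by (simp add: g_def)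
   show "norm (g n x) \<le> B * indicator T' x"
   proof (cases "x + t *\<^sub>R b \<in> T")
    case True
    then have "x \<in> T'" unfolding T'_def using t hn[of n] by (auto intro!: rev_image_eqI[of "(x + t *\<^sub>R b, t)"])
    then show ?thesis using g B(2) by simp
   next
    case False then show ?thesis using g T(3) B(1) by (simp add: indicator_def)
   qed
  qed
 qed
 moreover have "(LBINT x. g n x) = 0" for n
 proof -
  have "(LBINT x. g n x) = ((LBINT x. F (x + hn n *\<^sub>R b)) - (LBINT x. F x)) / hn n"
   unfolding g_def using iF lborel_translate(2)[OF Fm, of "hn n *\<^sub>R b"]
   by (subst LINT_diff[symmetric]) auto
  then show ?thesis using lborel_translate(1)[OF Fm, of "hn n *\<^sub>R b"] by simp
 qed
 ultimately show ?thesis using LIMSEQ_unique[of "\<lambda>_. 0"] by auto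
qed

lemma weak_derivative_of_C1:
 fixes u :: "'a::euclidean_space => real"
 assumes U: "open U" and u: "\<And>x. x \<in> U ==> (u has_derivative (\<lambda>h. g x \<bullet> h)) (at x)"
  and g: "continuous_on U g" and \<eta>: "\<eta> \<in> C_c_infinity U" and b: "b \<in> Basis"
 shows "(LBINT x. u x * frechet_derivative \<eta> (at x) b) = - (LBINT x. (g x \<bullet> b) * \<eta> x)"
proof -
 have S: "compact (supp \<eta>)" "supp \<eta> \<subseteq> U" "closed (supp \<eta>)" using \<eta> by (auto simp: C_c_infinity_def supp_def)
 have \<eta>0: "\<eta> x = 0" "frechet_derivative \<eta> (at x) b = 0" if "x \<notin> supp \<eta>" for x
  using that supp_nz C_c_infinity_partial(2)[OF \<eta> b] by auto
 \<comment> \<open>Nothing is known about u outside U, so the derivative of u \<eta> is set to 0 off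
   the support of \<eta>. Continuity follows because U and the complement of that support are open
   and cover the space.\<close>
 define F' where "F' x = (if x \<in> supp \<eta> then (\<lambda>h. u x * frechet_derivative \<eta> (at x) h + (g x \<bullet> h) * \<eta> x) else (\<lambda>_. 0))" for x
 have F'b: "F' x b = u x * frechet_derivative \<eta> (at x) b + (g x \<bullet> b) * \<eta> x" for x
  using \<eta>0 by (simp add: F'_def)
 have cu: "continuous_on U u"
  using u U by (auto intro!: continuous_at_imp_continuous_on has_derivative_continuous)
 have c1: "continuous_on UNIV (\<lambda>x. k x * f x)"
  if k: "continuous_on U k" and f: "continuous_on UNIV f" "\<And>x. x \<notin> supp \<eta> ==> f x = 0" for k f :: "'a => real"
 proof -
  have "continuous_on U (\<lambda>x. k x * f x)" using k f by (intro continuous_intros) (auto intro: continuous_on_subset)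
  moreover have "continuous_on (- supp \<eta>) (\<lambda>x. k x * f x)"
   using f(2) by (subst continuous_on_cong[OF refl, of _ _ "\<lambda>_. 0"]) auto
  ultimately have "continuous_on (U \<union> - supp \<eta>) (\<lambda>x. k x * f x)"
   using U S by (intro continuous_on_open_Un) auto
  moreover have "U \<union> - supp \<eta> = UNIV" using S by auto
  ultimately show ?thesis by simp
 qed
 have ca: "continuous_on UNIV (\<lambda>x. u x * frechet_derivative \<eta> (at x) b)"
  by (rule c1[OF cu C_c_infinity_partial(1)[OF \<eta> b] \<eta>0(2)])
 have cb: "continuous_on UNIV (\<lambda>x. (g x \<bullet> b) * \<eta> x)"
  using g by (intro c1 C_c_infinity_continuous[OF \<eta>] \<eta>0(1) continuous_intros)
 have "(LBINT x. F' x b) = 0"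
 proof (rule integral_directional_derivative_0[where F="\<lambda>x. u x * \<eta> x" and T="supp \<eta>"])
  show "((\<lambda>x. u x * \<eta> x) has_derivative F' x) (at x)" for x
  proof (cases "x \<in> supp \<eta>")
   case True
   then have "x \<in> U" using S by auto
   from has_derivative_mult[OF u[OF this] C_c_infinity_has_derivative[OF \<eta>]]
   show ?thesis using True by (simp add: F'_def)
  next
   case False
   have "open (- supp \<eta>)" using S by auto
   with False have "\<forall>\<^sub>F y in nhds x. y \<in> - supp \<eta>" by (intro eventually_nhds_in_open) auto
   then have ev: "\<forall>\<^sub>F y in at x. (\<lambda>_. 0) y = u y * \<eta> y"
    unfolding eventually_at_filter by eventually_elim (use \<eta>0 in auto)
   have "((\<lambda>y. u y * \<eta> y) has_derivative (\<lambda>_. 0)) (at x)"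
    by (rule has_derivative_transform_eventually[OF has_derivative_const[of 0] ev])
     (use False \<eta>0 in auto)
   then show ?thesis using False by (simp add: F'_def)
  qed
 qed (use S \<eta>0 F'b continuous_on_add[OF ca cb] in auto)
 moreover have "(LBINT x. F' x b) =
  (LBINT x. u x * frechet_derivative \<eta> (at x) b) + (LBINT x. (g x \<bullet> b) * \<eta> x)"
  unfolding F'b
  by (intro Bochner_Integration.integral_add integrable_continuous_compact_support[OF ca S(1)]
    integrable_continuous_compact_support[OF cb S(1)]) (auto simp: \<eta>0)
 ultimately show ?thesis by simp
qed

lemma continuous_Lp:
 fixes f :: "'a::euclidean_space => 'b::euclidean_space"
 assumes K: "compact K" and f: "continuous_on K f" and p: "p > 0"
 shows "f \<in> Lp p K"
proof -
 have KB: "K \<in> sets borel" using K by (rule borel_compact)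
 have c: "continuous_on K (\<lambda>x. norm (f x) powr p)"
  using f p by (intro continuous_on_powr') (auto intro!: continuous_intros)
 have KL: "K \<in> sets lebesgue" using KB by auto
 have "f \<in> borel_measurable (lebesgue_on K)"
  using f KL by (rule continuous_imp_measurable_on_sets_lebesgue)
 moreover have "integrable (lebesgue_on K) (\<lambda>x. norm (f x) powr p)"
 proof -
  have "integrable lborel (\<lambda>x. indicator K x *\<^sub>R (norm (f x) powr p))"
   using K c by (rule borel_integrable_compact)
  then have "integrable lebesgue (\<lambda>x. indicator K x *\<^sub>R (norm (f x) powr p))"
   by (subst integrable_completion) (auto dest: borel_measurable_integrable)
  then show ?thesis using KL by (subst integrable_restrict_space) auto
 qed
 ultimately show ?thesis by (simp add: Lp_def)
qed

lemma is_weak_gradient_C1: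
 fixes u :: "'a::euclidean_space => real"
 assumes K: "compact K" and u: "continuous_on K u" "\<And>x. x \<in> interior K ==> (u has_derivative (\<lambda>h. g x \<bullet> h)) (at x)"
  and g: "continuous_on K g"
 shows "is_weak_gradient (interior K) u g"
 unfolding is_weak_gradient_def
proof (intro ballI)
 fix \<eta> b assume \<eta>: "\<eta> \<in> C_c_infinity (interior K)" and b: "b \<in> (Basis :: 'a set)"
 have KB: "K \<in> sets borel" using K by (rule borel_compact)
 have U: "open (interior K)" "interior K \<subseteq> K" by (auto simp: interior_subset)
 have out: "\<eta> x = 0" "frechet_derivative \<eta> (at x) b = 0" if "x \<notin> interior K" for x
  using that \<eta> supp_nz[of \<eta> x] C_c_infinity_partial(2)[OF \<eta> b, of x] by (auto simp: C_c_infinity_def)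
 let ?u = "\<lambda>x. indicator K x *\<^sub>R u x" and ?g = "\<lambda>x. indicator K x *\<^sub>R g x"
 have bm: "?u \<in> borel_measurable borel" "?g \<in> borel_measurable borel"
  using compact_indicator(1)[OF K u(1)] compact_indicator(1)[OF K g] by auto
 have lm: "u \<in> borel_measurable (lebesgue_on K)" "g \<in> borel_measurable (lebesgue_on K)"
  using continuous_Lp[OF K u(1), of 1] continuous_Lp[OF K g, of 1] by (auto simp: Lp_def)
 have "(LINT x|lebesgue_on (interior K). u x * frechet_derivative \<eta> (at x) b) = (LBINT x. ?u x * frechet_derivative \<eta> (at x) b)"
  using out C_c_infinity_partial_integrable(2)[OF \<eta> b] bm lm
  by (intro weak_lebesgue_on_lborel[OF U KB]) (auto simp: AE_lebesgue_on[OF KB])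
 also have "\<dots> = (LBINT x. u x * frechet_derivative \<eta> (at x) b)"
  using out U(2) by (intro LINT_cong) (auto simp: indicator_def)
 also have "\<dots> = - (LBINT x. (g x \<bullet> b) * \<eta> x)"
  using g U(2) by (intro weak_derivative_of_C1[OF U(1) u(2) _ \<eta> b]) (auto intro: continuous_on_subset)
 also have "(LBINT x. (g x \<bullet> b) * \<eta> x) = (LBINT x. (?g x \<bullet> b) * \<eta> x)"
  using out U(2) by (intro LINT_cong) (auto simp: indicator_def)
 also have "\<dots> = (LINT x|lebesgue_on (interior K). (g x \<bullet> b) * \<eta> x)"
 proof (rule weak_lebesgue_on_lborel[OF U KB, symmetric])
  show "(\<lambda>x. ?g x \<bullet> b) \<in> borel_measurable borel" using bm(2) by (rule borel_measurable_inner) simp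
  show "(\<lambda>x. g x \<bullet> b) \<in> borel_measurable (lebesgue_on K)" using lm(2) by (rule borel_measurable_inner) simp
 qed (use out C_c_infinity_integrable(2)[OF \<eta>] in \<open>auto simp: AE_lebesgue_on[OF KB]\<close>)
 finally show "(LINT x|lebesgue_on (interior K). u x * frechet_derivative \<eta> (at x) b) =
  - (LINT x|lebesgue_on (interior K). (g x \<bullet> b) * \<eta> x)" .
qed

text \<open>A uniform interior cone condition whose length is normalised to 1 by absorbing it into
  \<open>c\<close> and \<open>\<kappa>\<close>. It is demanded at boundary points too, because
  averages are needed wherever the measures may have mass.\<close>

definition uniform_cone :: "'a::euclidean_space set => 'a set => ('a => real) => ('a => 'a) => real => bool" where
 "uniform_cone K I \<rho> c \<kappa> \<longleftrightarrow> finite I \<and> K \<subseteq> (\<Union>i\<in>I. ball i (\<rho> i)) \<and> \<kappa> > 0 \<and>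
   (\<forall>i\<in>I. \<rho> i > 0 \<and> (\<forall>x\<in>K \<inter> ball i (\<rho> i). \<forall>r. 0 < r \<and> r \<le> 1 \<longrightarrow>
    (\<forall>v\<in>ball (c i) \<kappa>. x + r *\<^sub>R v \<in> interior K)))"

section \<open>Lipschitz domains and cones\<close>

text \<open>Around an interior point a small ball does, with direction 0. At a boundary point the
  direction leads down the graph, against \<open>e\<close>, and the Lipschitz constant determines
  how wide the cone may be.\<close>

lemma lipschitz_local_cone:
 fixes K :: "'a::euclidean_space set"
 assumes L: "bounded_lipschitz_domain (interior K)" and cl: "K \<subseteq> closure (interior K)" and x0: "x0 \<in> K"
 shows "\<exists>\<rho>>0. \<exists>c. \<exists>\<kappa>>0. \<forall>x\<in>K \<inter> ball x0 \<rho>. \<forall>r. 0 < r \<and> r \<le> 1 \<longrightarrow>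
  (\<forall>v\<in>ball c \<kappa>. x + r *\<^sub>R v \<in> interior K)"
proof (cases "x0 \<in> interior K")
 case True
 then obtain e where e: "e > 0" "ball x0 e \<subseteq> interior K"
  using open_interior open_contains_ball by blast
 show ?thesis
 proof (intro exI[of _ "e/2"] conjI exI[of _ 0] ballI allI impI)
  fix x v :: 'a and r :: real assume a: "x \<in> K \<inter> ball x0 (e/2)" "0 < r \<and> r \<le> 1" "v \<in> ball 0 (e/2)"
  have "dist x0 (x + r *\<^sub>R v) \<le> dist x0 x + r * norm v"
   using dist_triangle[of x0 "x + r *\<^sub>R v" x] a by (simp add: dist_norm)
  also have "r * norm v \<le> 1 * norm v" using a by (intro mult_right_mono) auto
  finally have "dist x0 (x + r *\<^sub>R v) < e" using a by auto
  then show "x + r *\<^sub>R v \<in> interior K" using e by auto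
 qed (use e in auto)
next
 case False
 then have "x0 \<in> frontier (interior K)" using x0 cl by (auto simp: frontier_def)
 then obtain r e g M where r: "r > 0" and e: "norm e = 1" and g: "lipschitz_on M {z. z \<bullet> e = 0} g"
  and loc: "interior K \<inter> ball x0 r = {y \<in> ball x0 r. y \<bullet> e < g (y - (y \<bullet> e) *\<^sub>R e)}"
  using L[unfolded bounded_lipschitz_domain_def, THEN conjunct2, THEN conjunct2, THEN conjunct2,
   THEN conjunct2, THEN bspec, OF \<open>x0 \<in> frontier (interior K)\<close>] by blast
 have ee: "e \<bullet> e = 1" using e by (simp add: dot_square_norm)
 define P where "P y = y - (y \<bullet> e) *\<^sub>R e" for y
 have loc': "z \<in> interior K \<longleftrightarrow> z \<bullet> e < g (P z)" if "z \<in> ball x0 r" for z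
  using that eqset_imp_iff[OF loc, of z] by (simp add: P_def)
 have P0: "P y \<bullet> e = 0" for y by (simp add: P_def inner_diff_left ee)
 have Pn: "norm (P y) \<le> norm y" for y
 proof -
  have "(norm (P y))\<^sup>2 = (norm y)\<^sup>2 - (y \<bullet> e)\<^sup>2"
   unfolding power2_norm_eq_inner P_def
   by (simp add: inner_diff_left inner_diff_right ee inner_commute power2_eq_square)
  then have "(norm (P y))\<^sup>2 \<le> (norm y)\<^sup>2" by simp
  then show ?thesis by (rule power2_le_imp_le) simp
 qed
 have M: "M \<ge> 0" using g by (simp add: lipschitz_on_def)
 have gL: "\<bar>g (P y) - g (P z)\<bar> \<le> M * norm (P y - P z)" for y z
  using lipschitz_onD[OF g, of "P y" "P z"] P0 by (simp add: dist_norm)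
 have Pd: "P (y + z) = P y + P z" "P (y - z) = P y - P z" "P (a *\<^sub>R y) = a *\<^sub>R P y" for y z a
  by (simp_all add: P_def inner_add_left inner_diff_left algebra_simps)
 have Pe: "P e = 0" by (simp add: P_def ee)
 \<comment> \<open>Boundary points are limits of interior points and satisfy the graph inequality
   only weakly; the move in direction -e restores strictness.\<close>
 have le: "x \<bullet> e \<le> g (P x)" if x: "x \<in> K \<inter> ball x0 r" for x
 proof (rule field_le_epsilon)
  fix d :: real assume d: "d > 0"
  have "\<exists>y\<in>interior K. y \<in> ball x0 r \<and> dist y x * (1 + M) < d"
  proof -
   have "x \<in> closure (interior K)" using x cl by auto
   moreover have "min (d / (1 + M)) (r - dist x0 x) > 0" using d M x by auto
   ultimately obtain y where y: "y \<in> interior K" "dist y x < min (d / (1 + M)) (r - dist x0 x)"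
    unfolding closure_approachable by blast
   have "dist x0 y \<le> dist x0 x + dist y x" using dist_triangle[of x0 y x] by (simp add: dist_commute)
   then have "y \<in> ball x0 r" using y by auto
   moreover have "dist y x * (1 + M) < d" using y(2) M by (simp add: pos_less_divide_eq)
   ultimately show ?thesis using y by blast
  qed
  then obtain y where y: "y \<in> interior K" "y \<in> ball x0 r" "dist y x * (1 + M) < d" by blast
  have "y \<bullet> e < g (P y)" using loc'[OF y(2)] y(1) by simp
  also have "g (P y) \<le> g (P x) + M * norm (P y - P x)" using gL[of y x] by linarith
  also have "norm (P y - P x) \<le> dist y x" using Pn[of "y - x"] by (simp add: Pd dist_norm)
  finally have "y \<bullet> e < g (P x) + M * dist y x" using M by (simp add: mult_left_mono)
  moreover have "x \<bullet> e - y \<bullet> e \<le> dist y x"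
   using norm_cauchy_schwarz[of "x - y" e] e by (simp add: inner_diff_left dist_norm norm_minus_commute)
  ultimately show "x \<bullet> e \<le> g (P x) + d" using y(3) by (simp add: algebra_simps)
 qed
 \<comment> \<open>A vector of the cone is -h e + w with |w| < k. Its length is below 2 h = r/2, so
   starting from the half ball one stays where the graph describes the domain. The part w changes
   the height by less than k and the graph by less than or equal to M k, and k (1 + M) = h.\<close>
 define h where "h = r / 4"
 define k where "k = h / (1 + M)"
 have hk: "h > 0" "k > 0" "k * (1 + M) = h" "k \<le> h"
 proof -
  have M1: "1 + M > 0" "h > 0" using M r by (auto simp: h_def)
  then show "h > 0" "k > 0" "k * (1 + M) = h" by (auto simp: k_def)
  then show "k \<le> h" using M by (metis add_increasing2 less_imp_le mult_le_cancel_left1 order_refl linorder_not_le)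
 qed
 show ?thesis
 proof (rule exI[of _ "r/2"], rule conjI, use r in simp, rule exI[of _ "- h *\<^sub>R e"], rule exI[of _ k],
   intro conjI ballI allI impI)
  fix x v :: 'a and t :: real assume a: "x \<in> K \<inter> ball x0 (r/2)" "0 < t \<and> t \<le> 1" "v \<in> ball (- h *\<^sub>R e) k"
  define w where "w = v + h *\<^sub>R e"
  have w: "norm w < k" using a by (simp add: w_def dist_norm norm_minus_commute algebra_simps)
  have v: "v = w - h *\<^sub>R e" by (simp add: w_def)
  let ?y = "x + t *\<^sub>R v"
  have "norm v \<le> norm w + h" using norm_triangle_ineq4[of w "h *\<^sub>R e"] e hk by (simp add: v)
  also have "\<dots> < r/2" using w hk by (simp add: h_def)
  finally have nv: "norm v < r/2" .
  have "dist x0 ?y \<le> dist x0 x + t * norm v"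
   using dist_triangle[of x0 ?y x] a by (simp add: dist_norm)
  also have "t * norm v \<le> 1 * norm v" using a by (intro mult_right_mono) auto
  finally have yb: "?y \<in> ball x0 r" using nv a by auto
  have we: "w \<bullet> e \<le> norm w" using norm_cauchy_schwarz[of w e] e by simp
  have "?y \<bullet> e = x \<bullet> e + t * (w \<bullet> e - h)" by (simp add: v inner_add_left inner_diff_left ee)
  also have "x \<bullet> e \<le> g (P x)" using le a r by auto
  also have "g (P x) \<le> g (P ?y) + M * norm (P x - P ?y)" using gL[of x ?y] by linarith
  also have "P x - P ?y = - (t *\<^sub>R P w)" by (simp add: Pd v Pe)
  also have "norm (- (t *\<^sub>R P w)) \<le> t * norm w" using a Pn[of w] by (simp add: mult_left_mono)
  finally have "?y \<bullet> e \<le> g (P ?y) + M * (t * norm w) + t * (w \<bullet> e - h)"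
   using M by (simp add: mult_left_mono)
  also have "\<dots> \<le> g (P ?y) + t * ((1 + M) * norm w - h)"
   using a we by (simp add: algebra_simps)
  also have "(1 + M) * norm w < h" using w M hk(3) by (metis add_pos_nonneg mult.commute mult_less_cancel_left_pos zero_less_one)
  finally have "?y \<bullet> e < g (P ?y)" using a by (simp add: mult_less_0_iff)
  then show "?y \<in> interior K" using loc'[OF yb] by simp
 qed (rule hk)
qed

lemma lipschitz_uniform_cone:
 fixes K :: "'a::euclidean_space set"
 assumes K: "compact K" and L: "bounded_lipschitz_domain (interior K)" and cl: "K \<subseteq> closure (interior K)"
 shows "\<exists>I \<rho> c \<kappa>. uniform_cone K I \<rho> c \<kappa>"
proof -
 define P where "P x0 \<rho> c \<kappa> \<longleftrightarrow> (\<forall>x\<in>K \<inter> ball x0 \<rho>. \<forall>r. 0 < r \<and> r \<le> 1 \<longrightarrow>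
  (\<forall>v\<in>ball c \<kappa>. x + r *\<^sub>R v \<in> interior K))" for x0 c :: 'a and \<rho> \<kappa> :: real
 have "\<forall>x0\<in>K. \<exists>\<rho> c \<kappa>. \<rho> > 0 \<and> \<kappa> > 0 \<and> P x0 \<rho> c \<kappa>"
  using lipschitz_local_cone[OF L cl] unfolding P_def[symmetric] by blast
 then obtain \<rho> c \<kappa> where p: "\<And>x0. x0 \<in> K ==> \<rho> x0 > 0 \<and> \<kappa> x0 > 0 \<and> P x0 (\<rho> x0) (c x0) (\<kappa> x0)"
  by metis
 have cov: "K \<subseteq> (\<Union>i\<in>K. ball i (\<rho> i))" using p by (meson UN_I centre_in_ball subsetI)
 obtain I where I: "I \<subseteq> K" "finite I" "K \<subseteq> (\<Union>i\<in>I. ball i (\<rho> i))"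
  by (rule compactE_image[OF K _ cov]) (rule open_ball, rule that)
 \<comment> \<open>The inserted 1 keeps the minimum meaningful for an empty cover.\<close>
 define k where "k = Min (insert 1 (\<kappa> ` I))"
 have k: "k > 0" "\<And>i. i \<in> I ==> k \<le> \<kappa> i"
  using I p by (auto simp: k_def)
 show ?thesis
  unfolding uniform_cone_def
 proof (intro exI conjI ballI allI impI)
  show "finite I" "K \<subseteq> (\<Union>i\<in>I. ball i (\<rho> i))" "k > 0" using I k by auto
  fix i assume i: "i \<in> I"
  then show "\<rho> i > 0" using p I by auto
  fix x v :: 'a and r :: real assume "x \<in> K \<inter> ball i (\<rho> i)" "0 < r \<and> r \<le> 1" "v \<in> ball (c i) k"
  moreover have "v \<in> ball (c i) (\<kappa> i)" using calculation k(2)[OF i] by auto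
  ultimately show "x + r *\<^sub>R v \<in> interior K" using p[of i] I i unfolding P_def by blast
 qed
qed

text \<open>The enlarged domains are dilates of \<Omega>; this lets them inherit its cones, \<Omega>
  being where the Lipschitz property is known.\<close>

lemma uniform_cone_scale:
 fixes K :: "'a::euclidean_space set"
 assumes u: "uniform_cone K I \<rho> c \<kappa>" and a: "a > 0"
 shows "\<exists>I \<rho> c \<kappa>. uniform_cone ((\<lambda>x. a *\<^sub>R x) ` K) I \<rho> c \<kappa>"
proof -
 let ?s = "\<lambda>x::'a. a *\<^sub>R x"
 have int: "interior (?s ` K) = ?s ` interior K"
  using a by (intro interior_injective_linear_image linear_scaleR) (auto simp: inj_on_def)
 have db: "dist (a *\<^sub>R x) (a *\<^sub>R y) = a * dist x y" for x y :: 'a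
  using a by (simp add: dist_norm flip: scaleR_diff_right)
 show ?thesis
  unfolding uniform_cone_def
 proof (intro exI[of _ "?s ` I"] exI[of _ "\<lambda>y. a * \<rho> (y /\<^sub>R a)"] exI[of _ "\<lambda>y. a *\<^sub>R c (y /\<^sub>R a)"]
   exI[of _ "a * \<kappa>"] conjI ballI allI impI)
  show "finite (?s ` I)" "a * \<kappa> > 0" using u a by (auto simp: uniform_cone_def)
  show "?s ` K \<subseteq> (\<Union>i\<in>?s ` I. ball i (a * \<rho> (i /\<^sub>R a)))"
  proof (rule image_subsetI)
   fix x assume "x \<in> K"
   then obtain i where "i \<in> I" "x \<in> ball i (\<rho> i)" using u by (auto simp: uniform_cone_def)
   then show "?s x \<in> (\<Union>i\<in>?s ` I. ball i (a * \<rho> (i /\<^sub>R a)))" using a by (auto simp: db)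
  qed
  fix y assume "y \<in> ?s ` I"
  then obtain i where i: "i \<in> I" "y = ?s i" by auto
  have yi: "y /\<^sub>R a = i" using i a by simp
  show "a * \<rho> (y /\<^sub>R a) > 0" using u i a unfolding yi by (auto simp: uniform_cone_def)
  fix x v :: 'a and r :: real assume x: "x \<in> ?s ` K \<inter> ball y (a * \<rho> (y /\<^sub>R a))" and r: "0 < r \<and> r \<le> 1"
   and v: "v \<in> ball (a *\<^sub>R c (y /\<^sub>R a)) (a * \<kappa>)"
  obtain x' where x': "x' \<in> K" "x = ?s x'" using x by auto
  have "x' \<in> ball i (\<rho> i)" using x a unfolding yi by (simp add: x' i db)
  moreover have "v /\<^sub>R a \<in> ball (c i) \<kappa>"
   using v a db[of "c i" "v /\<^sub>R a"] unfolding yi by simp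
  ultimately have "x' + r *\<^sub>R (v /\<^sub>R a) \<in> interior K"
   using u i(1) x'(1) r unfolding uniform_cone_def by blast
  then have "?s (x' + r *\<^sub>R (v /\<^sub>R a)) \<in> ?s ` interior K" by blast
  moreover have "?s (x' + r *\<^sub>R (v /\<^sub>R a)) = x + r *\<^sub>R v" using a by (simp add: x' algebra_simps)
  ultimately show "x + r *\<^sub>R v \<in> interior (?s ` K)" by (simp add: int)
 qed
qed

section \<open>Fubini's theorem and measurability of the kernel\<close>

lemma Fubini_swap:
 fixes f :: "'a => 'b => 'c::{banach, second_countable_topology}"
 assumes s: "sigma_finite_measure M1" "sigma_finite_measure M2"
  and m: "case_prod f \<in> borel_measurable (M1 \<Otimes>\<^sub>M M2)"
  and fin: "(\<integral>\<^sup>+x. \<integral>\<^sup>+y. ennreal (norm (f x y)) \<partial>M2 \<partial>M1) < \<infinity>"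
 shows "(LINT x|M1. LINT y|M2. f x y) = (LINT y|M2. LINT x|M1. f x y)"
  and "integrable M1 (\<lambda>x. LINT y|M2. f x y)" and "integrable M2 (\<lambda>y. LINT x|M1. f x y)"
  and "integrable (M1 \<Otimes>\<^sub>M M2) (case_prod f)"
proof -
 interpret M1: sigma_finite_measure M1 by fact
 interpret M2: sigma_finite_measure M2 by fact
 interpret pair_sigma_finite M1 M2 ..
 have "(\<integral>\<^sup>+z. ennreal (norm (case_prod f z)) \<partial>(M1 \<Otimes>\<^sub>M M2)) = (\<integral>\<^sup>+x. \<integral>\<^sup>+y. ennreal (norm (f x y)) \<partial>M2 \<partial>M1)"
  using m by (subst M2.nn_integral_fst[symmetric]) auto
 then show i: "integrable (M1 \<Otimes>\<^sub>M M2) (case_prod f)"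
  using m fin by (intro integrableI_bounded) auto
 show "(LINT x|M1. LINT y|M2. f x y) = (LINT y|M2. LINT x|M1. f x y)"
  by (rule Fubini_integral[OF i, symmetric])
 show "integrable M1 (\<lambda>x. LINT y|M2. f x y)" using integrable_fst[OF i] .
 show "integrable M2 (\<lambda>y. LINT x|M1. f x y)" using integrable_snd[OF i] .
qed

lemma cone_kernel_measurable [measurable]:
 fixes \<beta> :: "'a::euclidean_space => real"
 assumes "\<beta> \<in> borel_measurable borel" "f \<in> borel_measurable M" "g \<in> borel_measurable M"
 shows "(\<lambda>p. cone_kernel \<beta> c (f p) (g p)) \<in> borel_measurable M"
 unfolding cone_kernel_def
proof (intro borel_measurable_divide borel_measurable_power assms)
 have "(\<lambda>p. g p /\<^sub>R f p - c) \<in> borel_measurable M" using assms by measurable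
 then show "(\<lambda>p. \<beta> (g p /\<^sub>R f p - c)) \<in> borel_measurable M"
  by (rule measurable_compose[OF _ assms(1)])
qed

section \<open>Morrey estimates and averages over cones\<close>

lemma cone_kernel_nonneg: "(\<And>x. \<beta> x \<ge> 0) ==> r > 0 ==> cone_kernel \<beta> c r y \<ge> 0"
 by (simp add: cone_kernel_def)

lemma nn_integral_cone_kernel:
 fixes \<beta> :: "'a::euclidean_space => real"
 assumes m: "\<beta> \<in> borel_measurable borel" and r: "r > 0"
 shows "(NN z. ennreal (cone_kernel \<beta> c r (z - x))) = (NN v. ennreal (\<beta> v))"
proof -
 have rp: "r ^ DIM('a) > 0" using r by simp
 have [measurable]: "(\<lambda>z. ennreal (cone_kernel \<beta> c r (z - x))) \<in> borel_measurable borel" using m by measurable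
 have "(NN z. ennreal (cone_kernel \<beta> c r (z - x))) =
  (\<integral>\<^sup>+z. ennreal (cone_kernel \<beta> c r (z - x)) \<partial>density (distr lborel borel (\<lambda>v. (x + r *\<^sub>R c) + r *\<^sub>R v)) (\<lambda>_. ennreal (\<bar>r\<bar>^DIM('a))))"
  using lborel_affine[of r "x + r *\<^sub>R c"] r by simp
 also have "\<dots> = (NN v. ennreal (r^DIM('a)) * ennreal (cone_kernel \<beta> c r ((x + r *\<^sub>R c) + r *\<^sub>R v - x)))"
  using r by (subst nn_integral_density) (auto simp: nn_integral_distr)
 also have "\<dots> = (NN v. ennreal (\<beta> v))"
 proof (rule nn_integral_cong)
  fix v :: 'a
  have "((x + r *\<^sub>R c) + r *\<^sub>R v - x) /\<^sub>R r - c = v" using r by (simp add: algebra_simps)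
  then have "cone_kernel \<beta> c r ((x + r *\<^sub>R c) + r *\<^sub>R v - x) = \<beta> v / r^DIM('a)" by (simp add: cone_kernel_def)
  then show "ennreal (r^DIM('a)) * ennreal (cone_kernel \<beta> c r ((x + r *\<^sub>R c) + r *\<^sub>R v - x)) = ennreal (\<beta> v)"
   using rp r by (simp add: ennreal_mult'[symmetric])
 qed
 finally show ?thesis .
qed

text \<open>Elementary substitute for Hoelder's inequality in the proof of Morrey's estimate.\<close>

lemma le_add_powr:
 fixes a s p :: real
 assumes "a \<ge> 0" "s > 0" "p \<ge> 1"
 shows "a \<le> s + s powr (1 - p) * a powr p"
proof (cases "a \<le> s")
 case True then show ?thesis using assms by (simp add: add_increasing2)
next
 case False
 then have "a powr (1 - p) \<le> s powr (1 - p)" using assms by (intro powr_mono2') auto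
 then have "a powr (1 - p) * a powr p \<le> s powr (1 - p) * a powr p" by (intro mult_right_mono) auto
 moreover have "a powr (1 - p) * a powr p = a" using False assms by (simp flip: powr_add)
 ultimately show ?thesis using assms by simp
qed

text \<open>\<open>\<gamma>\<close> is the power of 1/r lost in estimating an average; being below 1
  it is integrable at 0. The two conditions on \<theta> control the two terms of
  \<open>le_add_powr\<close> at the threshold s = r^-\<theta>.\<close>

definition morrey_exponent :: "'a::euclidean_space itself => real => real => bool" where
 "morrey_exponent _ p \<gamma> \<longleftrightarrow> p \<ge> 1 \<and> \<gamma> < 1 \<and> (\<exists>\<theta>. \<theta> \<le> \<gamma> \<and> real DIM('a) - \<theta> * (p - 1) \<le> \<gamma>)"

lemma morrey_exponent_exists:
 assumes "\<alpha> > 1" "\<alpha> * (real DIM('a::euclidean_space) - 1) < real DIM('a)"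
 shows "\<exists>\<gamma>. morrey_exponent TYPE('a) (conj_exp \<alpha>) \<gamma>"
proof -
 let ?d = "real DIM('a)"
 \<comment> \<open>Since p - 1 = 1 / (\<alpha> - 1), the exponent d - \<theta> (p - 1) is below 1
   exactly when \<theta> > (d - 1)(\<alpha> - 1). The upper bound on \<alpha> says that this leaves
   room for some \<theta> < 1.\<close>
 have "(?d - 1) * (\<alpha> - 1) < 1" using assms by (simp add: algebra_simps)
 then obtain \<theta> where \<theta>: "(?d - 1) * (\<alpha> - 1) < \<theta>" "\<theta> < 1" using dense by blast
 have p: "conj_exp \<alpha> - 1 = 1 / (\<alpha> - 1)" using assms by (simp add: conj_exp_def field_simps)
 have "?d - \<theta> * (conj_exp \<alpha> - 1) < 1" using \<theta> assms unfolding p by (simp add: field_simps)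
 then show ?thesis
  unfolding morrey_exponent_def using \<theta> assms p
  by (intro exI[of _ "max \<theta> (?d - \<theta> * (conj_exp \<alpha> - 1))"] conjI exI[of _ \<theta>])
   (auto simp: conj_exp_def)
qed

text \<open>Split \<open>g z\<close> at the threshold r^-\<theta>. The small part costs r^-\<theta>,
  as the kernel has mass 1; for the large part the kernel is at most B / r^d and the threshold gains
  r^(\<theta> (p - 1)).\<close>

lemma morrey_bound:
 fixes \<beta> :: "'a::euclidean_space => real"
 assumes m: "\<beta> \<in> borel_measurable borel" and \<beta>: "\<And>x. 0 \<le> \<beta> x" "\<And>x. \<beta> x \<le> B" "(NN v. ennreal (\<beta> v)) = 1"
  and e: "morrey_exponent TYPE('a) p \<gamma>" and r: "0 < r" "r \<le> 1"
  and g: "g \<in> borel_measurable borel" "\<And>x. g x \<ge> 0"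
 shows "(NN z. ennreal (cone_kernel \<beta> c r (z - x) * g z))
   \<le> ennreal (r powr - \<gamma>) * (1 + ennreal B * (NN z. ennreal (g z powr p)))"
proof -
 obtain \<theta> where \<theta>: "\<theta> \<le> \<gamma>" "real DIM('a) - \<theta> * (p - 1) \<le> \<gamma>" "p \<ge> 1" using e by (auto simp: morrey_exponent_def)
 have B: "B \<ge> 0" using \<beta>(1,2) order_trans by blast
 let ?F = "\<lambda>z. cone_kernel \<beta> c r (z - x)"
 have Fm[measurable]: "?F \<in> borel_measurable borel" using m by measurable
 note g(1)[measurable]
 have F0: "?F z \<ge> 0" for z using \<beta> r by (intro cone_kernel_nonneg) auto
 have pw: "?F z * g z \<le> r powr - \<gamma> * ?F z + r powr - \<gamma> * (B * g z powr p)" for z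
 proof -
  define s where "s = r powr - \<theta>"
  have s: "s > 0" using r by (simp add: s_def)
  have "g z \<le> s + s powr (1 - p) * g z powr p" using g s \<theta> by (intro le_add_powr) auto
  then have "?F z * g z \<le> ?F z * s + ?F z * (s powr (1 - p) * g z powr p)"
   using F0 by (metis distrib_left mult_left_mono)
  also have "?F z * s \<le> ?F z * r powr - \<gamma>"
   unfolding s_def using \<theta> r F0 by (intro mult_left_mono powr_mono') auto
  also have "?F z * (s powr (1 - p) * g z powr p) \<le> r powr - \<gamma> * (B * g z powr p)"
  proof -
   have "?F z \<le> B / r ^ DIM('a)" using \<beta> r by (simp add: cone_kernel_def divide_right_mono)
   also have "\<dots> = B * r powr - real DIM('a)" using r by (simp add: powr_minus powr_realpow divide_inverse)
   finally have "?F z * s powr (1 - p) \<le> B * r powr - real DIM('a) * s powr (1 - p)"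
    by (intro mult_right_mono) auto
   also have "\<dots> = B * r powr (- real DIM('a) + \<theta> * (p - 1))"
    unfolding s_def by (simp add: powr_powr powr_add[symmetric] algebra_simps)
   also have "\<dots> \<le> B * r powr - \<gamma>"
    using \<theta> r B by (intro mult_left_mono powr_mono') auto
   finally have "?F z * s powr (1 - p) * g z powr p \<le> B * r powr - \<gamma> * g z powr p"
    by (intro mult_right_mono) auto
   then show ?thesis by (simp add: ac_simps)
  qed
  finally show ?thesis by (simp add: ac_simps)
 qed
 have "(NN z. ennreal (?F z * g z))
  \<le> (NN z. ennreal (r powr - \<gamma>) * ennreal (?F z) + ennreal (r powr - \<gamma>) * (ennreal B * ennreal (g z powr p)))"
 proof (rule nn_integral_mono)
  fix z
  have "ennreal (?F z * g z) \<le> ennreal (r powr - \<gamma> * ?F z + r powr - \<gamma> * (B * g z powr p))"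
   by (intro ennreal_leI pw)
  also have "\<dots> = ennreal (r powr - \<gamma>) * ennreal (?F z) + ennreal (r powr - \<gamma>) * (ennreal B * ennreal (g z powr p))"
   using F0 B by (simp add: ennreal_plus ennreal_mult)
  finally show "ennreal (?F z * g z) \<le> \<dots>" .
 qed
 also have "\<dots> = ennreal (r powr - \<gamma>) * (NN z. ennreal (?F z)) +
   ennreal (r powr - \<gamma>) * (ennreal B * (NN z. ennreal (g z powr p)))"
  by (simp add: nn_integral_add nn_integral_cmult)
 also have "(NN z. ennreal (?F z)) = 1" using nn_integral_cone_kernel[OF m r(1)] \<beta>(3) by simp
 finally show ?thesis by (simp add: distrib_left)
qed

lemma nn_integral_powr_from_0:
 assumes "\<gamma> < 1" "t \<ge> 0"
 shows "(NN r. ennreal (indicator {0..t} r * r powr - \<gamma>)) = ennreal (t powr (1 - \<gamma>) / (1 - \<gamma>))"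
 using nn_integral_has_integral_lebesgue[OF _ has_integral_powr_from_0[of "- \<gamma>" t]] assms by simp

lemma morrey_bound_integrated:
 fixes \<beta> :: "'a::euclidean_space => real"
 assumes m: "\<beta> \<in> borel_measurable borel" and \<beta>: "\<And>x. 0 \<le> \<beta> x" "\<And>x. \<beta> x \<le> B" "(NN v. ennreal (\<beta> v)) = 1"
  and e: "morrey_exponent TYPE('a) p \<gamma>" and t: "0 \<le> t" "t \<le> 1"
  and g: "g \<in> borel_measurable borel" "\<And>x. g x \<ge> 0"
 shows "(NN r. indicator {0<..t} r * (NN z. ennreal (cone_kernel \<beta> c r (z - x) * g z)))
   \<le> ennreal (t powr (1 - \<gamma>) / (1 - \<gamma>)) * (1 + ennreal B * (NN z. ennreal (g z powr p)))"
proof -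
 let ?A = "1 + ennreal B * (NN z. ennreal (g z powr p))"
 have "(NN r. indicator {0<..t} r * (NN z. ennreal (cone_kernel \<beta> c r (z - x) * g z)))
  \<le> (NN r. ennreal (indicator {0..t} r * r powr - \<gamma>) * ?A)"
 proof (rule nn_integral_mono)
  fix r :: real
  show "indicator {0<..t} r * (NN z. ennreal (cone_kernel \<beta> c r (z - x) * g z))
   \<le> ennreal (indicator {0..t} r * r powr - \<gamma>) * ?A"
   using morrey_bound[OF m \<beta> e _ _ g, of r c x] t by (auto simp: indicator_def)
 qed
 also have "\<dots> = (NN r. ennreal (indicator {0..t} r * r powr - \<gamma>)) * ?A"
  by (rule nn_integral_multc) measurable
 also have "\<dots> = ennreal (t powr (1 - \<gamma>) / (1 - \<gamma>)) * ?A"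
  using e t by (subst nn_integral_powr_from_0) (auto simp: morrey_exponent_def)
 finally show ?thesis .
qed

section \<open>Convolutions with compactly supported kernels\<close>

lemma compact_support_uniformly_continuous:
 fixes f :: "'a::euclidean_space => 'b::real_normed_vector"
 assumes f: "continuous_on UNIV f" and T: "compact T" "\<And>x. x \<notin> T ==> f x = 0" and "e > 0"
 shows "\<exists>d>0. \<forall>x y. dist x y < d \<longrightarrow> dist (f x) (f y) < e"
proof -
 define T' where "T' = {x + v |x v. x \<in> T \<and> v \<in> cball 0 1}"
 have "compact T'" unfolding T'_def using T(1) by (intro compact_sums) auto
 then have "uniformly_continuous_on T' f"
  using f by (intro compact_uniformly_continuous) (auto intro: continuous_on_subset)
 then obtain d where d: "d > 0" "\<And>x x'. x \<in> T' ==> x' \<in> T' ==> dist x' x < d ==> dist (f x') (f x) < e"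
  using \<open>e > 0\<close> unfolding uniformly_continuous_on_def by metis
 have nb: "x + v \<in> T'" if "x \<in> T" "norm v \<le> 1" for x v using that by (auto simp: T'_def)
 have one: "dist (f x) (f y) < e" if "dist x y < min d 1" "x \<in> T" for x y
 proof -
  have "x \<in> T'" using nb[OF that(2), of 0] by simp
  moreover have "y \<in> T'" using nb[OF that(2), of "y - x"] that(1) by (simp add: dist_norm norm_minus_commute)
  ultimately show ?thesis using d(2)[of y x] that(1) by simp
 qed
 show ?thesis
 proof (intro exI[of _ "min d 1"] conjI allI impI)
  fix x y :: 'a assume a: "dist x y < min d 1"
  consider "x \<in> T" | "y \<in> T" | "x \<notin> T" "y \<notin> T" by blast
  then show "dist (f x) (f y) < e"
  proof cases
   case 1 then show ?thesis using one a by blast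
  next
   case 2 then show ?thesis using one[of y x] a by (simp add: dist_commute)
  next
   case 3 then show ?thesis using T(2) \<open>e > 0\<close> by simp
  qed
 qed (use d in auto)
qed

lemma integrable_conv:
 fixes f :: "'a::euclidean_space => real"
 assumes f: "f \<in> borel_measurable borel" "\<And>x. \<bar>f x\<bar> \<le> B" and \<phi>: "integrable lborel \<phi>"
 shows "integrable lborel (\<lambda>z. f (z - x) * \<phi> z)"
 using assms by (intro integrable_bounded_mult[where B=B]) auto

lemma conv_continuous:
 fixes f :: "'a::euclidean_space => real"
 assumes f: "continuous_on UNIV f" and T: "compact T" "\<And>x. x \<notin> T ==> f x = 0" and \<phi>: "integrable lborel \<phi>"
 shows "continuous_on UNIV (\<lambda>x. LINT z|lborel. f (z - x) * \<phi> z)"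
proof (rule continuous_onI)
 fix x :: 'a and e :: real assume "e > 0"
 obtain B where B: "\<And>x. norm (f x) \<le> B" by (rule continuous_compact_support_bounded[OF f T]) auto
 have fm: "f \<in> borel_measurable borel" using f by (rule borel_measurable_continuous_onI)
 define N where "N = (LBINT z. \<bar>\<phi> z\<bar>)"
 have N: "N \<ge> 0" by (simp add: N_def)
 define e' where "e' = e / (N + 1)"
 have e': "e' > 0" "e' * (N + 1) = e" using \<open>e > 0\<close> N by (auto simp: e'_def)
 obtain d where d: "d > 0" "\<And>x y. dist x y < d ==> dist (f x) (f y) < e'"
  using compact_support_uniformly_continuous[OF f T e'(1)] by blast
 have ic: "integrable lborel (\<lambda>z. f (z - x) * \<phi> z)" for x
  using B by (intro integrable_conv[OF fm _ \<phi>]) auto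
 show "\<exists>d>0. \<forall>x'\<in>UNIV. dist x' x < d \<longrightarrow>
   dist (LBINT z. f (z - x') * \<phi> z) (LBINT z. f (z - x) * \<phi> z) \<le> e"
 proof (intro exI[of _ d] conjI ballI impI d(1))
  fix x' assume x': "dist x' x < d"
  have "dist (LBINT z. f (z - x') * \<phi> z) (LBINT z. f (z - x) * \<phi> z)
   = \<bar>LBINT z. f (z - x') * \<phi> z - f (z - x) * \<phi> z\<bar>"
   using ic by (simp add: dist_real_def)
  also have "\<dots> \<le> (LBINT z. \<bar>f (z - x') * \<phi> z - f (z - x) * \<phi> z\<bar>)"
   using integral_norm_bound[of lborel "\<lambda>z. f (z - x') * \<phi> z - f (z - x) * \<phi> z"] by simp
  also have "\<dots> \<le> (LBINT z. e' * \<bar>\<phi> z\<bar>)"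
  proof (rule integral_mono)
   fix z
   have "dist (z - x') (z - x) < d" using x' by (simp add: dist_norm norm_minus_commute)
   then have "\<bar>f (z - x') - f (z - x)\<bar> \<le> e'" using d(2)[of "z - x'" "z - x"] by (simp add: dist_real_def)
   then have "\<bar>f (z - x') - f (z - x)\<bar> * \<bar>\<phi> z\<bar> \<le> e' * \<bar>\<phi> z\<bar>" by (intro mult_right_mono) auto
   then show "\<bar>f (z - x') * \<phi> z - f (z - x) * \<phi> z\<bar> \<le> e' * \<bar>\<phi> z\<bar>"
    by (simp add: abs_mult flip: left_diff_distrib)
  qed (use ic \<phi> in auto)
  also have "\<dots> = e' * N" by (simp add: N_def)
  also have "\<dots> \<le> e" using e' by (simp add: algebra_simps)
  finally show "dist (LBINT z. f (z - x') * \<phi> z) (LBINT z. f (z - x) * \<phi> z) \<le> e" .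
 qed
qed

lemma C_c_infinity_gradient:
 fixes \<eta> :: "'a::euclidean_space => real"
 assumes \<eta>: "\<eta> \<in> C_c_infinity U"
 shows "frechet_derivative \<eta> (at x) h = (\<Sum>b\<in>Basis. frechet_derivative \<eta> (at x) b *\<^sub>R b) \<bullet> h"
proof -
 have l: "linear (frechet_derivative \<eta> (at x))"
  using C_c_infinity_differentiable[OF \<eta>] by (rule linear_frechet_derivative)
 have "frechet_derivative \<eta> (at x) h = frechet_derivative \<eta> (at x) (\<Sum>b\<in>Basis. (h \<bullet> b) *\<^sub>R b)"
  by (simp add: euclidean_representation)
 also have "\<dots> = (\<Sum>b\<in>Basis. (h \<bullet> b) * frechet_derivative \<eta> (at x) b)"
  by (simp add: linear_sum[OF l] linear_cmul[OF l])
 finally show ?thesis by (simp add: inner_sum_left inner_sum_right inner_commute mult.commute)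
qed

text \<open>By the mean value theorem and uniform continuity of the gradient, the first-order
  remainder of \<open>\<eta>\<close> is at most e' |h| at all points simultaneously, and so survives
  integration against |\<phi>|.\<close>

lemma conv_has_derivative:
 fixes \<eta> :: "'a::euclidean_space => real"
 assumes \<eta>: "\<eta> \<in> C_c_infinity UNIV" and \<phi>: "integrable lborel \<phi>"
 shows "((\<lambda>x. LINT z|lborel. \<eta> (z - x) * \<phi> z) has_derivative
   (\<lambda>h. (\<Sum>b\<in>Basis. (- (LBINT z. frechet_derivative \<eta> (at (z - x)) b * \<phi> z)) *\<^sub>R b) \<bullet> h)) (at x)"
proof -
 define D where "D y = (\<Sum>b\<in>Basis. frechet_derivative \<eta> (at y) b *\<^sub>R b)" for y
 have D: "(\<eta> has_derivative (\<lambda>h. D y \<bullet> h)) (at y)" for y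
 proof -
  have "frechet_derivative \<eta> (at y) = (\<lambda>h. D y \<bullet> h)"
   unfolding D_def by (rule ext) (rule C_c_infinity_gradient[OF \<eta>])
  then show ?thesis using C_c_infinity_has_derivative[OF \<eta>, of y] by simp
 qed
 have Dc: "continuous_on UNIV D" unfolding D_def
  using C_c_infinity_partial(1)[OF \<eta>] by (intro continuous_intros) auto
 have S: "compact (supp \<eta>)" using \<eta> by (simp add: C_c_infinity_def)
 have D0: "D y = 0" if "y \<notin> supp \<eta>" for y
  unfolding D_def using C_c_infinity_partial(2)[OF \<eta> _ that] by (intro sum.neutral) auto
 obtain B where B: "\<And>x. \<bar>\<eta> x\<bar> \<le> B" using C_c_infinity_integrable(3)[OF \<eta>] by blast
 note i1 = integrable_conv[OF C_c_infinity_integrable(2)[OF \<eta>] B \<phi>]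
 have i2: "integrable lborel (\<lambda>z. frechet_derivative \<eta> (at (z - x)) b * \<phi> z)" if b: "b \<in> Basis" for b
 proof -
  obtain B where B: "\<And>x. \<bar>frechet_derivative \<eta> (at x) b\<bar> \<le> B" using C_c_infinity_partial_integrable(3)[OF \<eta> b] by blast
  show ?thesis by (rule integrable_conv[OF C_c_infinity_partial_integrable(2)[OF \<eta> b] B \<phi>])
 qed
 have Deq: "D y \<bullet> h = (\<Sum>b\<in>Basis. (h \<bullet> b) * frechet_derivative \<eta> (at y) b)" for y h
  by (simp add: D_def inner_sum_left inner_sum_right inner_commute mult.commute)
 have i3: "integrable lborel (\<lambda>z. (D (z - x) \<bullet> h) * \<phi> z)" for h
  unfolding Deq sum_distrib_right using i2 by (intro Bochner_Integration.integrable_sum) (auto simp: mult.assoc)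
 have eqL: "(\<Sum>b\<in>Basis. (- (LBINT z. frechet_derivative \<eta> (at (z - x)) b * \<phi> z)) *\<^sub>R b) \<bullet> h
   = - (LBINT z. (D (z - x) \<bullet> h) * \<phi> z)" for h
 proof -
  have "(LBINT z. (D (z - x) \<bullet> h) * \<phi> z) = (\<Sum>b\<in>Basis. LINT z|lborel. (h \<bullet> b) * (frechet_derivative \<eta> (at (z - x)) b * \<phi> z))"
   unfolding Deq sum_distrib_right using i2 by (subst Bochner_Integration.integral_sum[symmetric]) (auto simp: mult.assoc)
  then show ?thesis by (simp add: inner_sum_left inner_sum_right inner_commute mult.commute sum_negf)
 qed
 define N where "N = (LBINT z. \<bar>\<phi> z\<bar>)"
 have N: "N \<ge> 0" by (simp add: N_def)
 show ?thesis
  unfolding has_derivative_at_alt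
 proof (intro conjI allI impI)
  show "bounded_linear (\<lambda>h. (\<Sum>b\<in>Basis. (- (LBINT z. frechet_derivative \<eta> (at (z - x)) b * \<phi> z)) *\<^sub>R b) \<bullet> h)"
   by (rule bounded_linear_inner_right)
  fix e :: real assume "e > 0"
  define e' where "e' = e / (N + 1)"
  have e': "e' > 0" "e' * (N + 1) = e" using \<open>e > 0\<close> N by (auto simp: e'_def)
  obtain d where d: "d > 0" "\<And>x y. dist x y < d ==> dist (D x) (D y) < e'"
   using compact_support_uniformly_continuous[OF Dc S D0 e'(1)] by blast
  show "\<exists>d>0. \<forall>y. norm (y - x) < d \<longrightarrow>
    norm ((LBINT z. \<eta> (z - y) * \<phi> z) - (LBINT z. \<eta> (z - x) * \<phi> z) -
     (\<Sum>b\<in>Basis. (- (LBINT z. frechet_derivative \<eta> (at (z - x)) b * \<phi> z)) *\<^sub>R b) \<bullet> (y - x)) \<le> e * norm (y - x)"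
  proof (intro exI[of _ d] conjI allI impI d(1))
   fix y assume y: "norm (y - x) < d"
   define h where "h = y - x"
   have pw: "\<bar>\<eta> (w - h) - \<eta> w + D w \<bullet> h\<bar> \<le> e' * norm h" for w
   proof -
    have dl: "((\<lambda>t. \<eta> (w - t *\<^sub>R h)) has_real_derivative - (D (w - t *\<^sub>R h) \<bullet> h)) (at t)" for t
    proof -
     have "((\<lambda>t. \<eta> (w - t *\<^sub>R h)) has_derivative (\<lambda>s. D (w - t *\<^sub>R h) \<bullet> (- (s *\<^sub>R h)))) (at t)"
      by (rule has_derivative_compose[OF _ D]) (auto intro!: derivative_eq_intros)
     moreover have "(\<lambda>s. D (w - t *\<^sub>R h) \<bullet> (- (s *\<^sub>R h))) = (*) (- (D (w - t *\<^sub>R h) \<bullet> h))"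
      by (intro ext) simp
     ultimately show ?thesis by (simp add: has_field_derivative_def)
    qed
    obtain t where t: "0 < t" "t < 1" "\<eta> (w - 1 *\<^sub>R h) - \<eta> (w - 0 *\<^sub>R h) = (1 - 0) * - (D (w - t *\<^sub>R h) \<bullet> h)"
     using MVT2[of 0 1 "\<lambda>t. \<eta> (w - t *\<^sub>R h)" "\<lambda>t. - (D (w - t *\<^sub>R h) \<bullet> h)"] dl by auto
    have "norm (t *\<^sub>R h) \<le> norm h" using t by (simp add: mult_left_le_one_le)
    then have "dist w (w - t *\<^sub>R h) < d" using y by (simp add: dist_norm h_def)
    then have "norm (D w - D (w - t *\<^sub>R h)) \<le> e'" using d(2) by (metis dist_norm less_imp_le)
    moreover have "\<eta> (w - h) - \<eta> w + D w \<bullet> h = (D w - D (w - t *\<^sub>R h)) \<bullet> h"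
     using t(3) by (simp add: inner_diff_left)
    moreover have "\<bar>(D w - D (w - t *\<^sub>R h)) \<bullet> h\<bar> \<le> norm (D w - D (w - t *\<^sub>R h)) * norm h"
     by (rule Cauchy_Schwarz_ineq2)
    ultimately show ?thesis by (smt (verit) mult_right_mono norm_ge_zero)
   qed
   have "(LBINT z. \<eta> (z - y) * \<phi> z) - (LBINT z. \<eta> (z - x) * \<phi> z) -
     (- (LBINT z. (D (z - x) \<bullet> h) * \<phi> z))
    = (LBINT z. \<eta> (z - y) * \<phi> z - \<eta> (z - x) * \<phi> z + (D (z - x) \<bullet> h) * \<phi> z)"
    (is "?lhs = ?rhs") using i1 i3 by simp
   then have "\<bar>?lhs\<bar> = \<bar>?rhs\<bar>" by (rule arg_cong)
   also have "\<dots> \<le> (LBINT z. \<bar>\<eta> (z - y) * \<phi> z - \<eta> (z - x) * \<phi> z + (D (z - x) \<bullet> h) * \<phi> z\<bar>)"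
    using integral_norm_bound[of lborel "\<lambda>z. \<eta> (z - y) * \<phi> z - \<eta> (z - x) * \<phi> z + (D (z - x) \<bullet> h) * \<phi> z"] by simp
   also have "\<dots> \<le> (LBINT z. (e' * norm h) * \<bar>\<phi> z\<bar>)"
   proof (rule integral_mono)
    fix z
    have "z - y = (z - x) - h" by (simp add: h_def)
    then have "\<eta> (z - y) * \<phi> z - \<eta> (z - x) * \<phi> z + (D (z - x) \<bullet> h) * \<phi> z
     = (\<eta> ((z - x) - h) - \<eta> (z - x) + D (z - x) \<bullet> h) * \<phi> z" by (simp add: algebra_simps)
    then show "\<bar>\<eta> (z - y) * \<phi> z - \<eta> (z - x) * \<phi> z + (D (z - x) \<bullet> h) * \<phi> z\<bar> \<le> (e' * norm h) * \<bar>\<phi> z\<bar>"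
     using pw[of "z - x"] by (simp only: abs_mult) (intro mult_right_mono, auto)
   qed (use i1 i3 \<phi> in auto)
   also have "\<dots> = (e' * N) * norm h" by (simp add: N_def)
   also have "\<dots> \<le> e * norm h" using e' by (intro mult_right_mono) (auto simp: algebra_simps)
   finally show "norm ((LBINT z. \<eta> (z - y) * \<phi> z) - (LBINT z. \<eta> (z - x) * \<phi> z) -
     (\<Sum>b\<in>Basis. (- (LBINT z. frechet_derivative \<eta> (at (z - x)) b * \<phi> z)) *\<^sub>R b) \<bullet> (y - x)) \<le> e * norm (y - x)"
    unfolding h_def[symmetric] eqL by simp
  qed
 qed
qed

text \<open>The scaling derivative of the kernel is a divergence:
 \<open>d/dr F_r(y) = - div (F_r(y) y / r)\<close>. Hence the average \<open>\<integral>F_r(z - x) \<phi>(z) dz\<close> changes with \<open>r\<close> at a rate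
 which involves only the weak gradient of \<open>\<phi>\<close>.\<close>

lemma cone_average_identity:
 fixes \<beta> :: "'a::euclidean_space => real"
 assumes \<beta>: "\<beta> \<in> C_c_infinity UNIV" "supp \<beta> \<subseteq> ball 0 \<kappa>" and w: "weak_grad U \<phi> G"
  and st: "0 < s" "s \<le> t"
  and U: "\<And>r v. s \<le> r ==> r \<le> t ==> v \<in> ball c \<kappa> ==> x + r *\<^sub>R v \<in> U"
 shows "(LBINT z. cone_kernel \<beta> c t (z - x) * \<phi> z) - (LBINT z. cone_kernel \<beta> c s (z - x) * \<phi> z) =
   (LBINT r. indicator {s..t} r * (LBINT z. cone_kernel \<beta> c r (z - x) * (G z \<bullet> (z - x)) / r))"
proof -
 let ?d = "DIM('a)"
 have \<phi>: "integrable lborel \<phi>" "\<phi> \<in> borel_measurable borel" and G: "integrable lborel G"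
  using w by (auto simp: weak_grad_def dest: borel_measurable_integrable)
 define D where "D y = (\<Sum>b\<in>Basis. frechet_derivative \<beta> (at y) b *\<^sub>R b)" for y
 have D: "frechet_derivative \<beta> (at y) h = D y \<bullet> h" for y h
  unfolding D_def by (rule C_c_infinity_gradient[OF \<beta>(1)])
 have hd: "(\<beta> has_derivative (\<lambda>h. D y \<bullet> h)) (at y)" for y
 proof -
  have "frechet_derivative \<beta> (at y) = (\<lambda>h. D y \<bullet> h)" by (rule ext) (rule D)
  then show ?thesis using C_c_infinity_has_derivative[OF \<beta>(1), of y] by simp
 qed
 have Dc: "continuous_on UNIV D" unfolding D_def
  using C_c_infinity_partial(1)[OF \<beta>(1)] by (intro continuous_intros) auto
 have S: "compact (supp \<beta>)" using \<beta> by (simp add: C_c_infinity_def)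
 have D0: "D y = 0" if "y \<notin> supp \<beta>" for y
  unfolding D_def using C_c_infinity_partial(2)[OF \<beta>(1) _ that] by (intro sum.neutral) auto
 \<comment> \<open>The divergence of the field \<beta>(v - c) v. By the chain rule the scaling
   derivative of the kernel is -P(y / r) / r^(d + 1).\<close>
 define P where "P v = real ?d * \<beta> (v - c) + D (v - c) \<bullet> v" for v
 have bc: "continuous_on UNIV \<beta>" by (rule C_c_infinity_continuous[OF \<beta>(1)])
 have Pc: "continuous_on UNIV P"
  unfolding P_def
  by (intro continuous_intros continuous_on_compose2[OF bc] continuous_on_compose2[OF Dc]) auto
 have P0: "P v = 0" if "v \<notin> (+) c ` supp \<beta>" for v
 proof -
  have "v - c \<notin> supp \<beta>" using that by (metis add.commute diff_add_cancel imageI)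
  then show ?thesis using supp_nz[of \<beta> "v - c"] D0 by (auto simp: P_def)
 qed
 have "compact ((+) c ` supp \<beta>)" using S by (rule compact_translation)
 then obtain B where B: "B > 0" "\<And>v. \<bar>P v\<bar> \<le> B"
  using continuous_compact_support_bounded[OF Pc _ P0] by auto
 have Pm[measurable]: "P \<in> borel_measurable borel" using Pc by (rule borel_measurable_continuous_onI)
 define dF where "dF r y = - P (y /\<^sub>R r) / r ^ (?d + 1)" for r :: real and y :: 'a
 have deriv: "((\<lambda>r. cone_kernel \<beta> c r y) has_real_derivative dF r y) (at r)" if r: "r > 0" for r y
 proof -
  have 1: "((\<lambda>r. \<beta> (y /\<^sub>R r - c)) has_real_derivative - (D (y /\<^sub>R r - c) \<bullet> y) / r\<^sup>2) (at r)"
  proof -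
   have "((\<lambda>r. y /\<^sub>R r - c) has_derivative (\<lambda>h. (- (inverse r * h * inverse r)) *\<^sub>R y)) (at r)"
    using r by (auto intro!: derivative_eq_intros)
   from has_derivative_compose[OF this hd]
   have "((\<lambda>r. \<beta> (y /\<^sub>R r - c)) has_derivative (\<lambda>h. D (y /\<^sub>R r - c) \<bullet> ((- (inverse r * h * inverse r)) *\<^sub>R y))) (at r)" .
   moreover have "(\<lambda>h. D (y /\<^sub>R r - c) \<bullet> ((- (inverse r * h * inverse r)) *\<^sub>R y)) = (*) (- (D (y /\<^sub>R r - c) \<bullet> y) / r\<^sup>2)"
    by (intro ext) (simp add: power2_eq_square divide_inverse)
   ultimately show ?thesis by (simp add: has_field_derivative_def)
  qed
  have 2: "((\<lambda>r. inverse (r ^ ?d)) has_real_derivative - (real ?d / r ^ (?d + 1))) (at r)"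
  proof -
   have "((\<lambda>r. inverse (r ^ ?d)) has_real_derivative - (inverse (r ^ ?d) * (real ?d * r ^ (?d - 1)) * inverse (r ^ ?d))) (at r)"
    using r by (auto intro!: derivative_eq_intros)
   moreover have "r ^ ?d = r * r ^ (?d - 1)" by (metis DIM_positive power_eq_if less_numeral_extra(3))
   then have "inverse (r ^ ?d) * (real ?d * r ^ (?d - 1)) * inverse (r ^ ?d) = real ?d / r ^ (?d + 1)"
    using r by (simp add: field_simps)
   ultimately show ?thesis by simp
  qed
  have "((\<lambda>r. \<beta> (y /\<^sub>R r - c) * inverse (r ^ ?d)) has_real_derivative
    (- (D (y /\<^sub>R r - c) \<bullet> y) / r\<^sup>2) * inverse (r ^ ?d) + - (real ?d / r ^ (?d + 1)) * \<beta> (y /\<^sub>R r - c)) (at r)"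
   using DERIV_mult[OF 1 2] by simp
  moreover have "(- (D (y /\<^sub>R r - c) \<bullet> y) / r\<^sup>2) * inverse (r ^ ?d) + - (real ?d / r ^ (?d + 1)) * \<beta> (y /\<^sub>R r - c) = dF r y"
  proof -
   have "D (y /\<^sub>R r - c) \<bullet> y = r * (D (y /\<^sub>R r - c) \<bullet> (y /\<^sub>R r))" using r by simp
   moreover have "(- (r * E) / r\<^sup>2) * inverse (r ^ ?d) + - (real ?d / r ^ (?d + 1)) * A = - (real ?d * A + E) / r ^ (?d + 1)" for A E
   proof -
    have "(- (r * E) / r\<^sup>2) * inverse (r ^ ?d) = - (E / r ^ (?d + 1))"
     using r by (simp add: power2_eq_square divide_inverse)
    then show ?thesis by (simp add: add_divide_distrib diff_divide_distrib)
   qed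
   ultimately show ?thesis unfolding dF_def P_def by metis
  qed
  ultimately show ?thesis by (simp add: cone_kernel_def divide_inverse)
 qed
 have spt: "\<And>r. r \<in> {s..t} ==> r > 0" using st by auto
 \<comment> \<open>The bound blows up as s tends to 0. The limit s = 0 is therefore taken later,
   with the help of Morrey's estimate.\<close>
 have dFb: "\<bar>dF r y\<bar> \<le> B / s ^ (?d + 1)" if "r \<in> {s..t}" for r y
 proof -
  have "s ^ (?d + 1) \<le> r ^ (?d + 1)" using that st by (intro power_mono) auto
  then have "\<bar>P (y /\<^sub>R r)\<bar> / r ^ (?d + 1) \<le> B / s ^ (?d + 1)"
   using B st by (intro frac_le) (auto simp del: power_Suc)
  then show ?thesis using spt[OF that] by (simp add: dF_def abs_div del: power_Suc)
 qed
 have ftc: "(LBINT r. dF r y * indicator {s..t} r) = cone_kernel \<beta> c t y - cone_kernel \<beta> c s y" for y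
 proof (rule integral_FTC_Icc_real[OF st(2)])
  show "((\<lambda>r. cone_kernel \<beta> c r y) has_real_derivative dF r y) (at r)" if "s \<le> r" "r \<le> t" for r
   using deriv st that by simp
  show "isCont (\<lambda>r. dF r y) r" if "s \<le> r" "r \<le> t" for r
  proof -
   have r: "r \<noteq> 0" using st that by simp
   have Pz: "isCont P (y /\<^sub>R r)" using Pc by (simp add: continuous_on_eq_continuous_at)
   have "isCont (\<lambda>r. y /\<^sub>R r) r" using r by (intro continuous_intros)
   then have "isCont (\<lambda>r. P (y /\<^sub>R r)) r" using Pz by (rule isCont_o2)
   then show ?thesis unfolding dF_def
    by (rule continuous_divide[OF continuous_minus]) (use r in \<open>auto intro!: continuous_intros\<close>)
  qed
 qed
 have iF: "integrable lborel (\<lambda>z. cone_kernel \<beta> c r (z - x) * \<phi> z)" if "r \<in> {s..t}" for r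
 proof -
  have t1: "(\<lambda>z. cone_kernel \<beta> c r (z - x)) \<in> C_c_infinity U"
   using U that spt[OF that] by (intro cone_kernel_test(1)[OF \<beta>]) auto
  obtain B where "\<And>z. \<bar>cone_kernel \<beta> c r (z - x)\<bar> \<le> B" using C_c_infinity_integrable(3)[OF t1] by blast
  then show ?thesis by (intro integrable_bounded_mult[OF \<phi>(1)]) (use C_c_infinity_integrable(2)[OF t1] in auto)
 qed
 have inner: "(LBINT z. dF r (z - x) * \<phi> z) = (LBINT z. cone_kernel \<beta> c r (z - x) * (G z \<bullet> (z - x)) / r)"
  if rr: "r \<in> {s..t}" for r
 proof -
  note r = spt[OF rr]
  \<comment> \<open>The components of F_r(z - x)(z - x). Summing the weak gradient equation over
    them moves all derivatives from the kernel to \<phi>.\<close>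
  define \<eta> where "\<eta> b z = cone_kernel \<beta> c r (z - x) * ((z - x) \<bullet> b)" for b z
  have \<eta>: "\<eta> b \<in> C_c_infinity U" for b
   unfolding \<eta>_def[abs_def] using U rr r by (intro cone_kernel_test(2)[OF \<beta>]) auto
  have d\<eta>: "frechet_derivative (\<eta> b) (at z) b =
    cone_kernel \<beta> c r (z - x) + (D ((z - x) /\<^sub>R r - c) \<bullet> b) / r ^ (?d + 1) * ((z - x) \<bullet> b)" if b: "b \<in> Basis" for b z
  proof -
   have "((\<lambda>z. (z - x) /\<^sub>R r - c) has_derivative (\<lambda>h. h /\<^sub>R r)) (at z)"
    by (auto intro!: derivative_eq_intros)
   from has_derivative_compose[OF this hd]
   have h1: "((\<lambda>z. \<beta> ((z - x) /\<^sub>R r - c)) has_derivative (\<lambda>h. D ((z - x) /\<^sub>R r - c) \<bullet> (h /\<^sub>R r))) (at z)" .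
   have "((\<lambda>z. \<beta> ((z - x) /\<^sub>R r - c) * inverse (r ^ ?d)) has_derivative
     (\<lambda>h. (D ((z - x) /\<^sub>R r - c) \<bullet> (h /\<^sub>R r)) * inverse (r ^ ?d))) (at z)"
    by (rule has_derivative_mult_left[OF h1])
   then have h2: "((\<lambda>z. cone_kernel \<beta> c r (z - x)) has_derivative
     (\<lambda>h. (D ((z - x) /\<^sub>R r - c) \<bullet> (h /\<^sub>R r)) * inverse (r ^ ?d))) (at z)"
    by (simp add: cone_kernel_def divide_inverse)
   have h3: "((\<lambda>z. (z - x) \<bullet> b) has_derivative (\<lambda>h. h \<bullet> b)) (at z)" by (auto intro!: derivative_eq_intros)
   have "(\<eta> b has_derivative (\<lambda>h. cone_kernel \<beta> c r (z - x) * (h \<bullet> b) +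
     ((D ((z - x) /\<^sub>R r - c) \<bullet> (h /\<^sub>R r)) * inverse (r ^ ?d)) * ((z - x) \<bullet> b))) (at z)"
    unfolding \<eta>_def[abs_def] by (rule has_derivative_mult[OF h2 h3])
   from frechet_derivative_eqI[OF this, of b] show ?thesis using b by (simp add: divide_inverse)
  qed
  \<comment> \<open>The pointwise form of the scaling identity: the divergence of F_r(y) y is -r
    times the derivative of F_r in r.\<close>
  have sum: "(\<Sum>b\<in>Basis. frechet_derivative (\<eta> b) (at z) b) = - r * dF r (z - x)" for z
  proof -
   have "(\<Sum>b\<in>Basis. frechet_derivative (\<eta> b) (at z) b) =
     real ?d * cone_kernel \<beta> c r (z - x) + (\<Sum>b\<in>Basis. (D ((z - x) /\<^sub>R r - c) \<bullet> b) * ((z - x) \<bullet> b)) / r ^ (?d + 1)"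
    by (simp add: d\<eta> sum.distrib sum_divide_distrib)
   also have "(\<Sum>b\<in>Basis. (D ((z - x) /\<^sub>R r - c) \<bullet> b) * ((z - x) \<bullet> b)) = D ((z - x) /\<^sub>R r - c) \<bullet> (z - x)"
    by (rule euclidean_inner[symmetric])
   also have "\<dots> = r * (D ((z - x) /\<^sub>R r - c) \<bullet> ((z - x) /\<^sub>R r))" using r by simp
   finally have *: "(\<Sum>b\<in>Basis. frechet_derivative (\<eta> b) (at z) b) = real ?d * cone_kernel \<beta> c r (z - x) +
     r * (D ((z - x) /\<^sub>R r - c) \<bullet> ((z - x) /\<^sub>R r)) / r ^ (?d + 1)" .
   have alg: "real ?d * (A / r ^ ?d) + r * E / r ^ (?d + 1) = - r * (- (real ?d * A + E) / r ^ (?d + 1))" for A E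
    using r by (simp add: field_simps)
   show ?thesis unfolding * dF_def P_def cone_kernel_def by (rule alg)
  qed
  have i1: "integrable lborel (\<lambda>z. \<phi> z * frechet_derivative (\<eta> b) (at z) b)" if b: "b \<in> Basis" for b
  proof -
   obtain B where "\<And>z. \<bar>frechet_derivative (\<eta> b) (at z) b\<bar> \<le> B" using C_c_infinity_partial_integrable(3)[OF \<eta> b] by blast
   then have "integrable lborel (\<lambda>z. frechet_derivative (\<eta> b) (at z) b * \<phi> z)"
    by (intro integrable_bounded_mult[OF \<phi>(1)]) (use C_c_infinity_partial_integrable(2)[OF \<eta> b] in auto)
   then show ?thesis by (subst mult.commute)
  qed
  have i2: "integrable lborel (\<lambda>z. (G z \<bullet> b) * \<eta> b z)" for b
  proof -
   obtain B where "\<And>z. \<bar>\<eta> b z\<bar> \<le> B" using C_c_infinity_integrable(3)[OF \<eta>] by blast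
   then have "integrable lborel (\<lambda>z. \<eta> b z * (G z \<bullet> b))"
    using G C_c_infinity_integrable(2)[OF \<eta>] by (intro integrable_bounded_mult) auto
   then show ?thesis by (subst mult.commute)
  qed
  have "- r * (LBINT z. dF r (z - x) * \<phi> z) = (LBINT z. - r * (dF r (z - x) * \<phi> z))" by simp
  also have "\<dots> = (LBINT z. (\<Sum>b\<in>Basis. \<phi> z * frechet_derivative (\<eta> b) (at z) b))"
  proof (intro LINT_cong refl)
   fix z show "- r * (dF r (z - x) * \<phi> z) = (\<Sum>b\<in>Basis. \<phi> z * frechet_derivative (\<eta> b) (at z) b)"
    using sum[of z] by (simp flip: sum_distrib_left)
  qed
  also have "\<dots> = (\<Sum>b\<in>Basis. LINT z|lborel. \<phi> z * frechet_derivative (\<eta> b) (at z) b)"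
   using i1 by (intro Bochner_Integration.integral_sum) auto
  also have "\<dots> = (\<Sum>b\<in>Basis. - (LBINT z. (G z \<bullet> b) * \<eta> b z))"
   using w \<eta> unfolding weak_grad_def by (intro sum.cong) auto
  also have "\<dots> = - (LBINT z. (\<Sum>b\<in>Basis. (G z \<bullet> b) * \<eta> b z))"
   using i2 by (simp add: sum_negf Bochner_Integration.integral_sum)
  also have "(LBINT z. (\<Sum>b\<in>Basis. (G z \<bullet> b) * \<eta> b z)) = (LBINT z. r * (cone_kernel \<beta> c r (z - x) * (G z \<bullet> (z - x)) / r))"
  proof (intro LINT_cong refl)
   fix z show "(\<Sum>b\<in>Basis. (G z \<bullet> b) * \<eta> b z) = r * (cone_kernel \<beta> c r (z - x) * (G z \<bullet> (z - x)) / r)"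
   proof -
    have "(\<Sum>b\<in>Basis. (G z \<bullet> b) * \<eta> b z) = cone_kernel \<beta> c r (z - x) * (\<Sum>b\<in>Basis. (G z \<bullet> b) * ((z - x) \<bullet> b))"
     unfolding \<eta>_def sum_distrib_left by (intro sum.cong refl) (simp only: ac_simps)
    also have "(\<Sum>b\<in>Basis. (G z \<bullet> b) * ((z - x) \<bullet> b)) = G z \<bullet> (z - x)" by (rule euclidean_inner[symmetric])
    finally show ?thesis using r by simp
   qed
  qed
  finally show ?thesis using r by (simp add: eq_divide_eq mult.commute)
 qed
 have dFm[measurable]: "(\<lambda>(z, r). dF r (z - x)) \<in> borel_measurable (lborel \<Otimes>\<^sub>M lborel)"
  unfolding dF_def case_prod_beta
 proof (intro borel_measurable_divide borel_measurable_power borel_measurable_uminus)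
  have "(\<lambda>p. (fst p - x) /\<^sub>R snd p) \<in> borel_measurable (lborel \<Otimes>\<^sub>M lborel)" by measurable
  then show "(\<lambda>p. P ((fst p - x) /\<^sub>R snd p)) \<in> borel_measurable (lborel \<Otimes>\<^sub>M lborel)"
   by (rule measurable_compose[OF _ Pm])
 qed measurable
 let ?f = "\<lambda>z r. (dF r (z - x) * indicator {s..t} r) * \<phi> z"
 have fm: "case_prod ?f \<in> borel_measurable (lborel \<Otimes>\<^sub>M lborel)"
  using dFm \<phi>(2) by (auto simp: case_prod_beta)
 have "(NN z. (NN r. ennreal (norm (?f z r)))) \<le>
  (NN z. ennreal \<bar>\<phi> z\<bar> * (NN r. ennreal (B / s ^ (?d + 1)) * indicator {s..t} r))"
 proof (rule nn_integral_mono)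
  fix z
  have "(NN r. ennreal (norm (?f z r))) \<le> (NN r. ennreal \<bar>\<phi> z\<bar> * (ennreal (B / s ^ (?d + 1)) * indicator {s..t} r))"
  proof (rule nn_integral_mono)
   fix r
   have "norm (?f z r) \<le> \<bar>\<phi> z\<bar> * (B / s ^ (?d + 1))" if "r \<in> {s..t}"
   proof -
    have "norm (?f z r) = \<bar>\<phi> z\<bar> * \<bar>dF r (z - x)\<bar>" using that by (simp add: abs_mult mult.commute)
    also have "\<dots> \<le> \<bar>\<phi> z\<bar> * (B / s ^ (?d + 1))" by (rule mult_left_mono[OF dFb[OF that]]) simp
    finally show ?thesis .
   qed
   then show "ennreal (norm (?f z r)) \<le> ennreal \<bar>\<phi> z\<bar> * (ennreal (B / s ^ (?d + 1)) * indicator {s..t} r)"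
    using B st by (auto simp: indicator_def ennreal_mult[symmetric] ennreal_leI simp del: power_Suc)
  qed
  then show "(NN r. ennreal (norm (?f z r))) \<le> ennreal \<bar>\<phi> z\<bar> * (NN r. ennreal (B / s ^ (?d + 1)) * indicator {s..t} r)"
   by (subst (asm) nn_integral_cmult) auto
 qed
 also have "\<dots> = (NN z. ennreal \<bar>\<phi> z\<bar>) * (ennreal (B / s ^ (?d + 1)) * ennreal (t - s))"
  using \<phi> st by (simp add: nn_integral_multc nn_integral_cmult_indicator)
 also have "\<dots> < \<infinity>"
  using \<phi> by (auto simp: integrable_iff_bounded ennreal_mult_less_top)
 finally have fin: "(NN z. (NN r. ennreal (norm (?f z r)))) < \<infinity>" .
 have "(LBINT z. cone_kernel \<beta> c t (z - x) * \<phi> z) - (LBINT z. cone_kernel \<beta> c s (z - x) * \<phi> z)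
  = (LBINT z. (cone_kernel \<beta> c t (z - x) - cone_kernel \<beta> c s (z - x)) * \<phi> z)"
  using iF[of s] iF[of t] st by (simp add: left_diff_distrib)
 also have "\<dots> = (LBINT z. LINT r|lborel. ?f z r)"
  by (intro LINT_cong refl) (simp only: integral_mult_left_zero ftc)
 also have "\<dots> = (LBINT r. LINT z|lborel. ?f z r)"
  by (rule Fubini_swap(1)[OF lborel.sigma_finite_measure_axioms lborel.sigma_finite_measure_axioms fm fin])
 also have "\<dots> = (LBINT r. indicator {s..t} r * (LBINT z. dF r (z - x) * \<phi> z))"
  by (intro LINT_cong refl) (auto simp: indicator_def)
 also have "\<dots> = (LBINT r. indicator {s..t} r * (LBINT z. cone_kernel \<beta> c r (z - x) * (G z \<bullet> (z - x)) / r))"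
  using inner by (intro LINT_cong refl) (auto simp: indicator_def)
 finally show ?thesis .
qed

section \<open>Averages over the cones of a cover\<close>

locale cone_setting =
 fixes K :: "'a::euclidean_space set" and I :: "'a set" and \<rho> :: "'a => real" and c :: "'a => 'a" and \<kappa> :: real
  and \<beta> :: "'a => real" and B p \<gamma> :: real
 assumes compact_K: "compact K" and cone: "uniform_cone K I \<rho> c \<kappa>"
  and \<beta>: "\<beta> \<in> C_c_infinity UNIV" "\<And>x. 0 \<le> \<beta> x" "\<And>x. \<beta> x \<le> B" "(LBINT x. \<beta> x) = 1" "supp \<beta> \<subseteq> ball 0 \<kappa>"
  and exponent: "morrey_exponent TYPE('a) p \<gamma>"
begin

abbreviation F :: "'a => real => 'a => real" where "F i \<equiv> cone_kernel \<beta> (c i)"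

text \<open>One radius for all directions: a kernel of scale r vanishes at distances beyond r R, see
  \<open>F_support\<close>.\<close>

definition R :: real where "R = (\<Sum>i\<in>I. norm (c i)) + \<kappa>"

text \<open>The integral of r^-\<gamma> over 0 < r \<le> t, the modulus of continuity in Morrey's
  estimate.\<close>

definition modulus :: "real => real" where "modulus t = t powr (1 - \<gamma>) / (1 - \<gamma>)"

definition energy :: "('a => 'a) => ennreal" where
 "energy G = 1 + ennreal B * (NN z. ennreal (norm (G z) powr p))"

definition average :: "('a => real) => 'a => real => 'a => real" where
 "average \<phi> i r x = (LBINT z. F i r (z - x) * \<phi> z)"

text \<open>The rate of change of \<open>average\<close> in r, which
  \<open>cone_average_identity\<close> expresses by the weak gradient alone.\<close>

definition rate :: "('a => 'a) => 'a => 'a => real => real" where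
 "rate G i x r = (LBINT z. F i r (z - x) * (G z \<bullet> (z - x)) / r)"

lemma K_borel [measurable]: "K \<in> sets borel" using compact_K by (rule borel_compact)

lemma finite_I: "finite I" using cone by (simp add: uniform_cone_def)

lemma \<beta>_measurable [measurable]: "\<beta> \<in> borel_measurable borel"
 using C_c_infinity_integrable(2)[OF \<beta>(1)] .

lemma nn_integral_\<beta>: "(NN x. ennreal (\<beta> x)) = 1"
 using C_c_infinity_integrable(1)[OF \<beta>(1)] \<beta>(2,4) by (subst nn_integral_eq_integral) auto

lemma B_nonneg: "0 \<le> B" using \<beta>(2,3) order_trans by blast

lemma R_pos: "0 < R" using cone by (auto simp: R_def uniform_cone_def intro!: add_nonneg_pos sum_nonneg)

lemma F_nonneg: "r > 0 ==> 0 \<le> F i r y" using \<beta>(2) by (rule cone_kernel_nonneg)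

lemma F_le: "r > 0 ==> F i r y \<le> B / r ^ DIM('a)" using \<beta>(3) by (simp add: cone_kernel_def divide_right_mono)

lemma F_support: "r > 0 ==> i \<in> I ==> F i r y \<noteq> 0 ==> norm y \<le> r * R"
proof -
 assume a: "r > 0" "i \<in> I" "F i r y \<noteq> 0"
 have "norm y \<le> r * (norm (c i) + \<kappa>)" using cone_kernel_norm_le[OF \<beta>(5) a(1,3)] .
 also have "norm (c i) \<le> (\<Sum>i\<in>I. norm (c i))" using a(2) finite_I by (intro member_le_sum) auto
 finally show ?thesis using a(1) by (simp add: R_def mult_left_mono)
qed

lemma cone_interior: "i \<in> I ==> x \<in> K ==> x \<in> ball i (\<rho> i) ==> 0 < r ==> r \<le> 1 ==> v \<in> ball (c i) \<kappa> ==>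
  x + r *\<^sub>R v \<in> interior K"
 using cone unfolding uniform_cone_def by blast

lemma F_interior:
 assumes "i \<in> I" "x \<in> K" "x \<in> ball i (\<rho> i)" "0 < r" "r \<le> 1" "F i r (z - x) \<noteq> 0"
 shows "z \<in> interior K"
proof -
 obtain v where v: "v \<in> ball (c i) \<kappa>" "z - x = r *\<^sub>R v"
  using cone_kernel_support[OF \<beta>(5) assms(4,6)] by blast
 have "x + r *\<^sub>R v \<in> interior K" using assms v(1) by (intro cone_interior) auto
 moreover have "x + r *\<^sub>R v = z" unfolding v(2)[symmetric] by simp
 ultimately show ?thesis by simp
qed

lemma nn_integral_F: "r > 0 ==> (NN z. ennreal (F i r (z - x))) = 1"
 using nn_integral_cone_kernel[OF \<beta>_measurable] nn_integral_\<beta> by simp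

lemma integrable_F: "r > 0 ==> integrable lborel (\<lambda>z. F i r (z - x))"
 using nn_integral_F[of r i x] F_nonneg by (intro integrableI_nonneg) auto

lemma integral_F: "r > 0 ==> (LBINT z. F i r (z - x)) = 1"
 using nn_integral_F[of r i x] F_nonneg by (subst integral_eq_nn_integral) auto

lemma integrable_F_mult:
 assumes "r > 0" "integrable lborel \<phi>" shows "integrable lborel (\<lambda>z. F i r (z - x) * \<phi> z)"
 using assms F_le[of r i] F_nonneg[of r i]
 by (intro integrable_bounded_mult[where B="B / r ^ DIM('a)"]) auto

lemma modulus_nonneg: "t \<ge> 0 ==> 0 \<le> modulus t"
 using exponent by (auto simp: modulus_def morrey_exponent_def)

lemma modulus_tendsto: "(modulus \<longlongrightarrow> 0) (at_right 0)"
proof -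
 have g: "\<gamma> < 1" using exponent by (simp add: morrey_exponent_def)
 have "((\<lambda>t::real. t powr (1 - \<gamma>)) \<longlongrightarrow> 0 powr (1 - \<gamma>)) (at_right 0)"
  using g by (intro tendsto_powr') (auto simp: eventually_at_right_less intro!: eventually_mono[OF eventually_at_right_less])
 then have "((\<lambda>t. t powr (1 - \<gamma>) / (1 - \<gamma>)) \<longlongrightarrow> 0 / (1 - \<gamma>)) (at_right 0)"
  using g by (intro tendsto_divide) auto
 then show ?thesis by (simp add: modulus_def[abs_def])
qed

lemma kernel_energy_bound:
 assumes "g \<in> borel_measurable borel" "\<And>x. g x \<ge> 0" "0 \<le> t" "t \<le> 1"
 shows "(NN r. indicator {0<..t} r * (NN z. ennreal (F i r (z - x) * g z)))
   \<le> ennreal (modulus t) * (1 + ennreal B * (NN z. ennreal (g z powr p)))"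
 unfolding modulus_def
 by (rule morrey_bound_integrated[OF \<beta>_measurable \<beta>(2,3) nn_integral_\<beta> exponent assms(3,4,1,2)])

text \<open>On the support of the kernel |z - x| \<le> r R, so the singular factor 1/r cancels and a
  plain average of |G| remains.\<close>

lemma rate_integrand_le:
 assumes "r > 0" "i \<in> I"
 shows "\<bar>F i r (z - x) * (G z \<bullet> (z - x)) / r\<bar> \<le> R * (F i r (z - x) * norm (G z))"
proof (cases "F i r (z - x) = 0")
 case False
 have "\<bar>G z \<bullet> (z - x)\<bar> \<le> norm (G z) * norm (z - x)" by (rule Cauchy_Schwarz_ineq2)
 also have "\<dots> \<le> norm (G z) * (r * R)" using F_support[OF assms False] by (intro mult_left_mono) auto
 finally have "\<bar>G z \<bullet> (z - x)\<bar> / r \<le> norm (G z) * R" using assms(1) by (simp add: pos_divide_le_eq ac_simps)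
 then have "F i r (z - x) * (\<bar>G z \<bullet> (z - x)\<bar> / r) \<le> F i r (z - x) * (norm (G z) * R)"
  using F_nonneg[OF assms(1)] by (intro mult_left_mono) auto
 then show ?thesis using F_nonneg[OF assms(1), of i "z - x"] assms(1) by (simp add: abs_mult ac_simps)
qed simp

lemma ennreal_abs_integral_le: "ennreal \<bar>LINT x|M. f x\<bar> \<le> (\<integral>\<^sup>+x. ennreal \<bar>f x\<bar> \<partial>M)"
proof (cases "integrable M f")
 case True then show ?thesis using integral_norm_bound_ennreal[OF True] by simp
qed (simp add: not_integrable_integral_eq)

lemma rate_le:
 assumes "r > 0" "i \<in> I" and [measurable]: "G \<in> borel_measurable borel"
 shows "ennreal \<bar>rate G i x r\<bar> \<le> ennreal R * (NN z. ennreal (F i r (z - x) * norm (G z)))"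
proof -
 have "ennreal \<bar>rate G i x r\<bar> \<le> (NN z. ennreal \<bar>F i r (z - x) * (G z \<bullet> (z - x)) / r\<bar>)"
  unfolding rate_def by (rule ennreal_abs_integral_le)
 also have "\<dots> \<le> (NN z. ennreal (R * (F i r (z - x) * norm (G z))))"
  by (intro nn_integral_mono ennreal_leI rate_integrand_le assms)
 also have "\<dots> = ennreal R * (NN z. ennreal (F i r (z - x) * norm (G z)))"
  using R_pos F_nonneg[OF assms(1)] by (simp add: ennreal_mult nn_integral_cmult)
 finally show ?thesis .
qed

lemma rate_measurable [measurable]:
 assumes [measurable]: "G \<in> borel_measurable borel"
 shows "(\<lambda>p. rate G i (fst p) (snd p)) \<in> borel_measurable (borel \<Otimes>\<^sub>M borel)"
  and "(\<lambda>r. rate G i x r) \<in> borel_measurable borel"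
proof -
 have "(\<lambda>p. LINT z|lborel. F i (snd p) (z - fst p) * (G z \<bullet> (z - fst p)) / snd p) \<in> borel_measurable (borel \<Otimes>\<^sub>M borel)"
  by measurable
 then show 1: "(\<lambda>p. rate G i (fst p) (snd p)) \<in> borel_measurable (borel \<Otimes>\<^sub>M borel)"
  by (simp add: rate_def)
 have "(\<lambda>r. (x, r)) \<in> borel \<rightarrow>\<^sub>M borel \<Otimes>\<^sub>M borel" by measurable
 from measurable_compose[OF this 1] show "(\<lambda>r. rate G i x r) \<in> borel_measurable borel" by simp
qed

lemma rate_integral_le:
 assumes "i \<in> I" "0 \<le> t" "t \<le> 1" and G[measurable]: "G \<in> borel_measurable borel"
 shows "(NN r. ennreal \<bar>indicator {0<..t} r * rate G i x r\<bar>) \<le> ennreal R * (ennreal (modulus t) * energy G)"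
proof -
 have "(NN r. ennreal \<bar>indicator {0<..t} r * rate G i x r\<bar>)
   \<le> (NN r. ennreal R * (indicator {0<..t} r * (NN z. ennreal (F i r (z - x) * norm (G z)))))"
 proof (rule nn_integral_mono)
  fix r :: real
  show "ennreal \<bar>indicator {0<..t} r * rate G i x r\<bar> \<le>
    ennreal R * (indicator {0<..t} r * (NN z. ennreal (F i r (z - x) * norm (G z))))"
   using rate_le[OF _ assms(1) G, of r x] by (auto simp: indicator_def)
 qed
 also have "\<dots> = ennreal R * (NN r. indicator {0<..t} r * (NN z. ennreal (F i r (z - x) * norm (G z))))"
  by (rule nn_integral_cmult) measurable
 also have "\<dots> \<le> ennreal R * (ennreal (modulus t) * energy G)"
  unfolding energy_def using assms by (intro mult_left_mono kernel_energy_bound) auto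
 finally show ?thesis .
qed

lemma rate_integrable:
 assumes "i \<in> I" "0 \<le> t" "t \<le> 1" "G \<in> borel_measurable borel" "energy G < \<infinity>"
 shows "integrable lborel (\<lambda>r. indicator {0<..t} r * rate G i x r)"
  and "\<bar>LBINT r. indicator {0<..t} r * rate G i x r\<bar> \<le> R * (modulus t * enn2real (energy G))"
proof -
 have e: "energy G = ennreal (enn2real (energy G))" using assms(5) by simp
 have "(NN r. ennreal \<bar>indicator {0<..t} r * rate G i x r\<bar>) \<le> ennreal R * (ennreal (modulus t) * energy G)"
  by (rule rate_integral_le[OF assms(1-4)])
 also have "\<dots> = ennreal (R * (modulus t * enn2real (energy G)))"
  using R_pos modulus_nonneg[OF assms(2)] by (subst e) (simp add: ennreal_mult)
 finally have le: "(NN r. ennreal \<bar>indicator {0<..t} r * rate G i x r\<bar>) \<le> ennreal (R * (modulus t * enn2real (energy G)))" .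
 show "integrable lborel (\<lambda>r. indicator {0<..t} r * rate G i x r)"
  using rate_measurable(2)[OF assms(4)] le
  by (intro integrableI_bounded) (auto intro: le_less_trans)
 have "ennreal \<bar>LBINT r. indicator {0<..t} r * rate G i x r\<bar> \<le> ennreal (R * (modulus t * enn2real (energy G)))"
  by (rule order_trans[OF ennreal_abs_integral_le le])
 then show "\<bar>LBINT r. indicator {0<..t} r * rate G i x r\<bar> \<le> R * (modulus t * enn2real (energy G))"
  using R_pos modulus_nonneg[OF assms(2)] by (subst (asm) ennreal_le_iff) auto
qed

lemma average_diff:
 assumes w: "weak_grad (interior K) \<phi> G" and "i \<in> I" "x \<in> K" "x \<in> ball i (\<rho> i)" "0 < s" "s \<le> t" "t \<le> 1"
 shows "average \<phi> i t x - average \<phi> i s x = (LBINT r. indicator {s..t} r * rate G i x r)"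
 unfolding average_def rate_def
 using assms by (intro cone_average_identity[OF \<beta>(1,5) w] cone_interior) auto

lemma average_diff_le:
 assumes w: "weak_grad (interior K) \<phi> G" and a: "i \<in> I" "x \<in> K" "x \<in> ball i (\<rho> i)" "0 < s" "s \<le> t" "t \<le> 1"
  and G: "G \<in> borel_measurable borel" "energy G < \<infinity>"
 shows "\<bar>average \<phi> i t x - average \<phi> i s x\<bar> \<le> R * (modulus t * enn2real (energy G))"
proof -
 have t: "0 \<le> t" using a by simp
 have e: "energy G = ennreal (enn2real (energy G))" using G(2) by simp
 have "ennreal \<bar>average \<phi> i t x - average \<phi> i s x\<bar> \<le> (NN r. ennreal \<bar>indicator {s..t} r * rate G i x r\<bar>)"
  unfolding average_diff[OF w a] by (rule ennreal_abs_integral_le)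
 also have "\<dots> \<le> (NN r. ennreal \<bar>indicator {0<..t} r * rate G i x r\<bar>)"
  using a by (intro nn_integral_mono) (auto simp: indicator_def)
 also have "\<dots> \<le> ennreal R * (ennreal (modulus t) * energy G)"
  by (rule rate_integral_le[OF a(1) t a(6) G(1)])
 also have "\<dots> = ennreal (R * (modulus t * enn2real (energy G)))"
  using R_pos modulus_nonneg[OF t] by (subst e) (simp add: ennreal_mult)
 finally show ?thesis
  using R_pos modulus_nonneg[OF t] by (subst (asm) ennreal_le_iff) auto
qed

lemma F_test: "r > 0 ==> F i r \<in> C_c_infinity UNIV"
 using cone_kernel_test(1)[OF \<beta>(1,5), of r "c i" 0 UNIV] by simp

lemma average_has_derivative:
 assumes "r > 0" "integrable lborel \<phi>"
 shows "((\<lambda>x. average \<phi> i r x) has_derivative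
   (\<lambda>h. (\<Sum>b\<in>Basis. (- (LBINT z. frechet_derivative (F i r) (at (z - x)) b * \<phi> z)) *\<^sub>R b) \<bullet> h)) (at x)"
 unfolding average_def using conv_has_derivative[OF F_test[OF assms(1)] assms(2)] .

lemma average_continuous: "r > 0 ==> integrable lborel \<phi> ==> continuous_on UNIV (average \<phi> i r)"
 using average_has_derivative
 by (intro continuous_at_imp_continuous_on ballI) (blast intro: has_derivative_continuous)

definition average_grad :: "('a => real) => 'a => real => 'a => 'a" where
 "average_grad \<phi> i r x = (\<Sum>b\<in>Basis. (- (LBINT z. frechet_derivative (F i r) (at (z - x)) b * \<phi> z)) *\<^sub>R b)"

lemma average_grad_continuous:
 assumes "r > 0" "integrable lborel \<phi>" shows "continuous_on UNIV (average_grad \<phi> i r)"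
proof -
 have S: "compact (supp (F i r))" using F_test[OF assms(1)] by (auto simp: C_c_infinity_def)
 have "continuous_on UNIV (\<lambda>x. LINT z|lborel. frechet_derivative (F i r) (at (z - x)) b * \<phi> z)" if "b \<in> Basis" for b
  using C_c_infinity_partial[OF F_test[OF assms(1)] that] S assms(2) by (intro conv_continuous) auto
 then show ?thesis unfolding average_grad_def[abs_def] by (intro continuous_intros) auto
qed

text \<open>The derivative of the kernel in x is minus that in z, and the weak gradient equation
  supplies a second minus sign. It applies because the cone keeps the support of the kernel in the
  interior.\<close>

lemma average_grad_eq:
 assumes w: "weak_grad (interior K) \<phi> G" and a: "i \<in> I" "x \<in> K" "x \<in> ball i (\<rho> i)" "0 < r" "r \<le> 1"
  and b: "b \<in> Basis"
 shows "average_grad \<phi> i r x \<bullet> b = (LBINT z. F i r (z - x) * (G z \<bullet> b))"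
proof -
 have t: "(\<lambda>z. F i r (z - x)) \<in> C_c_infinity (interior K)"
  using a by (intro cone_kernel_test(1)[OF \<beta>(1,5)] cone_interior) auto
 have d: "frechet_derivative (\<lambda>z. F i r (z - x)) (at z) b = frechet_derivative (F i r) (at (z - x)) b" for z
 proof (rule frechet_derivative_eqI)
  have "((\<lambda>z. z - x) has_derivative (\<lambda>h. h)) (at z)" by (auto intro!: derivative_eq_intros)
  from has_derivative_compose[OF this C_c_infinity_has_derivative[OF F_test[OF a(4)]]]
  show "((\<lambda>z. F i r (z - x)) has_derivative frechet_derivative (F i r) (at (z - x))) (at z)" .
 qed
 have "average_grad \<phi> i r x \<bullet> b = - (LBINT z. \<phi> z * frechet_derivative (\<lambda>z. F i r (z - x)) (at z) b)"
  using b unfolding d average_grad_def by (simp add: inner_sum_left inner_Basis if_distrib mult.commute cong: if_cong)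
 also have "\<dots> = (LBINT z. (G z \<bullet> b) * F i r (z - x))"
  using w t b unfolding weak_grad_def by auto
 finally show ?thesis by (simp add: mult.commute)
qed

end

text \<open>The points of disagreement in the interior form an open null set, which is empty, and
  density of the interior does the rest. Measures may charge Lebesgue null sets, so for integrals
  against them equality almost everywhere would not suffice.\<close>

lemma continuous_AE_unique:
 fixes K :: "'a::euclidean_space set" and f g :: "'a => real"
 assumes K: "compact K" and cl: "K \<subseteq> closure (interior K)" and f: "continuous_on K f" and g: "continuous_on K g"
  and ae: "AE x in lborel. x \<in> K \<longrightarrow> f x = g x" and x: "x \<in> K"
 shows "f x = g x"
proof -
 have cK: "closure (interior K) = K"
  using cl K closure_minimal[OF interior_subset] by (auto dest: compact_imp_closed)
 define S where "S = interior K \<inter> (\<lambda>y. f y - g y) -` (- {0})"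
 have c: "continuous_on (interior K) (\<lambda>y. f y - g y)"
  using f g interior_subset by (intro continuous_on_diff) (auto intro: continuous_on_subset)
 have op: "open S" unfolding S_def by (rule continuous_open_preimage[OF c]) auto
 have "AE y in lborel. y \<notin> S"
  using ae by eventually_elim (use interior_subset in \<open>auto simp: S_def\<close>)
 then have "S \<in> null_sets lborel" using op by (subst AE_iff_null_sets) auto
 then have "negligible S" by (simp add: negligible_iff_null_sets null_sets_completionI)
 then have "S = {}" using open_not_negligible[OF op] by blast
 then have eq: "f y - g y = 0" if "y \<in> interior K" for y using that by (auto simp: S_def)
 have "continuous_on (closure (interior K)) (\<lambda>y. f y - g y)"
  unfolding cK using f g by (rule continuous_on_diff)
 from continuous_constant_on_closure[OF this eq, of x] show ?thesis using x cK by simp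
qed

section \<open>Partition of unity and continuous representatives\<close>

text \<open>The square of a positive part is just C1, which is all that is asked of a test function
  here, and its gradient is explicit.\<close>

definition partition_bump :: "('a::euclidean_space => real) => 'a => 'a => real" where
 "partition_bump \<rho> i x = (max 0 ((\<rho> i)\<^sup>2 - (norm (x - i))\<^sup>2))\<^sup>2"

definition partition_bump_grad :: "('a::euclidean_space => real) => 'a => 'a => 'a" where
 "partition_bump_grad \<rho> i x = (- 4 * max 0 ((\<rho> i)\<^sup>2 - (norm (x - i))\<^sup>2)) *\<^sub>R (x - i)"

lemma max0_square_has_derivative: "((\<lambda>s::real. (max 0 s)\<^sup>2) has_real_derivative 2 * max 0 s) (at s)"
proof (cases s "0::real" rule: linorder_cases)
 case less
 have "((\<lambda>s::real. (max 0 s)\<^sup>2) has_real_derivative 0) (at s)"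
  by (rule has_field_derivative_transform_within_open[of "\<lambda>_. 0" _ _ "{..<0}"]) (use less in auto)
 then show ?thesis using less by simp
next
 case equal
 have "((\<lambda>h::real. max 0 h) \<longlongrightarrow> max 0 0) (at 0)" by (intro tendsto_intros)
 moreover have "\<forall>\<^sub>F h in at 0. max 0 h = ((max 0 (0 + h))\<^sup>2 - (max 0 0)\<^sup>2) / (h::real)"
  unfolding eventually_at_filter by (intro always_eventually) (auto simp: max_def power2_eq_square)
 ultimately have "((\<lambda>h::real. ((max 0 (0 + h))\<^sup>2 - (max 0 0)\<^sup>2) / h) \<longlongrightarrow> max 0 0) (at 0)"
  by (rule Lim_transform_eventually)
 then show ?thesis using equal by (simp add: DERIV_def)
next
 case greater
 have "((\<lambda>s::real. (max 0 s)\<^sup>2) has_real_derivative 2 * s) (at s)"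
  by (rule has_field_derivative_transform_within_open[of "\<lambda>s. s\<^sup>2" _ _ "{0<..}"])
   (use greater in \<open>auto intro!: derivative_eq_intros\<close>)
 then show ?thesis using greater by simp
qed

lemma partition_bump_has_derivative:
 "(partition_bump \<rho> i has_derivative (\<lambda>h. partition_bump_grad \<rho> i x \<bullet> h)) (at x)"
proof -
 have 1: "((\<lambda>x. (\<rho> i)\<^sup>2 - (norm (x - i))\<^sup>2) has_derivative (\<lambda>h. - 2 * ((x - i) \<bullet> h))) (at x)"
  unfolding power2_norm_eq_inner by (auto intro!: derivative_eq_intros simp: inner_commute)
 have "((\<lambda>x. (max 0 ((\<rho> i)\<^sup>2 - (norm (x - i))\<^sup>2))\<^sup>2) has_derivative
   (\<lambda>h. 2 * max 0 ((\<rho> i)\<^sup>2 - (norm (x - i))\<^sup>2) * (- 2 * ((x - i) \<bullet> h)))) (at x)"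
  using has_derivative_compose[OF 1 max0_square_has_derivative[unfolded has_field_derivative_def]] by simp
 moreover have "(\<lambda>h. 2 * max 0 ((\<rho> i)\<^sup>2 - (norm (x - i))\<^sup>2) * (- 2 * ((x - i) \<bullet> h))) = (\<lambda>h. partition_bump_grad \<rho> i x \<bullet> h)"
  by (intro ext) (simp add: partition_bump_grad_def)
 ultimately show ?thesis by (simp add: partition_bump_def[abs_def])
qed

lemma partition_bump_nonneg: "0 \<le> partition_bump \<rho> i x" by (simp add: partition_bump_def)

lemma partition_bump_pos: "x \<in> ball i (\<rho> i) ==> 0 < partition_bump \<rho> i x"
proof -
 assume "x \<in> ball i (\<rho> i)"
 then have "(norm (x - i))\<^sup>2 < (\<rho> i)\<^sup>2" by (intro power_strict_mono) (auto simp: dist_norm norm_minus_commute)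
 then show ?thesis by (simp add: partition_bump_def)
qed

lemma partition_bump_0:
 assumes "\<rho> i > 0" "x \<notin> ball i (\<rho> i)"
 shows "partition_bump \<rho> i x = 0" "partition_bump_grad \<rho> i x = 0"
proof -
 have "(\<rho> i)\<^sup>2 \<le> (norm (x - i))\<^sup>2" using assms by (intro power_mono) (auto simp: dist_norm norm_minus_commute)
 then show "partition_bump \<rho> i x = 0" "partition_bump_grad \<rho> i x = 0"
  by (simp_all add: partition_bump_def partition_bump_grad_def)
qed

lemma partition_bump_grad_continuous: "continuous_on UNIV (partition_bump_grad \<rho> i)"
 unfolding partition_bump_grad_def[abs_def] by (intro continuous_intros)

lemma partition_bump_continuous: "continuous_on UNIV (partition_bump \<rho> i)"
 unfolding partition_bump_def[abs_def] by (intro continuous_intros)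

context cone_setting
begin

definition total_bump :: "'a => real" where "total_bump x = (\<Sum>i\<in>I. partition_bump \<rho> i x)"

text \<open>A partition of unity on \<open>K\<close> only. Elsewhere the sum of the bumps may be 0,
  and the quotient is then 0 by convention.\<close>

definition chi :: "'a => 'a => real" where "chi i x = partition_bump \<rho> i x / total_bump x"

definition chi_grad :: "'a => 'a => 'a" where
 "chi_grad i x = (1 / total_bump x) *\<^sub>R partition_bump_grad \<rho> i x -
   (partition_bump \<rho> i x / (total_bump x)\<^sup>2) *\<^sub>R (\<Sum>j\<in>I. partition_bump_grad \<rho> j x)"

lemma K_cover: "x \<in> K ==> \<exists>i\<in>I. x \<in> ball i (\<rho> i)"
 using cone unfolding uniform_cone_def by blast

lemma \<rho>_pos: "i \<in> I ==> \<rho> i > 0" using cone by (auto simp: uniform_cone_def)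

lemma total_bump_pos: "x \<in> K ==> 0 < total_bump x"
proof -
 assume "x \<in> K"
 then obtain i where i: "i \<in> I" "x \<in> ball i (\<rho> i)" using K_cover by blast
 then show ?thesis unfolding total_bump_def
  using finite_I by (intro sum_pos2[OF _ i(1)]) (auto intro: partition_bump_pos partition_bump_nonneg)
qed

lemma chi_nonneg: "0 \<le> chi i x"
 by (auto simp: chi_def total_bump_def intro!: divide_nonneg_nonneg sum_nonneg partition_bump_nonneg)

lemma sum_chi: "x \<in> K ==> (\<Sum>i\<in>I. chi i x) = 1"
 using total_bump_pos[of x] by (simp add: chi_def total_bump_def flip: sum_divide_distrib)

lemma chi_le_1: "x \<in> K ==> i \<in> I ==> chi i x \<le> 1"
 using sum_chi[of x] member_le_sum[of i I "\<lambda>i. chi i x"] finite_I chi_nonneg by auto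

lemma chi_support: "i \<in> I ==> chi i x \<noteq> 0 ==> x \<in> ball i (\<rho> i)"
 using partition_bump_0(1)[where \<rho>=\<rho> and i=i and x=x] \<rho>_pos by (auto simp: chi_def)

lemma chi_grad_support: "i \<in> I ==> chi_grad i x \<noteq> 0 ==> x \<in> ball i (\<rho> i)"
 using partition_bump_0[where \<rho>=\<rho> and i=i and x=x] \<rho>_pos by (rule_tac ccontr) (simp add: chi_grad_def)

text \<open>The gradient of the constant 1. This cancellation removes the values of the Sobolev
  function itself from the divergence of the recovery field.\<close>

lemma sum_chi_grad: "x \<in> K ==> (\<Sum>i\<in>I. chi_grad i x) = 0"
proof -
 assume "x \<in> K"
 then have t: "total_bump x > 0" by (rule total_bump_pos)
 have "(\<Sum>i\<in>I. chi_grad i x) = (1 / total_bump x) *\<^sub>R (\<Sum>i\<in>I. partition_bump_grad \<rho> i x) -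
   ((\<Sum>i\<in>I. partition_bump \<rho> i x) / (total_bump x)\<^sup>2) *\<^sub>R (\<Sum>j\<in>I. partition_bump_grad \<rho> j x)"
  unfolding chi_grad_def sum_subtractf scaleR_sum_right[symmetric] scaleR_sum_left[symmetric] sum_divide_distrib ..
 also have "(\<Sum>i\<in>I. partition_bump \<rho> i x) / (total_bump x)\<^sup>2 = 1 / total_bump x"
  using t by (simp add: total_bump_def[symmetric] power2_eq_square)
 finally show ?thesis by simp
qed

lemma total_bump_continuous: "continuous_on UNIV total_bump"
 unfolding total_bump_def[abs_def] by (intro continuous_intros partition_bump_continuous)

lemma chi_continuous: "continuous_on K (chi i)"
 unfolding chi_def[abs_def]
 using total_bump_pos partition_bump_continuous total_bump_continuous
 by (intro continuous_on_divide) (auto intro: continuous_on_subset simp: less_imp_neq[THEN not_sym])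

lemma chi_grad_continuous: "continuous_on K (chi_grad i)"
 unfolding chi_grad_def[abs_def]
 using total_bump_pos
 by (intro continuous_on_diff continuous_on_scaleR continuous_on_divide continuous_on_power continuous_on_sum
   continuous_on_const continuous_on_subset[OF total_bump_continuous]
   continuous_on_subset[OF partition_bump_continuous] continuous_on_subset[OF partition_bump_grad_continuous])
  (auto simp: less_imp_neq[THEN not_sym])

lemma chi_has_derivative:
 assumes x: "x \<in> K" shows "(chi i has_derivative (\<lambda>h. chi_grad i x \<bullet> h)) (at x)"
proof -
 have t: "total_bump x > 0" using x by (rule total_bump_pos)
 have d: "(total_bump has_derivative (\<lambda>h. \<Sum>j\<in>I. partition_bump_grad \<rho> j x \<bullet> h)) (at x)"
  unfolding total_bump_def[abs_def] by (intro has_derivative_sum partition_bump_has_derivative)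
 have "((\<lambda>x. partition_bump \<rho> i x / total_bump x) has_derivative
   (\<lambda>h. ((partition_bump_grad \<rho> i x \<bullet> h) * total_bump x - partition_bump \<rho> i x * (\<Sum>j\<in>I. partition_bump_grad \<rho> j x \<bullet> h))
    / (total_bump x * total_bump x))) (at x)"
  using t by (intro has_derivative_divide'[OF partition_bump_has_derivative d]) simp
 moreover have "((partition_bump_grad \<rho> i x \<bullet> h) * total_bump x - partition_bump \<rho> i x * (\<Sum>j\<in>I. partition_bump_grad \<rho> j x \<bullet> h))
    / (total_bump x * total_bump x) = chi_grad i x \<bullet> h" for h
  using t by (simp add: chi_grad_def inner_diff_left inner_sum_left diff_divide_distrib power2_eq_square)
 ultimately show ?thesis by (simp add: chi_def[abs_def])
qed

section \<open>Continuous representatives and exact formula for the averages\<close>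

lemma scales: "0 < inverse (real (Suc n))" "inverse (real (Suc n)) \<le> 1"
 by (auto simp: inverse_le_1_iff)

lemma average_diff_small:
 assumes w: "weak_grad (interior K) \<phi> G" and G: "G \<in> borel_measurable borel" "energy G < \<infinity>" and e: "e > 0"
 shows "\<exists>N. \<forall>m\<ge>N. \<forall>n\<ge>N. \<forall>i\<in>I. \<forall>x\<in>K \<inter> ball i (\<rho> i).
  \<bar>average \<phi> i (inverse (real (Suc m))) x - average \<phi> i (inverse (real (Suc n))) x\<bar> < e"
proof -
 let ?A = "\<lambda>t. R * (modulus t * enn2real (energy G))"
 have "(?A \<longlongrightarrow> R * (0 * enn2real (energy G))) (at_right 0)"
  by (intro tendsto_intros modulus_tendsto)
 moreover have "filterlim (\<lambda>n. inverse (real (Suc n))) (at_right 0) sequentially"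
  using LIMSEQ_inverse_real_of_nat scales by (auto simp: filterlim_at)
 ultimately have "(\<lambda>n. ?A (inverse (real (Suc n)))) \<longlonglongrightarrow> 0"
  using filterlim_compose by fastforce
 then have "\<forall>\<^sub>F n in sequentially. ?A (inverse (real (Suc n))) < e" using e by (rule order_tendstoD(2))
 then obtain N where N: "\<And>n. n \<ge> N ==> ?A (inverse (real (Suc n))) < e" by (auto simp: eventually_sequentially)
 have le: "\<bar>average \<phi> i (inverse (real (Suc m))) x - average \<phi> i (inverse (real (Suc n))) x\<bar> < e"
  if "m \<ge> N" "m \<le> n" "i \<in> I" "x \<in> K" "x \<in> ball i (\<rho> i)" for m n i x
 proof -
  have "inverse (real (Suc n)) \<le> inverse (real (Suc m))" using that by (intro le_imp_inverse_le) auto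
  then have "\<bar>average \<phi> i (inverse (real (Suc m))) x - average \<phi> i (inverse (real (Suc n))) x\<bar> \<le> ?A (inverse (real (Suc m)))"
   by (intro average_diff_le[OF w that(3-5) _ _ _ G] scales)
  also have "\<dots> < e" using N that(1) by blast
  finally show ?thesis .
 qed
 show ?thesis
 proof (intro exI[of _ N] allI impI ballI)
  fix m n i x assume a: "m \<ge> N" "n \<ge> N" "i \<in> I" "x \<in> K \<inter> ball i (\<rho> i)"
  show "\<bar>average \<phi> i (inverse (real (Suc m))) x - average \<phi> i (inverse (real (Suc n))) x\<bar> < e"
   using le[of m n i x] le[of n m i x] a by (cases "m \<le> n") (auto simp: abs_minus_commute)
 qed
qed

lemma F_averaging_AE:
 assumes \<phi>: "integrable lborel \<phi>" and S: "S \<in> sets borel" and i: "i \<in> I"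
  and lim: "\<And>x. x \<in> S ==> (\<lambda>n. average \<phi> i (inverse (real (Suc n))) x) \<longlonglongrightarrow> \<psi> x"
 shows "AE x in lborel. x \<in> S \<longrightarrow> \<psi> x = \<phi> x"
proof (rule averaging_AE[where \<beta>="\<lambda>n. F i (inverse (real (Suc n)))" and B="\<lambda>n. B / inverse (real (Suc n)) ^ DIM('a)"])
 note sc = scales(1)
 show "integrable lborel \<phi>" "S \<in> sets borel" by fact+
 show "F i (inverse (real (Suc n))) \<in> borel_measurable borel" for n by measurable
 show "0 \<le> F i (inverse (real (Suc n))) v" for n v using F_nonneg[OF sc] .
 show "F i (inverse (real (Suc n))) v \<le> B / inverse (real (Suc n)) ^ DIM('a)" for n v using F_le[OF sc] .
 show "integrable lborel (F i (inverse (real (Suc n))))" for n using integrable_F[OF sc, of i _ 0] by simp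
 show "(LBINT v. F i (inverse (real (Suc n))) v) = 1" for n using integral_F[OF sc, of i _ 0] by simp
 show "\<forall>\<^sub>F n in sequentially. \<forall>v. F i (inverse (real (Suc n))) v \<noteq> 0 \<longrightarrow> norm v < r" if "r > 0" for r
 proof -
  have "(\<lambda>n. inverse (real (Suc n)) * R) \<longlonglongrightarrow> 0 * R" by (intro tendsto_intros LIMSEQ_inverse_real_of_nat)
  then have "\<forall>\<^sub>F n in sequentially. inverse (real (Suc n)) * R < r" using that by (intro order_tendstoD(2)) auto
  then show ?thesis by eventually_elim (use F_support[OF sc i] in \<open>blast intro: le_less_trans\<close>)
 qed
 show "(\<lambda>n. LINT v|lborel. F i (inverse (real (Suc n))) v * \<phi> (x + v)) \<longlonglongrightarrow> \<psi> x" if x: "x \<in> S" for x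
 proof -
  have "(LBINT v. F i (inverse (real (Suc n))) v * \<phi> (x + v)) = average \<phi> i (inverse (real (Suc n))) x" for n
  proof -
   have "(LBINT v. F i (inverse (real (Suc n))) (v + x - x) * \<phi> (v + x)) = average \<phi> i (inverse (real (Suc n))) x"
    unfolding average_def
   proof (rule lborel_translate(1)[of "\<lambda>z. F i (inverse (real (Suc n))) (z - x) * \<phi> z"])
    have [measurable]: "\<phi> \<in> borel_measurable borel" using borel_measurable_integrable[OF \<phi>] by simp
    show "(\<lambda>z. F i (inverse (real (Suc n))) (z - x) * \<phi> z) \<in> borel_measurable borel" by measurable
   qed
   then show ?thesis by (simp add: add.commute)
  qed
  then show ?thesis using lim[OF x] by simp
 qed
qed

text \<open>Morrey's embedding. Each direction gives uniformly convergent averages on its own ball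
  only; the partition of unity glues them into continuous functions on all of \<open>K\<close>, and
  almost everywhere the limit is \<open>\<phi>\<close>.\<close>

theorem continuous_representative:
 assumes w: "weak_grad (interior K) \<phi> G" and G: "G \<in> borel_measurable borel" "energy G < \<infinity>"
 shows "\<exists>\<psi>. continuous_on K \<psi> \<and> (AE x in lborel. x \<in> K \<longrightarrow> \<psi> x = \<phi> x)"
proof -
 have \<phi>: "integrable lborel \<phi>" using w by (simp add: weak_grad_def)
 let ?s = "\<lambda>n. inverse (real (Suc n))"
 define f where "f n x = (\<Sum>i\<in>I. chi i x * average \<phi> i (?s n) x)" for n x
 have fc: "continuous_on K (f n)" for n
  unfolding f_def[abs_def] using average_continuous[OF scales(1) \<phi>]
  by (intro continuous_intros chi_continuous) (auto intro: continuous_on_subset)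
 have cau: "uniformly_Cauchy_on K f"
  unfolding uniformly_Cauchy_on_def
 proof (intro allI impI)
  fix e :: real assume e: "e > 0"
  obtain N where N: "\<And>m n i x. m \<ge> N ==> n \<ge> N ==> i \<in> I ==> x \<in> K \<inter> ball i (\<rho> i) ==>
    \<bar>average \<phi> i (?s m) x - average \<phi> i (?s n) x\<bar> < e/2"
   using average_diff_small[OF w G, of "e/2"] e by (metis half_gt_zero)
  show "\<exists>M. \<forall>x\<in>K. \<forall>m\<ge>M. \<forall>n\<ge>M. dist (f m x) (f n x) < e"
  proof (intro exI[of _ N] ballI allI impI)
   fix x m n assume a: "x \<in> K" "m \<ge> N" "n \<ge> N"
   have "dist (f m x) (f n x) = \<bar>\<Sum>i\<in>I. chi i x * (average \<phi> i (?s m) x - average \<phi> i (?s n) x)\<bar>"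
    by (simp add: f_def dist_real_def right_diff_distrib sum_subtractf)
   also have "\<dots> \<le> (\<Sum>i\<in>I. \<bar>chi i x * (average \<phi> i (?s m) x - average \<phi> i (?s n) x)\<bar>)" by (rule sum_abs)
   also have "\<dots> \<le> (\<Sum>i\<in>I. chi i x * (e/2))"
   proof (rule sum_mono)
    fix i assume i: "i \<in> I"
    show "\<bar>chi i x * (average \<phi> i (?s m) x - average \<phi> i (?s n) x)\<bar> \<le> chi i x * (e/2)"
    proof (cases "chi i x = 0")
     case False
     then have "\<bar>average \<phi> i (?s m) x - average \<phi> i (?s n) x\<bar> < e/2"
      using N a i chi_support[OF i] by auto
     then show ?thesis using chi_nonneg[of i x] unfolding abs_mult by (simp only: abs_of_nonneg) (intro mult_left_mono, auto)
    qed simp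
   qed
   also have "\<dots> = e/2" unfolding sum_distrib_right[symmetric] using sum_chi[OF a(1)] by simp
   finally show "dist (f m x) (f n x) < e" using e by simp
  qed
 qed
 then obtain \<psi> where \<psi>: "uniform_limit K f \<psi> sequentially"
  using Cauchy_uniformly_convergent uniformly_convergent_on_def by blast
 have "continuous_on K \<psi>"
  by (rule uniform_limit_theorem[OF _ \<psi>]) (use fc in auto)
 moreover have "AE x in lborel. x \<in> K \<longrightarrow> \<psi> x = \<phi> x"
 proof -
  define \<psi>i where "\<psi>i i x = lim (\<lambda>n. average \<phi> i (?s n) x)" for i x
  have li: "(\<lambda>n. average \<phi> i (?s n) x) \<longlonglongrightarrow> \<psi>i i x" if "i \<in> I" "x \<in> K \<inter> ball i (\<rho> i)" for i x
  proof -
   have "Cauchy (\<lambda>n. average \<phi> i (?s n) x)"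
    unfolding Cauchy_def dist_real_def
    using average_diff_small[OF w G] that by meson
   then show ?thesis unfolding \<psi>i_def by (simp add: Cauchy_convergent convergent_LIMSEQ_iff[symmetric])
  qed
  have "AE x in lborel. x \<in> K \<inter> ball i (\<rho> i) \<longrightarrow> \<psi>i i x = \<phi> x" if "i \<in> I" for i
   using li[OF that] by (intro F_averaging_AE[OF \<phi> _ that]) auto
  then have "AE x in lborel. \<forall>i\<in>I. x \<in> K \<inter> ball i (\<rho> i) \<longrightarrow> \<psi>i i x = \<phi> x"
   using finite_I by (intro AE_finite_allI) auto
  then show ?thesis
  proof eventually_elim
   case (elim x)
   show ?case
   proof
    assume x: "x \<in> K"
    have "(\<lambda>n. f n x) \<longlonglongrightarrow> (\<Sum>i\<in>I. chi i x * \<phi> x)"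
     unfolding f_def
    proof (rule tendsto_sum)
     fix i assume i: "i \<in> I"
     show "(\<lambda>n. chi i x * average \<phi> i (?s n) x) \<longlonglongrightarrow> chi i x * \<phi> x"
     proof (cases "chi i x = 0")
      case False
      then have xb: "x \<in> K \<inter> ball i (\<rho> i)" using chi_support[OF i] x by auto
      then show ?thesis using li[OF i xb] elim i by (intro tendsto_intros) auto
     qed simp
    qed
    also have "(\<Sum>i\<in>I. chi i x * \<phi> x) = \<phi> x" using sum_chi[OF x] by (simp flip: sum_distrib_right)
    finally show "\<psi> x = \<phi> x"
     using tendsto_uniform_limitI[OF \<psi> x] LIMSEQ_unique by blast
   qed
  qed
 qed
 ultimately show ?thesis by blast
qed

text \<open>The kernel lives in the interior of \<open>K\<close>, where \<open>\<phi>\<close> agrees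
  almost everywhere with the continuous function, and its support shrinks to
  \<open>x\<close>.\<close>

lemma average_tendsto:
 assumes \<phi>: "integrable lborel \<phi>" and \<psi>: "continuous_on K \<psi>" "AE x in lborel. x \<in> K \<longrightarrow> \<psi> x = \<phi> x"
  and a: "i \<in> I" "x \<in> K" "x \<in> ball i (\<rho> i)"
 shows "(\<lambda>n. average \<phi> i (inverse (real (Suc n))) x) \<longlonglongrightarrow> \<psi> x"
proof (rule LIMSEQ_I)
 fix e :: real assume e: "e > 0"
 let ?s = "\<lambda>n. inverse (real (Suc n))"
 obtain d where d: "d > 0" "\<And>z. z \<in> K ==> dist z x < d ==> dist (\<psi> z) (\<psi> x) < e/2"
  using \<psi>(1) a(2) e unfolding continuous_on_iff by (metis half_gt_zero)
 have "(\<lambda>n. ?s n * R) \<longlonglongrightarrow> 0 * R" by (intro tendsto_intros LIMSEQ_inverse_real_of_nat)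
 then have "\<forall>\<^sub>F n in sequentially. ?s n * R < d" using d by (intro order_tendstoD(2)) auto
 then obtain N where N: "\<And>n. n \<ge> N ==> ?s n * R < d" by (auto simp: eventually_sequentially)
 show "\<exists>no. \<forall>n\<ge>no. norm (average \<phi> i (?s n) x - \<psi> x) < e"
 proof (intro exI[of _ N] allI impI)
  fix n assume n: "n \<ge> N"
  have i1: "integrable lborel (\<lambda>z. F i (?s n) (z - x) * \<phi> z)" by (rule integrable_F_mult[OF scales(1) \<phi>])
  have i2: "integrable lborel (\<lambda>z. F i (?s n) (z - x) * \<psi> x)" by (intro integrable_mult_left integrable_F scales)
  have i3: "integrable lborel (\<lambda>z. F i (?s n) (z - x) * (e/2))" by (intro integrable_mult_left integrable_F scales)
  have eq: "average \<phi> i (?s n) x - \<psi> x = (LBINT z. F i (?s n) (z - x) * \<phi> z) - (LBINT z. F i (?s n) (z - x) * \<psi> x)"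
   using integral_F[OF scales(1)[of n], of i x] by (simp add: average_def)
  have "norm (average \<phi> i (?s n) x - \<psi> x) = norm (LBINT z. F i (?s n) (z - x) * \<phi> z - F i (?s n) (z - x) * \<psi> x)"
   unfolding eq using i1 i2 by simp
  also have "\<dots> \<le> (LBINT z. norm (F i (?s n) (z - x) * \<phi> z - F i (?s n) (z - x) * \<psi> x))"
   by (rule integral_norm_bound)
  also have "\<dots> \<le> (LBINT z. F i (?s n) (z - x) * (e/2))"
  proof (rule integral_mono_AE)
   show "AE z in lborel. norm (F i (?s n) (z - x) * \<phi> z - F i (?s n) (z - x) * \<psi> x) \<le> F i (?s n) (z - x) * (e/2)"
    using \<psi>(2)
   proof eventually_elim
    case (elim z)
    show ?case
    proof (cases "F i (?s n) (z - x) = 0")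
     case False
     have "z \<in> K" using F_interior[OF a scales False] interior_subset by blast
     moreover have "dist z x < d" using F_support[OF scales(1) a(1) False] N[OF n] by (simp add: dist_norm)
     ultimately have "\<bar>\<phi> z - \<psi> x\<bar> \<le> e/2" using d(2)[of z] elim by (simp add: dist_real_def)
     then have "F i (?s n) (z - x) * \<bar>\<phi> z - \<psi> x\<bar> \<le> F i (?s n) (z - x) * (e/2)"
      using F_nonneg[OF scales(1)] by (intro mult_left_mono) auto
     then show ?thesis using F_nonneg[OF scales(1)[of n], of i "z - x"] by (simp add: abs_mult flip: right_diff_distrib)
    qed simp
   qed
  qed (use i1 i2 i3 in auto)
  also have "\<dots> = e/2" using integral_F[OF scales(1)[of n], of i x] by simp
  finally show "norm (average \<phi> i (?s n) x - \<psi> x) < e" using e by simp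
 qed
qed

text \<open>The limit of \<open>average_diff\<close> as the smaller scale tends to 0, dominated
  because the rate is integrable down to 0. It holds at every point of the patch, boundary included,
  as integration against measures that charge null sets requires.\<close>

theorem average_identity:
 assumes w: "weak_grad (interior K) \<phi> G" and G: "G \<in> borel_measurable borel" "energy G < \<infinity>"
  and \<psi>: "continuous_on K \<psi>" "AE x in lborel. x \<in> K \<longrightarrow> \<psi> x = \<phi> x"
  and a: "i \<in> I" "x \<in> K" "x \<in> ball i (\<rho> i)" and t: "0 < t" "t \<le> 1"
 shows "average \<phi> i t x - \<psi> x = (LBINT r. indicator {0<..t} r * rate G i x r)"
proof -
 have \<phi>: "integrable lborel \<phi>" using w by (simp add: weak_grad_def)
 let ?s = "\<lambda>n. inverse (real (Suc n))"
 have t0: "0 \<le> t" using t by simp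
 have 1: "(\<lambda>n. average \<phi> i t x - average \<phi> i (?s n) x) \<longlonglongrightarrow> average \<phi> i t x - \<psi> x"
  by (intro tendsto_intros average_tendsto[OF \<phi> \<psi> a])
 have 2: "(\<lambda>n. LINT r|lborel. indicator {?s n..t} r * rate G i x r) \<longlonglongrightarrow> (LBINT r. indicator {0<..t} r * rate G i x r)"
 proof (rule integral_dominated_convergence[where w="\<lambda>r. \<bar>indicator {0<..t} r * rate G i x r\<bar>"])
  show "integrable lborel (\<lambda>r. \<bar>indicator {0<..t} r * rate G i x r\<bar>)"
   using rate_integrable(1)[OF a(1) t0 t(2) G] by auto
  show "AE r in lborel. (\<lambda>n. indicator {?s n..t} r * rate G i x r) \<longlonglongrightarrow> indicator {0<..t} r * rate G i x r"
  proof (rule AE_I2, rule tendsto_eventually)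
   fix r :: real
   show "\<forall>\<^sub>F n in sequentially. indicator {?s n..t} r * rate G i x r = indicator {0<..t} r * rate G i x r"
   proof (cases "0 < r")
    case True
    then have "\<forall>\<^sub>F n in sequentially. ?s n < r" using LIMSEQ_inverse_real_of_nat by (rule order_tendstoD(2)[rotated])
    then show ?thesis by eventually_elim (auto simp: indicator_def True)
   next
    case False
    then show ?thesis by (intro always_eventually) (use less_le_trans[OF scales(1)] in \<open>auto simp: indicator_def simp del: of_nat_Suc\<close>)
   qed
  qed
  show "AE r in lborel. norm (indicator {?s n..t} r * rate G i x r) \<le> \<bar>indicator {0<..t} r * rate G i x r\<bar>" for n
   using less_le_trans[OF scales(1)[of n]] by (intro AE_I2) (auto simp: indicator_def simp del: of_nat_Suc)
 qed (use rate_measurable(2)[OF G(1)] in measurable)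
 have 3: "\<forall>\<^sub>F n in sequentially. (LBINT r. indicator {?s n..t} r * rate G i x r) = average \<phi> i t x - average \<phi> i (?s n) x"
 proof -
  have "\<forall>\<^sub>F n in sequentially. ?s n < t" using t(1) LIMSEQ_inverse_real_of_nat by (rule order_tendstoD(2)[rotated])
  then show ?thesis by eventually_elim (use average_diff[OF w a scales(1) _ t(2)] in auto)
 qed
 show ?thesis by (rule LIMSEQ_unique[OF 1 Lim_transform_eventually[OF 2 3]])
qed

end

section \<open>Recovery fields\<close>

text \<open>\<open>correction\<close> and \<open>smoothing\<close> both superpose kernels over a
  parameter measure; this is their common Fubini argument. The inequality for nonnegative
  \<open>g\<close> is the form in which the duality for L^\<alpha> uses it.\<close>

lemma kernel_field:
 fixes k :: "'p => 'a::euclidean_space => 'b::euclidean_space"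
 assumes P: "sigma_finite_measure P" and k: "(\<lambda>(q, z). k q z) \<in> borel_measurable (P \<Otimes>\<^sub>M lborel)"
 defines "f \<equiv> \<lambda>z. LINT q|P. k q z"
 shows "f \<in> borel_measurable borel"
  and "\<And>g. g \<in> borel_measurable borel ==> (\<And>x. 0 \<le> g x) ==>
   (NN z. ennreal (norm (f z) * g z)) \<le> (\<integral>\<^sup>+q. (NN z. ennreal (norm (k q z) * g z)) \<partial>P)"
  and "\<And>G. G \<in> borel_measurable borel ==> (\<integral>\<^sup>+q. (NN z. ennreal (norm (k q z) * norm (G z))) \<partial>P) < \<infinity> ==>
   (LBINT z. f z \<bullet> G z) = (LINT q|P. LINT z|lborel. k q z \<bullet> G z) \<and>
   integrable lborel (\<lambda>z. f z \<bullet> G z) \<and> integrable P (\<lambda>q. LINT z|lborel. k q z \<bullet> G z) \<and>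
   integrable (P \<Otimes>\<^sub>M lborel) (\<lambda>(q, z). k q z \<bullet> G z)"
proof -
 interpret Q: sigma_finite_measure P by fact
 interpret pair_sigma_finite P lborel ..
 note k[measurable]
 have k'[measurable]: "(\<lambda>(z, q). k q z) \<in> borel_measurable (lborel \<Otimes>\<^sub>M P)"
  using measurable_compose[OF measurable_pair_swap' k] by (simp add: case_prod_beta)
 show fm[measurable]: "f \<in> borel_measurable borel"
  using Q.borel_measurable_lebesgue_integral[OF k'] by (simp add: f_def)
 \<comment> \<open>Where the integral does not exist, f z is 0 by convention and the bound is
   trivial.\<close>
 have nf: "ennreal (norm (f z)) \<le> (\<integral>\<^sup>+q. ennreal (norm (k q z)) \<partial>P)" for z
 proof (cases "integrable P (\<lambda>q. k q z)")
  case True then show ?thesis using integral_norm_bound_ennreal[OF True] by (simp add: f_def)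
 qed (simp add: f_def not_integrable_integral_eq)
 {
  fix g :: "'a => real" assume g[measurable]: "g \<in> borel_measurable borel" and g0: "\<And>x. 0 \<le> g x"
  have "(NN z. ennreal (norm (f z) * g z)) \<le> (NN z. \<integral>\<^sup>+q. ennreal (norm (k q z) * g z) \<partial>P)"
  proof (rule nn_integral_mono)
   fix z
   have kz: "(\<lambda>q. k q z) \<in> borel_measurable P" by measurable
   have "ennreal (norm (f z) * g z) = ennreal (norm (f z)) * ennreal (g z)" using g0 by (simp add: ennreal_mult)
   also have "\<dots> \<le> (\<integral>\<^sup>+q. ennreal (norm (k q z)) \<partial>P) * ennreal (g z)" by (intro mult_right_mono nf) simp
   also have "\<dots> = (\<integral>\<^sup>+q. ennreal (norm (k q z)) * ennreal (g z) \<partial>P)" using kz by (subst nn_integral_multc) auto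
   finally show "ennreal (norm (f z) * g z) \<le> (\<integral>\<^sup>+q. ennreal (norm (k q z) * g z) \<partial>P)"
    using g0 by (simp add: ennreal_mult)
  qed
  also have "\<dots> = (\<integral>\<^sup>+q. (NN z. ennreal (norm (k q z) * g z)) \<partial>P)"
   by (rule Fubini'[of "\<lambda>q z. ennreal (norm (k q z) * g z)"]) measurable
  finally show "(NN z. ennreal (norm (f z) * g z)) \<le> (\<integral>\<^sup>+q. (NN z. ennreal (norm (k q z) * g z)) \<partial>P)" .
 }
 {
  fix G :: "'a => 'b" assume G[measurable]: "G \<in> borel_measurable borel"
   and fin: "(\<integral>\<^sup>+q. (NN z. ennreal (norm (k q z) * norm (G z))) \<partial>P) < \<infinity>"
  have m: "(\<lambda>(q, z). k q z \<bullet> G z) \<in> borel_measurable (P \<Otimes>\<^sub>M lborel)" by measurable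
  have "(\<integral>\<^sup>+q. (NN z. ennreal (norm (k q z \<bullet> G z))) \<partial>P) \<le> (\<integral>\<^sup>+q. (NN z. ennreal (norm (k q z) * norm (G z))) \<partial>P)"
   by (intro nn_integral_mono ennreal_leI) (simp add: Cauchy_Schwarz_ineq2)
  then have fin2: "(\<integral>\<^sup>+q. (NN z. ennreal (norm (k q z \<bullet> G z))) \<partial>P) < \<infinity>" using fin by (rule le_less_trans)
  note sw = Fubini_swap[OF P lborel.sigma_finite_measure_axioms m fin2]
  have "(NN z. \<integral>\<^sup>+q. ennreal (norm (k q z) * norm (G z)) \<partial>P) < \<infinity>"
   using fin by (subst Fubini'[of "\<lambda>q z. ennreal (norm (k q z) * norm (G z))"]) measurable
  then have "AE z in lborel. (\<integral>\<^sup>+q. ennreal (norm (k q z) * norm (G z)) \<partial>P) \<noteq> \<infinity>"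
   by (intro nn_integral_PInf_AE) auto
  then have ae: "AE z in lborel. (LINT q|P. k q z \<bullet> G z) = f z \<bullet> G z"
  proof eventually_elim
   case (elim z)
   show ?case
   \<comment> \<open>Where G vanishes both sides are 0; elsewhere the finite double integral forces
     k to be integrable over the parameter.\<close>
   proof (cases "G z = 0")
    case False
    have kz: "(\<lambda>q. k q z) \<in> borel_measurable P" by measurable
    have "(\<integral>\<^sup>+q. ennreal (norm (k q z)) \<partial>P) * ennreal (norm (G z)) = (\<integral>\<^sup>+q. ennreal (norm (k q z) * norm (G z)) \<partial>P)"
     using kz by (subst nn_integral_multc[symmetric]) (auto simp: ennreal_mult)
    then have "(\<integral>\<^sup>+q. ennreal (norm (k q z)) \<partial>P) * ennreal (norm (G z)) < \<infinity>" using elim by (simp add: less_top)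
    then have "(\<integral>\<^sup>+q. ennreal (norm (k q z)) \<partial>P) < \<infinity>"
     using False by (auto simp: ennreal_mult_less_top)
    then have "integrable P (\<lambda>q. k q z)" using kz by (intro integrableI_bounded) auto
    then show ?thesis by (simp add: f_def)
   qed simp
  qed
  have gm: "(\<lambda>z. LINT q|P. k q z \<bullet> G z) \<in> borel_measurable lborel" by measurable
  have "integrable lborel (\<lambda>z. f z \<bullet> G z)"
   using sw(3) ae gm by (subst (asm) integrable_cong_AE) auto
  moreover have "(LBINT z. f z \<bullet> G z) = (LINT q|P. LINT z|lborel. k q z \<bullet> G z)"
   unfolding sw(1) using ae gm by (intro integral_cong_AE[symmetric]) auto
  ultimately show "(LBINT z. f z \<bullet> G z) = (LINT q|P. LINT z|lborel. k q z \<bullet> G z) \<and>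
   integrable lborel (\<lambda>z. f z \<bullet> G z) \<and> integrable P (\<lambda>q. LINT z|lborel. k q z \<bullet> G z) \<and>
   integrable (P \<Otimes>\<^sub>M lborel) (\<lambda>(q, z). k q z \<bullet> G z)" using sw(2,4) by simp
 }
qed

text \<open>Test with a small multiple of the truncated power \<open>|f|^(\<alpha> - 1)\<close>.\<close>

lemma powr_integrable_by_duality:
 fixes f :: "'a::euclidean_space => 'b::euclidean_space"
 assumes f[measurable]: "f \<in> borel_measurable borel" and \<alpha>: "\<alpha> > 1" and CD: "C \<ge> 0" "D \<ge> 0"
  and le: "\<And>g. g \<in> borel_measurable borel ==> (\<And>x. 0 \<le> g x) ==>
   (NN z. ennreal (norm (f z) * g z)) \<le> ennreal C * (1 + ennreal D * (NN z. ennreal (g z powr conj_exp \<alpha>)))"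
 shows "(NN z. ennreal (norm (f z) powr \<alpha>)) < \<infinity>"
proof -
 let ?p = "conj_exp \<alpha>"
 have p: "?p > 1" "(\<alpha> - 1) * ?p = \<alpha>" using \<alpha> by (auto simp: conj_exp_def field_simps)
 \<comment> \<open>Chosen to make C D s \<le> 1/2, so that the power term can be absorbed. The
   multiplier l below turns |f|^(\<alpha> - 1) into a test function whose p-th power is l s
   |f|^\<alpha>.\<close>
 define s where "s = 1 / (2 * (C * D + 1))"
 have CD1: "C * D + 1 > 0" using CD by (simp add: add_nonneg_pos)
 have s: "s > 0" using CD1 by (simp add: s_def)
 have sCD: "C * D * s \<le> 1/2"
 proof -
  have "s * (2 * (C * D + 1)) = 1" using CD1 by (simp add: s_def)
  then have "2 * (C * D * s) = 1 - 2 * s" by (simp add: algebra_simps)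
  then show ?thesis using s by simp
 qed
 define l where "l = s powr (1 / (?p - 1))"
 have l: "l > 0" "l powr (?p - 1) = s" using s p by (auto simp: l_def powr_powr)
 have lp: "l powr ?p = l * s" using l by (metis add.commute diff_add_cancel powr_add powr_one less_imp_le mult.commute)
 \<comment> \<open>Cutting off in height and in space makes the integral J below finite in advance,
   which is what permits subtracting it; Fatou's lemma removes the cut-off.\<close>
 define m where "m N z = min (norm (f z)) (real N) * indicator (ball 0 (real N)) z" for N :: nat and z
 have mm[measurable]: "m N \<in> borel_measurable borel" for N
  unfolding m_def by (intro borel_measurable_times borel_measurable_min borel_measurable_indicator) auto
 have m0: "0 \<le> m N z" "m N z \<le> norm (f z)" for N z by (auto simp: m_def indicator_def)
 have J: "(NN z. ennreal (m N z powr \<alpha>)) \<le> ennreal (2 * C / l)" for N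
 proof -
  have "(NN z. ennreal (m N z powr \<alpha>)) \<le> (NN z. ennreal (real N powr \<alpha>) * indicator (ball (0::'a) (real N)) z)"
   using \<alpha> by (intro nn_integral_mono) (auto simp: m_def indicator_def intro!: ennreal_leI powr_mono2)
  also have "\<dots> = ennreal (real N powr \<alpha>) * emeasure lborel (ball (0::'a) (real N))"
   by (subst nn_integral_cmult_indicator) auto
  also have "\<dots> < \<infinity>" using emeasure_lborel_ball_finite[of "0::'a" "real N"] by (auto simp: ennreal_mult_less_top)
  finally have "(NN z. ennreal (m N z powr \<alpha>)) < \<infinity>" .
  then obtain J where J: "(NN z. ennreal (m N z powr \<alpha>)) = ennreal J" "J \<ge> 0"
   by (metis ennreal_cases infinity_ennreal_def less_irrefl)
  have "ennreal (l * J) = (NN z. ennreal l * ennreal (m N z powr \<alpha>))"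
   using l J by (subst nn_integral_cmult) (auto simp: ennreal_mult)
  also have "\<dots> \<le> (NN z. ennreal (norm (f z) * (l * m N z powr (\<alpha> - 1))))"
  proof (rule nn_integral_mono)
   fix z
   have "m N z powr \<alpha> = m N z * m N z powr (\<alpha> - 1)"
    using m0[of N z] by (cases "m N z = 0") (auto simp: powr_mult_base)
   also have "\<dots> \<le> norm (f z) * m N z powr (\<alpha> - 1)" using m0 by (intro mult_right_mono) auto
   finally have "l * m N z powr \<alpha> \<le> norm (f z) * (l * m N z powr (\<alpha> - 1))" using l by (simp add: mult.left_commute mult_left_mono)
   then show "ennreal l * ennreal (m N z powr \<alpha>) \<le> ennreal (norm (f z) * (l * m N z powr (\<alpha> - 1)))"
    using l by (simp add: ennreal_mult[symmetric] ennreal_leI)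
  qed
  also have "\<dots> \<le> ennreal C * (1 + ennreal D * (NN z. ennreal ((l * m N z powr (\<alpha> - 1)) powr ?p)))"
   using l by (intro le) auto
  also have "(NN z. ennreal ((l * m N z powr (\<alpha> - 1)) powr ?p)) = (NN z. ennreal (l * s) * ennreal (m N z powr \<alpha>))"
  proof (intro nn_integral_cong)
   fix z
   have "(l * m N z powr (\<alpha> - 1)) powr ?p = l powr ?p * m N z powr \<alpha>"
    using l by (simp add: powr_mult powr_powr p)
   then show "ennreal ((l * m N z powr (\<alpha> - 1)) powr ?p) = ennreal (l * s) * ennreal (m N z powr \<alpha>)"
    using l s by (simp add: lp ennreal_mult)
  qed
  also have "\<dots> = ennreal (l * s * J)" using l s J by (subst nn_integral_cmult) (auto simp: ennreal_mult)
  also have "ennreal C * (1 + ennreal D * ennreal (l * s * J)) = ennreal (C * (1 + D * (l * s * J)))"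
   using CD l s J(2) by (simp add: ennreal_mult ennreal_plus flip: ennreal_1)
  finally have "l * J \<le> C * (1 + D * (l * s * J))"
   using CD l s J(2) by (subst (asm) ennreal_le_iff) auto
  also have "\<dots> = C + (C * D * s) * (l * J)" by (simp add: algebra_simps)
  also have "\<dots> \<le> C + 1/2 * (l * J)" using sCD l J(2) by (intro add_left_mono mult_right_mono) auto
  finally have "J \<le> 2 * C / l" using l by (simp add: field_simps)
  then show ?thesis by (simp add: J ennreal_leI)
 qed
 have "(NN z. ennreal (norm (f z) powr \<alpha>)) = (NN z. liminf (\<lambda>N. ennreal (m N z powr \<alpha>)))"
 proof (rule nn_integral_cong)
  fix z
  have "\<forall>\<^sub>F N in sequentially. max (norm (f z)) (norm z) < real N"
   using filterlim_real_sequentially by (rule filterlim_at_top_dense[THEN iffD1, rule_format])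
  then have "\<forall>\<^sub>F N in sequentially. ennreal (m N z powr \<alpha>) = ennreal (norm (f z) powr \<alpha>)"
   by eventually_elim (auto simp: m_def)
  then have "(\<lambda>N. ennreal (m N z powr \<alpha>)) \<longlonglongrightarrow> ennreal (norm (f z) powr \<alpha>)" by (rule tendsto_eventually)
  then show "ennreal (norm (f z) powr \<alpha>) = liminf (\<lambda>N. ennreal (m N z powr \<alpha>))"
   by (rule lim_imp_Liminf[OF trivial_limit_sequentially, symmetric])
 qed
 also have "\<dots> \<le> liminf (\<lambda>N. (NN z. ennreal (m N z powr \<alpha>)))"
  by (rule nn_integral_liminf) measurable
 also have "\<dots> \<le> ennreal (2 * C / l)"
  using J by (intro Liminf_le) auto
 finally show ?thesis by (rule le_less_trans) simp
qed

context cone_setting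
begin

text \<open>At each x the field is the integral of F_r(z - x)(z - x)/r over r, weighted by
  \<open>b x\<close>. Paired with the gradient of \<phi> it gives the integral of \<open>b\<close>
  times the average of \<phi> at scale \<open>t\<close> minus \<phi>. The product measure treats x
  and r in one Fubini argument.\<close>

definition correction :: "'a measure => ('a => real) => 'a => real => 'a => 'a" where
 "correction \<nu> b i t z = (LINT q|(\<nu> \<Otimes>\<^sub>M lborel). (b (fst q) * (indicator {0<..t} (snd q) * (F i (snd q) (z - fst q) / snd q))) *\<^sub>R (z - fst q))"

text \<open>The factor |z - x| / r is at most R on the support. Against the constant 1 this leaves
  the length t of the range of r, hence the small mass; against p-integrable functions it leaves
  Morrey's bound, which by duality puts the field into L^\<alpha>.\<close>

lemma correction:
 assumes \<nu>: "finite_measure \<nu>" "sets \<nu> = sets borel" and b: "integrable \<nu> b"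
  and bK: "\<And>x. b x \<noteq> 0 ==> x \<in> K \<inter> ball i (\<rho> i)" and i: "i \<in> I" and t: "0 < t" "t \<le> 1"
 shows "correction \<nu> b i t \<in> borel_measurable borel"
  and "z \<notin> interior K ==> correction \<nu> b i t z = 0"
  and "(NN z. ennreal (norm (correction \<nu> b i t z))) \<le> ennreal (t * (R * (LINT x|\<nu>. \<bar>b x\<bar>)))"
  and "p = conj_exp \<alpha> ==> \<alpha> > 1 ==> (NN z. ennreal (norm (correction \<nu> b i t z) powr \<alpha>)) < \<infinity>"
  and "G \<in> borel_measurable borel ==> energy G < \<infinity> ==>
   integrable lborel (\<lambda>z. correction \<nu> b i t z \<bullet> G z) \<and>
   integrable \<nu> (\<lambda>x. b x * (LBINT r. indicator {0<..t} r * rate G i x r)) \<and>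
   (LBINT z. correction \<nu> b i t z \<bullet> G z) = (LINT x|\<nu>. b x * (LBINT r. indicator {0<..t} r * rate G i x r))"
proof -
 interpret \<nu>: finite_measure \<nu> by fact
 interpret pair_sigma_finite \<nu> lborel ..
 have bm[measurable]: "b \<in> borel_measurable \<nu>" using b by auto
 have fstm: "fst \<in> borel_measurable ((\<nu> \<Otimes>\<^sub>M lborel))"
  using \<nu>(2) measurable_fst[of \<nu> "lborel :: real measure"] by (simp cong: measurable_cong_sets)
 let ?P = "\<nu> \<Otimes>\<^sub>M (lborel :: real measure)"
 define k where "k q z = (b (fst q) * (indicator {0<..t} (snd q) * (F i (snd q) (z - fst q) / snd q))) *\<^sub>R (z - fst q)" for q :: "'a \<times> real" and z
 have P: "sigma_finite_measure ?P" by (rule sigma_finite_measure_axioms)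
 have km: "(\<lambda>(q, z). k q z) \<in> borel_measurable (?P \<Otimes>\<^sub>M lborel)"
 proof -
  have f1[measurable]: "(\<lambda>p. fst (fst p)) \<in> borel_measurable (?P \<Otimes>\<^sub>M (lborel :: 'a measure))"
   by (rule measurable_compose[OF measurable_fst fstm])
  have f2[measurable]: "(\<lambda>p. b (fst (fst p))) \<in> borel_measurable (?P \<Otimes>\<^sub>M (lborel :: 'a measure))" by measurable
  show ?thesis unfolding k_def case_prod_beta by measurable
 qed
 note kf = kernel_field[OF P km]
 have corr: "correction \<nu> b i t = (\<lambda>z. LINT q|?P. k q z)" by (rule ext) (simp add: correction_def k_def)
 show cm: "correction \<nu> b i t \<in> borel_measurable borel" unfolding corr by (rule kf(1))
 have k0: "k q z = 0" if "z \<notin> interior K" for q z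
 proof (rule ccontr)
  assume "k q z \<noteq> 0"
  then have "b (fst q) \<noteq> 0" "snd q \<in> {0<..t}" "F i (snd q) (z - fst q) \<noteq> 0"
   by (auto simp: k_def indicator_def split: if_splits)
  then have "z \<in> interior K" using bK t by (intro F_interior[OF i, of "fst q" "snd q" z]) auto
  then show False using that by simp
 qed
 show "z \<notin> interior K ==> correction \<nu> b i t z = 0" for z unfolding corr by (simp add: k0)
 have kn: "norm (k q z) \<le> R * (\<bar>b (fst q)\<bar> * (indicator {0<..t} (snd q) * F i (snd q) (z - fst q)))" for q z
 proof (cases "snd q \<in> {0<..t} \<and> F i (snd q) (z - fst q) \<noteq> 0")
  case True
  then have r: "snd q > 0" by auto
  have "norm (z - fst q) / snd q \<le> R" using F_support[OF r i] True r by (simp add: pos_divide_le_eq mult.commute)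
  then have "(\<bar>b (fst q)\<bar> * F i (snd q) (z - fst q)) * (norm (z - fst q) / snd q) \<le> (\<bar>b (fst q)\<bar> * F i (snd q) (z - fst q)) * R"
   using F_nonneg[OF r] by (intro mult_left_mono) auto
  then show ?thesis using True F_nonneg[OF r, of i "z - fst q"] by (simp add: k_def abs_mult ac_simps)
 qed (auto simp: k_def)
 have nnk: "(\<integral>\<^sup>+q. (NN z. ennreal (norm (k q z) * g z)) \<partial>?P) \<le>
   ennreal R * (\<integral>\<^sup>+x. ennreal \<bar>b x\<bar> * (NN r. indicator {0<..t} r * (NN z. ennreal (F i r (z - x) * g z))) \<partial>\<nu>)"
  if g[measurable]: "g \<in> borel_measurable borel" and g0: "\<And>x. 0 \<le> g x" for g
 proof -
  have [measurable]: "(\<lambda>q. (NN z. ennreal (F i (snd q) (z - fst q) * g z))) \<in> borel_measurable ?P"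
  proof -
   have f1[measurable]: "(\<lambda>p. fst (fst p)) \<in> borel_measurable (?P \<Otimes>\<^sub>M (lborel :: 'a measure))"
    by (rule measurable_compose[OF measurable_fst fstm])
   show ?thesis by measurable
  qed
  have "(\<integral>\<^sup>+q. (NN z. ennreal (norm (k q z) * g z)) \<partial>?P) \<le>
   (\<integral>\<^sup>+q. ennreal R * (ennreal \<bar>b (fst q)\<bar> * (indicator {0<..t} (snd q) * (NN z. ennreal (F i (snd q) (z - fst q) * g z)))) \<partial>?P)"
  proof (rule nn_integral_mono)
   fix q
   show "(NN z. ennreal (norm (k q z) * g z)) \<le>
    ennreal R * (ennreal \<bar>b (fst q)\<bar> * (indicator {0<..t} (snd q) * (NN z. ennreal (F i (snd q) (z - fst q) * g z))))"
   proof (cases "snd q \<in> {0<..t}")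
    case True
    then have r: "snd q > 0" by auto
    have "(NN z. ennreal (norm (k q z) * g z)) \<le> (NN z. ennreal (R * \<bar>b (fst q)\<bar>) * ennreal (F i (snd q) (z - fst q) * g z))"
    proof (rule nn_integral_mono)
     fix z
     have "norm (k q z) * g z \<le> (R * \<bar>b (fst q)\<bar>) * (F i (snd q) (z - fst q) * g z)"
      using mult_right_mono[OF kn[of q z] g0[of z]] True by (simp add: mult.assoc)
     then show "ennreal (norm (k q z) * g z) \<le> ennreal (R * \<bar>b (fst q)\<bar>) * ennreal (F i (snd q) (z - fst q) * g z)"
      using R_pos F_nonneg[OF r] g0 by (subst ennreal_mult[symmetric]) (auto intro: ennreal_leI)
    qed
    also have "\<dots> = ennreal (R * \<bar>b (fst q)\<bar>) * (NN z. ennreal (F i (snd q) (z - fst q) * g z))"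
     by (rule nn_integral_cmult) measurable
    finally show ?thesis using True R_pos by (simp add: ennreal_mult mult.assoc)
   qed (simp add: k_def)
  qed
  also have "\<dots> = ennreal R * (\<integral>\<^sup>+q. (ennreal \<bar>b (fst q)\<bar> * (indicator {0<..t} (snd q) * (NN z. ennreal (F i (snd q) (z - fst q) * g z)))) \<partial>?P)"
   by (rule nn_integral_cmult) measurable
  also have "(\<integral>\<^sup>+q. (ennreal \<bar>b (fst q)\<bar> * (indicator {0<..t} (snd q) * (NN z. ennreal (F i (snd q) (z - fst q) * g z)))) \<partial>?P)
   = (\<integral>\<^sup>+x. (NN r. ennreal \<bar>b x\<bar> * (indicator {0<..t} r * (NN z. ennreal (F i r (z - x) * g z)))) \<partial>\<nu>)"
   by (subst lborel.nn_integral_fst[symmetric]) (auto intro!: borel_measurable_times_ennreal)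
  also have "\<dots> = (\<integral>\<^sup>+x. ennreal \<bar>b x\<bar> * (NN r. indicator {0<..t} r * (NN z. ennreal (F i r (z - x) * g z))) \<partial>\<nu>)"
   by (intro nn_integral_cong nn_integral_cmult) measurable
  finally show ?thesis .
 qed
 have nb: "(\<integral>\<^sup>+x. ennreal \<bar>b x\<bar> \<partial>\<nu>) = ennreal (LINT x|\<nu>. \<bar>b x\<bar>)" using b by (intro nn_integral_eq_integral) auto
 have b0: "0 \<le> (LINT x|\<nu>. \<bar>b x\<bar>)" by simp
 have nnk2: "(\<integral>\<^sup>+q. (NN z. ennreal (norm (k q z) * g z)) \<partial>?P) \<le> ennreal (R * (LINT x|\<nu>. \<bar>b x\<bar>)) * A"
  if g: "g \<in> borel_measurable borel" and g0: "\<And>x. 0 \<le> g x"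
   and A: "\<And>x. (NN r. indicator {0<..t} r * (NN z. ennreal (F i r (z - x) * g z))) \<le> A" for g A
 proof -
  have "(\<integral>\<^sup>+q. (NN z. ennreal (norm (k q z) * g z)) \<partial>?P) \<le> ennreal R * (\<integral>\<^sup>+x. ennreal \<bar>b x\<bar> * A \<partial>\<nu>)"
   by (rule order_trans[OF nnk[OF g g0]]) (auto intro!: mult_left_mono nn_integral_mono A)
  also have "\<dots> = ennreal R * ((\<integral>\<^sup>+x. ennreal \<bar>b x\<bar> \<partial>\<nu>) * A)" by (subst nn_integral_multc) auto
  finally show ?thesis using R_pos b0 by (simp add: nb ennreal_mult mult.assoc)
 qed
 note t' = less_imp_le[OF t(1)] t(2)
 have L1: "(NN r. indicator {0<..t} r * (NN z. ennreal (F i r (z - x) * 1))) \<le> ennreal t" for x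
 proof -
  have "(NN r. indicator {0<..t} r * (NN z. ennreal (F i r (z - x) * 1))) = (NN r. indicator {0<..t} r)"
   by (intro nn_integral_cong) (auto simp: indicator_def nn_integral_F)
  also have "\<dots> = ennreal t" using t by simp
  finally show ?thesis by simp
 qed
 have "(NN z. ennreal (norm (correction \<nu> b i t z) * 1)) \<le> (\<integral>\<^sup>+q. (NN z. ennreal (norm (k q z) * 1)) \<partial>?P)"
  unfolding corr by (intro kf(2)) auto
 also have "\<dots> \<le> ennreal (R * (LINT x|\<nu>. \<bar>b x\<bar>)) * ennreal t"
  by (intro nnk2 L1) auto
 finally show "(NN z. ennreal (norm (correction \<nu> b i t z))) \<le> ennreal (t * (R * (LINT x|\<nu>. \<bar>b x\<bar>)))"
  using t R_pos b0 by (simp add: ennreal_mult[symmetric] mult.commute)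
 have dual: "(\<integral>\<^sup>+q. (NN z. ennreal (norm (k q z) * g z)) \<partial>?P) \<le>
   ennreal (R * (LINT x|\<nu>. \<bar>b x\<bar>) * modulus t) * (1 + ennreal B * (NN z. ennreal (g z powr p)))"
  if g: "g \<in> borel_measurable borel" "\<And>x. 0 \<le> g x" for g
 proof -
  have "(\<integral>\<^sup>+q. (NN z. ennreal (norm (k q z) * g z)) \<partial>?P) \<le>
   ennreal (R * (LINT x|\<nu>. \<bar>b x\<bar>)) * (ennreal (modulus t) * (1 + ennreal B * (NN z. ennreal (g z powr p))))"
   by (intro nnk2 g kernel_energy_bound t')
  then show ?thesis using R_pos b0 modulus_nonneg[OF t'(1)] by (simp add: ennreal_mult mult.assoc)
 qed
 show "(NN z. ennreal (norm (correction \<nu> b i t z) powr \<alpha>)) < \<infinity>" if p: "p = conj_exp \<alpha>" "\<alpha> > 1"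
 proof (rule powr_integrable_by_duality[OF cm p(2), where C="R * (LINT x|\<nu>. \<bar>b x\<bar>) * modulus t" and D=B])
  show "0 \<le> R * (LINT x|\<nu>. \<bar>b x\<bar>) * modulus t" using R_pos b0 modulus_nonneg[OF t'(1)] by simp
  show "0 \<le> B" by (rule B_nonneg)
  fix g :: "'a => real" assume g: "g \<in> borel_measurable borel" "\<And>x. 0 \<le> g x"
  have "(NN z. ennreal (norm (correction \<nu> b i t z) * g z)) \<le> (\<integral>\<^sup>+q. (NN z. ennreal (norm (k q z) * g z)) \<partial>?P)"
   unfolding corr by (rule kf(2)[OF g])
  also note dual[OF g]
  finally show "(NN z. ennreal (norm (correction \<nu> b i t z) * g z)) \<le>
    ennreal (R * (LINT x|\<nu>. \<bar>b x\<bar>) * modulus t) * (1 + ennreal B * (NN z. ennreal (g z powr conj_exp \<alpha>)))"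
   unfolding p(1) .
 qed
 show "integrable lborel (\<lambda>z. correction \<nu> b i t z \<bullet> G z) \<and>
   integrable \<nu> (\<lambda>x. b x * (LBINT r. indicator {0<..t} r * rate G i x r)) \<and>
   (LBINT z. correction \<nu> b i t z \<bullet> G z) = (LINT x|\<nu>. b x * (LBINT r. indicator {0<..t} r * rate G i x r))"
  if G: "G \<in> borel_measurable borel" "energy G < \<infinity>" for G
 proof -
  have "(\<integral>\<^sup>+q. (NN z. ennreal (norm (k q z) * norm (G z))) \<partial>?P) \<le>
   ennreal (R * (LINT x|\<nu>. \<bar>b x\<bar>) * modulus t) * energy G"
   unfolding energy_def using G by (intro dual) auto
  also have "\<dots> < \<infinity>" using G(2) by (auto simp: ennreal_mult_less_top)
  finally have fin: "(\<integral>\<^sup>+q. (NN z. ennreal (norm (k q z) * norm (G z))) \<partial>?P) < \<infinity>" .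
  note kG = kf(3)[OF G(1) fin]
  have inner: "(LBINT z. k (x, r) z \<bullet> G z) = b x * (indicator {0<..t} r * rate G i x r)" for x r
  proof -
   have "k (x, r) z \<bullet> G z = b x * (indicator {0<..t} r * (F i r (z - x) * (G z \<bullet> (z - x)) / r))" for z
    by (simp add: k_def inner_commute)
   then show ?thesis by (simp add: rate_def)
  qed
  have split: "(\<lambda>(x, r). LINT z|lborel. k (x, r) z \<bullet> G z) = (\<lambda>q. LINT z|lborel. k q z \<bullet> G z)"
   by (rule ext) (simp add: case_prod_beta)
  have ik: "integrable ?P (\<lambda>(x, r). LINT z|lborel. k (x, r) z \<bullet> G z)" unfolding split using kG by blast
  have 1: "(LINT q|?P. LINT z|lborel. k q z \<bullet> G z) = (LINT x|\<nu>. LINT r|lborel. LINT z|lborel. k (x, r) z \<bullet> G z)"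
   using integral_fst[OF ik] unfolding split by (rule sym)
  have 2: "integrable \<nu> (\<lambda>x. LINT r|lborel. LINT z|lborel. k (x, r) z \<bullet> G z)"
   using integrable_fst[OF ik] .
  show ?thesis unfolding corr using kG 1 2 by (simp add: inner)
 qed
qed

definition smoothing :: "'a measure => ('a => 'a) => 'a => real => 'a => 'a" where
 "smoothing M v i t z = (LINT x|M. F i t (z - x) *\<^sub>R v x)"

lemma smoothing:
 assumes M: "finite_measure M" "sets M = sets borel" and v: "integrable M v"
  and vK: "\<And>x. v x \<noteq> 0 ==> x \<in> K \<inter> ball i (\<rho> i)" and i: "i \<in> I" and t: "0 < t" "t \<le> 1"
 shows "smoothing M v i t \<in> borel_measurable borel"
  and "z \<notin> interior K ==> smoothing M v i t z = 0"
  and "norm (smoothing M v i t z) \<le> B / t ^ DIM('a) * (LINT x|M. norm (v x))"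
  and "g \<in> borel_measurable borel ==> (\<And>x. 0 \<le> g x) ==>
   (NN z. ennreal (norm (smoothing M v i t z) * g z)) \<le> (\<integral>\<^sup>+x. ennreal (norm (v x)) * (NN z. ennreal (F i t (z - x) * g z)) \<partial>M)"
  and "G \<in> borel_measurable borel ==> (\<And>x. (NN z. ennreal (F i t (z - x) * norm (G z))) \<le> ennreal A) ==>
   integrable lborel (\<lambda>z. smoothing M v i t z \<bullet> G z) \<and>
   integrable M (\<lambda>x. LINT z|lborel. F i t (z - x) * (v x \<bullet> G z)) \<and>
   (LBINT z. smoothing M v i t z \<bullet> G z) = (LINT x|M. LINT z|lborel. F i t (z - x) * (v x \<bullet> G z))"
proof -
 interpret M: finite_measure M by fact
 have vm[measurable]: "v \<in> borel_measurable M" using v by auto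
 have idm[measurable]: "(\<lambda>x. x) \<in> borel_measurable M" using M(2) by (simp cong: measurable_cong_sets)
 define k where "k x z = F i t (z - x) *\<^sub>R v x" for x z
 have P: "sigma_finite_measure M" by (rule M.sigma_finite_measure_axioms)
 have km: "(\<lambda>(q, z). k q z) \<in> borel_measurable (M \<Otimes>\<^sub>M lborel)"
 proof -
  have [measurable]: "(\<lambda>p. fst p) \<in> borel_measurable (M \<Otimes>\<^sub>M (lborel :: 'a measure))"
   by (rule measurable_compose[OF measurable_fst idm])
  show ?thesis unfolding k_def case_prod_beta by measurable
 qed
 note kf = kernel_field[OF P km]
 have sm: "smoothing M v i t = (\<lambda>z. LINT x|M. k x z)" by (rule ext) (simp add: smoothing_def k_def)
 show "smoothing M v i t \<in> borel_measurable borel" unfolding sm by (rule kf(1))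
 have k0: "k x z = 0" if "z \<notin> interior K" for x z
 proof (rule ccontr)
  assume "k x z \<noteq> 0"
  then have "v x \<noteq> 0" "F i t (z - x) \<noteq> 0" by (auto simp: k_def)
  then have "z \<in> interior K" using vK t by (intro F_interior[OF i, of x t z]) auto
  then show False using that by simp
 qed
 show "z \<notin> interior K ==> smoothing M v i t z = 0" for z unfolding sm by (simp add: k0)
 show "norm (smoothing M v i t z) \<le> B / t ^ DIM('a) * (LINT x|M. norm (v x))" for z
 proof -
  have le: "norm (k x z) \<le> B / t ^ DIM('a) * norm (v x)" for x
  proof -
   have "norm (k x z) = F i t (z - x) * norm (v x)" using F_nonneg[OF t(1), of i "z - x"] by (simp add: k_def)
   also have "\<dots> \<le> B / t ^ DIM('a) * norm (v x)" by (rule mult_right_mono[OF F_le[OF t(1)] norm_ge_zero])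
   finally show ?thesis .
  qed
  have "(\<lambda>x. k x z) \<in> borel_measurable M" unfolding k_def by measurable
  then have "integrable M (\<lambda>x. k x z)"
  proof (rule Bochner_Integration.integrable_bound[OF integrable_mult_right[OF integrable_norm[OF v], of "B / t ^ DIM('a)"]])
   show "AE x in M. norm (k x z) \<le> norm (B / t ^ DIM('a) * norm (v x))"
    using order_trans[OF le abs_ge_self] by (intro AE_I2) (simp only: real_norm_def)
  qed
  then have "norm (LINT x|M. k x z) \<le> (LINT x|M. B / t ^ DIM('a) * norm (v x))"
   using v le by (intro order_trans[OF integral_norm_bound integral_mono]) auto
  then show ?thesis unfolding sm by simp
 qed
 have nk: "(NN z. ennreal (norm (k x z) * g z)) = ennreal (norm (v x)) * (NN z. ennreal (F i t (z - x) * g z))"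
  if g[measurable]: "g \<in> borel_measurable borel" and g0: "\<And>x. 0 \<le> g x" for g x
 proof -
  have "(NN z. ennreal (norm (k x z) * g z)) = (NN z. ennreal (norm (v x)) * ennreal (F i t (z - x) * g z))"
   using F_nonneg[OF t(1)] g0 by (intro nn_integral_cong) (simp add: k_def ennreal_mult ac_simps)
  then show ?thesis by (simp add: nn_integral_cmult)
 qed
 show "(NN z. ennreal (norm (smoothing M v i t z) * g z)) \<le> (\<integral>\<^sup>+x. ennreal (norm (v x)) * (NN z. ennreal (F i t (z - x) * g z)) \<partial>M)"
  if g: "g \<in> borel_measurable borel" "\<And>x. 0 \<le> g x" for g
  using kf(2)[OF g] unfolding sm nk[OF g] .
 show "integrable lborel (\<lambda>z. smoothing M v i t z \<bullet> G z) \<and>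
   integrable M (\<lambda>x. LINT z|lborel. F i t (z - x) * (v x \<bullet> G z)) \<and>
   (LBINT z. smoothing M v i t z \<bullet> G z) = (LINT x|M. LINT z|lborel. F i t (z - x) * (v x \<bullet> G z))"
  if G: "G \<in> borel_measurable borel" and A: "\<And>x. (NN z. ennreal (F i t (z - x) * norm (G z))) \<le> ennreal A" for G A
 proof -
  have "(\<integral>\<^sup>+x. (NN z. ennreal (norm (k x z) * norm (G z))) \<partial>M) = (\<integral>\<^sup>+x. ennreal (norm (v x)) * (NN z. ennreal (F i t (z - x) * norm (G z))) \<partial>M)"
   using G by (intro nn_integral_cong nk) auto
  also have "\<dots> \<le> (\<integral>\<^sup>+x. ennreal (norm (v x)) * ennreal A \<partial>M)" by (intro nn_integral_mono mult_left_mono A) simp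
  also have "\<dots> = (\<integral>\<^sup>+x. ennreal (norm (v x)) \<partial>M) * ennreal A" by (rule nn_integral_multc) measurable
  also have "\<dots> < \<infinity>" using v by (auto simp: ennreal_mult_less_top integrable_iff_bounded)
  finally have fin: "(\<integral>\<^sup>+x. (NN z. ennreal (norm (k x z) * norm (G z))) \<partial>M) < \<infinity>" .
  show ?thesis using kf(3)[OF G fin] unfolding sm by (simp add: k_def)
 qed
qed

end

section \<open>Test functions for the divergence equation\<close>

lemma set_integral_const_prob:
 assumes "prob_space \<mu>" "sets \<mu> = sets borel" "emeasure \<mu> (- K) = 0" "K \<in> sets borel"
 shows "(LINT x:K|\<mu>. (a::real)) = a"
proof -
 interpret prob_space \<mu> by fact
 have "measure \<mu> (- K) = 0" using assms(3) by (simp add: measure_def)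
 moreover have "measure \<mu> (- K) = 1 - measure \<mu> K"
  using prob_compl[of K] assms(2,4) sets_eq_imp_space_eq[OF assms(2)] by (simp add: Compl_eq_Diff_UNIV)
 ultimately show ?thesis using assms by (simp add: set_lebesgue_integral_def)
qed

lemma set_integrable_continuous_finite:
 fixes \<phi> :: "'a::euclidean_space => real"
 assumes "finite_measure \<mu>" "sets \<mu> = sets borel" "compact K" "continuous_on K \<phi>"
 shows "integrable \<mu> (\<lambda>x. indicator K x * \<phi> x)"
proof -
 interpret finite_measure \<mu> by fact
 obtain B where "\<forall>x. norm (indicator K x *\<^sub>R \<phi> x) \<le> B"
  using compact_indicator(2)[OF assms(3,4)] by blast
 then show ?thesis
  using compact_indicator(1)[OF assms(3,4)] assms(2)
  by (intro integrable_const_bound[of _ B]) (auto cong: measurable_cong_sets)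
qed

lemma div_measure_eq_C1:
 fixes K :: "'a::euclidean_space set"
 assumes K: "compact K" and d: "div_measure_eq K q \<mu>p \<mu>m"
  and \<mu>: "prob_space \<mu>p" "sets \<mu>p = sets borel" "emeasure \<mu>p (- K) = 0"
   "prob_space \<mu>m" "sets \<mu>m = sets borel" "emeasure \<mu>m (- K) = 0"
  and \<phi>: "continuous_on K \<phi>" "continuous_on K g" "\<And>x. x \<in> interior K ==> (\<phi> has_derivative (\<lambda>v. g x \<bullet> v)) (at x)"
 shows "- vector_integral K q g = (LINT x:K|\<mu>p. \<phi> x) - (LINT x:K|\<mu>m. \<phi> x)"
proof -
 have KB: "K \<in> sets borel" using K by (rule borel_compact)
 interpret p: prob_space \<mu>p by fact
 interpret m: prob_space \<mu>m by fact
 define a where "a = (LINT x|lebesgue_on K. \<phi> x) / measure lborel K"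
 have eqB: "(LINT x|lebesgue_on K. \<psi> x) = (LBINT x. indicator K x * \<psi> x)" if "continuous_on K \<psi>" for \<psi> :: "'a => real"
 proof -
  have "(LINT x|lebesgue_on K. \<psi> x) = (LINT x|lebesgue_on K. indicator K x *\<^sub>R \<psi> x)"
   by (intro LINT_cong) (auto simp: indicator_def)
  also have "\<dots> = (LBINT x. indicator K x *\<^sub>R (indicator K x *\<^sub>R \<psi> x))"
   using compact_indicator(1)[OF K that] by (intro lebesgue_on_borel[OF KB])
  also have "\<dots> = (LBINT x. indicator K x * \<psi> x)"
   by (intro LINT_cong) (auto simp: indicator_def)
  finally show ?thesis .
 qed
 have il: "integrable lborel (\<lambda>x. indicator K x * \<psi> x)" if "continuous_on K \<psi>" for \<psi> :: "'a => real"
  using borel_integrable_compact[OF K that] by simp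
 have ca: "continuous_on K (\<lambda>x. \<phi> x - a)" using \<phi>(1) by (intro continuous_intros)
 have "(LINT x|lebesgue_on K. \<phi> x - a) = (LBINT x. indicator K x * \<phi> x - indicator K x * a)"
  unfolding eqB[OF ca] by (simp add: right_diff_distrib)
 also have "\<dots> = (LBINT x. indicator K x * \<phi> x) - (LBINT x. indicator K x * a)"
  using il[OF \<phi>(1)] il[of "\<lambda>_. a"] by (intro LINT_diff) auto
 also have "(LBINT x. indicator K x * a) = measure lborel K * a" using KB by simp
 also have "(LBINT x. indicator K x * \<phi> x) - measure lborel K * a = 0"
 \<comment> \<open>For a null set K the division gives a = 0, and the integral is then 0 as
   well.\<close>
 proof (cases "measure lborel K = 0")
  case True
  then have "emeasure lborel K = 0"
   using emeasure_compact_finite[OF K] by (auto simp: measure_def enn2real_eq_0_iff)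
  then have "K \<in> null_sets lborel" using KB by auto
  then have "AE x in lborel. x \<notin> K" by (rule AE_not_in)
  then have "AE x in lborel. indicator K x * \<phi> x = 0" by eventually_elim auto
  then have "(LBINT x. indicator K x * \<phi> x) = 0" by (rule integral_eq_zero_AE)
  then show ?thesis using True by simp
 next
  case False then show ?thesis by (simp add: a_def eqB[OF \<phi>(1)])
 qed
 finally have "(LINT x|lebesgue_on K. \<phi> x - a) = 0" .
 moreover have "((\<lambda>x. \<phi> x - a) has_derivative (\<lambda>v. g x \<bullet> v)) (at x)" if "x \<in> interior K" for x
  using \<phi>(3)[OF that] by (auto intro!: derivative_eq_intros)
 ultimately have "(\<lambda>x. \<phi> x - a, g) \<in> C1_mean0 K" using ca \<phi>(2) by (auto simp: C1_mean0_def)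
 then have "- vector_integral K q g = (LINT x:K|\<mu>p. \<phi> x - a) - (LINT x:K|\<mu>m. \<phi> x - a)"
  using d by (auto simp: div_measure_eq_def)
 moreover have "(LINT x:K|\<mu>. \<phi> x - a) = (LINT x:K|\<mu>. \<phi> x) - a"
  if "prob_space \<mu>" "sets \<mu> = sets borel" "emeasure \<mu> (- K) = 0" for \<mu>
 proof -
  have f: "finite_measure \<mu>" using that(1) by (rule prob_space.finite_measure)
  have "(LINT x:K|\<mu>. \<phi> x - a) = (LINT x:K|\<mu>. \<phi> x) - (LINT x:K|\<mu>. a)"
   using set_integrable_continuous_finite[OF f that(2) K \<phi>(1)] set_integrable_continuous_finite[OF f that(2) K continuous_on_const[of K a]]
   by (intro set_integral_diff) (auto simp: set_integrable_def)
  then show ?thesis using set_integral_const_prob[OF that KB] by simp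
 qed
 ultimately show ?thesis using \<mu> by simp
qed

context cone_setting
begin

text \<open>\<open>\<phi>\<close> itself need not be C1; \<open>u\<close> is the substitute that may
  be inserted into the equation for the limit measure. It is differentiable at boundary points of
  \<open>K\<close> too, since averages and bumps are defined on the whole space.\<close>

lemma average_as_C1:
 assumes \<phi>: "integrable lborel \<phi>" and t: "0 < t"
 defines "u \<equiv> \<lambda>x. \<Sum>i\<in>I. chi i x * average \<phi> i t x"
  and "g \<equiv> \<lambda>x. \<Sum>i\<in>I. chi i x *\<^sub>R average_grad \<phi> i t x + average \<phi> i t x *\<^sub>R chi_grad i x"
 shows "continuous_on K u" "continuous_on K g" "\<And>x. x \<in> K ==> (u has_derivative (\<lambda>v. g x \<bullet> v)) (at x)"
proof -
 show "continuous_on K u" unfolding u_def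
  by (intro continuous_on_sum continuous_on_mult chi_continuous continuous_on_subset[OF average_continuous[OF t \<phi>]]) auto
 show "continuous_on K g" unfolding g_def
  by (intro continuous_on_sum continuous_on_add continuous_on_scaleR chi_continuous chi_grad_continuous
   continuous_on_subset[OF average_continuous[OF t \<phi>]] continuous_on_subset[OF average_grad_continuous[OF t \<phi>]]) auto
 fix x assume x: "x \<in> K"
 have "(u has_derivative (\<lambda>v. \<Sum>i\<in>I. chi i x * (average_grad \<phi> i t x \<bullet> v) + (chi_grad i x \<bullet> v) * average \<phi> i t x)) (at x)"
  unfolding u_def average_grad_def
  by (intro has_derivative_sum has_derivative_mult chi_has_derivative[OF x] average_has_derivative[OF t \<phi>])
 then show "(u has_derivative (\<lambda>v. g x \<bullet> v)) (at x)"
  by (simp add: g_def inner_sum_left inner_add_left mult.commute)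
qed

text \<open>Each piece of the measure is smoothed in its own direction. The first correction undoes
  the error from differentiating the partition of unity. The other two undo the averaging under
  \<open>\<mu>p\<close> and \<open>\<mu>m\<close>, which enter the divergence with opposite
  signs.\<close>

definition recovery :: "'a measure => ('a => 'a) => 'a measure => 'a measure => real => 'a => 'a" where
 "recovery M f \<mu>p \<mu>m t z = (\<Sum>i\<in>I. smoothing M (\<lambda>x. (indicator K x * chi i x) *\<^sub>R f x) i t z
   + correction M (\<lambda>x. indicator K x * (chi_grad i x \<bullet> f x)) i t z
   + correction \<mu>p (\<lambda>x. indicator K x * chi i x) i t z - correction \<mu>m (\<lambda>x. indicator K x * chi i x) i t z)"

end

section \<open>The divergence of the recovery field\<close>

locale recovery_setting = cone_setting +
 fixes M :: "'a measure" and q :: "'a set => 'a" and f :: "'a => 'a" and \<mu>p \<mu>m :: "'a measure" and \<alpha> :: real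
 assumes M: "finite_measure M" and q: "represents q M f"
  and \<mu>p: "prob_space \<mu>p" "sets \<mu>p = sets borel" "emeasure \<mu>p (- K) = 0"
  and \<mu>m: "prob_space \<mu>m" "sets \<mu>m = sets borel" "emeasure \<mu>m (- K) = 0"
  and div: "div_measure_eq K q \<mu>p \<mu>m"
  and p: "p = conj_exp \<alpha>" "\<alpha> > 1"
begin

abbreviation "rec \<equiv> recovery M f \<mu>p \<mu>m"
abbreviation "sv i x \<equiv> (indicator K x * chi i x) *\<^sub>R f x"
abbreviation "cq i x \<equiv> indicator K x * (chi_grad i x \<bullet> f x)"
abbreviation "cm i x \<equiv> indicator K x * chi i x"

lemma Ms: "sets M = sets borel" and fM: "integrable M f" using q by (auto simp: represents_def)

lemma fin_p: "finite_measure \<mu>p" and fin_m: "finite_measure \<mu>m"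
 using \<mu>p \<mu>m by (auto intro: prob_space.finite_measure)

lemma chiK_measurable: "sets N = sets borel ==> (\<lambda>x. indicator K x * chi i x) \<in> borel_measurable N"
 using compact_indicator(1)[OF compact_K chi_continuous] by (simp cong: measurable_cong_sets)

lemma sv_integrable: "i \<in> I ==> integrable M (sv i)"
proof (rule Bochner_Integration.integrable_bound[OF integrable_norm[OF fM]])
 show "(\<lambda>x. sv i x) \<in> borel_measurable M" using chiK_measurable[OF Ms] fM by auto
 show "AE x in M. norm (sv i x) \<le> norm (norm (f x))" if "i \<in> I"
  using chi_nonneg chi_le_1 that by (intro AE_I2) (auto simp: indicator_def mult_left_le_one_le)
qed

lemma cq_integrable: "integrable M (cq i)"
 by (rule vector_integral_represents(2)[OF q compact_K chi_grad_continuous])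

lemma cm_integrable: "finite_measure \<mu> ==> sets \<mu> = sets borel ==> integrable \<mu> (cm i)"
 using set_integrable_continuous_finite[OF _ _ compact_K chi_continuous] .

lemma sv_K: "i \<in> I ==> sv i x \<noteq> 0 ==> x \<in> K \<inter> ball i (\<rho> i)"
 using chi_support[of i x] by (auto simp: indicator_def split: if_splits)

lemma cq_K: "i \<in> I ==> cq i x \<noteq> 0 ==> x \<in> K \<inter> ball i (\<rho> i)"
 using chi_grad_support[of i x] by (cases "chi_grad i x = 0") (auto simp: indicator_def split: if_splits)

lemma cm_K: "i \<in> I ==> cm i x \<noteq> 0 ==> x \<in> K \<inter> ball i (\<rho> i)"
 using chi_support[of i x] by (auto simp: indicator_def split: if_splits)

lemma parts_measurable:
 assumes "i \<in> I" "0 < t" "t \<le> 1"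
 shows "smoothing M (sv i) i t \<in> borel_measurable borel" "correction M (cq i) i t \<in> borel_measurable borel"
  "correction \<mu>p (cm i) i t \<in> borel_measurable borel" "correction \<mu>m (cm i) i t \<in> borel_measurable borel"
 using assms
 by (auto intro!: smoothing(1)[OF M Ms sv_integrable sv_K] correction(1)[OF M Ms cq_integrable cq_K]
  correction(1)[OF fin_p \<mu>p(2) cm_integrable[OF fin_p \<mu>p(2)] cm_K]
  correction(1)[OF fin_m \<mu>m(2) cm_integrable[OF fin_m \<mu>m(2)] cm_K])

lemma parts_outside:
 assumes i: "i \<in> I" and t: "0 < t" "t \<le> 1" and z: "z \<notin> interior K"
 shows "smoothing M (sv i) i t z = 0" "correction M (cq i) i t z = 0"
  "correction \<mu>p (cm i) i t z = 0" "correction \<mu>m (cm i) i t z = 0"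
 using smoothing(2)[OF M Ms sv_integrable[OF i] sv_K[OF i] i t z] correction(2)[OF M Ms cq_integrable cq_K[OF i] i t z]
  correction(2)[OF fin_p \<mu>p(2) cm_integrable[OF fin_p \<mu>p(2)] cm_K[OF i] i t z]
  correction(2)[OF fin_m \<mu>m(2) cm_integrable[OF fin_m \<mu>m(2)] cm_K[OF i] i t z] by auto

lemma rec_measurable: "0 < t ==> t \<le> 1 ==> rec t \<in> borel_measurable borel"
 unfolding recovery_def[abs_def]
 by (intro borel_measurable_sum borel_measurable_add borel_measurable_diff parts_measurable)

lemma rec_outside: "0 < t ==> t \<le> 1 ==> z \<notin> interior K ==> rec t z = 0"
 unfolding recovery_def by (simp add: parts_outside cong: sum.cong)

lemma powr_add_le:
 fixes a b :: real
 assumes "a \<ge> 0" "b \<ge> 0" "\<alpha> \<ge> 0"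
 shows "(a + b) powr \<alpha> \<le> 2 powr \<alpha> * (a powr \<alpha> + b powr \<alpha>)"
proof -
 have "(a + b) powr \<alpha> \<le> (2 * max a b) powr \<alpha>" using assms by (intro powr_mono2) auto
 also have "\<dots> = 2 powr \<alpha> * (max a b) powr \<alpha>" using assms by (simp add: powr_mult)
 also have "(max a b) powr \<alpha> \<le> a powr \<alpha> + b powr \<alpha>" by (auto simp: max_def)
 finally show ?thesis by simp
qed

definition finite_power :: "('a => 'a) => bool" where
 "finite_power h \<longleftrightarrow> h \<in> borel_measurable borel \<and> (NN z. ennreal (norm (h z) powr \<alpha>)) < \<infinity>"

lemma finite_power_add:
 assumes "finite_power h" "finite_power k" shows "finite_power (\<lambda>z. h z + k z)"
proof -
 have m[measurable]: "h \<in> borel_measurable borel" "k \<in> borel_measurable borel" using assms by (auto simp: finite_power_def)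
 have "(NN z. ennreal (norm (h z + k z) powr \<alpha>)) \<le>
  (NN z. ennreal (2 powr \<alpha>) * (ennreal (norm (h z) powr \<alpha>) + ennreal (norm (k z) powr \<alpha>)))"
 proof (rule nn_integral_mono)
  fix z
  have "norm (h z + k z) powr \<alpha> \<le> (norm (h z) + norm (k z)) powr \<alpha>"
   using p by (intro powr_mono2 norm_triangle_ineq) auto
  also have "\<dots> \<le> 2 powr \<alpha> * (norm (h z) powr \<alpha> + norm (k z) powr \<alpha>)" using p by (intro powr_add_le) auto
  finally have "ennreal (norm (h z + k z) powr \<alpha>) \<le> ennreal (2 powr \<alpha> * (norm (h z) powr \<alpha> + norm (k z) powr \<alpha>))"
   by (rule ennreal_leI)
  then show "ennreal (norm (h z + k z) powr \<alpha>) \<le> ennreal (2 powr \<alpha>) * (ennreal (norm (h z) powr \<alpha>) + ennreal (norm (k z) powr \<alpha>))"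
   by (simp add: ennreal_mult ennreal_plus)
 qed
 also have "\<dots> = ennreal (2 powr \<alpha>) * ((NN z. ennreal (norm (h z) powr \<alpha>)) + (NN z. ennreal (norm (k z) powr \<alpha>)))"
  by (simp add: nn_integral_cmult nn_integral_add)
 also have "\<dots> < \<infinity>" using assms by (auto simp: finite_power_def ennreal_mult_less_top)
 finally show ?thesis by (simp add: finite_power_def)
qed

lemma finite_power_uminus: "finite_power h ==> finite_power (\<lambda>z. - h z)"
 by (auto simp: finite_power_def)

lemma finite_power_sum: "finite J ==> (\<And>i. i \<in> J ==> finite_power (h i)) ==> finite_power (\<lambda>z. \<Sum>i\<in>J. h i z)"
 by (induction J rule: finite_induct) (auto intro!: finite_power_add simp: finite_power_def[of "\<lambda>_. 0"])

lemma smoothing_finite_power: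
 assumes i: "i \<in> I" and t: "0 < t" "t \<le> 1"
 shows "finite_power (smoothing M (sv i) i t)"
proof -
 let ?C = "B / t ^ DIM('a) * (LINT x|M. norm (sv i x))"
 have "(NN z. ennreal (norm (smoothing M (sv i) i t z) powr \<alpha>)) \<le> (NN z. ennreal (?C powr \<alpha>) * indicator K z)"
 proof (rule nn_integral_mono)
  fix z
  show "ennreal (norm (smoothing M (sv i) i t z) powr \<alpha>) \<le> ennreal (?C powr \<alpha>) * indicator K z"
  proof (cases "z \<in> interior K")
   case True
   then have "z \<in> K" using interior_subset by blast
   then show ?thesis using smoothing(3)[OF M Ms sv_integrable[OF i] sv_K[OF i] i t, of z] p by (auto intro!: ennreal_leI powr_mono2)
  next
   case False
   then show ?thesis using parts_outside(1)[OF i t False] p by simp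
  qed
 qed
 also have "\<dots> < \<infinity>" using emeasure_compact_finite[OF compact_K] by (simp add: nn_integral_cmult_indicator ennreal_mult_less_top)
 finally show ?thesis using parts_measurable(1)[OF i t] by (simp add: finite_power_def)
qed

lemma corrections_finite_power:
 assumes i: "i \<in> I" and t: "0 < t" "t \<le> 1"
 shows "finite_power (correction M (cq i) i t)" "finite_power (correction \<mu>p (cm i) i t)"
  "finite_power (correction \<mu>m (cm i) i t)"
 unfolding finite_power_def
 using parts_measurable[OF i t] correction(4)[OF M Ms cq_integrable cq_K[OF i] i t p]
  correction(4)[OF fin_p \<mu>p(2) cm_integrable[OF fin_p \<mu>p(2)] cm_K[OF i] i t p]
  correction(4)[OF fin_m \<mu>m(2) cm_integrable[OF fin_m \<mu>m(2)] cm_K[OF i] i t p] by auto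

lemma rec_finite_power: "0 < t ==> t \<le> 1 ==> finite_power (rec t)"
 unfolding recovery_def[abs_def] diff_conv_add_uminus
 by (intro finite_power_sum[OF finite_I] finite_power_add finite_power_uminus smoothing_finite_power
  corrections_finite_power)

lemma rec_integrable:
 assumes t: "0 < t" "t \<le> 1" shows "integrable lborel (rec t)"
proof -
 have m: "rec t \<in> borel_measurable borel" and f: "(NN z. ennreal (norm (rec t z) powr \<alpha>)) < \<infinity>"
  using rec_finite_power[OF t] by (auto simp: finite_power_def)
 have "(NN z. ennreal (norm (rec t z))) \<le> (NN z. indicator K z + ennreal (norm (rec t z) powr \<alpha>))"
 proof (rule nn_integral_mono)
  fix z
  consider "z \<notin> K" | "z \<in> K" "norm (rec t z) \<le> 1" | "norm (rec t z) > 1" by linarith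
  then show "ennreal (norm (rec t z)) \<le> indicator K z + ennreal (norm (rec t z) powr \<alpha>)"
  proof cases
   case 1
   then have "rec t z = 0" using rec_outside[OF t] interior_subset by blast
   then show ?thesis by simp
  next
   case 2
   then have "ennreal (norm (rec t z)) \<le> 1" by (metis ennreal_1 ennreal_leI)
   then show ?thesis using 2 by (simp add: add_increasing2)
  next
   case 3
   then have "norm (rec t z) powr 1 \<le> norm (rec t z) powr \<alpha>" using p by (intro powr_mono) auto
   then show ?thesis using 3 by (simp add: add_increasing ennreal_leI)
  qed
 qed
 also have "\<dots> < \<infinity>"
  using f m emeasure_compact_finite[OF compact_K] by (simp add: nn_integral_add)
 finally show ?thesis using m by (intro integrableI_bounded) auto
qed

text \<open>By Fubini, smoothing the measure is the transpose of averaging the gradient, and the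
  averaged weak gradient is the classical gradient of the average wherever the piece has
  mass.\<close>

lemma smoothing_gradient:
 assumes w: "weak_grad (interior K) \<phi> G" and G: "G \<in> borel_measurable borel" and i: "i \<in> I" and t: "0 < t" "t \<le> 1"
 shows "integrable lborel (\<lambda>z. smoothing M (sv i) i t z \<bullet> G z)"
  and "integrable M (\<lambda>x. sv i x \<bullet> average_grad \<phi> i t x)"
  and "(LBINT z. smoothing M (sv i) i t z \<bullet> G z) = (LINT x|M. sv i x \<bullet> average_grad \<phi> i t x)"
proof -
 have Gi: "integrable lborel G" using w by (simp add: weak_grad_def)
 let ?A = "B / t ^ DIM('a) * (LBINT z. norm (G z))"
 have A: "(NN z. ennreal (F i t (z - x) * norm (G z))) \<le> ennreal ?A" for x
 proof -
  have "(NN z. ennreal (F i t (z - x) * norm (G z))) \<le> (NN z. ennreal (B / t ^ DIM('a) * norm (G z)))"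
   using F_le[OF t(1)] by (intro nn_integral_mono ennreal_leI mult_right_mono) auto
  also have "\<dots> = ennreal (LBINT z. B / t ^ DIM('a) * norm (G z))"
   using Gi B_nonneg t by (intro nn_integral_eq_integral) auto
  finally show ?thesis by simp
 qed
 have eq: "(LBINT z. F i t (z - x) * (sv i x \<bullet> G z)) = sv i x \<bullet> average_grad \<phi> i t x" for x
 proof (cases "sv i x = 0")
  case False
  have x: "x \<in> K" "x \<in> ball i (\<rho> i)" using sv_K[OF i False] by blast+
  have ib: "integrable lborel (\<lambda>z. F i t (z - x) * (G z \<bullet> b))" for b
   using Gi by (intro integrable_F_mult[OF t(1)]) auto
  have e: "sv i x \<bullet> y = (\<Sum>b\<in>Basis. (sv i x \<bullet> b) * (y \<bullet> b))" for y by (rule euclidean_inner)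
  have "F i t (z - x) * (sv i x \<bullet> G z) = (\<Sum>b\<in>Basis. (sv i x \<bullet> b) * (F i t (z - x) * (G z \<bullet> b)))" for z
  proof -
   have "F i t (z - x) * (sv i x \<bullet> G z) = F i t (z - x) * (\<Sum>b\<in>Basis. (sv i x \<bullet> b) * (G z \<bullet> b))"
    by (rule arg_cong[OF e])
   also have "\<dots> = (\<Sum>b\<in>Basis. (sv i x \<bullet> b) * (F i t (z - x) * (G z \<bullet> b)))"
    unfolding sum_distrib_left by (intro sum.cong refl mult.left_commute)
   finally show ?thesis .
  qed
  then have "(LBINT z. F i t (z - x) * (sv i x \<bullet> G z)) = (\<Sum>b\<in>Basis. (sv i x \<bullet> b) * (LBINT z. F i t (z - x) * (G z \<bullet> b)))"
   using ib by (simp add: Bochner_Integration.integral_sum)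
  also have "\<dots> = (\<Sum>b\<in>Basis. (sv i x \<bullet> b) * (average_grad \<phi> i t x \<bullet> b))"
   by (intro sum.cong refl) (simp add: average_grad_eq[OF w i x t])
  also have "\<dots> = sv i x \<bullet> average_grad \<phi> i t x" by (rule e[symmetric])
  finally show ?thesis .
 next
  case True show ?thesis unfolding True by simp
 qed
 note s = smoothing(5)[OF M Ms sv_integrable[OF i] sv_K[OF i] i t G A, unfolded eq]
 show "integrable lborel (\<lambda>z. smoothing M (sv i) i t z \<bullet> G z)"
  "integrable M (\<lambda>x. sv i x \<bullet> average_grad \<phi> i t x)"
  "(LBINT z. smoothing M (sv i) i t z \<bullet> G z) = (LINT x|M. sv i x \<bullet> average_grad \<phi> i t x)"
  using s by blast+
qed

lemma correction_gradient:
 assumes w: "weak_grad (interior K) \<phi> G" and G: "G \<in> borel_measurable borel" "energy G < \<infinity>"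
  and \<psi>: "continuous_on K \<psi>" "AE x in lborel. x \<in> K \<longrightarrow> \<psi> x = \<phi> x"
  and \<nu>: "finite_measure \<nu>" "sets \<nu> = sets borel" and b: "integrable \<nu> b"
  and bK: "\<And>x. b x \<noteq> 0 ==> x \<in> K \<inter> ball i (\<rho> i)" and i: "i \<in> I" and t: "0 < t" "t \<le> 1"
 shows "integrable lborel (\<lambda>z. correction \<nu> b i t z \<bullet> G z)"
  and "integrable \<nu> (\<lambda>x. b x * (average \<phi> i t x - \<psi> x))"
  and "(LBINT z. correction \<nu> b i t z \<bullet> G z) = (LINT x|\<nu>. b x * (average \<phi> i t x - \<psi> x))"
proof -
 have eq: "b x * (LBINT r. indicator {0<..t} r * rate G i x r) = b x * (average \<phi> i t x - \<psi> x)" for x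
 proof (cases "b x = 0")
  case False
  have x: "x \<in> K" "x \<in> ball i (\<rho> i)" using bK[OF False] by blast+
  show ?thesis using average_identity[OF w G \<psi> i x t] by simp
 qed simp
 note c = correction(5)[OF \<nu> b bK i t G, unfolded eq]
 show "integrable lborel (\<lambda>z. correction \<nu> b i t z \<bullet> G z)"
  "integrable \<nu> (\<lambda>x. b x * (average \<phi> i t x - \<psi> x))"
  "(LBINT z. correction \<nu> b i t z \<bullet> G z) = (LINT x|\<nu>. b x * (average \<phi> i t x - \<psi> x))"
  using c by blast+
qed

text \<open>Smoothed pieces and first corrections together give the pairing of \<open>q\<close> with
  the gradient of u. The equation for \<open>q\<close> evaluates it as a difference of integrals of
  u, and the remaining corrections exchange u for \<open>\<psi>\<close>.\<close>

theorem recovery_divergence: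
 assumes w: "weak_grad (interior K) \<phi> G" and G: "G \<in> borel_measurable borel" "energy G < \<infinity>"
  and \<psi>: "continuous_on K \<psi>" "AE x in lborel. x \<in> K \<longrightarrow> \<psi> x = \<phi> x" and t: "0 < t" "t \<le> 1"
 shows "- (LBINT z. rec t z \<bullet> G z) = (LINT x:K|\<mu>p. \<psi> x) - (LINT x:K|\<mu>m. \<psi> x)"
proof -
 have \<phi>: "integrable lborel \<phi>" using w by (simp add: weak_grad_def)
 define u where "u x = (\<Sum>i\<in>I. chi i x * average \<phi> i t x)" for x
 define g where "g x = (\<Sum>i\<in>I. chi i x *\<^sub>R average_grad \<phi> i t x + average \<phi> i t x *\<^sub>R chi_grad i x)" for x
 note C1 = average_as_C1[OF \<phi> t(1), folded u_def[abs_def] g_def[abs_def], folded g_def]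
 note S = smoothing_gradient[OF w G(1) _ t]
 note Cq = correction_gradient[OF w G \<psi> M Ms cq_integrable cq_K _ t]
 note Cp = correction_gradient[OF w G \<psi> fin_p \<mu>p(2) cm_integrable[OF fin_p \<mu>p(2)] cm_K _ t]
 note Cm = correction_gradient[OF w G \<psi> fin_m \<mu>m(2) cm_integrable[OF fin_m \<mu>m(2)] cm_K _ t]
 have u\<psi>: "(\<Sum>i\<in>I. cm i x * (average \<phi> i t x - \<psi> x)) = indicator K x * u x - indicator K x * \<psi> x" for x
 proof (cases "x \<in> K")
  case True
  have "(\<Sum>i\<in>I. chi i x * \<psi> x) = \<psi> x" unfolding sum_distrib_right[symmetric] using sum_chi[OF True] by simp
  then show ?thesis using True by (simp add: u_def right_diff_distrib sum_subtractf)
 qed simp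
 have Ik: "integrable \<mu> (\<lambda>x. indicator K x * \<psi>' x)" if "finite_measure \<mu>" "sets \<mu> = sets borel" "continuous_on K \<psi>'" for \<mu> :: "'a measure" and \<psi>' :: "'a => real"
  using set_integrable_continuous_finite[OF that(1,2) compact_K that(3)] .
 have sum\<mu>: "(\<Sum>i\<in>I. LINT z|lborel. correction \<mu> (cm i) i t z \<bullet> G z) = (LINT x:K|\<mu>. u x) - (LINT x:K|\<mu>. \<psi> x)"
  if \<mu>: "finite_measure \<mu>" "sets \<mu> = sets borel" for \<mu>
 proof -
  note C = correction_gradient[OF w G \<psi> \<mu> cm_integrable[OF \<mu>] cm_K _ t]
  have "(\<Sum>i\<in>I. LINT z|lborel. correction \<mu> (cm i) i t z \<bullet> G z) = (\<Sum>i\<in>I. LINT x|\<mu>. cm i x * (average \<phi> i t x - \<psi> x))"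
   by (intro sum.cong refl C(3))
  also have "\<dots> = (LINT x|\<mu>. (\<Sum>i\<in>I. cm i x * (average \<phi> i t x - \<psi> x)))"
   by (intro Bochner_Integration.integral_sum[symmetric] C(2))
  also have "\<dots> = (LINT x|\<mu>. indicator K x * u x) - (LINT x|\<mu>. indicator K x * \<psi> x)"
   unfolding u\<psi> using Ik[OF \<mu> C1(1)] Ik[OF \<mu> \<psi>(1)] by (rule LINT_diff)
  finally show ?thesis by (simp add: set_lebesgue_integral_def)
 qed
 \<comment> \<open>The terms with \<psi> carry the sum of the \<nabla>\<chi>_i as a factor and
   disappear; the rest is the gradient of u.\<close>
 have gf: "(\<Sum>i\<in>I. sv i x \<bullet> average_grad \<phi> i t x + cq i x * (average \<phi> i t x - \<psi> x)) = indicator K x * (g x \<bullet> f x)" for x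
 proof (cases "x \<in> K")
  case True
  have "(\<Sum>i\<in>I. (chi_grad i x \<bullet> f x) * \<psi> x) = ((\<Sum>i\<in>I. chi_grad i x) \<bullet> f x) * \<psi> x"
   by (simp add: sum_distrib_right inner_sum_left)
  then have "(\<Sum>i\<in>I. (chi_grad i x \<bullet> f x) * \<psi> x) = 0" using sum_chi_grad[OF True] by simp
  then show ?thesis using True
   by (simp add: g_def inner_sum_left inner_add_left right_diff_distrib sum_subtractf sum.distrib inner_commute[of "f x"] ac_simps)
 qed simp
 have "(\<Sum>i\<in>I. (LBINT z. smoothing M (sv i) i t z \<bullet> G z) + (LBINT z. correction M (cq i) i t z \<bullet> G z))
   = (\<Sum>i\<in>I. LINT x|M. (sv i x \<bullet> average_grad \<phi> i t x + cq i x * (average \<phi> i t x - \<psi> x)))"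
 proof (intro sum.cong refl)
  fix i assume i: "i \<in> I"
  note Si = smoothing_gradient[OF w G(1) i t]
  note Ci = correction_gradient[OF w G \<psi> M Ms cq_integrable cq_K[OF i] i t]
  show "(LBINT z. smoothing M (sv i) i t z \<bullet> G z) + (LBINT z. correction M (cq i) i t z \<bullet> G z) =
   (LINT x|M. (sv i x \<bullet> average_grad \<phi> i t x + cq i x * (average \<phi> i t x - \<psi> x)))"
  proof -
   have c: "(LBINT z. correction M (cq i) i t z \<bullet> G z) = (LINT x|M. cq i x * (average \<phi> i t x - \<psi> x))"
    by (rule Ci(3))
   show ?thesis unfolding Si(3) c by (rule Bochner_Integration.integral_add[OF Si(2) Ci(2), symmetric])
  qed
 qed
 also have "\<dots> = (LINT x|M. (\<Sum>i\<in>I. sv i x \<bullet> average_grad \<phi> i t x + cq i x * (average \<phi> i t x - \<psi> x)))"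
  by (intro Bochner_Integration.integral_sum[symmetric] Bochner_Integration.integrable_add S(2) Cq(2))
 also have "\<dots> = vector_integral K q g"
  unfolding gf by (rule vector_integral_represents(1)[OF q compact_K C1(2), symmetric])
 finally have main: "(\<Sum>i\<in>I. (LBINT z. smoothing M (sv i) i t z \<bullet> G z) + (LBINT z. correction M (cq i) i t z \<bullet> G z))
   = vector_integral K q g" .
 have "(LBINT z. rec t z \<bullet> G z) = (LBINT z. (\<Sum>i\<in>I. smoothing M (sv i) i t z \<bullet> G z + correction M (cq i) i t z \<bullet> G z
   + correction \<mu>p (cm i) i t z \<bullet> G z - correction \<mu>m (cm i) i t z \<bullet> G z))"
  by (simp add: recovery_def inner_sum_left inner_add_left inner_diff_left)
 also have "\<dots> = (\<Sum>i\<in>I. LINT z|lborel. smoothing M (sv i) i t z \<bullet> G z + correction M (cq i) i t z \<bullet> G z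
   + correction \<mu>p (cm i) i t z \<bullet> G z - correction \<mu>m (cm i) i t z \<bullet> G z)"
  by (intro Bochner_Integration.integral_sum Bochner_Integration.integrable_add Bochner_Integration.integrable_diff S(1) Cq(1) Cp(1) Cm(1))
 also have "\<dots> = (\<Sum>i\<in>I. (LBINT z. smoothing M (sv i) i t z \<bullet> G z) + (LBINT z. correction M (cq i) i t z \<bullet> G z)
   + (LBINT z. correction \<mu>p (cm i) i t z \<bullet> G z) - (LBINT z. correction \<mu>m (cm i) i t z \<bullet> G z))"
 proof (intro sum.cong refl)
  fix i assume i: "i \<in> I"
  have "integrable lborel (\<lambda>z. smoothing M (sv i) i t z \<bullet> G z)" by (rule S(1)[OF i])
  moreover have "integrable lborel (\<lambda>z. correction M (cq i) i t z \<bullet> G z)"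
   by (rule correction_gradient(1)[OF w G \<psi> M Ms cq_integrable cq_K[OF i] i t])
  moreover have "integrable lborel (\<lambda>z. correction \<mu>p (cm i) i t z \<bullet> G z)"
   by (rule correction_gradient(1)[OF w G \<psi> fin_p \<mu>p(2) cm_integrable[OF fin_p \<mu>p(2)] cm_K[OF i] i t])
  moreover have "integrable lborel (\<lambda>z. correction \<mu>m (cm i) i t z \<bullet> G z)"
   by (rule correction_gradient(1)[OF w G \<psi> fin_m \<mu>m(2) cm_integrable[OF fin_m \<mu>m(2)] cm_K[OF i] i t])
  ultimately show "(LBINT z. smoothing M (sv i) i t z \<bullet> G z + correction M (cq i) i t z \<bullet> G z
   + correction \<mu>p (cm i) i t z \<bullet> G z - correction \<mu>m (cm i) i t z \<bullet> G z)
   = (LBINT z. smoothing M (sv i) i t z \<bullet> G z) + (LBINT z. correction M (cq i) i t z \<bullet> G z)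
   + (LBINT z. correction \<mu>p (cm i) i t z \<bullet> G z) - (LBINT z. correction \<mu>m (cm i) i t z \<bullet> G z)"
   by (simp del: inner_commute)
 qed
 also have "\<dots> = vector_integral K q g + ((LINT x:K|\<mu>p. u x) - (LINT x:K|\<mu>p. \<psi> x)) - ((LINT x:K|\<mu>m. u x) - (LINT x:K|\<mu>m. \<psi> x))"
  unfolding sum_subtractf sum.distrib[of _ "\<lambda>i. LINT z|lborel. correction \<mu>p (cm i) i t z \<bullet> G z"]
  using main sum\<mu>[OF fin_p \<mu>p(2)] sum\<mu>[OF fin_m \<mu>m(2)] by simp
 finally have "(LBINT z. rec t z \<bullet> G z) = vector_integral K q g + ((LINT x:K|\<mu>p. u x) - (LINT x:K|\<mu>p. \<psi> x))
  - ((LINT x:K|\<mu>m. u x) - (LINT x:K|\<mu>m. \<psi> x))" .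
 moreover have "- vector_integral K q g = (LINT x:K|\<mu>p. u x) - (LINT x:K|\<mu>m. u x)"
 proof (rule div_measure_eq_C1[OF compact_K div \<mu>p \<mu>m C1(1,2)])
  fix x assume "x \<in> interior K"
  then have "x \<in> K" using interior_subset by blast
  then show "(u has_derivative (\<lambda>v. g x \<bullet> v)) (at x)" by (rule C1(3))
 qed
 ultimately show ?thesis by simp
qed

section \<open>Energy and weak-* limit of the recovery field\<close>

definition corr_const :: real where
 "corr_const = (\<Sum>i\<in>I. R * (LINT x|M. \<bar>cq i x\<bar>) + R * (LINT x|\<mu>p. \<bar>cm i x\<bar>) + R * (LINT x|\<mu>m. \<bar>cm i x\<bar>))"

lemma corr_const_nonneg: "0 \<le> corr_const"
 unfolding corr_const_def using R_pos by (intro sum_nonneg add_nonneg_nonneg mult_nonneg_nonneg) auto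

definition corr_norm :: "real => 'a => real" where
 "corr_norm t z = (\<Sum>i\<in>I. norm (correction M (cq i) i t z) + norm (correction \<mu>p (cm i) i t z) + norm (correction \<mu>m (cm i) i t z))"

text \<open>Because the corrections have L1 norm of order t, only the smoothed pieces matter in the
  two limits below.\<close>

lemma corr_norm_small:
 assumes t: "0 < t" "t \<le> 1"
 shows "corr_norm t \<in> borel_measurable borel" "(NN z. ennreal (corr_norm t z)) \<le> ennreal (t * corr_const)"
proof -
 note pm = parts_measurable[OF _ t]
 show m: "corr_norm t \<in> borel_measurable borel"
  unfolding corr_norm_def[abs_def] using pm by (auto intro!: borel_measurable_sum borel_measurable_add)
 have "(NN z. ennreal (corr_norm t z)) = (NN z. (\<Sum>i\<in>I. ennreal (norm (correction M (cq i) i t z))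
   + ennreal (norm (correction \<mu>p (cm i) i t z)) + ennreal (norm (correction \<mu>m (cm i) i t z))))"
  by (intro nn_integral_cong) (simp add: corr_norm_def sum_nonneg flip: sum_ennreal ennreal_plus)
 also have "\<dots> = (\<Sum>i\<in>I. (NN z. ennreal (norm (correction M (cq i) i t z)))
   + (NN z. ennreal (norm (correction \<mu>p (cm i) i t z))) + (NN z. ennreal (norm (correction \<mu>m (cm i) i t z))))"
  using pm by (subst nn_integral_sum) (auto intro!: sum.cong simp: nn_integral_add)
 also have "\<dots> \<le> (\<Sum>i\<in>I. ennreal (t * (R * (LINT x|M. \<bar>cq i x\<bar>))) + ennreal (t * (R * (LINT x|\<mu>p. \<bar>cm i x\<bar>))) + ennreal (t * (R * (LINT x|\<mu>m. \<bar>cm i x\<bar>))))"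
  by (intro sum_mono add_mono correction(3)[OF M Ms cq_integrable cq_K _ t]
   correction(3)[OF fin_p \<mu>p(2) cm_integrable[OF fin_p \<mu>p(2)] cm_K _ t]
   correction(3)[OF fin_m \<mu>m(2) cm_integrable[OF fin_m \<mu>m(2)] cm_K _ t])
 also have "\<dots> = (\<Sum>i\<in>I. ennreal (t * (R * (LINT x|M. \<bar>cq i x\<bar>)) + t * (R * (LINT x|\<mu>p. \<bar>cm i x\<bar>)) + t * (R * (LINT x|\<mu>m. \<bar>cm i x\<bar>))))"
  using t R_pos by (intro sum.cong refl) (simp add: ennreal_plus)
 also have "\<dots> = ennreal (\<Sum>i\<in>I. t * (R * (LINT x|M. \<bar>cq i x\<bar>)) + t * (R * (LINT x|\<mu>p. \<bar>cm i x\<bar>)) + t * (R * (LINT x|\<mu>m. \<bar>cm i x\<bar>)))"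
  using t R_pos by (intro sum_ennreal) auto
 finally show "(NN z. ennreal (corr_norm t z)) \<le> ennreal (t * corr_const)"
  by (simp add: corr_const_def sum_distrib_left distrib_left)
qed

lemma rec_norm_le: "norm (rec t z) \<le> (\<Sum>i\<in>I. norm (smoothing M (sv i) i t z)) + corr_norm t z"
proof -
 have "norm (rec t z) \<le> (\<Sum>i\<in>I. norm (smoothing M (sv i) i t z + correction M (cq i) i t z
   + correction \<mu>p (cm i) i t z - correction \<mu>m (cm i) i t z))"
  unfolding recovery_def by (rule norm_sum)
 also have "\<dots> \<le> (\<Sum>i\<in>I. norm (smoothing M (sv i) i t z) + (norm (correction M (cq i) i t z)
   + norm (correction \<mu>p (cm i) i t z) + norm (correction \<mu>m (cm i) i t z)))"
 proof (rule sum_mono)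
  fix i
  have "norm (a + b + c - d) \<le> norm a + (norm b + norm c + norm d)" for a b c d :: 'a
   using norm_triangle_ineq4[of "a + b + c" d] norm_triangle_ineq[of "a + b" c] norm_triangle_ineq[of a b] by linarith
  then show "norm (smoothing M (sv i) i t z + correction M (cq i) i t z + correction \<mu>p (cm i) i t z - correction \<mu>m (cm i) i t z)
   \<le> norm (smoothing M (sv i) i t z) + (norm (correction M (cq i) i t z) + norm (correction \<mu>p (cm i) i t z) + norm (correction \<mu>m (cm i) i t z))" .
 qed
 finally show ?thesis by (simp only: corr_norm_def sum.distrib)
qed

lemma uniform_on_K:
 fixes W :: "'a => 'b::metric_space"
 assumes "continuous_on K W" "e > 0"
 obtains t0 where "0 < t0" "t0 \<le> 1"
  "\<And>t i x z. 0 < t ==> t \<le> t0 ==> i \<in> I ==> x \<in> K ==> x \<in> ball i (\<rho> i) ==> F i t (z - x) \<noteq> 0 ==> z \<in> K \<and> dist (W z) (W x) < e"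
proof -
 have "uniformly_continuous_on K W" using compact_uniformly_continuous[OF assms(1) compact_K] .
 then obtain d where d: "d > 0" "\<And>x z. x \<in> K ==> z \<in> K ==> dist z x < d ==> dist (W z) (W x) < e"
  using assms(2) unfolding uniformly_continuous_on_def by metis
 show thesis
 proof (rule that[of "min 1 (d / (2 * R))"])
  show "0 < min 1 (d / (2 * R))" "min 1 (d / (2 * R)) \<le> 1" using d R_pos by auto
  fix t i x z assume a: "0 < t" "t \<le> min 1 (d / (2 * R))" "i \<in> I" "x \<in> K" "x \<in> ball i (\<rho> i)" "F i t (z - x) \<noteq> 0"
  have "z \<in> K" using F_interior[OF a(3-5,1) _ a(6)] a(2) interior_subset by auto
  moreover have "norm (z - x) \<le> t * R" by (rule F_support[OF a(1,3,6)])
  moreover have "t * R \<le> d / 2" using a(2) R_pos by (simp add: field_simps)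
  ultimately show "z \<in> K \<and> dist (W z) (W x) < e" using d a(4) by (auto simp: dist_norm)
 qed
qed

lemma measurable_norm_id: "(norm :: 'a => real) \<in> borel_measurable borel"
 by measurable

lemma sum_norm_sv: "(\<Sum>i\<in>I. norm (sv i x)) = indicator K x * norm (f x)"
proof (cases "x \<in> K")
 case True
 then have "(\<Sum>i\<in>I. norm (sv i x)) = (\<Sum>i\<in>I. chi i x * norm (f x))" using chi_nonneg by simp
 also have "\<dots> = norm (f x)" unfolding sum_distrib_right[symmetric] using sum_chi[OF True] by simp
 finally show ?thesis using True by simp
qed simp

text \<open>The kernel has mass 1 and support of size t R, so the weight can be evaluated at x
  instead of z up to e1. The splitting loses nothing: the factors of the partition are nonnegative
  scalars, so the norms of the pieces add up to the norm of \<open>f\<close>, see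
  \<open>sum_norm_sv\<close>.\<close>

theorem recovery_energy:
 assumes W: "continuous_on K W" "\<And>x. x \<in> K ==> 0 \<le> W x" and e: "e > 0"
 shows "\<exists>t0>0. t0 \<le> 1 \<and> (\<forall>t. 0 < t \<and> t \<le> t0 \<longrightarrow>
  (NN z. ennreal (norm (rec t z) * (indicator K z * W z))) \<le> ennreal ((LINT x|M. indicator K x * (W x * norm (f x))) + e))"
proof -
 define Wt where "Wt z = indicator K z * W z" for z
 have Wt[measurable]: "Wt \<in> borel_measurable borel"
  using compact_indicator(1)[OF compact_K W(1)] by (simp add: Wt_def[abs_def])
 have Wt0: "0 \<le> Wt z" for z using W(2) by (auto simp: Wt_def indicator_def)
 obtain C where C: "C \<ge> 0" "\<And>z. \<bar>Wt z\<bar> \<le> C"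
  using compact_indicator(2)[OF compact_K W(1)] by (auto simp: Wt_def)
 define Nf where "Nf = (LINT x|M. norm (f x))"
 have Nf: "Nf \<ge> 0" by (simp add: Nf_def)
 \<comment> \<open>Half of e pays for freezing the weight, the other half for the corrections; hence
   the factor 2 here and again in t1.\<close>
 define e1 where "e1 = e / (2 * (Nf + 1))"
 have e1: "e1 > 0" using e Nf by (simp add: e1_def)
 have "e1 * (2 * (Nf + 1)) = e" using Nf by (simp add: e1_def)
 then have e1N: "e1 * Nf \<le> e/2" using e1 by (simp add: algebra_simps)
 obtain t0 where t0: "0 < t0" "t0 \<le> 1"
  "\<And>t i x z. 0 < t ==> t \<le> t0 ==> i \<in> I ==> x \<in> K ==> x \<in> ball i (\<rho> i) ==> F i t (z - x) \<noteq> 0 ==> z \<in> K \<and> dist (W z) (W x) < e1"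
  by (rule uniform_on_K[OF W(1) e1]) blast
 define CC where "CC = C * corr_const"
 have CC: "CC \<ge> 0" using C corr_const_nonneg by (simp add: CC_def)
 define t1 where "t1 = min t0 (e / (2 * (CC + 1)))"
 have t1: "t1 > 0" "t1 \<le> t0" using t0 e CC by (auto simp: t1_def)
 have intW: "integrable M (\<lambda>x. indicator K x * (W x * norm (f x)))"
  using integrable_bounded_mult[of M "\<lambda>x. norm (f x)" Wt C] fM C Wt Ms
  by (simp add: Wt_def mult.assoc cong: measurable_cong_sets)
 show ?thesis
 proof (intro exI[of _ t1] conjI allI impI)
  show "t1 > 0" "t1 \<le> 1" using t1 t0 by auto
  fix t assume "0 < t \<and> t \<le> t1"
  then have t: "0 < t" "t \<le> 1" and tt: "t \<le> t0" "t \<le> e / (2 * (CC + 1))" using t1 t0 by (auto simp: t1_def)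
  note pm = parts_measurable[OF _ t]
  have CCt: "CC * t \<le> e/2"
  proof -
   have "CC * t \<le> (CC + 1) * t" using t by (simp add: mult_right_mono)
   also have "\<dots> \<le> (CC + 1) * (e / (2 * (CC + 1)))" using tt CC by (intro mult_left_mono) auto
   also have "\<dots> = e/2" using CC add_nonneg_pos[OF CC zero_less_one] by (simp add: divide_simps)
   finally show ?thesis .
  qed
  have S: "(NN z. ennreal (norm (smoothing M (sv i) i t z) * Wt z)) \<le> (\<integral>\<^sup>+x. ennreal (norm (sv i x) * (Wt x + e1)) \<partial>M)"
   if i: "i \<in> I" for i
  proof -
   have "(NN z. ennreal (norm (smoothing M (sv i) i t z) * Wt z)) \<le>
    (\<integral>\<^sup>+x. ennreal (norm (sv i x)) * (NN z. ennreal (F i t (z - x) * Wt z)) \<partial>M)"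
    by (rule smoothing(4)[OF M Ms sv_integrable[OF i] sv_K[OF i] i t Wt Wt0])
   also have "\<dots> \<le> (\<integral>\<^sup>+x. ennreal (norm (sv i x) * (Wt x + e1)) \<partial>M)"
   proof (rule nn_integral_mono)
    fix x
    show "ennreal (norm (sv i x)) * (NN z. ennreal (F i t (z - x) * Wt z)) \<le> ennreal (norm (sv i x) * (Wt x + e1))"
    proof (cases "sv i x = 0")
     case True show ?thesis unfolding True by simp
    next
     case False
     have x: "x \<in> K" "x \<in> ball i (\<rho> i)" using sv_K[OF i False] by blast+
     have "(NN z. ennreal (F i t (z - x) * Wt z)) \<le> (NN z. ennreal (F i t (z - x)) * ennreal (Wt x + e1))"
     proof (rule nn_integral_mono)
      fix z
      have "F i t (z - x) * Wt z \<le> F i t (z - x) * (Wt x + e1)"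
      proof (cases "F i t (z - x) = 0")
       case False
       have "z \<in> K \<and> dist (W z) (W x) < e1" by (rule t0(3)[OF t(1) tt(1) i x False])
       then have "Wt z \<le> Wt x + e1" using x by (auto simp: Wt_def dist_real_def)
       then show ?thesis using F_nonneg[OF t(1)] by (intro mult_left_mono) auto
      qed simp
      then show "ennreal (F i t (z - x) * Wt z) \<le> ennreal (F i t (z - x)) * ennreal (Wt x + e1)"
       using F_nonneg[OF t(1)] Wt0 e1 by (subst ennreal_mult[symmetric]) (auto intro: ennreal_leI add_nonneg_nonneg)
     qed
     also have "\<dots> = ennreal (Wt x + e1)" using nn_integral_F[OF t(1)] by (subst nn_integral_multc) auto
     finally show ?thesis using Wt0 e1 by (subst ennreal_mult) (auto intro!: mult_left_mono add_nonneg_nonneg)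
    qed
   qed
   finally show ?thesis .
  qed
  have svm: "(\<lambda>x. sv i x) \<in> borel_measurable M" if "i \<in> I" for i using sv_integrable[OF that] by auto
  have WtM: "Wt \<in> borel_measurable M" using Wt Ms by (simp cong: measurable_cong_sets)
  have "(NN z. ennreal (norm (rec t z) * Wt z)) \<le> (NN z. (\<Sum>i\<in>I. ennreal (norm (smoothing M (sv i) i t z) * Wt z)) + ennreal C * ennreal (corr_norm t z))"
  proof (rule nn_integral_mono)
   fix z
   have cn: "0 \<le> corr_norm t z" unfolding corr_norm_def by (intro sum_nonneg) auto
   have "norm (rec t z) * Wt z \<le> ((\<Sum>i\<in>I. norm (smoothing M (sv i) i t z)) + corr_norm t z) * Wt z"
    by (intro mult_right_mono rec_norm_le Wt0)
   also have "\<dots> \<le> (\<Sum>i\<in>I. norm (smoothing M (sv i) i t z) * Wt z) + C * corr_norm t z"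
    using C(2)[of z] cn by (auto simp: distrib_right sum_distrib_right mult.commute[of C] intro!: mult_left_mono)
   finally have "ennreal (norm (rec t z) * Wt z) \<le> ennreal ((\<Sum>i\<in>I. norm (smoothing M (sv i) i t z) * Wt z) + C * corr_norm t z)"
    by (rule ennreal_leI)
   also have "\<dots> = (\<Sum>i\<in>I. ennreal (norm (smoothing M (sv i) i t z) * Wt z)) + ennreal C * ennreal (corr_norm t z)"
   proof -
    have "0 \<le> (\<Sum>i\<in>I. norm (smoothing M (sv i) i t z) * Wt z)" using Wt0 by (intro sum_nonneg mult_nonneg_nonneg) auto
    then have "ennreal ((\<Sum>i\<in>I. norm (smoothing M (sv i) i t z) * Wt z) + C * corr_norm t z)
     = ennreal (\<Sum>i\<in>I. norm (smoothing M (sv i) i t z) * Wt z) + ennreal C * ennreal (corr_norm t z)"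
     using C(1) cn by (subst ennreal_plus) (auto simp: ennreal_mult)
    also have "ennreal (\<Sum>i\<in>I. norm (smoothing M (sv i) i t z) * Wt z) = (\<Sum>i\<in>I. ennreal (norm (smoothing M (sv i) i t z) * Wt z))"
     using Wt0 by (intro sum_ennreal[symmetric] mult_nonneg_nonneg) auto
    finally show ?thesis .
   qed
   finally show "ennreal (norm (rec t z) * Wt z) \<le> (\<Sum>i\<in>I. ennreal (norm (smoothing M (sv i) i t z) * Wt z)) + ennreal C * ennreal (corr_norm t z)" .
  qed
  also have "\<dots> = (\<Sum>i\<in>I. (NN z. ennreal (norm (smoothing M (sv i) i t z) * Wt z))) + ennreal C * (NN z. ennreal (corr_norm t z))"
   using pm corr_norm_small(1)[OF t] by (simp add: nn_integral_add nn_integral_sum nn_integral_cmult)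
  also have "\<dots> \<le> (\<Sum>i\<in>I. \<integral>\<^sup>+x. ennreal (norm (sv i x) * (Wt x + e1)) \<partial>M) + ennreal C * ennreal (t * corr_const)"
   by (intro add_mono sum_mono S mult_left_mono corr_norm_small(2)[OF t]) auto
  also have "(\<Sum>i\<in>I. \<integral>\<^sup>+x. ennreal (norm (sv i x) * (Wt x + e1)) \<partial>M) = (\<integral>\<^sup>+x. (\<Sum>i\<in>I. ennreal (norm (sv i x) * (Wt x + e1))) \<partial>M)"
   using borel_measurable_times[OF measurable_compose[OF svm measurable_norm_id] borel_measurable_add[OF WtM borel_measurable_const]]
   by (intro nn_integral_sum[symmetric] measurable_compose[OF _ measurable_ennreal])
  also have "\<dots> \<le> (\<integral>\<^sup>+x. ennreal (indicator K x * (W x * norm (f x)) + e1 * norm (f x)) \<partial>M)"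
  proof (rule nn_integral_mono)
   fix x
   have "(\<Sum>i\<in>I. ennreal (norm (sv i x) * (Wt x + e1))) = ennreal (\<Sum>i\<in>I. norm (sv i x) * (Wt x + e1))"
    using Wt0 e1 by (intro sum_ennreal mult_nonneg_nonneg add_nonneg_nonneg) auto
   also have "(\<Sum>i\<in>I. norm (sv i x) * (Wt x + e1)) = (indicator K x * norm (f x)) * (Wt x + e1)"
    unfolding sum_distrib_right[symmetric] sum_norm_sv ..
   also have "\<dots> \<le> indicator K x * (W x * norm (f x)) + e1 * norm (f x)"
    using e1 by (auto simp: Wt_def indicator_def algebra_simps)
   finally show "(\<Sum>i\<in>I. ennreal (norm (sv i x) * (Wt x + e1))) \<le> ennreal (indicator K x * (W x * norm (f x)) + e1 * norm (f x))"
    by (simp add: ennreal_leI)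
  qed
  also have "\<dots> = ennreal (LINT x|M. indicator K x * (W x * norm (f x)) + e1 * norm (f x))"
   using intW fM W(2) e1 by (intro nn_integral_eq_integral) (auto simp: indicator_def)
  also have "(LINT x|M. indicator K x * (W x * norm (f x)) + e1 * norm (f x)) = (LINT x|M. indicator K x * (W x * norm (f x))) + e1 * Nf"
   using intW fM by (simp add: Nf_def)
  also have "ennreal ((LINT x|M. indicator K x * (W x * norm (f x))) + e1 * Nf) + ennreal C * ennreal (t * corr_const)
   = ennreal ((LINT x|M. indicator K x * (W x * norm (f x))) + e1 * Nf + C * (t * corr_const))"
   using C t corr_const_nonneg e1 Nf W(2)
   by (subst ennreal_mult[symmetric], simp, simp, subst ennreal_plus[symmetric])
    (auto intro!: add_nonneg_nonneg integral_nonneg_AE AE_I2 simp: indicator_def)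
  also have "\<dots> \<le> ennreal ((LINT x|M. indicator K x * (W x * norm (f x))) + e)"
   using e1N CCt by (intro ennreal_leI) (simp add: CC_def algebra_simps)
  finally show "(NN z. ennreal (norm (rec t z) * (indicator K z * W z))) \<le> ennreal ((LINT x|M. indicator K x * (W x * norm (f x))) + e)"
   by (simp add: Wt_def add_mono)
 qed
qed

text \<open>The argument for the energy with a continuous field in place of the weight. The pairing
  is signed now, and the pieces of the partition add up to \<open>f\<close> itself.\<close>

theorem recovery_weak_star:
 assumes \<psi>: "continuous_on K \<psi>" and e: "e > 0"
 shows "\<exists>t0>0. t0 \<le> 1 \<and> (\<forall>t. 0 < t \<and> t \<le> t0 \<longrightarrow>
  \<bar>(LBINT z. rec t z \<bullet> (indicator K z *\<^sub>R \<psi> z)) - (LINT x|M. indicator K x * (\<psi> x \<bullet> f x))\<bar> \<le> e)"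
proof -
 define \<Psi> where "\<Psi> z = indicator K z *\<^sub>R \<psi> z" for z
 have \<Psi>m[measurable]: "\<Psi> \<in> borel_measurable borel"
  using compact_indicator(1)[OF compact_K \<psi>] by (simp add: \<Psi>_def[abs_def])
 obtain C where C: "C \<ge> 0" "\<And>z. norm (\<Psi> z) \<le> C"
  using compact_indicator(2)[OF compact_K \<psi>] by (auto simp: \<Psi>_def)
 have \<Psi>M: "\<Psi> \<in> borel_measurable M" using \<Psi>m Ms by (simp cong: measurable_cong_sets)
 define Nf where "Nf = (LINT x|M. norm (f x))"
 have Nf: "Nf \<ge> 0" by (simp add: Nf_def)
 define e1 where "e1 = e / (2 * (Nf + 1))"
 have e1: "e1 > 0" using e Nf by (simp add: e1_def)
 have "e1 * (2 * (Nf + 1)) = e" using Nf by (simp add: e1_def)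
 then have e1N: "e1 * Nf \<le> e/2" using e1 by (simp add: algebra_simps)
 obtain t0 where t0: "0 < t0" "t0 \<le> 1"
  "\<And>t i x z. 0 < t ==> t \<le> t0 ==> i \<in> I ==> x \<in> K ==> x \<in> ball i (\<rho> i) ==> F i t (z - x) \<noteq> 0 ==> z \<in> K \<and> dist (\<psi> z) (\<psi> x) < e1"
  by (rule uniform_on_K[OF \<psi> e1]) blast
 define CC where "CC = C * corr_const"
 have CC: "CC \<ge> 0" using C corr_const_nonneg by (simp add: CC_def)
 define t1 where "t1 = min t0 (e / (2 * (CC + 1)))"
 have t1: "t1 > 0" "t1 \<le> t0" using t0 e CC by (auto simp: t1_def)
 show ?thesis
 proof (intro exI[of _ t1] conjI allI impI)
  show "t1 > 0" "t1 \<le> 1" using t1 t0 by auto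
  fix t assume "0 < t \<and> t \<le> t1"
  then have t: "0 < t" "t \<le> 1" and tt: "t \<le> t0" "t \<le> e / (2 * (CC + 1))" using t1 t0 by (auto simp: t1_def)
  note pm = parts_measurable[OF _ t]
  have CCt: "CC * t \<le> e/2"
  proof -
   have "CC * t \<le> (CC + 1) * t" using t by (simp add: mult_right_mono)
   also have "\<dots> \<le> (CC + 1) * (e / (2 * (CC + 1)))" using tt CC by (intro mult_left_mono) auto
   also have "\<dots> = e/2" using CC add_nonneg_pos[OF CC zero_less_one] by (simp add: divide_simps)
   finally show ?thesis .
  qed
  have A: "(NN z. ennreal (F i t (z - x) * norm (\<Psi> z))) \<le> ennreal C" for i x
  proof -
   have "(NN z. ennreal (F i t (z - x) * norm (\<Psi> z))) \<le> (NN z. ennreal (F i t (z - x)) * ennreal C)"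
    using F_nonneg[OF t(1)] C by (intro nn_integral_mono) (auto simp: ennreal_mult[symmetric] intro!: ennreal_leI mult_left_mono)
   also have "\<dots> = ennreal C" using nn_integral_F[OF t(1)] by (subst nn_integral_multc) auto
   finally show ?thesis .
  qed
  have S: "integrable lborel (\<lambda>z. smoothing M (sv i) i t z \<bullet> \<Psi> z) \<and>
    integrable M (\<lambda>x. LINT z|lborel. F i t (z - x) * (sv i x \<bullet> \<Psi> z)) \<and>
    (LBINT z. smoothing M (sv i) i t z \<bullet> \<Psi> z) = (LINT x|M. LINT z|lborel. F i t (z - x) * (sv i x \<bullet> \<Psi> z))"
   if i: "i \<in> I" for i
   by (rule smoothing(5)[OF M Ms sv_integrable[OF i] sv_K[OF i] i t \<Psi>m A])
  have isv: "integrable M (\<lambda>x. sv i x \<bullet> \<Psi> x)" if i: "i \<in> I" for i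
  proof (rule Bochner_Integration.integrable_bound[OF integrable_mult_right[OF integrable_norm[OF sv_integrable[OF i]], of C]])
   show "(\<lambda>x. sv i x \<bullet> \<Psi> x) \<in> borel_measurable M"
    using borel_measurable_integrable[OF sv_integrable[OF i]] \<Psi>M by (rule borel_measurable_inner)
   show "AE x in M. norm (sv i x \<bullet> \<Psi> x) \<le> norm (C * norm (sv i x))"
   proof (rule AE_I2)
    fix x
    have "\<bar>sv i x \<bullet> \<Psi> x\<bar> \<le> norm (sv i x) * norm (\<Psi> x)" by (rule Cauchy_Schwarz_ineq2)
    also have "\<dots> \<le> norm (sv i x) * C" using C by (intro mult_left_mono) auto
    finally show "norm (sv i x \<bullet> \<Psi> x) \<le> norm (C * norm (sv i x))"
     using C(1) by (simp only: real_norm_def abs_mult abs_norm_cancel abs_of_nonneg mult.commute)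
   qed
  qed
  have dS: "\<bar>(LBINT z. F i t (z - x) * (sv i x \<bullet> \<Psi> z)) - sv i x \<bullet> \<Psi> x\<bar> \<le> e1 * norm (sv i x)" if i: "i \<in> I" for i x
  proof (cases "sv i x = 0")
   case True show ?thesis unfolding True by simp
  next
   case False
   have x: "x \<in> K" "x \<in> ball i (\<rho> i)" using sv_K[OF i False] by blast+
   define v where "v = sv i x"
   have i1: "integrable lborel (\<lambda>z. F i t (z - x) * (v \<bullet> \<Psi> z))"
   proof -
    have "\<bar>v \<bullet> \<Psi> z\<bar> \<le> norm v * C" for z
     using order_trans[OF Cauchy_Schwarz_ineq2 mult_left_mono[OF C(2) norm_ge_zero]] .
    then have "integrable lborel (\<lambda>z. (v \<bullet> \<Psi> z) * F i t (z - x))"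
     by (intro integrable_bounded_mult[OF integrable_F[OF t(1)]]) auto
    then show ?thesis by (simp only: mult.commute)
   qed
   have i2: "integrable lborel (\<lambda>z. F i t (z - x) * (v \<bullet> \<Psi> x))" by (intro integrable_mult_left integrable_F t)
   have "(LBINT z. F i t (z - x) * (v \<bullet> \<Psi> z)) - v \<bullet> \<Psi> x = (LBINT z. F i t (z - x) * (v \<bullet> \<Psi> z)) - (LBINT z. F i t (z - x) * (v \<bullet> \<Psi> x))"
    using integral_F[OF t(1), of i x] by simp
   also have "\<dots> = (LBINT z. F i t (z - x) * (v \<bullet> \<Psi> z) - F i t (z - x) * (v \<bullet> \<Psi> x))"
    using i1 i2 by (rule LINT_diff[symmetric])
   finally have "\<bar>(LBINT z. F i t (z - x) * (v \<bullet> \<Psi> z)) - v \<bullet> \<Psi> x\<bar> \<le> (LBINT z. \<bar>F i t (z - x) * (v \<bullet> \<Psi> z) - F i t (z - x) * (v \<bullet> \<Psi> x)\<bar>)"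
    using integral_norm_bound[of lborel "\<lambda>z. F i t (z - x) * (v \<bullet> \<Psi> z) - F i t (z - x) * (v \<bullet> \<Psi> x)"] by simp
   also have "\<dots> \<le> (LBINT z. F i t (z - x) * (e1 * norm v))"
   proof (rule integral_mono)
    show "integrable lborel (\<lambda>z. \<bar>F i t (z - x) * (v \<bullet> \<Psi> z) - F i t (z - x) * (v \<bullet> \<Psi> x)\<bar>)" using i1 i2 by auto
    show "integrable lborel (\<lambda>z. F i t (z - x) * (e1 * norm v))" by (intro integrable_mult_left integrable_F t)
    fix z
    show "\<bar>F i t (z - x) * (v \<bullet> \<Psi> z) - F i t (z - x) * (v \<bullet> \<Psi> x)\<bar> \<le> F i t (z - x) * (e1 * norm v)"
    proof (cases "F i t (z - x) = 0")
     case False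
     have "z \<in> K \<and> dist (\<psi> z) (\<psi> x) < e1" by (rule t0(3)[OF t(1) tt(1) i x False])
     then have "norm (\<Psi> z - \<Psi> x) \<le> e1" using x by (auto simp: \<Psi>_def dist_norm)
     then have "norm v * norm (\<Psi> z - \<Psi> x) \<le> norm v * e1" by (intro mult_left_mono) auto
     then have "\<bar>v \<bullet> (\<Psi> z - \<Psi> x)\<bar> \<le> e1 * norm v"
      using Cauchy_Schwarz_ineq2[of v "\<Psi> z - \<Psi> x"] by (simp only: mult.commute)
     then have "F i t (z - x) * \<bar>v \<bullet> (\<Psi> z - \<Psi> x)\<bar> \<le> F i t (z - x) * (e1 * norm v)"
      using F_nonneg[OF t(1)] by (intro mult_left_mono) auto
     moreover have "\<bar>F i t (z - x) * (v \<bullet> \<Psi> z) - F i t (z - x) * (v \<bullet> \<Psi> x)\<bar> = F i t (z - x) * \<bar>v \<bullet> (\<Psi> z - \<Psi> x)\<bar>"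
      using F_nonneg[OF t(1), of i "z - x"] by (simp add: abs_mult inner_diff_right flip: right_diff_distrib)
     ultimately show ?thesis by simp
    qed simp
   qed
   also have "\<dots> = e1 * norm v" using integral_F[OF t(1), of i x] by simp
   finally show ?thesis unfolding v_def .
  qed
  have dSi: "\<bar>(LBINT z. smoothing M (sv i) i t z \<bullet> \<Psi> z) - (LINT x|M. sv i x \<bullet> \<Psi> x)\<bar> \<le> e1 * (LINT x|M. norm (sv i x))" if i: "i \<in> I" for i
  proof -
   have "(LBINT z. smoothing M (sv i) i t z \<bullet> \<Psi> z) - (LINT x|M. sv i x \<bullet> \<Psi> x)
    = (LINT x|M. (LBINT z. F i t (z - x) * (sv i x \<bullet> \<Psi> z)) - sv i x \<bullet> \<Psi> x)"
    using S[OF i] isv[OF i] by (subst LINT_diff) auto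
   then have "\<bar>(LBINT z. smoothing M (sv i) i t z \<bullet> \<Psi> z) - (LINT x|M. sv i x \<bullet> \<Psi> x)\<bar>
    \<le> (LINT x|M. \<bar>(LBINT z. F i t (z - x) * (sv i x \<bullet> \<Psi> z)) - sv i x \<bullet> \<Psi> x\<bar>)"
    using integral_norm_bound[of M "\<lambda>x. (LBINT z. F i t (z - x) * (sv i x \<bullet> \<Psi> z)) - sv i x \<bullet> \<Psi> x"] by simp
   also have "\<dots> \<le> (LINT x|M. e1 * norm (sv i x))"
    by (intro integral_mono integrable_abs Bochner_Integration.integrable_diff isv[OF i] integrable_mult_right
     integrable_norm sv_integrable[OF i] dS[OF i] S[OF i, THEN conjunct2, THEN conjunct1])
   also have "\<dots> = e1 * (LINT x|M. norm (sv i x))" by (rule integral_mult_right_zero)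
   finally show ?thesis .
  qed
  \<comment> \<open>All corrections together. Their pairing with the bounded field is at most C
    times their mass, hence of order t.\<close>
  define E where "E z = (\<Sum>i\<in>I. correction M (cq i) i t z + correction \<mu>p (cm i) i t z - correction \<mu>m (cm i) i t z)" for z
  have Em: "E \<in> borel_measurable borel"
   unfolding E_def[abs_def] by (intro borel_measurable_sum borel_measurable_add borel_measurable_diff pm)
  have rE: "rec t z = (\<Sum>i\<in>I. smoothing M (sv i) i t z) + E z" for z
   unfolding recovery_def E_def sum.distrib[symmetric] by (intro sum.cong refl) (simp add: algebra_simps)
  have El: "norm (E z) \<le> corr_norm t z" for z
   unfolding E_def corr_norm_def
  proof (rule order_trans[OF norm_sum], rule sum_mono)
   fix i
   have "norm (b + c - d) \<le> norm b + norm c + norm d" for b c d :: 'a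
    using norm_triangle_ineq4[of "b + c" d] norm_triangle_ineq[of b c] by linarith
   then show "norm (correction M (cq i) i t z + correction \<mu>p (cm i) i t z - correction \<mu>m (cm i) i t z)
    \<le> norm (correction M (cq i) i t z) + norm (correction \<mu>p (cm i) i t z) + norm (correction \<mu>m (cm i) i t z)" .
  qed
  have E\<Psi>: "(NN z. ennreal \<bar>E z \<bullet> \<Psi> z\<bar>) \<le> ennreal (CC * t)"
  proof -
   have "(NN z. ennreal \<bar>E z \<bullet> \<Psi> z\<bar>) \<le> (NN z. ennreal C * ennreal (corr_norm t z))"
   proof (rule nn_integral_mono)
    fix z
    have cn: "0 \<le> corr_norm t z" unfolding corr_norm_def by (intro sum_nonneg) auto
    have "\<bar>E z \<bullet> \<Psi> z\<bar> \<le> norm (E z) * norm (\<Psi> z)" by (rule Cauchy_Schwarz_ineq2)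
    also have "\<dots> \<le> corr_norm t z * C" using El C cn by (intro mult_mono) auto
    finally show "ennreal \<bar>E z \<bullet> \<Psi> z\<bar> \<le> ennreal C * ennreal (corr_norm t z)"
     using C(1) cn by (subst ennreal_mult[symmetric]) (auto simp: mult.commute intro: ennreal_leI)
   qed
   also have "\<dots> = ennreal C * (NN z. ennreal (corr_norm t z))"
    using corr_norm_small(1)[OF t] by (intro nn_integral_cmult) auto
   also have "\<dots> \<le> ennreal C * ennreal (t * corr_const)" by (intro mult_left_mono corr_norm_small(2)[OF t]) simp
   also have "\<dots> = ennreal (CC * t)" using C corr_const_nonneg t by (simp add: CC_def ennreal_mult[symmetric] ac_simps)
   finally show ?thesis .
  qed
  have iE: "integrable lborel (\<lambda>z. E z \<bullet> \<Psi> z)"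
   using Em E\<Psi> by (intro integrableI_bounded) (auto intro: le_less_trans)
  have "ennreal \<bar>LBINT z. E z \<bullet> \<Psi> z\<bar> \<le> ennreal (CC * t)"
   by (rule order_trans[OF ennreal_abs_integral_le E\<Psi>])
  then have Eb: "\<bar>LBINT z. E z \<bullet> \<Psi> z\<bar> \<le> CC * t" using CC t by (subst (asm) ennreal_le_iff) auto
  have "(LBINT z. rec t z \<bullet> \<Psi> z) = (LBINT z. (\<Sum>i\<in>I. smoothing M (sv i) i t z \<bullet> \<Psi> z) + E z \<bullet> \<Psi> z)"
   by (simp add: rE inner_add_left inner_sum_left)
  also have "\<dots> = (\<Sum>i\<in>I. LINT z|lborel. smoothing M (sv i) i t z \<bullet> \<Psi> z) + (LBINT z. E z \<bullet> \<Psi> z)"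
   using S iE by (subst Bochner_Integration.integral_add) (auto simp: Bochner_Integration.integral_sum)
  finally have r1: "(LBINT z. rec t z \<bullet> \<Psi> z) = (\<Sum>i\<in>I. LINT z|lborel. smoothing M (sv i) i t z \<bullet> \<Psi> z) + (LBINT z. E z \<bullet> \<Psi> z)" .
  have sumsv: "(\<Sum>i\<in>I. sv i x \<bullet> \<Psi> x) = indicator K x * (\<psi> x \<bullet> f x)" for x
  proof (cases "x \<in> K")
   case True
   then have "(\<Sum>i\<in>I. sv i x \<bullet> \<Psi> x) = (\<Sum>i\<in>I. chi i x * (f x \<bullet> \<psi> x))" by (simp add: \<Psi>_def)
   also have "\<dots> = f x \<bullet> \<psi> x" unfolding sum_distrib_right[symmetric] using sum_chi[OF True] by simp
   finally show ?thesis using True by (simp add: inner_commute)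
  qed simp
  have r2: "(LINT x|M. indicator K x * (\<psi> x \<bullet> f x)) = (\<Sum>i\<in>I. LINT x|M. sv i x \<bullet> \<Psi> x)"
   unfolding sumsv[symmetric] by (intro Bochner_Integration.integral_sum isv)
  have "(\<Sum>i\<in>I. (LINT x|M. norm (sv i x))) = (LINT x|M. indicator K x * norm (f x))"
   unfolding sum_norm_sv[symmetric] by (intro Bochner_Integration.integral_sum[symmetric] integrable_norm sv_integrable)
  also have "\<dots> \<le> Nf"
   unfolding Nf_def using fM Ms by (intro integral_mono integrable_indicator_mult) (auto simp: indicator_def)
  finally have r3: "(\<Sum>i\<in>I. (LINT x|M. norm (sv i x))) \<le> Nf" .
  have "\<bar>(LBINT z. rec t z \<bullet> \<Psi> z) - (LINT x|M. indicator K x * (\<psi> x \<bullet> f x))\<bar>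
   = \<bar>(\<Sum>i\<in>I. (LBINT z. smoothing M (sv i) i t z \<bullet> \<Psi> z) - (LINT x|M. sv i x \<bullet> \<Psi> x)) + (LBINT z. E z \<bullet> \<Psi> z)\<bar>"
   unfolding r1 r2 sum_subtractf by simp
  also have "\<dots> \<le> (\<Sum>i\<in>I. \<bar>(LBINT z. smoothing M (sv i) i t z \<bullet> \<Psi> z) - (LINT x|M. sv i x \<bullet> \<Psi> x)\<bar>) + \<bar>LBINT z. E z \<bullet> \<Psi> z\<bar>"
   by (rule order_trans[OF abs_triangle_ineq add_right_mono[OF sum_abs]])
  also have "\<dots> \<le> (\<Sum>i\<in>I. e1 * (LINT x|M. norm (sv i x))) + CC * t"
   by (intro add_mono sum_mono dSi Eb)
  also have "\<dots> = e1 * (\<Sum>i\<in>I. (LINT x|M. norm (sv i x))) + CC * t" by (simp only: sum_distrib_left)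
  also have "\<dots> \<le> e1 * Nf + CC * t" using r3 e1 by (intro add_right_mono mult_left_mono) auto
  also have "\<dots> \<le> e" using e1N CCt by simp
  finally show "\<bar>(LBINT z. rec t z \<bullet> (indicator K z *\<^sub>R \<psi> z)) - (LINT x|M. indicator K x * (\<psi> x \<bullet> f x))\<bar> \<le> e"
   unfolding \<Psi>_def .
 qed
qed

end

section \<open>The functionals\<close>

lemma vector_RN_deriv_represents:
 assumes "countably_additive_fun q" "abs_cont q"
 shows "represents q lborel (vector_RN_deriv q)"
proof -
 obtain f where "represents q lborel f"
  using represents_sigma_finite[OF lborel.sigma_finite_measure_axioms _ assms(1)] assms(2)
  unfolding abs_cont_def by auto
 then have "\<exists>f. integrable lborel f \<and> (\<forall>A\<in>sets borel. q A = (LBINT x:A. f x))"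
  by (auto simp: represents_def)
 from someI_ex[OF this]
 have "integrable lborel (vector_RN_deriv q) \<and> (\<forall>A\<in>sets borel. q A = (LBINT x:A. vector_RN_deriv q x))"
  unfolding vector_RN_deriv_def[symmetric] .
 then show ?thesis unfolding represents_def by (intro conjI) (auto simp only: sets_lborel)
qed

lemma represents_zero_on:
 assumes sf: "sigma_finite_measure M" and r: "represents q M f" and B: "B \<in> sets borel" and z: "\<And>A. A \<in> sets borel ==> A \<subseteq> B ==> q A = 0"
 shows "AE x in M. x \<in> B \<longrightarrow> f x = 0"
proof -
 have M: "sets M = sets borel" and f: "integrable M f" using r by (auto simp: represents_def)
 have i: "integrable M (\<lambda>x. indicator B x *\<^sub>R f x)" using B M f by (intro integrable_mult_indicator) auto
 have "AE x in M. indicator B x *\<^sub>R f x = 0"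
 proof (rule sigma_finite_measure.density_unique_banach[OF sf i integrable_zero])
  fix A assume "A \<in> sets M"
  then have A: "A \<in> sets borel" using M by simp
  have "set_lebesgue_integral M A (\<lambda>x. indicator B x *\<^sub>R f x) = (LINT x:A \<inter> B|M. f x)"
   unfolding set_lebesgue_integral_def by (intro LINT_cong) (auto simp: indicator_def)
  also have "\<dots> = q (A \<inter> B)" using r A B by (simp add: represents_def)
  also have "\<dots> = 0" using A B by (intro z) auto
  finally show "set_lebesgue_integral M A (\<lambda>x. indicator B x *\<^sub>R f x) = set_lebesgue_integral M A (\<lambda>_. 0)"
   by (simp add: set_lebesgue_integral_def)
 qed
 then show ?thesis by eventually_elim (auto simp: indicator_def)
qed

lemma represents_unique:
 assumes "sigma_finite_measure M" "represents q M f" "represents q M g" shows "AE x in M. f x = g x"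
 using assms by (intro sigma_finite_measure.density_unique_banach) (auto simp: represents_def)

text \<open>For |q| \<le> \<delta> one has W |q| \<le> \<delta> W, which together with the summand
  -\<delta> W accounts for 2 \<delta> W; for larger q the deficit is at most 3/2 \<delta> W.
  Upwards, the quadratic branch stays below W |q|, so only the power term adds anything.\<close>

lemma G_star_bounds:
 assumes "0 \<le> W x" "0 \<le> \<epsilon>" "0 < \<delta>" "1 < \<alpha>"
 shows "W x * norm q - 2 * \<delta> * W x \<le> G_star \<alpha> W \<epsilon> \<delta> x q"
  and "G_star \<alpha> W \<epsilon> \<delta> x q \<le> W x * norm q + \<epsilon> / \<alpha> * norm q powr \<alpha>"
proof -
 have le: "W x * norm q \<le> \<delta> * W x" if "norm q \<le> \<delta>"
  using mult_left_mono[OF that assms(1)] by (simp add: mult.commute)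
 have p0: "0 \<le> (norm q)\<^sup>2 * (W x / (2 * \<delta>))" "0 \<le> \<delta> * W x" "0 \<le> \<epsilon> / \<alpha> * norm q powr \<alpha>" "0 \<le> W x * norm q"
  "0 \<le> \<epsilon> / \<alpha> * (norm q - \<delta>) powr \<alpha>"
  using assms by auto
 show "W x * norm q - 2 * \<delta> * W x \<le> G_star \<alpha> W \<epsilon> \<delta> x q"
  using le p0 by (auto simp: G_star_def mult.commute[of "norm q"])
 have q: "(norm q)\<^sup>2 * (W x / (2 * \<delta>)) \<le> W x * norm q" if "norm q \<le> \<delta>"
 proof -
  have "(norm q)\<^sup>2 * (W x / (2 * \<delta>)) = (W x * norm q) * (norm q / (2 * \<delta>))" by (simp add: power2_eq_square)
  also have "\<dots> \<le> (W x * norm q) * 1" using that assms p0 by (intro mult_left_mono) auto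
  finally show ?thesis by simp
 qed
 have r: "\<epsilon> / \<alpha> * (norm q - \<delta>) powr \<alpha> \<le> \<epsilon> / \<alpha> * norm q powr \<alpha>" if "norm q > \<delta>"
  using that assms by (intro mult_left_mono powr_mono2) auto
 show "G_star \<alpha> W \<epsilon> \<delta> x q \<le> W x * norm q + \<epsilon> / \<alpha> * norm q powr \<alpha>"
  using p0 q r by (auto simp: G_star_def mult.commute[of "norm q"])
qed

lemma G_star_integral_bounds:
 fixes f :: "'a::euclidean_space => 'a"
 assumes K: "compact K" and W: "continuous_on K W" "\<And>x. x \<in> K ==> 0 \<le> W x"
  and f: "integrable lborel f" "f \<in> Lp \<alpha> K" and c: "0 \<le> \<epsilon>" "0 < \<delta>" "1 < \<alpha>"
 shows "(LBINT x. indicator K x * (W x * norm (f x))) - 2 * \<delta> * (LBINT x. indicator K x * W x)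
   \<le> (LINT x|lebesgue_on K. G_star \<alpha> W \<epsilon> \<delta> x (f x))"
  and "(LINT x|lebesgue_on K. G_star \<alpha> W \<epsilon> \<delta> x (f x)) \<le>
   (LBINT x. indicator K x * (W x * norm (f x))) + \<epsilon> / \<alpha> * (LBINT x. indicator K x * norm (f x) powr \<alpha>)"
  and "integrable lborel (\<lambda>x. indicator K x * (W x * norm (f x)))"
proof -
 have KB[measurable]: "K \<in> sets borel" using K by (rule borel_compact)
 have fm[measurable]: "f \<in> borel_measurable borel" using f by (auto dest: borel_measurable_integrable)
 define Wt where "Wt x = indicator K x * W x" for x
 have Wt[measurable]: "Wt \<in> borel_measurable borel"
  using compact_indicator(1)[OF K W(1)] by (simp add: Wt_def[abs_def])
 have Wt0: "0 \<le> Wt x" for x using W(2) by (auto simp: Wt_def indicator_def)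
 obtain C where C: "\<And>z. \<bar>Wt z\<bar> \<le> C"
  using compact_indicator(2)[OF K W(1)] by (auto simp: Wt_def)
 have i1: "integrable lborel (\<lambda>x. indicator K x * (W x * norm (f x)))"
  using integrable_bounded_mult[of lborel "\<lambda>x. norm (f x)" Wt C] f(1) C Wt by (simp add: Wt_def mult.assoc)
 then show "integrable lborel (\<lambda>x. indicator K x * (W x * norm (f x)))" .
 have i2: "integrable lborel (\<lambda>x. indicator K x * W x)" using borel_integrable_compact[OF K W(1)] by simp
 have i3: "integrable lborel (\<lambda>x. indicator K x * norm (f x) powr \<alpha>)"
 proof -
  have "integrable (lebesgue_on K) (\<lambda>x. norm (f x) powr \<alpha>)" using f(2) by (simp add: Lp_def)
  then show ?thesis by (subst (asm) lebesgue_on_borel[OF KB]) auto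
 qed
 define g where "g x = G_star \<alpha> Wt \<epsilon> \<delta> x (f x)" for x
 have gm: "g \<in> borel_measurable borel" unfolding g_def G_star_def by measurable
 have gi: "(LINT x|lebesgue_on K. G_star \<alpha> W \<epsilon> \<delta> x (f x)) = (LBINT x. indicator K x * g x)"
 proof -
  have "(LINT x|lebesgue_on K. G_star \<alpha> W \<epsilon> \<delta> x (f x)) = (LINT x|lebesgue_on K. g x)"
   by (intro LINT_cong) (auto simp: g_def G_star_def Wt_def)
  also have "\<dots> = (LBINT x. indicator K x *\<^sub>R g x)" by (rule lebesgue_on_borel(2)[OF KB gm])
  finally show ?thesis by simp
 qed
 have lo: "indicator K x * (W x * norm (f x)) - 2 * \<delta> * (indicator K x * W x) \<le> indicator K x * g x" for x
  using G_star_bounds(1)[of Wt x \<epsilon> \<delta> \<alpha> "f x"] Wt0 c by (auto simp: g_def Wt_def indicator_def)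
 have up: "indicator K x * g x \<le> indicator K x * (W x * norm (f x)) + \<epsilon> / \<alpha> * (indicator K x * norm (f x) powr \<alpha>)" for x
  using G_star_bounds(2)[of Wt x \<epsilon> \<delta> \<alpha> "f x"] Wt0 c by (auto simp: g_def Wt_def indicator_def)
 have ilo: "integrable lborel (\<lambda>x. indicator K x * (W x * norm (f x)) - 2 * \<delta> * (indicator K x * W x))" using i1 i2 by auto
 have iup: "integrable lborel (\<lambda>x. indicator K x * (W x * norm (f x)) + \<epsilon> / \<alpha> * (indicator K x * norm (f x) powr \<alpha>))" using i1 i3 by auto
 have ig: "integrable lborel (\<lambda>x. indicator K x * g x)"
 proof (rule Bochner_Integration.integrable_bound[OF Bochner_Integration.integrable_add[OF integrable_abs[OF ilo] integrable_abs[OF iup]]])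
  show "AE x in lborel. norm (indicator K x * g x) \<le> norm (\<bar>indicator K x * (W x * norm (f x)) - 2 * \<delta> * (indicator K x * W x)\<bar> +
   \<bar>indicator K x * (W x * norm (f x)) + \<epsilon> / \<alpha> * (indicator K x * norm (f x) powr \<alpha>)\<bar>)"
   using lo up by (intro AE_I2) (smt (verit) real_norm_def)
 qed (use gm in auto)
 have "(LBINT x. indicator K x * (W x * norm (f x)) - 2 * \<delta> * (indicator K x * W x)) \<le> (LBINT x. indicator K x * g x)"
  by (rule integral_mono[OF ilo ig lo])
 then show "(LBINT x. indicator K x * (W x * norm (f x))) - 2 * \<delta> * (LBINT x. indicator K x * W x)
   \<le> (LINT x|lebesgue_on K. G_star \<alpha> W \<epsilon> \<delta> x (f x))"
  unfolding gi using i1 i2 by simp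
 have "(LBINT x. indicator K x * g x) \<le> (LBINT x. indicator K x * (W x * norm (f x)) + \<epsilon> / \<alpha> * (indicator K x * norm (f x) powr \<alpha>))"
  by (rule integral_mono[OF ig iup up])
 then show "(LINT x|lebesgue_on K. G_star \<alpha> W \<epsilon> \<delta> x (f x)) \<le>
   (LBINT x. indicator K x * (W x * norm (f x))) + \<epsilon> / \<alpha> * (LBINT x. indicator K x * norm (f x) powr \<alpha>)"
  unfolding gi using i1 i3 by simp
qed

section \<open>Star-shaped and enlarged domains\<close>

lemma star_shaped_scale:
 assumes "strictly_star_shaped K" "a > 0"
 shows "strictly_star_shaped ((\<lambda>x. a *\<^sub>R x) ` K)"
 unfolding strictly_star_shaped_def
proof (intro ballI allI impI)
 fix y and l :: real assume y: "y \<in> (\<lambda>x. a *\<^sub>R x) ` K" and l: "0 \<le> l \<and> l < 1"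
 have int: "interior ((\<lambda>x. a *\<^sub>R x) ` K) = (\<lambda>x. a *\<^sub>R x) ` interior K"
  using assms(2) by (intro interior_injective_linear_image linear_scaleR) (auto simp: inj_on_def)
 obtain x where x: "x \<in> K" "y = a *\<^sub>R x" using y by auto
 have "l *\<^sub>R x \<in> interior K" using assms(1) x l by (auto simp: strictly_star_shaped_def)
 then have "a *\<^sub>R (l *\<^sub>R x) \<in> (\<lambda>x. a *\<^sub>R x) ` interior K" by blast
 then show "l *\<^sub>R y \<in> interior ((\<lambda>x. a *\<^sub>R x) ` K)" unfolding int x(2) by (simp add: mult.commute)
qed

lemma star_shaped_closure:
 fixes K :: "'a::euclidean_space set"
 assumes "strictly_star_shaped K" shows "K \<subseteq> closure (interior K)"
proof
 fix x assume x: "x \<in> K"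
 have "(\<lambda>n. (1 - inverse (real (Suc n))) *\<^sub>R x) \<longlonglongrightarrow> (1 - 0) *\<^sub>R x"
  by (intro tendsto_intros LIMSEQ_inverse_real_of_nat)
 moreover have "(1 - inverse (real (Suc n))) *\<^sub>R x \<in> interior K" for n
  using assms x unfolding strictly_star_shaped_def by (auto simp: inverse_le_1_iff)
 ultimately show "x \<in> closure (interior K)" unfolding closure_sequential
  by (intro exI[of _ "\<lambda>n. (1 - inverse (real (Suc n))) *\<^sub>R x"]) auto
qed

text \<open>A ray from the origin meets the frontier at most once, since all shorter multiples of a
  point of \<open>K\<close> are interior. Weak gradients are determined in the interior only; by
  this lemma that means almost everywhere on \<open>K\<close>.\<close>

lemma star_shaped_frontier_negligible:
 fixes K :: "'a::euclidean_space set"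
 assumes K: "compact K" and s: "strictly_star_shaped K"
 shows "negligible (frontier K)"
 unfolding negligible_iff_null_sets
proof (rule starlike_negligible_compact)
 show "compact (frontier K)" using K by (rule compact_frontier)
 fix c :: real and x :: 'a assume a: "c *\<^sub>R x \<in> frontier K" "0 \<le> c" "x \<in> frontier K"
 have fr: "frontier K \<subseteq> K" using K by (intro frontier_subset_closed compact_imp_closed)
 have ni: "y \<notin> interior K" if "y \<in> frontier K" for y using that by (auto simp: frontier_def)
 show "c = 1"
 proof (rule ccontr)
  assume "c \<noteq> 1"
  then consider "c < 1" | "c > 1" by linarith
  then show False
  proof cases
   case 1
   then have "c *\<^sub>R x \<in> interior K" using s a fr unfolding strictly_star_shaped_def by blast
   then show False using ni a by blast
  next
   \<comment> \<open>The roles are exchanged: x is now a shorter multiple of the frontier point c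
     x.\<close>
   case 2
   have "(1 / c) *\<^sub>R (c *\<^sub>R x) \<in> interior K" using s a(1) fr 2 unfolding strictly_star_shaped_def by (meson divide_less_eq_1_pos less_le_trans subsetD zero_le_divide_1_iff zero_le_one order_less_imp_le less_trans zero_less_one)
   then show False using ni[OF a(3)] 2 by simp
  qed
 qed
qed

locale gamma_setting =
 fixes \<Omega> \<Omega>t :: "'a::euclidean_space set" and w wh :: "'a => real" and \<alpha> :: real
  and \<mu>p \<mu>m :: "'a measure" and \<tau> :: "nat => real" and \<beta> :: "nat => 'a => real" and s :: "real => real"
 assumes compact_\<Omega>: "compact \<Omega>" and lipschitz: "bounded_lipschitz_domain (interior \<Omega>)"
  and star: "strictly_star_shaped \<Omega>"
  and w: "continuous_on \<Omega> w" "\<And>x. x \<in> \<Omega> ==> 0 \<le> w x"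
  and \<alpha>: "1 < \<alpha>" "\<alpha> * (real DIM('a) - 1) < real DIM('a)"
  and \<mu>p: "prob_space \<mu>p" "sets \<mu>p = sets borel" "emeasure \<mu>p (- \<Omega>) = 0"
  and \<mu>m: "prob_space \<mu>m" "sets \<mu>m = sets borel" "emeasure \<mu>m (- \<Omega>) = 0"
  and \<tau>: "\<And>n. \<tau> n > 0" "\<tau> \<longlonglongrightarrow> 0" and \<beta>: "mollifiers \<beta>"
  and s: "\<And>n. s (\<tau> n) > 0" "(\<lambda>n. s (\<tau> n)) \<longlonglongrightarrow> 0"
  and nested: "\<And>m n. \<tau> m > \<tau> n ==> enlarged s \<Omega> (\<tau> n) \<subseteq> enlarged s \<Omega> (\<tau> m)"
  and \<Omega>t: "\<Omega>t = (\<Union>n. enlarged s \<Omega> (\<tau> n))"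
  and wh: "continuous_on \<Omega>t wh" "\<And>x. x \<in> \<Omega> ==> wh x = w x" "(INF x\<in>\<Omega>t. wh x) = (INF x\<in>\<Omega>. w x)"
begin

lemma enlarged_props:
 assumes "e \<in> range \<tau>"
 shows "compact (enlarged s \<Omega> e)" "strictly_star_shaped (enlarged s \<Omega> e)" "\<Omega> \<subseteq> enlarged s \<Omega> e"
  "enlarged s \<Omega> e \<subseteq> \<Omega>t" "enlarged s \<Omega> e \<in> sets borel"
  "enlarged s \<Omega> e \<subseteq> closure (interior (enlarged s \<Omega> e))" "negligible (frontier (enlarged s \<Omega> e))"
proof -
 have a: "1 + s e > 0" using assms s by (auto intro: add_pos_pos)
 have s0: "s e > 0" using assms s by auto
 show c: "compact (enlarged s \<Omega> e)" unfolding enlarged_def using compact_\<Omega> by (rule compact_scaling)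
 show st: "strictly_star_shaped (enlarged s \<Omega> e)" unfolding enlarged_def using star a by (rule star_shaped_scale)
 show "\<Omega> \<subseteq> enlarged s \<Omega> e"
 proof
  fix x assume x: "x \<in> \<Omega>"
  have "(1 / (1 + s e)) *\<^sub>R x \<in> interior \<Omega>"
   using star x s0 a unfolding strictly_star_shaped_def by simp
  then have "(1 / (1 + s e)) *\<^sub>R x \<in> \<Omega>" using interior_subset by blast
  moreover have "x = (1 + s e) *\<^sub>R ((1 / (1 + s e)) *\<^sub>R x)" using a by simp
  ultimately show "x \<in> enlarged s \<Omega> e" unfolding enlarged_def by blast
 qed
 show "enlarged s \<Omega> e \<subseteq> \<Omega>t" unfolding \<Omega>t using assms by auto
 show "enlarged s \<Omega> e \<in> sets borel" using c by (rule borel_compact)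
 show "enlarged s \<Omega> e \<subseteq> closure (interior (enlarged s \<Omega> e))" by (rule star_shaped_closure[OF st])
 show "negligible (frontier (enlarged s \<Omega> e))" by (rule star_shaped_frontier_negligible[OF c st])
qed

lemma \<Omega>_nonempty: "\<Omega> \<noteq> {}" using lipschitz interior_subset by (auto simp: bounded_lipschitz_domain_def)

lemma \<Omega>_borel: "\<Omega> \<in> sets borel" using compact_\<Omega> by (rule borel_compact)

text \<open>As \<open>\<tau>\<close> is positive and tends to 0, its largest value is attained, and
  nesting makes the corresponding domain the whole union. Hence \<open>\<Omega>t\<close> is compact,
  and continuous fields on it are bounded.\<close>

lemma \<Omega>t_enlarged: "\<exists>m. \<Omega>t = enlarged s \<Omega> (\<tau> m)"
proof -
 have "\<forall>\<^sub>F n in sequentially. \<tau> n < \<tau> 0" using \<tau> by (intro order_tendstoD(2)) auto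
 then obtain N where N: "\<And>n. n \<ge> N ==> \<tau> n < \<tau> 0" by (auto simp: eventually_sequentially)
 have "Max (\<tau> ` {..N}) \<in> \<tau> ` {..N}" by (intro Max_in) auto
 then obtain m where m: "\<tau> m = Max (\<tau> ` {..N})" by (metis imageE)
 have le: "\<tau> n \<le> \<tau> m" if "n \<le> N" for n unfolding m using that by (intro Max_ge) auto
 have "\<tau> n \<le> \<tau> m" for n using N[of n] le[of n] le[of 0] by (cases "n \<le> N") auto
 then have "enlarged s \<Omega> (\<tau> n) \<subseteq> enlarged s \<Omega> (\<tau> m)" for n
  using nested[where m=m and n=n] by (cases "\<tau> n = \<tau> m") (auto simp: less_le)
 then show ?thesis unfolding \<Omega>t by (intro exI[of _ m]) blast
qed

lemma compact_\<Omega>t: "compact \<Omega>t" and \<Omega>_sub_\<Omega>t: "\<Omega> \<subseteq> \<Omega>t"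
 using \<Omega>t_enlarged enlarged_props(1,3) by auto

lemma \<Omega>t_borel: "\<Omega>t \<in> sets borel" using compact_\<Omega>t by (rule borel_compact)

text \<open>The extension keeps the infimum of \<open>w\<close>, which is nonnegative; continuity on
  a compact set makes the infimum a genuine lower bound. The duality with fields bounded by
  \<open>wh\<close> needs this.\<close>

lemma wh_nonneg: "x \<in> \<Omega>t ==> 0 \<le> wh x"
proof -
 assume x: "x \<in> \<Omega>t"
 have "bounded (wh ` \<Omega>t)" using compact_\<Omega>t wh(1) by (intro compact_imp_bounded compact_continuous_image)
 then have "(INF x\<in>\<Omega>t. wh x) \<le> wh x" using x by (intro cINF_lower bounded_imp_bdd_below)
 moreover have "0 \<le> (INF x\<in>\<Omega>. w x)" using w \<Omega>_nonempty by (intro cINF_greatest) auto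
 ultimately show ?thesis using wh(3) by simp
qed

lemma Inter_enlarged:
 assumes "\<And>k. x \<in> enlarged s \<Omega> (\<tau> k)" shows "x \<in> \<Omega>"
proof -
 have a: "1 + s (\<tau> k) > 0" for k using s by (simp add: add_pos_pos)
 have m: "(1 / (1 + s (\<tau> k))) *\<^sub>R x \<in> \<Omega>" for k
 proof -
  obtain y where "y \<in> \<Omega>" "x = (1 + s (\<tau> k)) *\<^sub>R y" using assms[of k] by (auto simp: enlarged_def)
  then show ?thesis using a[of k] by simp
 qed
 have "(\<lambda>k. (1 / (1 + s (\<tau> k))) *\<^sub>R x) \<longlonglongrightarrow> (1 / (1 + 0)) *\<^sub>R x"
  by (intro tendsto_intros s) auto
 then show ?thesis using closed_sequentially[OF compact_imp_closed[OF compact_\<Omega>] m] by auto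
qed

lemma enlarged_eventually:
 assumes "\<And>n. \<epsilon> n \<in> range \<tau>" "\<epsilon> \<longlonglongrightarrow> 0"
 shows "\<forall>\<^sub>F n in sequentially. enlarged s \<Omega> (\<epsilon> n) \<subseteq> enlarged s \<Omega> (\<tau> k)"
proof -
 have "\<forall>\<^sub>F n in sequentially. \<epsilon> n < \<tau> k" using assms(2) \<tau> by (intro order_tendstoD(2)) auto
 then show ?thesis
 proof eventually_elim
  case (elim n)
  obtain m where "\<epsilon> n = \<tau> m" using assms(1)[of n] by auto
  then show ?case using nested[of m k] elim by simp
 qed
qed

end

lemma weighted_variation:
 fixes K :: "'a::euclidean_space set" and q :: "'a set => 'a"
 assumes r: "represents q M f" and fin: "finite_measure M" and K: "compact K"
  and w: "continuous_on K w" "\<And>x. x \<in> K ==> 0 \<le> w x"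
 shows "(\<integral>\<^sup>+x\<in>K. ennreal (w x) \<partial>total_variation q) = ennreal (LINT x|M. indicator K x * (w x * norm (f x)))"
  and "integrable M (\<lambda>x. indicator K x * (w x * norm (f x)))"
proof -
 have sM[measurable_cong]: "sets M = sets borel" and f: "integrable M f" using r by (auto simp: represents_def)
 have fm[measurable]: "f \<in> borel_measurable M" using f by auto
 have wm: "(\<lambda>x. indicator K x * w x) \<in> borel_measurable borel"
  using compact_indicator(1)[OF K w(1)] by simp
 then have wM[measurable]: "(\<lambda>x. indicator K x * w x) \<in> borel_measurable M" by simp
 obtain B where "\<And>x. \<bar>indicator K x * w x\<bar> \<le> B" using compact_indicator(2)[OF K w(1)] by auto
 then have "integrable M (\<lambda>x. (indicator K x * w x) * norm (f x))"
  using f wM by (intro integrable_bounded_mult) auto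
 then show i: "integrable M (\<lambda>x. indicator K x * (w x * norm (f x)))" by (simp add: mult.assoc)
 have w0: "0 \<le> indicator K x * w x" for x using w(2) by (auto simp: indicator_def)
 have "(\<integral>\<^sup>+x\<in>K. ennreal (w x) \<partial>total_variation q) = (\<integral>\<^sup>+x. ennreal (indicator K x * w x) \<partial>total_variation q)"
  by (intro nn_integral_cong) (auto simp: indicator_def)
 also have "\<dots> = (\<integral>\<^sup>+x. ennreal (norm (f x)) * ennreal (indicator K x * w x) \<partial>M)"
  unfolding total_variation_density[OF r fin] by (rule nn_integral_density) auto
 also have "\<dots> = (\<integral>\<^sup>+x. ennreal (indicator K x * (w x * norm (f x))) \<partial>M)"
  using w0 by (intro nn_integral_cong) (simp add: ennreal_mult[symmetric] mult_ac)
 also have "\<dots> = ennreal (LINT x|M. indicator K x * (w x * norm (f x)))"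
  using i w(2) by (intro nn_integral_eq_integral AE_I2) (auto simp: indicator_def)
 finally show "(\<integral>\<^sup>+x\<in>K. ennreal (w x) \<partial>total_variation q) = ennreal (LINT x|M. indicator K x * (w x * norm (f x)))" .
qed

lemma vector_integral_restrict:
 fixes \<psi> :: "'a::euclidean_space => 'a"
 assumes r: "represents q M f" and K: "compact K" "continuous_on K \<psi>" and E: "E \<subseteq> K" "E \<in> sets borel"
  and z: "AE x in M. x \<notin> E \<longrightarrow> f x = 0"
 shows "vector_integral K q \<psi> = (LINT x|M. indicator E x * (\<psi> x \<bullet> f x))"
  and "integrable M (\<lambda>x. indicator E x * (\<psi> x \<bullet> f x))"
proof -
 note v = vector_integral_represents[OF r K]
 have sM: "sets M = sets borel" using r by (auto simp: represents_def)
 have i: "integrable M (\<lambda>x. indicator E x * (indicator K x * (\<psi> x \<bullet> f x)))"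
  by (rule integrable_indicator_mult[OF _ v(2)]) (simp add: E sM)
 have eq: "(\<lambda>x. indicator E x * (indicator K x * (\<psi> x \<bullet> f x))) = (\<lambda>x. indicator E x * (\<psi> x \<bullet> f x))"
  using E by (auto simp: indicator_def fun_eq_iff)
 show i': "integrable M (\<lambda>x. indicator E x * (\<psi> x \<bullet> f x))" using i unfolding eq .
 show "vector_integral K q \<psi> = (LINT x|M. indicator E x * (\<psi> x \<bullet> f x))"
  unfolding v(1)
 proof (rule LINT_cong_AE)
  show "AE x in M. indicator K x * (\<psi> x \<bullet> f x) = indicator E x * (\<psi> x \<bullet> f x)"
   using z by eventually_elim (use E(1) in \<open>auto simp: indicator_def\<close>)
 qed (use v(2) i' in auto)
qed

context gamma_setting
begin

section \<open>Fields of finite regularised energy\<close>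

lemma regular_density:
 assumes e: "e \<in> range \<tau>" and H: "H_reg \<alpha> wh (enlarged s \<Omega> e) \<mu>p \<mu>m d \<delta> q < \<infinity>"
 shows "represents q lborel (vector_RN_deriv q)"
  and "AE x in lborel. x \<notin> enlarged s \<Omega> e \<longrightarrow> vector_RN_deriv q x = 0"
  and "vector_RN_deriv q \<in> Lp \<alpha> (enlarged s \<Omega> e)"
  and "eq_sobolev_dual_perp \<alpha> (enlarged s \<Omega> e) (div_Lp (enlarged s \<Omega> e) (vector_RN_deriv q)) (measure_functional (enlarged s \<Omega> e) \<mu>p \<mu>m)"
  and "H_reg \<alpha> wh (enlarged s \<Omega> e) \<mu>p \<mu>m d \<delta> q = ereal (\<integral>x. G_star \<alpha> wh d \<delta> x (vector_RN_deriv q x) \<partial>lebesgue_on (enlarged s \<Omega> e))"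
proof -
 have h: "q \<in> vector_measures (enlarged s \<Omega> e)" "abs_cont q" "vector_RN_deriv q \<in> Lp \<alpha> (enlarged s \<Omega> e)"
  "eq_sobolev_dual_perp \<alpha> (enlarged s \<Omega> e) (div_Lp (enlarged s \<Omega> e) (vector_RN_deriv q)) (measure_functional (enlarged s \<Omega> e) \<mu>p \<mu>m)"
  using H unfolding H_reg_def by (auto split: if_splits)
 show "vector_RN_deriv q \<in> Lp \<alpha> (enlarged s \<Omega> e)"
  "eq_sobolev_dual_perp \<alpha> (enlarged s \<Omega> e) (div_Lp (enlarged s \<Omega> e) (vector_RN_deriv q)) (measure_functional (enlarged s \<Omega> e) \<mu>p \<mu>m)"
  using h by auto
 show "H_reg \<alpha> wh (enlarged s \<Omega> e) \<mu>p \<mu>m d \<delta> q = ereal (\<integral>x. G_star \<alpha> wh d \<delta> x (vector_RN_deriv q x) \<partial>lebesgue_on (enlarged s \<Omega> e))"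
  unfolding H_reg_def using h by (intro if_P) auto
 show r: "represents q lborel (vector_RN_deriv q)"
  using h(1,2) by (intro vector_RN_deriv_represents vector_measures_caf)
 have "AE x in lborel. x \<in> - enlarged s \<Omega> e \<longrightarrow> vector_RN_deriv q x = 0"
 proof (rule represents_zero_on[OF lborel.sigma_finite_measure_axioms r])
  show "- enlarged s \<Omega> e \<in> sets borel" using enlarged_props(5)[OF e] by auto
  show "q A = 0" if "A \<in> sets borel" "A \<subseteq> - enlarged s \<Omega> e" for A
   using h(1) that unfolding vector_measures_def by blast
 qed
 then show "AE x in lborel. x \<notin> enlarged s \<Omega> e \<longrightarrow> vector_RN_deriv q x = 0" by simp
qed

lemma set_integral_enlarged:
 assumes "prob_space \<mu>" "sets \<mu> = sets borel" "emeasure \<mu> (- \<Omega>) = 0" and E: "E \<in> sets borel" "\<Omega> \<subseteq> E"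
  and f: "integrable \<mu> (\<lambda>x. indicator E x * f x)" "integrable \<mu> (\<lambda>x. indicator \<Omega> x * f x)"
 shows "(LINT x:E|\<mu>. f x) = (LINT x:\<Omega>|\<mu>. (f x::real))"
proof -
 have "- \<Omega> \<in> null_sets \<mu>" using assms(2,3) \<Omega>_borel by (intro null_setsI) auto
 then have "AE x in \<mu>. x \<in> \<Omega>" using AE_not_in by fastforce
 then have "AE x in \<mu>. indicator E x * f x = indicator \<Omega> x * f x"
  by eventually_elim (use E in \<open>auto simp: indicator_def\<close>)
 then show ?thesis unfolding set_lebesgue_integral_def real_scaleR_def
  using f by (intro LINT_cong_AE) auto
qed

text \<open>Subtracting the mean of \<open>u\<close> gives an admissible Sobolev test function.\<close>
lemma regular_divergence:
 assumes e: "e \<in> range \<tau>" and H: "H_reg \<alpha> wh (enlarged s \<Omega> e) \<mu>p \<mu>m d \<delta> q < \<infinity>"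
  and u: "continuous_on (enlarged s \<Omega> e) u" "continuous_on (enlarged s \<Omega> e) g"
   "\<And>x. x \<in> interior (enlarged s \<Omega> e) ==> (u has_derivative (\<lambda>v. g x \<bullet> v)) (at x)"
 shows "- (LBINT x. indicator (enlarged s \<Omega> e) x * (g x \<bullet> vector_RN_deriv q x)) =
  (LINT x:\<Omega>|\<mu>p. u x) - (LINT x:\<Omega>|\<mu>m. u x)"
proof -
 define E where "E = enlarged s \<Omega> e"
 define f where "f = vector_RN_deriv q"
 note EP = enlarged_props[OF e, folded E_def]
 note R = regular_density[OF e H, folded E_def f_def]
 have ac: "conj_exp \<alpha> \<ge> 1" using \<alpha> by (simp add: conj_exp_def field_simps)
 then have ac0: "conj_exp \<alpha> > 0" by linarith
 have u': "continuous_on E u" "continuous_on E g" "\<And>x. x \<in> interior E ==> (u has_derivative (\<lambda>v. g x \<bullet> v)) (at x)"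
  using u unfolding E_def .
 have ne: "interior \<Omega> \<noteq> {}" using lipschitz by (auto simp: bounded_lipschitz_domain_def)
 have fmE: "emeasure lborel E < \<infinity>" using EP(1) by (intro emeasure_bounded_finite compact_imp_bounded)
 \<comment> \<open>Positive volume is needed to divide by it in the mean m.\<close>
 have "0 < emeasure lborel (interior \<Omega>)"
 proof -
  have "\<not> negligible (interior \<Omega>)" using ne by (intro open_not_negligible) auto
  then have "emeasure lborel (interior \<Omega>) \<noteq> 0" by (simp add: negligible_iff_null_sets null_sets_def)
  then show ?thesis by (simp add: zero_less_iff_neq_zero)
 qed
 also have "\<dots> \<le> emeasure lborel E" using EP(3,5) interior_subset[of \<Omega>] by (intro emeasure_mono) auto
 finally have Epos: "0 < measure lborel E" using fmE by (simp add: measure_def enn2real_positive_iff)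
 define m where "m = (LINT x|lebesgue_on E. u x) / measure lborel E"
 define v where "v x = u x - m" for x
 have vc: "continuous_on E v" unfolding v_def by (intro continuous_intros u')
 have vd: "(v has_derivative (\<lambda>h. g x \<bullet> h)) (at x)" if "x \<in> interior E" for x
  unfolding v_def using u'(3)[OF that] by (auto intro!: derivative_eq_intros)
 have wg: "is_weak_gradient (interior E) v g" by (rule is_weak_gradient_C1[OF EP(1) vc vd u'(2)])
 have uL: "integrable (lebesgue_on E) h" if "continuous_on E h" for h :: "'a => real"
 proof -
  have "h \<in> borel_measurable (lebesgue_on E)" "integrable (lebesgue_on E) (\<lambda>x. norm (h x))"
   using continuous_Lp[OF EP(1) that, of 1] unfolding Lp_def by auto
  then show ?thesis using integrable_norm_iff by blast
 qed
 have c1: "integrable (lebesgue_on E) (\<lambda>x. m)" by (rule uL) (rule continuous_on_const)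
 have "(LINT x|lebesgue_on E. v x) = (LINT x|lebesgue_on E. u x) - (LINT x|lebesgue_on E. m)"
  unfolding v_def by (rule LINT_diff[OF uL[OF u'(1)] c1])
 also have "(LINT x|lebesgue_on E. m) = m * measure lborel E"
  using EP(5) by (simp add: measure_restrict_space)
 finally have v0: "(LINT x|lebesgue_on E. v x) = 0" using Epos by (simp add: m_def)
 have vs: "v \<in> sobolev_mean0 (conj_exp \<alpha>) E"
  unfolding sobolev_mean0_def sobolev_def
  using continuous_Lp[OF EP(1) vc ac0] continuous_Lp[OF EP(1) u'(2) ac0] wg v0 by blast
 have eqn: "div_Lp E f v = measure_functional E \<mu>p \<mu>m v"
  using R(4) vs by (auto simp: eq_sobolev_dual_perp_def)
 have g1: "g \<in> Lp 1 E" by (rule continuous_Lp[OF EP(1) u'(2)]) simp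
 note W = weak_gradient_AE[OF \<beta> EP(1) g1 wg]
 have fi: "integrable lborel f" using R(1) by (simp add: represents_def)
 have fm[measurable]: "f \<in> borel_measurable borel" using fi by (auto dest: borel_measurable_integrable)
 define gi where "gi x = indicator E x *\<^sub>R g x" for x
 have gim[measurable]: "gi \<in> borel_measurable borel"
  using compact_indicator(1)[OF EP(1) u'(2)] by (simp add: gi_def[abs_def])
 \<comment> \<open>The frontier is null, so the weak gradient, identified in the interior, is
   identified almost everywhere on E.\<close>
 have fr: "AE x in lebesgue_on E. x \<notin> frontier E"
 proof -
  have "frontier E \<in> null_sets lborel" using EP(7) by (simp add: negligible_iff_null_sets null_sets_def)
  then have "AE x in lborel. x \<notin> frontier E" by (rule AE_not_in)
  then show ?thesis unfolding AE_lebesgue_on[OF EP(5)] by eventually_elim simp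
 qed
 have fml: "f \<in> borel_measurable (lebesgue_on E)"
  using R(3) by (simp add: Lp_def)
 have gml: "gi \<in> borel_measurable (lebesgue_on E)"
  using gim by (intro measurable_restrict_space1 measurable_completion) simp
 have "(LINT x|lebesgue_on E. f x \<bullet> weak_gradient E v x) = (LINT x|lebesgue_on E. gi x \<bullet> f x)"
 proof (rule LINT_cong_AE)
  have "AE x in lebesgue_on E. x \<in> E" using AE_lebesgue_on[OF EP(5)] by simp
  with W(1) fr show "AE x in lebesgue_on E. f x \<bullet> weak_gradient E v x = gi x \<bullet> f x"
  proof eventually_elim
   case (elim x)
   then have "x \<in> interior E" using closure_subset[of E] by (auto simp: frontier_def)
   with elim show ?case by (simp add: gi_def inner_commute)
  qed
  have "weak_gradient E v \<in> borel_measurable (lebesgue_on E)" using W(2) by (simp add: Lp_def)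
  then show "(\<lambda>x. f x \<bullet> weak_gradient E v x) \<in> borel_measurable (lebesgue_on E)"
   by (intro borel_measurable_inner fml)
  show "(\<lambda>x. gi x \<bullet> f x) \<in> borel_measurable (lebesgue_on E)"
   by (intro borel_measurable_inner gml fml)
 qed
 also have "\<dots> = (LBINT x. indicator E x *\<^sub>R (gi x \<bullet> f x))"
  by (rule lebesgue_on_borel(2)[OF EP(5)]) measurable
 also have "\<dots> = (LBINT x. indicator E x * (g x \<bullet> f x))"
  by (intro LINT_cong) (auto simp: gi_def indicator_def)
 finally have L: "div_Lp E f v = - (LBINT x. indicator E x * (g x \<bullet> f x))" by (simp add: div_Lp_def)
 have "\<exists>\<psi>. continuous_on E \<psi> \<and> (AE x in lebesgue_on E. \<psi> x = v x)" using vc by auto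
 from someI_ex[OF this] have cr: "continuous_on E (cont_rep E v)" "AE x in lebesgue_on E. cont_rep E v x = v x"
  unfolding cont_rep_def[symmetric] by auto
 \<comment> \<open>The chosen representative agrees with v almost everywhere by definition;
   continuity upgrades this to every point of E, so the integrals against the two probability
   measures agree as well.\<close>
 have cv: "cont_rep E v x = v x" if "x \<in> E" for x
  using cr(2) unfolding AE_lebesgue_on[OF EP(5)] by (rule continuous_AE_unique[OF EP(1,6) cr(1) vc _ that])
 have part: "(LINT x:E|\<mu>. cont_rep E v x) = (LINT x:\<Omega>|\<mu>. u x) - m"
  if \<mu>: "prob_space \<mu>" "sets \<mu> = sets borel" "emeasure \<mu> (- \<Omega>) = 0" for \<mu>
 proof -
  have fin: "finite_measure \<mu>" using \<mu>(1) by (simp add: prob_space_def)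
  have iE: "integrable \<mu> (\<lambda>x. indicator E x * h x)" if "continuous_on E h" for h :: "'a => real"
   using set_integrable_continuous_finite[OF fin \<mu>(2) EP(1) that] .
  have i\<Omega>: "integrable \<mu> (\<lambda>x. indicator \<Omega> x * h x)" if "continuous_on E h" for h :: "'a => real"
   using set_integrable_continuous_finite[OF fin \<mu>(2) compact_\<Omega> continuous_on_subset[OF that EP(3)]] .
  have "(LINT x:E|\<mu>. cont_rep E v x) = (LINT x:E|\<mu>. v x)"
   unfolding set_lebesgue_integral_def by (intro LINT_cong) (auto simp: indicator_def cv)
  also have "\<dots> = (LINT x:\<Omega>|\<mu>. v x)" by (rule set_integral_enlarged[OF \<mu> EP(5,3) iE[OF vc] i\<Omega>[OF vc]])
  also have "\<dots> = (LINT x:\<Omega>|\<mu>. u x) - (LINT x:\<Omega>|\<mu>. m)" unfolding v_def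
   by (rule set_integral_diff) (use i\<Omega>[OF u'(1)] i\<Omega>[OF continuous_on_const] in \<open>auto simp: set_integrable_def\<close>)
  also have "(LINT x:\<Omega>|\<mu>. m) = m" by (rule set_integral_const_prob[OF \<mu> \<Omega>_borel])
  finally show ?thesis .
 qed
 have "measure_functional E \<mu>p \<mu>m v = (LINT x:\<Omega>|\<mu>p. u x) - (LINT x:\<Omega>|\<mu>m. u x)"
  unfolding measure_functional_def using part[OF \<mu>p] part[OF \<mu>m] by simp
 then show ?thesis using eqn L by (simp add: E_def f_def)
qed

text \<open>A pair in \<open>C1_mean0\<close> is differentiable only inside \<Omega>, while the
  regularised fields see a whole enlarged domain. Dilating the test function reaches that domain
  without extending it beyond \<Omega>.\<close>

lemma scaled_pair_continuous:
 fixes \<phi> :: "'a => real" and g :: "'a => 'a"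
 assumes \<phi>: "continuous_on \<Omega> \<phi>" "continuous_on \<Omega> g"
   "\<forall>x\<in>interior \<Omega>. (\<phi> has_derivative (\<lambda>v. g x \<bullet> v)) (at x)"
  and e: "e \<in> range \<tau>" and a: "a = 1 / (1 + s e)"
 shows "continuous_on (enlarged s \<Omega> e) (\<lambda>x. \<phi> (a *\<^sub>R x))" "continuous_on (enlarged s \<Omega> e) (\<lambda>x. a *\<^sub>R g (a *\<^sub>R x))"
  "x \<in> interior (enlarged s \<Omega> e) ==> ((\<lambda>x. \<phi> (a *\<^sub>R x)) has_derivative (\<lambda>v. (a *\<^sub>R g (a *\<^sub>R x)) \<bullet> v)) (at x)"
proof -
 have s1: "1 + s e > 0" using e s by (auto intro: add_pos_pos)
 have inv: "(\<lambda>x. a *\<^sub>R x) ` enlarged s \<Omega> e = \<Omega>"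
  using s1 unfolding enlarged_def image_image a by simp
 have int: "interior (enlarged s \<Omega> e) = (\<lambda>x. (1 + s e) *\<^sub>R x) ` interior \<Omega>"
  unfolding enlarged_def using s1 by (intro interior_injective_linear_image linear_scaleR) (auto simp: inj_on_def)
 have c: "continuous_on (enlarged s \<Omega> e) (\<lambda>x. a *\<^sub>R x)" by (intro continuous_intros)
 show "continuous_on (enlarged s \<Omega> e) (\<lambda>x. \<phi> (a *\<^sub>R x))"
  by (rule continuous_on_compose2[OF \<phi>(1) c]) (simp add: inv)
 show "continuous_on (enlarged s \<Omega> e) (\<lambda>x. a *\<^sub>R g (a *\<^sub>R x))"
  by (intro continuous_intros continuous_on_compose2[OF \<phi>(2) c]) (simp add: inv)
 assume "x \<in> interior (enlarged s \<Omega> e)"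
 then have "a *\<^sub>R x \<in> interior \<Omega>" using s1 unfolding int a by auto
 then have d: "(\<phi> has_derivative (\<lambda>v. g (a *\<^sub>R x) \<bullet> v)) (at (a *\<^sub>R x))" using \<phi>(3) by blast
 have "((\<lambda>x. a *\<^sub>R x) has_derivative (\<lambda>v. a *\<^sub>R v)) (at x)" by (auto intro!: derivative_eq_intros)
 from has_derivative_compose[OF this d]
 show "((\<lambda>x. \<phi> (a *\<^sub>R x)) has_derivative (\<lambda>v. (a *\<^sub>R g (a *\<^sub>R x)) \<bullet> v)) (at x)" by simp
qed

text \<open>Star-shapedness keeps the contracted points in \<Omega>, so the integrands are defined,
  bounded by a multiple of the norm of \<open>f\<close>, and converge pointwise by
  continuity.\<close>

lemma scaled_integral_limit:
 fixes h :: "'a => 'b::euclidean_space" and f :: "'a => 'b"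
 assumes M: "sets M = sets borel" and f: "integrable M f" and h: "continuous_on \<Omega> h"
 shows "(\<lambda>k. LINT x|M. indicator \<Omega> x * (h ((1 / (1 + s (\<tau> k))) *\<^sub>R x) \<bullet> f x)) \<longlonglongrightarrow> (LINT x|M. indicator \<Omega> x * (h x \<bullet> f x))"
proof -
 define a where "a k = 1 / (1 + s (\<tau> k))" for k
 have a: "0 \<le> a k" "a k \<le> 1" "a k < 1" for k using s(1)[of k] by (auto simp: a_def)
 have al: "a \<longlonglongrightarrow> 1 / (1 + 0)" unfolding a_def[abs_def] by (intro tendsto_intros s) auto
 have ax: "a k *\<^sub>R x \<in> \<Omega>" if "x \<in> \<Omega>" for k x
  using star that a[of k] interior_subset[of \<Omega>] unfolding strictly_star_shaped_def by blast
 obtain B where B: "B \<ge> 0" "\<And>x. norm (indicator \<Omega> x *\<^sub>R h x) \<le> B"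
  using compact_indicator(2)[OF compact_\<Omega> h] by auto
 have Bh: "norm (h x) \<le> B" if "x \<in> \<Omega>" for x using B(2)[of x] that by simp
 have fm: "f \<in> borel_measurable M" using f by auto
 have bm: "(\<lambda>x. indicator \<Omega> x * (h (c *\<^sub>R x) \<bullet> f x)) \<in> borel_measurable M" if c: "\<And>x. x \<in> \<Omega> ==> c *\<^sub>R x \<in> \<Omega>" for c
 proof -
  have "continuous_on \<Omega> (\<lambda>x. h (c *\<^sub>R x))"
   by (rule continuous_on_compose2[OF h]) (use c in \<open>auto intro!: continuous_intros\<close>)
  then have "(\<lambda>x. indicator \<Omega> x *\<^sub>R h (c *\<^sub>R x)) \<in> borel_measurable borel"
   by (rule compact_indicator(1)[OF compact_\<Omega>])
  then have "(\<lambda>x. indicator \<Omega> x *\<^sub>R h (c *\<^sub>R x)) \<in> borel_measurable M" using M by (simp cong: measurable_cong_sets)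
  from borel_measurable_inner[OF this fm] show ?thesis by simp
 qed
 show ?thesis unfolding a_def[symmetric]
 proof (rule integral_dominated_convergence)
  show "(\<lambda>x. indicator \<Omega> x * (h x \<bullet> f x)) \<in> borel_measurable M" using bm[of 1] by simp
  show "(\<lambda>x. indicator \<Omega> x * (h (a k *\<^sub>R x) \<bullet> f x)) \<in> borel_measurable M" for k using ax by (rule bm)
  show "integrable M (\<lambda>x. B * norm (f x))" using f by auto
  show "AE x in M. norm (indicator \<Omega> x * (h (a k *\<^sub>R x) \<bullet> f x)) \<le> B * norm (f x)" for k
  proof (intro AE_I2)
   fix x
   have "\<bar>h (a k *\<^sub>R x) \<bullet> f x\<bar> \<le> B * norm (f x)" if "x \<in> \<Omega>"
    using Cauchy_Schwarz_ineq2[of "h (a k *\<^sub>R x)" "f x"] mult_right_mono[OF Bh[OF ax[OF that, of k]], of "norm (f x)"] by simp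
   then show "norm (indicator \<Omega> x * (h (a k *\<^sub>R x) \<bullet> f x)) \<le> B * norm (f x)"
    using B(1) by (auto simp: indicator_def)
  qed
  show "AE x in M. (\<lambda>k. indicator \<Omega> x * (h (a k *\<^sub>R x) \<bullet> f x)) \<longlonglongrightarrow> indicator \<Omega> x * (h x \<bullet> f x)"
  proof (intro AE_I2)
   fix x :: 'a
   have "(\<lambda>k. a k *\<^sub>R x) \<longlonglongrightarrow> (1 / (1 + 0)) *\<^sub>R x" by (rule tendsto_scaleR[OF al tendsto_const])
   then have l: "(\<lambda>k. a k *\<^sub>R x) \<longlonglongrightarrow> x" by simp
   have "(\<lambda>k. h (a k *\<^sub>R x)) \<longlonglongrightarrow> h x" if x: "x \<in> \<Omega>"
    by (rule continuous_on_tendsto_compose[OF h l x]) (use ax[OF x] in auto)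
   then show "(\<lambda>k. indicator \<Omega> x * (h (a k *\<^sub>R x) \<bullet> f x)) \<longlonglongrightarrow> indicator \<Omega> x * (h x \<bullet> f x)"
    by (cases "x \<in> \<Omega>") (auto intro!: tendsto_intros)
  qed
 qed
qed

end

section \<open>Lower bound\<close>

text \<open>Here all energies lie below one constant; the contradiction argument in
  \<open>liminf_inequality\<close> reaches this situation by passing to a subsequence.\<close>

locale liminf_setting = gamma_setting \<Omega> for \<Omega> :: "'a::euclidean_space set" +
 fixes \<epsilon> \<delta> :: "nat => real" and qs :: "nat => 'a set => 'a" and q :: "'a set => 'a" and C :: real
 assumes \<epsilon>: "\<And>n. \<epsilon> n \<in> range \<tau>" "\<epsilon> \<longlonglongrightarrow> 0" and \<delta>: "\<And>n. \<delta> n > 0" "\<delta> \<longlonglongrightarrow> 0"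
  and q: "q \<in> vector_measures \<Omega>t" and conv: "weak_star_conv \<Omega>t qs q"
  and bound: "\<And>n. H_reg \<alpha> wh (enlarged s \<Omega> (\<epsilon> n)) \<mu>p \<mu>m (\<epsilon> n) (\<delta> n) (qs n) < ereal C"
begin

abbreviation "E n \<equiv> enlarged s \<Omega> (\<epsilon> n)"
abbreviation "fs n \<equiv> vector_RN_deriv (qs n)"

lemma fin: "H_reg \<alpha> wh (E n) \<mu>p \<mu>m (\<epsilon> n) (\<delta> n) (qs n) < \<infinity>"
 using bound[of n] by (rule less_le_trans) simp

lemmas EP = enlarged_props[OF \<epsilon>(1)]
lemmas regular = regular_density[OF \<epsilon>(1) fin]

lemma pairing:
 assumes "continuous_on \<Omega>t \<psi>"
 shows "vector_integral \<Omega>t (qs n) \<psi> = (LBINT x. indicator (E n) x * (\<psi> x \<bullet> fs n x))"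
  and "integrable lborel (\<lambda>x. indicator (E n) x * (\<psi> x \<bullet> fs n x))"
 using vector_integral_restrict[OF regular(1) compact_\<Omega>t assms EP(4,5) regular(2)] by auto

lemma pairing_limit:
 assumes "represents q M f" "continuous_on \<Omega>t \<psi>"
 shows "(\<lambda>n. LINT x|lborel. indicator (E n) x * (\<psi> x \<bullet> fs n x)) \<longlonglongrightarrow> (LINT x|M. indicator \<Omega>t x * (\<psi> x \<bullet> f x))"
 using conv assms(2) unfolding weak_star_conv_def vector_integral_represents(1)[OF assms(1) compact_\<Omega>t assms(2), symmetric]
  pairing(1)[OF assms(2), symmetric] by blast

text \<open>Fields bounded by the distance to the k-th domain vanish on it, so they do not see the
  approximating measures once these live inside. By duality the limit has no mass where this
  distance is positive, and the domains intersect in \<Omega>.\<close>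

lemma limit_supported:
 assumes r: "represents q M f"
 shows "AE x in M. x \<in> \<Omega>t \<longrightarrow> x \<notin> \<Omega> \<longrightarrow> f x = 0"
proof -
 have sM: "sets M = sets borel" and f: "integrable M f" using r by (auto simp: represents_def)
 have "AE x in M. x \<in> \<Omega>t \<longrightarrow> x \<notin> enlarged s \<Omega> (\<tau> k) \<longrightarrow> f x = 0" for k
 proof -
  define D where "D = enlarged s \<Omega> (\<tau> k)"
  have DP: "compact D" "D \<noteq> {}" unfolding D_def using enlarged_props(1,3)[of "\<tau> k"] \<Omega>_nonempty by auto
  have Wc: "continuous_on \<Omega>t (\<lambda>x. infdist x D)" by (intro continuous_intros)
  have i: "integrable M (\<lambda>x. indicator \<Omega>t x * (infdist x D * norm (f x)))"
  proof -
   obtain B where B: "\<And>x. \<bar>indicator \<Omega>t x * infdist x D\<bar> \<le> B"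
    using compact_indicator(2)[OF compact_\<Omega>t Wc] by auto
   have "(\<lambda>x. indicator \<Omega>t x * infdist x D) \<in> borel_measurable M"
    using compact_indicator(1)[OF compact_\<Omega>t Wc] sM by (simp cong: measurable_cong_sets)
   then have "integrable M (\<lambda>x. (indicator \<Omega>t x * infdist x D) * norm (f x))"
    using f B by (intro integrable_bounded_mult) auto
   then show ?thesis by (simp add: mult.assoc)
  qed
  have "(LINT x|M. indicator \<Omega>t x * (infdist x D * norm (f x))) \<le> 0"
  proof (rule integral_norm_le_by_duality[OF sM f compact_\<Omega>t Wc])
   show "0 \<le> infdist x D" for x by (rule infdist_nonneg)
   fix \<psi> :: "'a => 'a" assume \<psi>: "continuous_on \<Omega>t \<psi>" "\<And>x. x \<in> \<Omega>t ==> norm (\<psi> x) \<le> infdist x D"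
   have ev: "\<forall>\<^sub>F n in sequentially. (LBINT x. indicator (E n) x * (\<psi> x \<bullet> fs n x)) = 0"
    using enlarged_eventually[OF \<epsilon>, of k]
   proof eventually_elim
    case (elim n)
    have f0: "indicator (E n) x * (\<psi> x \<bullet> fs n x) = (0::real)" for x
     using \<psi>(2)[of x] elim EP(4)[of n] by (auto simp: indicator_def D_def subset_iff)
    show ?case by (simp only: f0 LINT_zero)
   qed
   have "(LINT x|M. indicator \<Omega>t x * (\<psi> x \<bullet> f x)) = 0"
    by (rule LIMSEQ_unique[OF pairing_limit[OF r \<psi>(1)]]) (rule tendsto_eventually[OF ev])
   then show "(LINT x|M. indicator \<Omega>t x * (\<psi> x \<bullet> f x)) \<le> 0" by simp
  qed
  moreover have nn: "0 \<le> indicator \<Omega>t x * (infdist x D * norm (f x))" for x by (simp add: infdist_nonneg)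
  ultimately have "(LINT x|M. indicator \<Omega>t x * (infdist x D * norm (f x))) = 0"
   by (meson LINT_nonneg antisym)
  then have "AE x in M. indicator \<Omega>t x * (infdist x D * norm (f x)) = 0"
   using integral_nonneg_eq_0_iff_AE[OF i] nn by simp
  then show ?thesis
  proof eventually_elim
   case (elim x)
   have "infdist x D \<noteq> 0" if "x \<notin> D" using that DP by (metis in_closed_iff_infdist_zero compact_imp_closed)
   then show ?case using elim by (auto simp: D_def)
  qed
 qed
 then have "AE x in M. \<forall>k. x \<in> \<Omega>t \<longrightarrow> x \<notin> enlarged s \<Omega> (\<tau> k) \<longrightarrow> f x = 0" unfolding AE_all_countable by blast
 then show ?thesis by eventually_elim (use Inter_enlarged in blast)
qed

text \<open>For fixed k the dilated test function is admissible for all large n, so its identity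
  passes exactly to the limit in n. Only afterwards does k tend to infinity and the dilation to the
  identity.\<close>

lemma limit_divergence:
 assumes r: "represents q M f" and z: "AE x in M. x \<notin> \<Omega> \<longrightarrow> f x = 0"
 shows "div_measure_eq \<Omega> q \<mu>p \<mu>m"
 unfolding div_measure_eq_def
proof clarify
 fix \<phi> :: "'a => real" and g :: "'a => 'a" assume "(\<phi>, g) \<in> C1_mean0 \<Omega>"
 then have \<phi>: "continuous_on \<Omega> \<phi>" "continuous_on \<Omega> g"
   "\<forall>x\<in>interior \<Omega>. (\<phi> has_derivative (\<lambda>v. g x \<bullet> v)) (at x)"
  by (auto simp: C1_mean0_def)
 have sM: "sets M = sets borel" and f: "integrable M f" using r by (auto simp: represents_def)
 define a where "a k = 1 / (1 + s (\<tau> k))" for k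
 have al: "a \<longlonglongrightarrow> 1 / (1 + 0)" unfolding a_def[abs_def] by (intro tendsto_intros s) auto
 have eq: "- (a k * (LINT x|M. indicator \<Omega> x * (g (a k *\<^sub>R x) \<bullet> f x))) = (LINT x:\<Omega>|\<mu>p. \<phi> (a k *\<^sub>R x)) - (LINT x:\<Omega>|\<mu>m. \<phi> (a k *\<^sub>R x))" for k
 proof -
  define D where "D = enlarged s \<Omega> (\<tau> k)"
  note sc = scaled_pair_continuous[OF \<phi> rangeI[of \<tau> k] a_def[of k], folded D_def]
  note DP = enlarged_props[OF rangeI[of \<tau> k], folded D_def]
  \<comment> \<open>Weak-* convergence asks for a field on \<open>\<Omega>t\<close>. How Tietze's
    theorem continues the gradient beyond D is irrelevant, as the approximating measures eventually
    live in D.\<close>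
  have "closedin (top_of_set \<Omega>t) D" using DP(1,4) by (meson closed_subset compact_imp_closed)
  then obtain \<psi> where \<psi>: "continuous_on \<Omega>t \<psi>" "\<And>x. x \<in> D ==> \<psi> x = a k *\<^sub>R g (a k *\<^sub>R x)"
   using Tietze_unbounded[OF sc(2)] by blast
  have ev: "\<forall>\<^sub>F n in sequentially. (LBINT x. indicator (E n) x * (\<psi> x \<bullet> fs n x)) =
    - ((LINT x:\<Omega>|\<mu>p. \<phi> (a k *\<^sub>R x)) - (LINT x:\<Omega>|\<mu>m. \<phi> (a k *\<^sub>R x)))"
   using enlarged_eventually[OF \<epsilon>, of k]
  proof eventually_elim
   case (elim n)
   then have ED: "E n \<subseteq> D" by (simp add: D_def)
   have "(LBINT x. indicator (E n) x * (\<psi> x \<bullet> fs n x)) = (LBINT x. indicator (E n) x * ((a k *\<^sub>R g (a k *\<^sub>R x)) \<bullet> fs n x))"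
    using ED \<psi>(2) by (intro LINT_cong) (auto simp: indicator_def)
   moreover have "- (LBINT x. indicator (E n) x * ((a k *\<^sub>R g (a k *\<^sub>R x)) \<bullet> fs n x)) =
     (LINT x:\<Omega>|\<mu>p. \<phi> (a k *\<^sub>R x)) - (LINT x:\<Omega>|\<mu>m. \<phi> (a k *\<^sub>R x))"
    by (rule regular_divergence[OF \<epsilon>(1) fin continuous_on_subset[OF sc(1) ED] continuous_on_subset[OF sc(2) ED]])
      (use sc(3) interior_mono[OF ED] in blast)
   ultimately show ?case by linarith
  qed
  have "(LINT x|M. indicator \<Omega>t x * (\<psi> x \<bullet> f x)) = - ((LINT x:\<Omega>|\<mu>p. \<phi> (a k *\<^sub>R x)) - (LINT x:\<Omega>|\<mu>m. \<phi> (a k *\<^sub>R x)))"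
   by (rule LIMSEQ_unique[OF pairing_limit[OF r \<psi>(1)]]) (rule tendsto_eventually[OF ev])
  moreover have "(LINT x|M. indicator \<Omega>t x * (\<psi> x \<bullet> f x)) = (LINT x|M. indicator \<Omega> x * (\<psi> x \<bullet> f x))"
   using vector_integral_restrict(1)[OF r compact_\<Omega>t \<psi>(1) \<Omega>_sub_\<Omega>t \<Omega>_borel z] vector_integral_represents(1)[OF r compact_\<Omega>t \<psi>(1)] by simp
  moreover have "(LINT x|M. indicator \<Omega> x * (\<psi> x \<bullet> f x)) = (LINT x|M. a k * (indicator \<Omega> x * (g (a k *\<^sub>R x) \<bullet> f x)))"
   using \<psi>(2) DP(3) by (intro LINT_cong) (auto simp: indicator_def)
  ultimately show ?thesis by simp
 qed
 have l1: "(\<lambda>k. - (a k * (LINT x|M. indicator \<Omega> x * (g (a k *\<^sub>R x) \<bullet> f x)))) \<longlonglongrightarrow> - (1 / (1 + 0) * (LINT x|M. indicator \<Omega> x * (g x \<bullet> f x)))"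
  using scaled_integral_limit[OF sM f \<phi>(2)] unfolding a_def[symmetric] by (intro tendsto_minus tendsto_mult al)
 have l2: "(\<lambda>k. LINT x:\<Omega>|\<mu>. \<phi> (a k *\<^sub>R x)) \<longlonglongrightarrow> (LINT x:\<Omega>|\<mu>. \<phi> x)" if \<mu>: "prob_space \<mu>" "sets \<mu> = sets borel" for \<mu>
  using scaled_integral_limit[OF \<mu>(2) finite_measure.integrable_const \<phi>(1), of 1] \<mu>(1)
  unfolding a_def[symmetric] set_lebesgue_integral_def by (simp add: prob_space_def)
 have "- (LINT x|M. indicator \<Omega> x * (g x \<bullet> f x)) = (LINT x:\<Omega>|\<mu>p. \<phi> x) - (LINT x:\<Omega>|\<mu>m. \<phi> x)"
  using LIMSEQ_unique[OF l1] tendsto_diff[OF l2[OF \<mu>p(1,2)] l2[OF \<mu>m(1,2)]] unfolding eq by simp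
 then show "- vector_integral \<Omega> q g = (LINT x:\<Omega>|\<mu>p. \<phi> x) - (LINT x:\<Omega>|\<mu>m. \<phi> x)"
  unfolding vector_integral_represents(1)[OF r compact_\<Omega> \<phi>(2)] .
qed

lemma limit_energy:
 assumes r: "represents q M f"
 shows "(LINT x|M. indicator \<Omega>t x * (wh x * norm (f x))) \<le> C"
proof -
 have sM: "sets M = sets borel" and f: "integrable M f" using r by (auto simp: represents_def)
 have iw: "integrable lborel (\<lambda>x. indicator \<Omega>t x * wh x)"
  using borel_integrable_compact[OF compact_\<Omega>t wh(1)] by simp
 define A where "A = (LBINT x. indicator \<Omega>t x * wh x)"
 show ?thesis
 proof (rule integral_norm_le_by_duality[OF sM f compact_\<Omega>t wh(1) wh_nonneg])
  fix \<psi> :: "'a => 'a" assume \<psi>: "continuous_on \<Omega>t \<psi>" "\<And>x. x \<in> \<Omega>t ==> norm (\<psi> x) \<le> wh x"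
  have le: "(LBINT x. indicator (E n) x * (\<psi> x \<bullet> fs n x)) \<le> C + 2 * \<delta> n * A" for n
  proof -
   have whE: "continuous_on (E n) wh" "\<And>x. x \<in> E n ==> 0 \<le> wh x"
    using EP(4)[of n] wh(1) wh_nonneg by (auto intro: continuous_on_subset)
   have whE2: "0 \<le> wh x" if "x \<in> E n" for x using whE(2) that .
   obtain m where m: "\<epsilon> n = \<tau> m" using \<epsilon>(1)[of n] by auto
   then have e0: "0 \<le> \<epsilon> n" using \<tau>(1)[of m] by simp
   have fi: "integrable lborel (fs n)" using regular(1)[of n] by (simp add: represents_def)
   note G = G_star_integral_bounds[OF EP(1) whE(1) whE2 fi regular(3) e0 \<delta>(1)[of n] \<alpha>(1)]
   have "(LBINT x. indicator (E n) x * (\<psi> x \<bullet> fs n x)) \<le> (LBINT x. indicator (E n) x * (wh x * norm (fs n x)))"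
   proof (rule integral_mono[OF pairing(2)[OF \<psi>(1)] G(3)])
    fix x
    have "\<psi> x \<bullet> fs n x \<le> wh x * norm (fs n x)" if "x \<in> E n"
     using norm_cauchy_schwarz[of "\<psi> x" "fs n x"] mult_right_mono[OF \<psi>(2)[of x], of "norm (fs n x)"] that EP(4)[of n] by force
    then show "indicator (E n) x * (\<psi> x \<bullet> fs n x) \<le> indicator (E n) x * (wh x * norm (fs n x))" by (auto simp: indicator_def)
   qed
   also have "\<dots> \<le> (LINT x|lebesgue_on (E n). G_star \<alpha> wh (\<epsilon> n) (\<delta> n) x (fs n x)) + 2 * \<delta> n * (LBINT x. indicator (E n) x * wh x)"
    using G(1) by linarith
   also have "\<dots> \<le> C + 2 * \<delta> n * A"
   proof (intro add_mono mult_left_mono)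
    show "(LINT x|lebesgue_on (E n). G_star \<alpha> wh (\<epsilon> n) (\<delta> n) x (fs n x)) \<le> C"
     using bound[of n] regular(5)[of n] by simp
    show "(LBINT x. indicator (E n) x * wh x) \<le> A" unfolding A_def
    proof (rule integral_mono[OF _ iw])
     show "integrable lborel (\<lambda>x. indicator (E n) x * wh x)" using borel_integrable_compact[OF EP(1) whE(1)] by simp
     show "indicator (E n) x * wh x \<le> indicator \<Omega>t x * wh x" for x
      using EP(4)[of n] wh_nonneg[of x] by (auto simp: indicator_def)
    qed
   qed (use \<delta>(1)[of n] in auto)
   finally show ?thesis .
  qed
  have "(\<lambda>n. C + 2 * \<delta> n * A) \<longlonglongrightarrow> C + 2 * 0 * A" by (intro tendsto_intros \<delta>)
  then show "(LINT x|M. indicator \<Omega>t x * (\<psi> x \<bullet> f x)) \<le> C"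
   using LIMSEQ_le[OF pairing_limit[OF r \<psi>(1)]] le by fastforce
 qed
qed

theorem H_lim_le: "H_lim w \<Omega> \<mu>p \<mu>m q \<le> ereal C"
proof -
 obtain M f where r: "represents q M f" and fM: "finite_measure M" and M0: "emeasure M (- \<Omega>t) = 0"
  using vector_measure_representation[OF q \<Omega>t_borel] by blast
 have sM: "sets M = sets borel" and f: "integrable M f" using r by (auto simp: represents_def)
 have "- \<Omega>t \<in> null_sets M" using M0 sM \<Omega>t_borel by (intro null_setsI) auto
 then have "AE x in M. x \<notin> - \<Omega>t" by (rule AE_not_in)
 with limit_supported[OF r] have z: "AE x in M. x \<notin> \<Omega> \<longrightarrow> f x = 0" by eventually_elim auto
 have q\<Omega>: "q \<in> vector_measures \<Omega>"
  unfolding vector_measures_def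
 proof (intro CollectI conjI ballI impI)
  show "\<forall>F. range F \<subseteq> sets borel \<and> disjoint_family F \<longrightarrow> (\<lambda>i::nat. q (F i)) sums q (\<Union>i. F i)"
   using q unfolding vector_measures_def by blast
  fix A :: "'a set" assume A: "A \<in> sets borel" "A \<inter> \<Omega> = {}"
  have "q A = (LINT x|M. indicator A x *\<^sub>R f x)" using r A(1) by (simp add: represents_def set_lebesgue_integral_def)
  also have "\<dots> = (LINT x|M. 0)"
  proof (rule LINT_cong_AE)
   show "AE x in M. indicator A x *\<^sub>R f x = 0" using z by eventually_elim (use A(2) in \<open>auto simp: indicator_def\<close>)
   show "(\<lambda>x. indicator A x *\<^sub>R f x) \<in> borel_measurable M" using f A(1) sM by (intro borel_measurable_scaleR) auto
  qed simp
  finally show "q A = 0" by simp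
 qed
 have wv: "(\<integral>\<^sup>+x\<in>\<Omega>. ennreal (w x) \<partial>total_variation q) = ennreal (LINT x|M. indicator \<Omega> x * (w x * norm (f x)))"
  "integrable M (\<lambda>x. indicator \<Omega> x * (w x * norm (f x)))"
  by (rule weighted_variation[OF r fM compact_\<Omega> w], assumption)+
 have whM: "integrable M (\<lambda>x. indicator \<Omega>t x * (wh x * norm (f x)))"
  by (rule weighted_variation(2)[OF r fM compact_\<Omega>t wh(1) wh_nonneg])
 have "(LINT x|M. indicator \<Omega> x * (w x * norm (f x))) \<le> (LINT x|M. indicator \<Omega>t x * (wh x * norm (f x)))"
 proof (rule integral_mono[OF wv(2) whM])
  show "indicator \<Omega> x * (w x * norm (f x)) \<le> indicator \<Omega>t x * (wh x * norm (f x))" for x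
   using wh(2)[of x] wh_nonneg[of x] \<Omega>_sub_\<Omega>t by (auto simp: indicator_def)
 qed
 also have "\<dots> \<le> C" by (rule limit_energy[OF r])
 finally have le: "(LINT x|M. indicator \<Omega> x * (w x * norm (f x))) \<le> C" .
 have nn: "0 \<le> (LINT x|M. indicator \<Omega> x * (w x * norm (f x)))"
  using w(2) by (intro LINT_nonneg) (auto simp: indicator_def)
 have "H_lim w \<Omega> \<mu>p \<mu>m q = enn2ereal (\<integral>\<^sup>+x\<in>\<Omega>. ennreal (w x) \<partial>total_variation q)"
  using q\<Omega> limit_divergence[OF r z] by (simp add: H_lim_def)
 also have "\<dots> = ereal (LINT x|M. indicator \<Omega> x * (w x * norm (f x)))" unfolding wv(1) using nn by (rule enn2ereal_ennreal)
 finally show ?thesis using le by simp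
qed

end

section \<open>Recovery sequence and conclusion\<close>

text \<open>\<open>P\<close> may grow at any rate, so k is slowed down: k n is the largest j \<le> n
  whose threshold N j has been passed, and past it \<epsilon> n * P j is at most 1 / (j +
  1).\<close>

lemma diagonal_index:
 fixes \<epsilon> P :: "nat => real"
 assumes \<epsilon>: "\<epsilon> \<longlonglongrightarrow> 0" "\<And>n. 0 \<le> \<epsilon> n" and P: "\<And>j. 0 \<le> P j"
 shows "\<exists>k. filterlim k at_top sequentially \<and> (\<lambda>n. \<epsilon> n * P (k n)) \<longlonglongrightarrow> 0"
proof -
 have "\<exists>N. \<forall>n\<ge>N. \<epsilon> n * P j \<le> inverse (real (Suc j))" for j
 proof -
  have "(\<lambda>n. \<epsilon> n * P j) \<longlonglongrightarrow> 0" using tendsto_mult_right[OF \<epsilon>(1), of "P j"] by simp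
  then have "\<forall>\<^sub>F n in sequentially. \<epsilon> n * P j < inverse (real (Suc j))" by (rule order_tendstoD) simp
  then show ?thesis unfolding eventually_sequentially by (meson less_imp_le)
 qed
 then obtain N where N: "\<And>j n. N j \<le> n ==> \<epsilon> n * P j \<le> inverse (real (Suc j))" by metis
 \<comment> \<open>The index 0 is always allowed so that S n is not empty; the bound at k n is
   therefore claimed only once k n \<ge> 1.\<close>
 define S where "S n = {j. j \<le> n \<and> (j = 0 \<or> N j \<le> n)}" for n
 define k where "k n = Max (S n)" for n
 have fS: "finite (S n)" "S n \<noteq> {}" for n unfolding S_def by auto
 have kS: "k n \<in> S n" for n unfolding k_def using fS by (rule Max_in)
 have big: "j \<le> k n" if "j \<le> n" "N j \<le> n" for j n
  unfolding k_def using that fS by (intro Max_ge) (auto simp: S_def)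
 have k: "filterlim k at_top sequentially" unfolding filterlim_at_top eventually_sequentially
 proof
  fix Z show "\<exists>N'. \<forall>n\<ge>N'. Z \<le> k n" using big[of Z] by (intro exI[of _ "max Z (N Z)"]) auto
 qed
 have inv: "(\<lambda>n. inverse (real (Suc (k n)))) \<longlonglongrightarrow> 0"
  by (rule filterlim_compose[OF LIMSEQ_inverse_real_of_nat k])
 have "\<forall>\<^sub>F n in sequentially. 1 \<le> k n" using k by (auto simp: filterlim_at_top)
 then have ub: "\<forall>\<^sub>F n in sequentially. \<epsilon> n * P (k n) \<le> inverse (real (Suc (k n)))"
 proof eventually_elim
  case (elim n)
  then show ?case using kS[of n] N[of "k n" n] by (auto simp: S_def)
 qed
 have lb: "\<forall>\<^sub>F n in sequentially. 0 \<le> \<epsilon> n * P (k n)" using \<epsilon>(2) P by (intro always_eventually) auto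
 show ?thesis using k tendsto_sandwich[OF lb ub tendsto_const inv] by blast
qed

section \<open>Admissible fields on all enlarged domains\<close>

lemma vector_measures_mono: "K \<subseteq> L ==> vector_measures K \<subseteq> vector_measures L"
 unfolding vector_measures_def by blast

lemma weak_grad_mono: "weak_grad V \<phi> G ==> U \<subseteq> V ==> weak_grad U \<phi> G"
 unfolding weak_grad_def using C_c_infinity_mono by blast

context gamma_setting
begin

text \<open>A single mollifier with support inside the cone opening is enough, since the scaling is
  done by the parameter r of the kernel.\<close>

lemma cone_setting_exists:
 assumes "compact K" "uniform_cone K I \<rho> c \<kappa>" "morrey_exponent TYPE('a) p \<gamma>"
 shows "\<exists>n B. cone_setting K I \<rho> c \<kappa> (\<beta> n) B p \<gamma>"
proof -
 have "\<kappa> > 0" using assms(2) by (simp add: uniform_cone_def)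
 then have "\<forall>\<^sub>F n in sequentially. supp (\<beta> n) \<subseteq> ball 0 \<kappa>" using \<beta> by (simp add: mollifiers_def)
 then obtain n where n: "supp (\<beta> n) \<subseteq> ball 0 \<kappa>" unfolding eventually_sequentially by blast
 have bn: "\<beta> n \<in> C_c_infinity UNIV" "\<And>x. 0 \<le> \<beta> n x" "(LBINT x. \<beta> n x) = 1"
  using \<beta> by (auto simp: mollifiers_def)
 have cs: "compact (supp (\<beta> n))" using bn(1) by (simp add: C_c_infinity_def)
 have ct: "continuous_on (supp (\<beta> n)) (\<beta> n)" using C_c_infinity_continuous[OF bn(1)] continuous_on_subset by blast
 have "bounded (\<beta> n ` supp (\<beta> n))" using cs ct by (intro compact_imp_bounded compact_continuous_image)
 then obtain B where B: "\<And>x. x \<in> supp (\<beta> n) ==> \<bar>\<beta> n x\<bar> \<le> B" by (auto simp: bounded_iff)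
 have "\<beta> n x \<le> max B 0" for x
 proof (cases "x \<in> supp (\<beta> n)")
  case False
  then have "\<beta> n x = 0" using supp_nz[of "\<beta> n" x] by auto
  then show ?thesis by simp
 qed (use B[of x] in auto)
 then show ?thesis using assms bn n by (intro exI[of _ n] exI[of _ "max B 0"] cone_setting.intro) auto
qed

lemma cone_\<Omega>: "\<exists>I \<rho> c \<kappa>. uniform_cone \<Omega> I \<rho> c \<kappa>"
 by (rule lipschitz_uniform_cone[OF compact_\<Omega> lipschitz star_shaped_closure[OF star]])

text \<open>\<open>cont_rep\<close> is a choice and says nothing unless a continuous representative
  exists; on the enlarged domains Morrey's embedding provides one.\<close>

lemma continuous_representative_enlarged:
 assumes e: "e \<in> range \<tau>" and g: "weak_grad (interior (enlarged s \<Omega> e)) \<phi> G" "G \<in> borel_measurable borel"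
  "(NN x. ennreal (norm (G x) powr conj_exp \<alpha>)) < \<infinity>"
 shows "\<exists>\<psi>. continuous_on (enlarged s \<Omega> e) \<psi> \<and> (AE x in lborel. x \<in> enlarged s \<Omega> e \<longrightarrow> \<psi> x = \<phi> x)"
proof -
 have a: "1 + s e > 0" using e s by (auto intro: add_pos_pos)
 obtain \<gamma> where \<gamma>: "morrey_exponent TYPE('a) (conj_exp \<alpha>) \<gamma>" using morrey_exponent_exists[OF \<alpha>] by blast
 obtain I \<rho> c \<kappa> where "uniform_cone (enlarged s \<Omega> e) I \<rho> c \<kappa>"
  using cone_\<Omega> uniform_cone_scale[OF _ a] unfolding enlarged_def by blast
 then obtain n B where "cone_setting (enlarged s \<Omega> e) I \<rho> c \<kappa> (\<beta> n) B (conj_exp \<alpha>) \<gamma>"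
  using cone_setting_exists[OF enlarged_props(1)[OF e] _ \<gamma>] by blast
 then interpret cs: cone_setting "enlarged s \<Omega> e" I \<rho> c \<kappa> "\<beta> n" B "conj_exp \<alpha>" \<gamma> .
 have "cs.energy G < \<infinity>" using g(3) unfolding cs.energy_def by (simp add: ennreal_mult_less_top)
 then show ?thesis by (rule cs.continuous_representative[OF g(1,2)])
qed

text \<open>What has to be remembered of a recovery field once the cover and the measure
  \<open>M\<close> are forgotten. The divergence is tested with functions having a weak gradient in
  the interior of \<Omega> only, so restrictions from any enlarged domain qualify.\<close>

definition admissible :: "('a => 'a) => bool" where
 "admissible r \<longleftrightarrow> r \<in> borel_measurable borel \<and> integrable lborel r \<and> (\<forall>z. z \<notin> interior \<Omega> \<longrightarrow> r z = 0) \<and>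
   (NN z. ennreal (norm (r z) powr \<alpha>)) < \<infinity> \<and>
   (\<forall>\<phi> G \<psi>. weak_grad (interior \<Omega>) \<phi> G \<longrightarrow> G \<in> borel_measurable borel \<longrightarrow>
    (NN x. ennreal (norm (G x) powr conj_exp \<alpha>)) < \<infinity> \<longrightarrow> continuous_on \<Omega> \<psi> \<longrightarrow>
    (AE x in lborel. x \<in> \<Omega> \<longrightarrow> \<psi> x = \<phi> x) \<longrightarrow>
    - (LBINT z. r z \<bullet> G z) = (LINT x:\<Omega>|\<mu>p. \<psi> x) - (LINT x:\<Omega>|\<mu>m. \<psi> x))"

lemma recovery_family:
 assumes q: "represents q M f" "finite_measure M" and d: "div_measure_eq \<Omega> q \<mu>p \<mu>m"
 obtains r :: "real => 'a => 'a" where "\<And>t. 0 < t ==> t \<le> 1 ==> admissible (r t)"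
  "\<And>e. e > 0 ==> \<exists>t0>0. \<forall>t. 0 < t \<and> t \<le> t0 \<longrightarrow> (NN z. ennreal (norm (r t z) * (indicator \<Omega> z * w z)))
    \<le> ennreal ((LINT x|M. indicator \<Omega> x * (w x * norm (f x))) + e)"
  "\<And>e \<psi>. continuous_on \<Omega> \<psi> ==> e > 0 ==> \<exists>t0>0. \<forall>t. 0 < t \<and> t \<le> t0 \<longrightarrow>
    \<bar>(LBINT z. r t z \<bullet> (indicator \<Omega> z *\<^sub>R \<psi> z)) - (LINT x|M. indicator \<Omega> x * (\<psi> x \<bullet> f x))\<bar> \<le> e"
proof -
 obtain \<gamma> where \<gamma>: "morrey_exponent TYPE('a) (conj_exp \<alpha>) \<gamma>" using morrey_exponent_exists[OF \<alpha>] by blast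
 obtain I \<rho> c \<kappa> where "uniform_cone \<Omega> I \<rho> c \<kappa>" using cone_\<Omega> by blast
 then obtain n B where cs: "cone_setting \<Omega> I \<rho> c \<kappa> (\<beta> n) B (conj_exp \<alpha>) \<gamma>"
  using cone_setting_exists[OF compact_\<Omega> _ \<gamma>] by blast
 interpret rs: recovery_setting \<Omega> I \<rho> c \<kappa> "\<beta> n" B "conj_exp \<alpha>" \<gamma> M q f \<mu>p \<mu>m \<alpha>
  by (rule recovery_setting.intro[OF cs recovery_setting_axioms.intro]) (use q d \<mu>p \<mu>m \<alpha> in auto)
 have en: "rs.energy G < \<infinity>" if "(NN x. ennreal (norm (G x) powr conj_exp \<alpha>)) < \<infinity>" for G
  using that unfolding rs.energy_def by (simp add: ennreal_mult_less_top)
 show ?thesis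
 proof (rule that[of "rs.recovery M f \<mu>p \<mu>m"])
  show "admissible (rs.recovery M f \<mu>p \<mu>m t)" if t: "0 < t" "t \<le> 1" for t
   unfolding admissible_def
   using rs.rec_measurable[OF t] rs.rec_integrable[OF t] rs.rec_outside[OF t] rs.rec_finite_power[OF t]
    rs.recovery_divergence[OF _ _ en _ _ t]
   unfolding rs.finite_power_def by blast
  show "\<exists>t0>0. \<forall>t. 0 < t \<and> t \<le> t0 \<longrightarrow> (NN z. ennreal (norm (rs.recovery M f \<mu>p \<mu>m t z) * (indicator \<Omega> z * w z)))
    \<le> ennreal ((LINT x|M. indicator \<Omega> x * (w x * norm (f x))) + e)" if "e > 0" for e
   using rs.recovery_energy[OF w that] by blast
  show "\<exists>t0>0. \<forall>t. 0 < t \<and> t \<le> t0 \<longrightarrow>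
    \<bar>(LBINT z. rs.recovery M f \<mu>p \<mu>m t z \<bullet> (indicator \<Omega> z *\<^sub>R \<psi> z)) - (LINT x|M. indicator \<Omega> x * (\<psi> x \<bullet> f x))\<bar> \<le> e"
   if "continuous_on \<Omega> \<psi>" "e > 0" for e \<psi>
   using rs.recovery_weak_star[OF that] by blast
 qed
qed

definition density_measure :: "('a => 'a) => 'a set => 'a" where
 "density_measure r A = (LBINT z:A. r z)"

lemma density_measure_represents: "integrable lborel r ==> represents (density_measure r) lborel r"
 by (simp add: represents_def density_measure_def)

lemma admissible_measure:
 assumes "admissible r"
 shows "density_measure r \<in> vector_measures \<Omega>" "abs_cont (density_measure r)"
  "AE x in lborel. vector_RN_deriv (density_measure r) x = r x"
proof -
 have i: "integrable lborel r" and z: "\<And>z. z \<notin> interior \<Omega> ==> r z = 0" using assms by (auto simp: admissible_def)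
 note r = density_measure_represents[OF i]
 have caf: "countably_additive_fun (density_measure r)" by (rule represents_caf[OF r])
 have "density_measure r A = 0" if "A \<inter> \<Omega> = {}" for A
 proof -
  have "indicator A x *\<^sub>R r x = 0" for x using z[of x] that interior_subset[of \<Omega>] by (auto simp: indicator_def)
  then have "(\<lambda>x. indicator A x *\<^sub>R r x) = (\<lambda>x. 0)" by blast
  then show ?thesis unfolding density_measure_def set_lebesgue_integral_def by (simp only: LINT_zero)
 qed
 then show "density_measure r \<in> vector_measures \<Omega>"
  using caf by (simp add: vector_measures_def countably_additive_fun_def)
 show a: "abs_cont (density_measure r)"
  unfolding abs_cont_def
 proof
  fix A :: "'a set" assume "A \<in> null_sets lborel"
  then have "AE x in lborel. indicator A x *\<^sub>R r x = 0"
   using AE_not_in[of A lborel] by (auto elim!: eventually_mono)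
  then show "density_measure r A = 0"
   by (simp add: density_measure_def set_lebesgue_integral_def integral_eq_zero_AE)
 qed
 show "AE x in lborel. vector_RN_deriv (density_measure r) x = r x"
  by (rule represents_unique[OF lborel.sigma_finite_measure_axioms vector_RN_deriv_represents[OF caf a] r])
qed

text \<open>A Sobolev function on the enlarged domain restricts to \<Omega>, and both sides see
  nothing else: \<open>r\<close> vanishes outside the interior of \<Omega>, and the two probability
  measures live on \<Omega>.\<close>

lemma admissible_divergence:
 assumes r: "admissible r" and e: "e \<in> range \<tau>" and E: "E = enlarged s \<Omega> e" and f: "f \<in> borel_measurable borel" "AE x in lborel. f x = r x"
 shows "eq_sobolev_dual_perp \<alpha> E (div_Lp E f) (measure_functional E \<mu>p \<mu>m)"
 unfolding eq_sobolev_dual_perp_def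
proof
 fix \<phi> assume "\<phi> \<in> sobolev_mean0 (conj_exp \<alpha>) E"
 then have \<phi>: "\<phi> \<in> sobolev (conj_exp \<alpha>) E" by (simp add: sobolev_mean0_def)
 note EP = enlarged_props[OF e, folded E]
 have rm: "r \<in> borel_measurable borel" and r0: "\<And>z. z \<notin> interior \<Omega> ==> r z = 0" using r by (auto simp: admissible_def)
 have ac: "conj_exp \<alpha> \<ge> 1" using \<alpha> by (simp add: conj_exp_def field_simps)
 obtain \<phi>0 G where G': "weak_grad (interior E) \<phi>0 G" "\<phi>0 \<in> borel_measurable borel" "G \<in> borel_measurable borel"
  "\<And>x. x \<notin> E ==> \<phi>0 x = 0"
  "AE x in lebesgue_on E. \<phi> x = \<phi>0 x" "AE x in lebesgue_on E. x \<in> interior E \<longrightarrow> weak_gradient E \<phi> x = G x"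
  "(NN x. ennreal (norm (G x) powr conj_exp \<alpha>)) < \<infinity>"
  by (rule sobolev_weak_grad[OF \<beta> EP(1) \<phi> ac], rule that)
 note G = G'(1,3,5,6,7)
 obtain g where g: "g \<in> Lp (conj_exp \<alpha>) E" "is_weak_gradient (interior E) \<phi> g" using \<phi> by (auto simp: sobolev_def)
 have wm: "weak_gradient E \<phi> \<in> borel_measurable (lebesgue_on E)"
  using weak_gradient_AE(2)[OF \<beta> EP(1) Lp_subset_L1[OF g(1) EP(1) ac] g(2)] by (simp add: Lp_def)
 have bl: "h \<in> borel_measurable (lebesgue_on E)" if "h \<in> borel_measurable borel" for h :: "'a => 'a"
  using that by (intro measurable_restrict_space1 measurable_completion) simp
 have "AE x in lebesgue_on E. f x = r x" using f(2) unfolding AE_lebesgue_on[OF EP(5)] by eventually_elim simp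
 with G(4) have ae: "AE x in lebesgue_on E. f x \<bullet> weak_gradient E \<phi> x = r x \<bullet> G x"
 proof eventually_elim
  case (elim x)
  then show ?case using r0[of x] interior_mono[OF EP(3)] by (cases "x \<in> interior \<Omega>") auto
 qed
 have "(LINT x|lebesgue_on E. f x \<bullet> weak_gradient E \<phi> x) = (LINT x|lebesgue_on E. r x \<bullet> G x)"
  by (rule LINT_cong_AE[OF _ _ ae]) (intro borel_measurable_inner wm bl f rm G)+
 also have "\<dots> = (LBINT x. indicator E x *\<^sub>R (r x \<bullet> G x))"
  by (rule lebesgue_on_borel(2)[OF EP(5)]) (intro borel_measurable_inner rm G)
 also have "\<dots> = (LBINT x. r x \<bullet> G x)"
 proof (intro LINT_cong refl)
  fix x
  have "x \<in> E" if "r x \<noteq> 0" using that r0 EP(3) interior_subset[of \<Omega>] by blast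
  then show "indicator E x *\<^sub>R (r x \<bullet> G x) = r x \<bullet> G x" by (cases "r x = 0") auto
 qed
 finally have dv: "div_Lp E f \<phi> = - (LBINT x. r x \<bullet> G x)" by (simp add: div_Lp_def)
 obtain \<psi> where \<psi>: "continuous_on E \<psi>" "AE x in lborel. x \<in> E \<longrightarrow> \<psi> x = \<phi>0 x"
  using continuous_representative_enlarged[OF e G(1,2,5)[unfolded E]] unfolding E by blast
 have ph: "AE x in lborel. x \<in> E \<longrightarrow> \<phi> x = \<phi>0 x" using G(3) unfolding AE_lebesgue_on[OF EP(5)] .
 with \<psi>(2) have "AE x in lborel. x \<in> E \<longrightarrow> \<psi> x = \<phi> x" by eventually_elim auto
 then have "\<exists>\<psi>. continuous_on E \<psi> \<and> (AE x in lebesgue_on E. \<psi> x = \<phi> x)"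
  using \<psi>(1) unfolding AE_lebesgue_on[OF EP(5)] by blast
 from someI_ex[OF this] have cr: "continuous_on E (cont_rep E \<phi>)" "AE x in lebesgue_on E. cont_rep E \<phi> x = \<phi> x"
  unfolding cont_rep_def[symmetric] by auto
 have c\<Omega>: "continuous_on \<Omega> (cont_rep E \<phi>)" using cr(1) EP(3) by (rule continuous_on_subset)
 have ce: "AE x in lborel. x \<in> \<Omega> \<longrightarrow> cont_rep E \<phi> x = \<phi>0 x"
  using cr(2)[unfolded AE_lebesgue_on[OF EP(5)]] ph by eventually_elim (use EP(3) in auto)
 have "- (LBINT z. r z \<bullet> G z) = (LINT x:\<Omega>|\<mu>p. cont_rep E \<phi> x) - (LINT x:\<Omega>|\<mu>m. cont_rep E \<phi> x)"
  using r weak_grad_mono[OF G(1) interior_mono[OF EP(3)]] G(2,5) c\<Omega> ce unfolding admissible_def by blast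
 moreover have "(LINT x:E|\<mu>. cont_rep E \<phi> x) = (LINT x:\<Omega>|\<mu>. cont_rep E \<phi> x)"
  if \<mu>: "prob_space \<mu>" "sets \<mu> = sets borel" "emeasure \<mu> (- \<Omega>) = 0" for \<mu>
 proof (rule set_integral_enlarged[OF \<mu> EP(5,3)])
  have fin: "finite_measure \<mu>" using \<mu>(1) by (simp add: prob_space_def)
  show "integrable \<mu> (\<lambda>x. indicator E x * cont_rep E \<phi> x)" by (rule set_integrable_continuous_finite[OF fin \<mu>(2) EP(1) cr(1)])
  show "integrable \<mu> (\<lambda>x. indicator \<Omega> x * cont_rep E \<phi> x)" by (rule set_integrable_continuous_finite[OF fin \<mu>(2) compact_\<Omega> c\<Omega>])
 qed
 ultimately show "div_Lp E f \<phi> = measure_functional E \<mu>p \<mu>m \<phi>"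
  using \<mu>p \<mu>m by (simp add: dv measure_functional_def)
qed

lemma admissible_energy:
 assumes r: "admissible r" and e: "e \<in> range \<tau>" and d: "0 \<le> d" "0 < \<delta>" and V: "0 \<le> V"
  "(NN z. ennreal (norm (r z) * (indicator \<Omega> z * w z))) \<le> ennreal V"
 shows "H_reg \<alpha> wh (enlarged s \<Omega> e) \<mu>p \<mu>m d \<delta> (density_measure r) \<le>
  ereal (V + d / \<alpha> * enn2real (NN z. ennreal (norm (r z) powr \<alpha>)))"
proof -
 define E where "E = enlarged s \<Omega> e"
 define q where "q = density_measure r"
 define f where "f = vector_RN_deriv q"
 note EP = enlarged_props[OF e, folded E_def]
 note Q = admissible_measure[OF r, folded q_def f_def]
 have rm: "r \<in> borel_measurable borel" and r0: "\<And>z. z \<notin> interior \<Omega> ==> r z = 0"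
  and rf: "(NN z. ennreal (norm (r z) powr \<alpha>)) < \<infinity>" using r by (auto simp: admissible_def)
 have fi: "integrable lborel f"
  using vector_RN_deriv_represents[OF vector_measures_caf[OF Q(1)] Q(2)] by (simp add: represents_def f_def)
 have fm[measurable]: "f \<in> borel_measurable borel" using fi by (auto dest: borel_measurable_integrable)
 have nf: "(NN z. ennreal (indicator E z * norm (f z) powr \<alpha>)) = (NN z. ennreal (norm (r z) powr \<alpha>))"
 proof (rule nn_integral_cong_AE)
  show "AE z in lborel. ennreal (indicator E z * norm (f z) powr \<alpha>) = ennreal (norm (r z) powr \<alpha>)"
   using Q(3) by eventually_elim (use r0 EP(3) interior_subset[of \<Omega>] in \<open>auto simp: indicator_def\<close>)
 qed
 have fa: "integrable lborel (\<lambda>z. indicator E z * norm (f z) powr \<alpha>)"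
 proof (rule integrableI_nonneg)
  show "(\<lambda>z. indicator E z * norm (f z) powr \<alpha>) \<in> borel_measurable lborel" using EP(5) by measurable
 qed (use nf rf in auto)
 have fL: "f \<in> Lp \<alpha> E"
 proof -
  have "f \<in> borel_measurable (lebesgue_on E)" using fm by (intro measurable_restrict_space1 measurable_completion) simp
  moreover have "integrable (lebesgue_on E) (\<lambda>z. norm (f z) powr \<alpha>)"
   by (subst lebesgue_on_borel(1)[OF EP(5)]) (use fa in auto)
  ultimately show ?thesis by (simp add: Lp_def)
 qed
 have whE: "continuous_on E wh" using EP(4) wh(1) continuous_on_subset by blast
 have wh0: "0 \<le> wh x" if "x \<in> E" for x using that EP(4) wh_nonneg by blast
 have i3: "integrable lborel (\<lambda>x. indicator E x * (wh x * norm (f x)))"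
  by (rule G_star_integral_bounds(3)[OF EP(1) whE wh0 fi fL d \<alpha>(1)])
 have "H_reg \<alpha> wh E \<mu>p \<mu>m d \<delta> q = ereal (LINT x|lebesgue_on E. G_star \<alpha> wh d \<delta> x (f x))"
  unfolding H_reg_def f_def[symmetric]
  using Q(1,2) fL admissible_divergence[OF r e E_def fm Q(3)] vector_measures_mono[OF EP(3)] by (intro if_P) auto
 moreover have "(LINT x|lebesgue_on E. G_star \<alpha> wh d \<delta> x (f x)) \<le>
   (LBINT x. indicator E x * (wh x * norm (f x))) + d / \<alpha> * (LBINT x. indicator E x * norm (f x) powr \<alpha>)"
  by (rule G_star_integral_bounds(2)[OF EP(1) whE wh0 fi fL d \<alpha>(1)])
 moreover have "(LBINT x. indicator E x * norm (f x) powr \<alpha>) = enn2real (NN z. ennreal (norm (r z) powr \<alpha>))"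
  unfolding nf[symmetric] using fa by (intro integral_eq_nn_integral) auto
 moreover have "(LBINT x. indicator E x * (wh x * norm (f x))) \<le> V"
 proof -
  have "ennreal (LBINT x. indicator E x * (wh x * norm (f x))) = (NN x. ennreal (indicator E x * (wh x * norm (f x))))"
   using i3 wh0 by (intro nn_integral_eq_integral[symmetric] AE_I2) (auto simp: indicator_def)
  also have "\<dots> = (NN z. ennreal (norm (r z) * (indicator \<Omega> z * w z)))"
  proof (rule nn_integral_cong_AE)
   show "AE z in lborel. ennreal (indicator E z * (wh z * norm (f z))) = ennreal (norm (r z) * (indicator \<Omega> z * w z))"
    using Q(3)
   proof eventually_elim
    case (elim z)
    have "z \<in> \<Omega>" "z \<in> E" if "z \<in> interior \<Omega>" using that EP(3) interior_subset[of \<Omega>] by auto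
    then show ?case using elim r0[of z] wh(2)[of z] by (cases "z \<in> interior \<Omega>") (auto simp: mult.commute)
   qed
  qed
  also have "\<dots> \<le> ennreal V" by (rule V(2))
  finally show ?thesis using V(1) by (simp add: ennreal_le_iff)
 qed
 ultimately show ?thesis unfolding E_def q_def by simp
qed

lemma limsup_inequality:
 fixes \<epsilon> \<delta> :: "nat => real"
 assumes \<epsilon>: "\<And>n. \<epsilon> n \<in> range \<tau>" "\<epsilon> \<longlonglongrightarrow> 0" and \<delta>: "\<And>n. \<delta> n > 0"
  and q: "q \<in> vector_measures \<Omega>" and dv: "div_measure_eq \<Omega> q \<mu>p \<mu>m"
 shows "\<exists>qs. (\<forall>n. qs n \<in> vector_measures \<Omega>t) \<and> weak_star_conv \<Omega>t qs q \<and>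
  limsup (\<lambda>n. H_reg \<alpha> wh (enlarged s \<Omega> (\<epsilon> n)) \<mu>p \<mu>m (\<epsilon> n) (\<delta> n) (qs n)) \<le> H_lim w \<Omega> \<mu>p \<mu>m q"
proof -
 obtain M f where rep: "represents q M f" and fM: "finite_measure M" and M0: "emeasure M (- \<Omega>) = 0"
  using vector_measure_representation[OF q \<Omega>_borel] by blast
 have sM: "sets M = sets borel" using rep by (simp add: represents_def)
 define V where "V = (LINT x|M. indicator \<Omega> x * (w x * norm (f x)))"
 have V0: "0 \<le> V" unfolding V_def using w(2) by (intro LINT_nonneg) (auto simp: indicator_def)
 have HV: "H_lim w \<Omega> \<mu>p \<mu>m q = ereal V"
 proof -
  have "(\<integral>\<^sup>+x\<in>\<Omega>. ennreal (w x) \<partial>total_variation q) = ennreal V"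
   unfolding V_def by (rule weighted_variation(1)[OF rep fM compact_\<Omega> w])
  then have "H_lim w \<Omega> \<mu>p \<mu>m q = enn2ereal (ennreal V)" unfolding H_lim_def using q dv by simp
  then show ?thesis using enn2ereal_ennreal[OF V0] by simp
 qed
 obtain r :: "real => 'a => 'a" where adm: "\<And>t. 0 < t ==> t \<le> 1 ==> admissible (r t)"
  and en: "\<And>e. e > 0 ==> \<exists>t0>0. \<forall>t. 0 < t \<and> t \<le> t0 \<longrightarrow> (NN z. ennreal (norm (r t z) * (indicator \<Omega> z * w z))) \<le> ennreal (V + e)"
  and ws: "\<And>e \<psi>. continuous_on \<Omega> \<psi> ==> e > 0 ==> \<exists>t0>0. \<forall>t. 0 < t \<and> t \<le> t0 \<longrightarrow>
    \<bar>(LBINT z. r t z \<bullet> (indicator \<Omega> z *\<^sub>R \<psi> z)) - (LINT x|M. indicator \<Omega> x * (\<psi> x \<bullet> f x))\<bar> \<le> e"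
  by (rule recovery_family[OF rep fM dv, folded V_def]) (rule that)
 define t where "t j = inverse (real (Suc j))" for j
 have t: "0 < t j" "t j \<le> 1" for j by (auto simp: t_def inverse_le_1_iff)
 \<comment> \<open>Finite for every j by the duality argument, but with no bound as j grows; this is
   why the scale t (k n) is chosen by \<open>diagonal_index\<close>.\<close>
 define P where "P j = enn2real (NN z. ennreal (norm (r (t j) z) powr \<alpha>))" for j
 have \<epsilon>0: "0 \<le> \<epsilon> n" for n
 proof -
  obtain m where "\<epsilon> n = \<tau> m" using \<epsilon>(1)[of n] by auto
  then show ?thesis using \<tau>(1)[of m] by simp
 qed
 have P0: "0 \<le> P j" for j by (simp add: P_def)
 obtain k where k: "filterlim k at_top sequentially" "(\<lambda>n. \<epsilon> n * P (k n)) \<longlonglongrightarrow> 0"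
  using diagonal_index[where \<epsilon>=\<epsilon> and P=P, OF \<epsilon>(2) \<epsilon>0 P0] by (elim exE conjE)
 have tk: "(\<lambda>n. t (k n)) \<longlonglongrightarrow> 0" unfolding t_def
  by (rule filterlim_compose[OF LIMSEQ_inverse_real_of_nat k(1)])
 have ev: "\<forall>\<^sub>F n in sequentially. t (k n) \<le> t0" if "t0 > 0" for t0
  using order_tendstoD(2)[OF tk that] by eventually_elim simp
 define qs where "qs n = density_measure (r (t (k n)))" for n
 have qv: "qs n \<in> vector_measures \<Omega>t" for n
  unfolding qs_def using admissible_measure(1)[OF adm[OF t]] vector_measures_mono[OF \<Omega>_sub_\<Omega>t] by blast
 have wsc: "weak_star_conv \<Omega>t qs q" unfolding weak_star_conv_def
 proof (intro allI impI)
  fix \<psi> :: "'a => 'a" assume \<psi>: "continuous_on \<Omega>t \<psi>"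
  have c\<Omega>: "continuous_on \<Omega> \<psi>" using \<psi> \<Omega>_sub_\<Omega>t by (rule continuous_on_subset)
  have v: "vector_integral \<Omega>t (qs n) \<psi> = (LBINT z. r (t (k n)) z \<bullet> (indicator \<Omega> z *\<^sub>R \<psi> z))" for n
  proof -
   have a: "integrable lborel (r (t (k n)))" "\<And>z. z \<notin> interior \<Omega> ==> r (t (k n)) z = 0"
    using adm[OF t, of "k n"] by (auto simp: admissible_def)
   show ?thesis
    unfolding qs_def vector_integral_represents(1)[OF density_measure_represents[OF a(1)] compact_\<Omega>t \<psi>]
   proof (intro LINT_cong refl)
    fix x
    have "x \<in> \<Omega>" if "r (t (k n)) x \<noteq> 0" using that a(2)[of x] interior_subset[of \<Omega>] by blast
    then show "indicator \<Omega>t x * (\<psi> x \<bullet> r (t (k n)) x) = r (t (k n)) x \<bullet> (indicator \<Omega> x *\<^sub>R \<psi> x)"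
     using \<Omega>_sub_\<Omega>t by (cases "r (t (k n)) x = 0") (auto simp: inner_commute)
   qed
  qed
  have "AE x in M. x \<notin> - \<Omega>" using M0 sM \<Omega>_borel by (intro AE_not_in null_setsI) auto
  then have z: "AE x in M. x \<in> \<Omega>" by simp
  have l: "vector_integral \<Omega>t q \<psi> = (LINT x|M. indicator \<Omega> x * (\<psi> x \<bullet> f x))"
  proof -
   note v1 = vector_integral_represents[OF rep compact_\<Omega>t \<psi>] and v2 = vector_integral_represents[OF rep compact_\<Omega> c\<Omega>]
   show ?thesis unfolding v1(1)
   proof (rule LINT_cong_AE)
    show "AE x in M. indicator \<Omega>t x * (\<psi> x \<bullet> f x) = indicator \<Omega> x * (\<psi> x \<bullet> f x)"
     using z by eventually_elim (use \<Omega>_sub_\<Omega>t in \<open>auto simp: indicator_def\<close>)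
   qed (use v1(2) v2(2) in auto)
  qed
  show "(\<lambda>n. vector_integral \<Omega>t (qs n) \<psi>) \<longlonglongrightarrow> vector_integral \<Omega>t q \<psi>"
   unfolding v l
  proof (rule tendstoI)
   fix e :: real assume "e > 0"
   then obtain t0 where t0: "t0 > 0" "\<And>t. 0 < t \<and> t \<le> t0 ==>
    \<bar>(LBINT z. r t z \<bullet> (indicator \<Omega> z *\<^sub>R \<psi> z)) - (LINT x|M. indicator \<Omega> x * (\<psi> x \<bullet> f x))\<bar> \<le> e / 2"
    using ws[OF c\<Omega>, of "e / 2"] by auto
   show "\<forall>\<^sub>F n in sequentially. dist (LBINT z. r (t (k n)) z \<bullet> (indicator \<Omega> z *\<^sub>R \<psi> z)) (LINT x|M. indicator \<Omega> x * (\<psi> x \<bullet> f x)) < e"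
    using ev[OF t0(1)]
   proof eventually_elim
    case (elim n)
    show ?case using t0(2)[of "t (k n)"] t[of "k n"] elim \<open>e > 0\<close> by (simp add: dist_real_def)
   qed
  qed
 qed
 have lim_e: "limsup (\<lambda>n. H_reg \<alpha> wh (enlarged s \<Omega> (\<epsilon> n)) \<mu>p \<mu>m (\<epsilon> n) (\<delta> n) (qs n)) \<le> ereal V + ereal e" if e: "e > 0" for e
 proof (rule Limsup_bounded)
  obtain t0 where t0: "t0 > 0" "\<And>t. 0 < t \<and> t \<le> t0 ==>
    (NN z. ennreal (norm (r t z) * (indicator \<Omega> z * w z))) \<le> ennreal (V + e / 2)"
   using en[of "e / 2"] e by auto
  have "(\<lambda>n. \<epsilon> n * P (k n) / \<alpha>) \<longlonglongrightarrow> 0 / \<alpha>" using \<alpha>(1) by (intro tendsto_divide k tendsto_const) auto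
  then have "\<forall>\<^sub>F n in sequentially. \<epsilon> n * P (k n) / \<alpha> < e / 2" using e by (intro order_tendstoD(2)) auto
  then show "\<forall>\<^sub>F n in sequentially. H_reg \<alpha> wh (enlarged s \<Omega> (\<epsilon> n)) \<mu>p \<mu>m (\<epsilon> n) (\<delta> n) (qs n) \<le> ereal V + ereal e"
   using ev[OF t0(1)]
  proof eventually_elim
   case (elim n)
   have "H_reg \<alpha> wh (enlarged s \<Omega> (\<epsilon> n)) \<mu>p \<mu>m (\<epsilon> n) (\<delta> n) (qs n) \<le> ereal ((V + e / 2) + \<epsilon> n / \<alpha> * P (k n))"
    unfolding qs_def P_def
    by (rule admissible_energy[OF adm[OF t] \<epsilon>(1) \<epsilon>0 \<delta>]) (use V0 e t0(2)[of "t (k n)"] t elim in auto)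
   also have "\<dots> \<le> ereal (V + e)"
   proof -
    have "\<epsilon> n / \<alpha> * P (k n) = \<epsilon> n * P (k n) / \<alpha>" by simp
    with elim(1) have "(V + e / 2) + \<epsilon> n / \<alpha> * P (k n) \<le> V + e" by linarith
    then show ?thesis by (simp only: ereal_less_eq)
   qed
   finally show ?case by simp
  qed
 qed
 have "limsup (\<lambda>n. H_reg \<alpha> wh (enlarged s \<Omega> (\<epsilon> n)) \<mu>p \<mu>m (\<epsilon> n) (\<delta> n) (qs n)) \<le> H_lim w \<Omega> \<mu>p \<mu>m q"
  unfolding HV by (rule ereal_le_epsilon2) (rule lim_e)
 then show ?thesis using qv wsc by (intro exI[of _ qs] conjI allI)
qed

lemma liminf_inequality:
 fixes \<epsilon> \<delta> :: "nat => real"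
 assumes \<epsilon>: "\<And>n. \<epsilon> n \<in> range \<tau>" "\<epsilon> \<longlonglongrightarrow> 0" and \<delta>: "\<And>n. \<delta> n > 0" "\<delta> \<longlonglongrightarrow> 0"
  and q: "q \<in> vector_measures \<Omega>t" and conv: "weak_star_conv \<Omega>t qs q"
 shows "H_lim w \<Omega> \<mu>p \<mu>m q \<le> liminf (\<lambda>n. H_reg \<alpha> wh (enlarged s \<Omega> (\<epsilon> n)) \<mu>p \<mu>m (\<epsilon> n) (\<delta> n) (qs n))"
proof (rule ccontr)
 let ?H = "\<lambda>n. H_reg \<alpha> wh (enlarged s \<Omega> (\<epsilon> n)) \<mu>p \<mu>m (\<epsilon> n) (\<delta> n) (qs n)"
 assume "\<not> H_lim w \<Omega> \<mu>p \<mu>m q \<le> liminf ?H"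
 \<comment> \<open>A constant strictly between the two sides. Infinitely many energies lie below it,
   and along these indices the lower bound gives the contradiction.\<close>
 then obtain C where C: "liminf ?H < ereal C" "ereal C < H_lim w \<Omega> \<mu>p \<mu>m q"
  using ereal_dense2 by (meson not_le)
 have "infinite {n. ?H n < ereal C}"
 proof
  assume "finite {n. ?H n < ereal C}"
  then have "\<forall>\<^sub>F n in sequentially. \<not> ?H n < ereal C"
   unfolding cofinite_eq_sequentially[symmetric] eventually_cofinite by simp
  then have "\<forall>\<^sub>F n in sequentially. ereal C \<le> ?H n" by eventually_elim simp
  then have "ereal C \<le> liminf ?H" by (rule Liminf_bounded)
  with C(1) show False by simp
 qed
 from infinite_enumerate[OF this] obtain g :: "nat => nat" where g: "strict_mono g" "\<And>n. ?H (g n) < ereal C" by auto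
 have "liminf_setting \<Omega>t w wh \<alpha> \<mu>p \<mu>m \<tau> \<beta> s \<Omega> (\<lambda>n. \<epsilon> (g n)) (\<lambda>n. \<delta> (g n)) (\<lambda>n. qs (g n)) q C"
 proof (intro liminf_setting.intro liminf_setting_axioms.intro)
  show "(\<lambda>n. \<epsilon> (g n)) \<longlonglongrightarrow> 0" "(\<lambda>n. \<delta> (g n)) \<longlonglongrightarrow> 0"
   using LIMSEQ_subseq_LIMSEQ[OF \<epsilon>(2) g(1)] LIMSEQ_subseq_LIMSEQ[OF \<delta>(2) g(1)] by (simp_all add: comp_def)
  show "weak_star_conv \<Omega>t (\<lambda>n. qs (g n)) q"
   unfolding weak_star_conv_def
  proof (intro allI impI)
   fix \<phi> :: "'a => 'a" assume "continuous_on \<Omega>t \<phi>"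
   then have "(\<lambda>n. vector_integral \<Omega>t (qs n) \<phi>) \<longlonglongrightarrow> vector_integral \<Omega>t q \<phi>" using conv by (simp add: weak_star_conv_def)
   from LIMSEQ_subseq_LIMSEQ[OF this g(1)] show "(\<lambda>n. vector_integral \<Omega>t (qs (g n)) \<phi>) \<longlonglongrightarrow> vector_integral \<Omega>t q \<phi>" by (simp add: comp_def)
  qed
 qed (use \<epsilon> \<delta> q g(2) gamma_setting_axioms in auto)
 from liminf_setting.H_lim_le[OF this] C(2) show False by simp
qed

end

theorem theorem4p10:
  fixes \<Omega> \<Omega>t :: "'a::euclidean_space set"
    and w wh :: "'a \<Rightarrow> real"
    and \<alpha> :: real
    and \<mu>p \<mu>m :: "'a measure"
    and \<tau> :: "nat \<Rightarrow> real"
    and moll :: "real \<Rightarrow> 'a \<Rightarrow> real"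
    and s h :: "real \<Rightarrow> real"
    and \<epsilon> \<delta> :: "nat \<Rightarrow> real"
  assumes "compact \<Omega>"
    and "bounded_lipschitz_domain (interior \<Omega>)"
    and "strictly_star_shaped \<Omega>"
    and "continuous_on \<Omega> w" and "\<forall>x\<in>\<Omega>. w x \<ge> 0"
    and "1 < \<alpha>"
    and "DIM('a) = 1 \<or> \<alpha> < real DIM('a) / (real DIM('a) - 1)"
    and "prob_space \<mu>p" and "sets \<mu>p = sets borel" and "emeasure \<mu>p (- \<Omega>) = 0"
    and "prob_space \<mu>m" and "sets \<mu>m = sets borel" and "emeasure \<mu>m (- \<Omega>) = 0"
    and "poisson_uniquely_solvable (conj_exp \<alpha>) \<Omega>"
    and "\<forall>n. \<tau> n > 0" and "\<tau> \<longlonglongrightarrow> 0"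
    and "\<forall>n. moll (\<tau> n) \<in> C_c_infinity UNIV \<and> (\<forall>x. moll (\<tau> n) x \<ge> 0) \<and>
             (\<integral>x. moll (\<tau> n) x \<partial>lborel) = 1"
    and "\<forall>r>0. \<forall>\<^sub>F n in sequentially. supp (moll (\<tau> n)) \<subseteq> ball 0 r"
    and "\<forall>n. s (\<tau> n) > 0" and "(\<lambda>n. s (\<tau> n)) \<longlonglongrightarrow> 0"
    and "\<forall>n. {x + y |x y. x \<in> \<Omega> \<and> y \<in> supp (moll (\<tau> n))} \<subseteq> enlarged s \<Omega> (\<tau> n)"
    and "\<forall>m n. \<tau> m > \<tau> n \<longrightarrow> enlarged s \<Omega> (\<tau> n) \<subseteq> enlarged s \<Omega> (\<tau> m)"
    and "\<Omega>t = (\<Union>n. enlarged s \<Omega> (\<tau> n))"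
    and "continuous_on \<Omega>t wh" and "\<forall>x\<in>\<Omega>. wh x = w x"
    and "(INF x\<in>\<Omega>t. wh x) = (INF x\<in>\<Omega>. w x)"
    and "\<forall>x>0. h x \<ge> 0" and "filterlim h at_top (at_right 0)"
    and "\<forall>n. \<epsilon> n \<in> range \<tau>" and "\<forall>n. \<delta> n > 0"
    and "\<epsilon> \<longlonglongrightarrow> 0" and "\<delta> \<longlonglongrightarrow> 0"
    and "(\<lambda>n. \<epsilon> n * h (\<delta> n) powr \<alpha>) \<longlonglongrightarrow> 0"
  shows "Gamma_lim (vector_measures \<Omega>t) (weak_star_conv \<Omega>t)
           (\<lambda>n. H_reg \<alpha> wh (enlarged s \<Omega> (\<epsilon> n)) \<mu>p \<mu>m (\<epsilon> n) (\<delta> n))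
           (H_lim w \<Omega> \<mu>p \<mu>m)"
proof -
 \<comment> \<open>The product form also covers dimension 1, where it reads 0 < 1 and \<alpha> has
   no upper bound.\<close>
 have \<alpha>d: "\<alpha> * (real DIM('a) - 1) < real DIM('a)"
 proof (cases "DIM('a) = 1")
  case False
  have "0 < DIM('a)" by (rule DIM_positive)
  then have "1 < DIM('a)" using False by linarith
  then have "real DIM('a) - 1 > 0" by simp
  then show ?thesis using assms(7) False by (simp add: pos_less_divide_eq)
 qed simp
 interpret gamma_setting \<Omega> \<Omega>t w wh \<alpha> \<mu>p \<mu>m \<tau> "\<lambda>n. moll (\<tau> n)" s
 proof (rule gamma_setting.intro)
  show "mollifiers (\<lambda>n. moll (\<tau> n))" unfolding mollifiers_def using assms(17,18) by blast
 qed (fact assms(1-3) \<alpha>d assms(4,6,8-13,16,20,23,24,26) | use assms(5,15,19,22,25) in blast)+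
 show ?thesis
  unfolding Gamma_lim_def
 proof (intro conjI ballI allI impI)
  fix q qs assume q: "q \<in> vector_measures \<Omega>t" and qs: "(\<forall>n. qs n \<in> vector_measures \<Omega>t) \<and> weak_star_conv \<Omega>t qs q"
  show "H_lim w \<Omega> \<mu>p \<mu>m q \<le> liminf (\<lambda>n. H_reg \<alpha> wh (enlarged s \<Omega> (\<epsilon> n)) \<mu>p \<mu>m (\<epsilon> n) (\<delta> n) (qs n))"
   by (rule liminf_inequality) (use assms(29-32) q qs in auto)
 next
  fix q assume q: "q \<in> vector_measures \<Omega>t"
  show "\<exists>qs. (\<forall>n. qs n \<in> vector_measures \<Omega>t) \<and> weak_star_conv \<Omega>t qs q \<and>
    limsup (\<lambda>n. H_reg \<alpha> wh (enlarged s \<Omega> (\<epsilon> n)) \<mu>p \<mu>m (\<epsilon> n) (\<delta> n) (qs n)) \<le> H_lim w \<Omega> \<mu>p \<mu>m q"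
  proof (cases "q \<in> vector_measures \<Omega> \<and> div_measure_eq \<Omega> q \<mu>p \<mu>m")
   case True
   then show ?thesis using assms(29-31) by (intro limsup_inequality) auto
  next
   case False
   then have "H_lim w \<Omega> \<mu>p \<mu>m q = \<infinity>" unfolding H_lim_def by (rule if_not_P)
   \<comment> \<open>Against an infinite limit value any convergent sequence will do, in particular
     the constant one.\<close>
   then show ?thesis using q by (intro exI[of _ "\<lambda>_. q"]) (simp add: weak_star_conv_def)
  qed
 qed
qed

end
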